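(* Let $p\in(2,\infty)$, $s\in(1+1/p,2)$ and $f\in W^s_p(\mathbb{R})$. Then for every $\lambda\in\mathbb{R}$ with $|\lambda|\ge1$, $\lambda-\mathbb{A}(f)\in\operatorname{Isom}(L_p(\mathbb{R}))$.
   Context: $W^s_p(\mathbb{R})$ is the Sobolev–Slobodeckij space. For $f\in W^s_p(\mathbb{R})$, $\mathbb{A}(f)\in\mathcal{L}(L_p(\mathbb{R}))$ is the (bounded extension of the) singular integral operator \[ \mathbb{A}(f)[\overline{\omega}](x):=\frac1\pi\operatorname{PV}\int_{\mathbb{R}}\frac{yf'(x)-(f(x)-f(x-y))}{y^2+(f(x)-f(x-y))^2}\overline{\omega}(x-y)\,dy . \] $\operatorname{Isom}(X)$ denotes bounded linear bijections of $X$ with bounded inverse. *)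

theory Defs
  imports "HOL-Analysis.Analysis"
begin

text \<open>Functions on the real line are represented by representatives
  real => real; all identities between L_p elements are understood
  almost everywhere w.r.t. Lebesgue measure.\<close>

definition Lp :: "real \<Rightarrow> (real \<Rightarrow> real) set" where
  "Lp p = {g. g \<in> borel_measurable lborel \<and> integrable lborel (\<lambda>x. \<bar>g x\<bar> powr p)}"

definition Lp_norm :: "real \<Rightarrow> (real \<Rightarrow> real) \<Rightarrow> real" where
  "Lp_norm p g = (LINT x|lborel. \<bar>g x\<bar> powr p) powr (1 / p)"

definition test_fun :: "(real \<Rightarrow> real) \<Rightarrow> bool" where
  "test_fun \<phi> \<longleftrightarrow> (\<forall>n x. ((deriv ^^ n) \<phi>) differentiable (at x))
      \<and> compact (closure {x. \<phi> x \<noteq> 0})"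

definition weak_deriv :: "(real \<Rightarrow> real) \<Rightarrow> (real \<Rightarrow> real) \<Rightarrow> bool" where
  "weak_deriv f g \<longleftrightarrow>
     (\<forall>K. compact K \<longrightarrow> set_integrable lborel K f \<and> set_integrable lborel K g) \<and>
     (\<forall>\<phi>. test_fun \<phi> \<longrightarrow>
        (LINT x|lborel. f x * deriv \<phi> x) = - (LINT x|lborel. g x * \<phi> x))"

definition sobolev_slobodeckij :: "real \<Rightarrow> real \<Rightarrow> (real \<Rightarrow> real) \<Rightarrow> bool" where
  "sobolev_slobodeckij s p f \<longleftrightarrow> 1 < s \<and> s < 2 \<and> f \<in> Lp p \<and>
     (\<exists>g. weak_deriv f g \<and> g \<in> Lp p \<and>
        integrable (lborel \<Otimes>\<^sub>M lborel)
          (\<lambda>(x, y). \<bar>g x - g y\<bar> powr p / \<bar>x - y\<bar> powr (1 + (s - 1) * p)))"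

definition bounded_op_Lp :: "real \<Rightarrow> ((real \<Rightarrow> real) \<Rightarrow> (real \<Rightarrow> real)) \<Rightarrow> bool" where
  "bounded_op_Lp p T \<longleftrightarrow>
     (\<forall>g\<in>Lp p. T g \<in> Lp p) \<and>
     (\<forall>g\<in>Lp p. \<forall>h\<in>Lp p. (AE x in lborel. g x = h x) \<longrightarrow> (AE x in lborel. T g x = T h x)) \<and>
     (\<forall>g\<in>Lp p. \<forall>h\<in>Lp p. \<forall>a b. AE x in lborel.
         T (\<lambda>y. a * g y + b * h y) x = a * T g x + b * T h x) \<and>
     (\<exists>C. \<forall>g\<in>Lp p. Lp_norm p (T g) \<le> C * Lp_norm p g)"

definition isom_Lp :: "real \<Rightarrow> ((real \<Rightarrow> real) \<Rightarrow> (real \<Rightarrow> real)) \<Rightarrow> bool" where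
  "isom_Lp p S \<longleftrightarrow> bounded_op_Lp p S \<and>
     (\<exists>R. bounded_op_Lp p R \<and>
        (\<forall>g\<in>Lp p. (AE x in lborel. R (S g) x = g x) \<and> (AE x in lborel. S (R g) x = g x)))"

definition A_trunc ::
  "(real \<Rightarrow> real) \<Rightarrow> (real \<Rightarrow> real) \<Rightarrow> (real \<Rightarrow> real) \<Rightarrow> real \<Rightarrow> real \<Rightarrow> real" where
  "A_trunc f f' w x \<epsilon> = (1 / pi) *
     (LINT y:{y. \<epsilon> < \<bar>y\<bar>}|lborel.
        (y * f' x - (f x - f (x - y))) / (y\<^sup>2 + (f x - f (x - y))\<^sup>2) * w (x - y))"

text \<open>T is the bounded extension to L_p(R) of the principal value operator A(f),
  which is given by the PV integral on the dense class of test functions.\<close>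
definition is_A_op :: "real \<Rightarrow> (real \<Rightarrow> real) \<Rightarrow> (real \<Rightarrow> real)
    \<Rightarrow> ((real \<Rightarrow> real) \<Rightarrow> (real \<Rightarrow> real)) \<Rightarrow> bool" where
  "is_A_op p f f' T \<longleftrightarrow> bounded_op_Lp p T \<and>
     (\<forall>w. test_fun w \<longrightarrow>
        (AE x in lborel. ((\<lambda>\<epsilon>. A_trunc f f' w x \<epsilon>) \<longlongrightarrow> T w x) (at_right 0)))"

end

theory Submission
  imports Defs
begin

text \<open>Since \<open>f'\<close> is Hoelder continuous by Morrey's embedding, the kernel of \<open>A(f)\<close> is only weakly
  singular. The Gagliardo seminorm near the diagonal and \<open>f, f' \<in> L\<^sub>p\<close> far away place it in a
  weighted \<open>L\<^sub>p\<close> space of kernels, where it is approximated by finite rank kernels; by Hoelder's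
  inequality the approximation holds in the operator norms of \<open>L\<^sub>p\<close> and of \<open>L\<^sub>2\<close> at once. Hence
  \<open>\<lambda> - A(f)\<close> is a finite rank perturbation of an invertible operator on \<open>L\<^sub>p\<close>, and its kernel in
  \<open>L\<^sub>p\<close> lies in \<open>L\<^sub>2\<close>. On \<open>L\<^sub>2\<close> the kernel is trivial: the Cauchy integral of a density along the
  graph has boundary values from the two sides whose squares integrate to zero against \<open>dz\<close> by
  Cauchy's theorem, and the real and imaginary parts of these Rellich identities make
  \<open>\<lambda> - A(f)\<close> coercive for \<open>\<bar>\<lambda>\<bar> \<ge> 1\<close>.\<close>

subsection \<open>Lebesgue spaces on the line\<close>

text \<open>Rellich identities are quadratic, so they give injectivity on L_2 only, while for p > 2
  an element of L_p need not lie in L_2. The bridge is one kernel norm that controls the operator on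
  both spaces: with \<eta> integrable, k is measured in L_p of the plane with weight \<eta>(x -
  s)^(2 - p), and Hoelder with exponents 1/p, 1/p, (p - 2)/p balances this weight on L_p as well as
  on L_2. This is where p > 2 enters. If \<lambda> w = A(f) w in L_p, inverting the small part by a
  Neumann series, the same pointwise series in both spaces, writes w as an image of a bounded
  function with bounded support, so w lies in L_2. The hypothesis s > 1 + 1/p makes the Hoelder
  exponent s - 1 - 1/p positive and the weight integrable at the origin. On L_2 the Rellich
  identities combine to a form containing (\<lambda>^2 - 1) times the squared density, which is
  nonnegative exactly when |\<lambda>| >= 1; coercivity is shown for Lipschitz densities and
  extended by density.\<close>

lemma weighted_AM_GM2:
  fixes u v \<alpha> \<beta> :: real
  assumes "0 < \<alpha>" "0 < \<beta>" "\<alpha> + \<beta> = 1" "0 \<le> u" "0 \<le> v"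
  shows "u powr \<alpha> * v powr \<beta> \<le> \<alpha> * u + \<beta> * v"
proof (cases "u = 0 \<or> v = 0")
  case True
  then show ?thesis using assms by auto
next
  case False
  then show ?thesis using Youngs_inequality_0[of \<alpha> \<beta> u v] assms by auto
qed

text \<open>Dividing by the integrals normalises both factors to mass 1, and then the weighted AM-GM
  inequality integrates to the bound. If an integral vanishes this normalisation is impossible, but
  then the factor is zero almost everywhere.\<close>

lemma Holder2:
  fixes u v :: "'a \<Rightarrow> real"
  assumes ab: "0 < \<alpha>" "0 < \<beta>" "\<alpha> + \<beta> = 1"
    and u: "integrable M u" "\<And>x. 0 \<le> u x" and v: "integrable M v" "\<And>x. 0 \<le> v x"
  shows "integrable M (\<lambda>x. u x powr \<alpha> * v x powr \<beta>)"
    and "(\<integral>x. u x powr \<alpha> * v x powr \<beta> \<partial>M) \<le> (\<integral>x. u x \<partial>M) powr \<alpha> * (\<integral>x. v x \<partial>M) powr \<beta>"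
proof -
  have [measurable]: "u \<in> borel_measurable M" "v \<in> borel_measurable M"
    using u v by auto
  have pt: "u x powr \<alpha> * v x powr \<beta> \<le> \<alpha> * u x + \<beta> * v x" for x
    using weighted_AM_GM2 ab u v by blast
  show int: "integrable M (\<lambda>x. u x powr \<alpha> * v x powr \<beta>)"
    by (rule Bochner_Integration.integrable_bound[of M "\<lambda>x. \<alpha> * u x + \<beta> * v x"])
      (use u v ab pt in \<open>auto intro!: AE_I2 simp: abs_mult\<close>)
  let ?U = "\<integral>x. u x \<partial>M" and ?V = "\<integral>x. v x \<partial>M"
  have U0: "0 \<le> ?U" "0 \<le> ?V" using u v by (auto intro: Bochner_Integration.integral_nonneg)
  show "(\<integral>x. u x powr \<alpha> * v x powr \<beta> \<partial>M) \<le> ?U powr \<alpha> * ?V powr \<beta>"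
  proof (cases "?U = 0 \<or> ?V = 0")
    case True
    have "(AE x in M. u x = 0) \<or> (AE x in M. v x = 0)"
      using True integral_nonneg_eq_0_iff_AE[of M u] integral_nonneg_eq_0_iff_AE[of M v] u v by auto
    then have "AE x in M. u x powr \<alpha> * v x powr \<beta> = 0" by auto
    then have "(\<integral>x. u x powr \<alpha> * v x powr \<beta> \<partial>M) = 0" by (rule integral_eq_zero_AE)
    then show ?thesis by auto
  next
    case False
    then have pos: "?U > 0" "?V > 0" using U0 by auto
    let ?c = "?U powr \<alpha> * ?V powr \<beta>"
    have pt2: "u x powr \<alpha> * v x powr \<beta> \<le> ?c * (\<alpha> / ?U * u x + \<beta> / ?V * v x)" for x
    proof -
      have "(u x / ?U) powr \<alpha> * (v x / ?V) powr \<beta> \<le> \<alpha> * (u x / ?U) + \<beta> * (v x / ?V)"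
        using weighted_AM_GM2[OF ab, of "u x / ?U" "v x / ?V"] u v U0 by simp
      then have "u x powr \<alpha> * v x powr \<beta> / ?c \<le> \<alpha> / ?U * u x + \<beta> / ?V * v x"
        using u v U0 pos by (simp add: powr_divide)
      then show ?thesis using pos by (simp add: divide_le_eq mult.commute)
    qed
    have "(\<integral>x. u x powr \<alpha> * v x powr \<beta> \<partial>M) \<le> (\<integral>x. ?c * (\<alpha> / ?U * u x + \<beta> / ?V * v x) \<partial>M)"
      by (rule integral_mono[OF int]) (use u v pt2 in auto)
    also have "\<dots> = ?c * (\<alpha> / ?U * ?U + \<beta> / ?V * ?V)" using u v by simp
    also have "\<dots> = ?c" using pos ab by (simp)
    finally show ?thesis .
  qed
qed

text \<open>The factors \<open>v\<close> and \<open>w\<close> are merged into one function, with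
  exponents rescaled by 1 - \<alpha> so that they sum to 1, and the two-factor inequality is used
  twice. The kernel estimates on L_p and L_2 rest on this form.\<close>

lemma Holder3:
  fixes u v w :: "'a \<Rightarrow> real"
  assumes abc: "0 < \<alpha>" "0 < \<beta>" "0 < \<gamma>" "\<alpha> + \<beta> + \<gamma> = 1"
    and u: "integrable M u" "\<And>x. 0 \<le> u x" and v: "integrable M v" "\<And>x. 0 \<le> v x"
    and w: "integrable M w" "\<And>x. 0 \<le> w x"
  shows "integrable M (\<lambda>x. u x powr \<alpha> * v x powr \<beta> * w x powr \<gamma>)"
    and "(\<integral>x. u x powr \<alpha> * v x powr \<beta> * w x powr \<gamma> \<partial>M)
      \<le> (\<integral>x. u x \<partial>M) powr \<alpha> * (\<integral>x. v x \<partial>M) powr \<beta> * (\<integral>x. w x \<partial>M) powr \<gamma>"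
proof -
  let ?b = "\<beta> / (1 - \<alpha>)" and ?c = "\<gamma> / (1 - \<alpha>)"
  have a1: "1 - \<alpha> > 0" using abc by linarith
  have bc: "0 < ?b" "0 < ?c" "?b + ?c = 1"
    using abc a1 by (auto simp: add_divide_distrib[symmetric])
  let ?z = "\<lambda>x. v x powr ?b * w x powr ?c"
  have z: "integrable M ?z" "\<And>x. 0 \<le> ?z x"
    and zle: "(\<integral>x. ?z x \<partial>M) \<le> (\<integral>x. v x \<partial>M) powr ?b * (\<integral>x. w x \<partial>M) powr ?c"
    using Holder2[OF bc v w] by auto
  have eq: "u x powr \<alpha> * ?z x powr (1 - \<alpha>) = u x powr \<alpha> * v x powr \<beta> * w x powr \<gamma>" for x
    using a1 by (simp add: powr_mult powr_powr)
  have a2: "\<alpha> + (1 - \<alpha>) = 1" by simp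
  note H = Holder2[OF abc(1) a1 a2 u z, unfolded eq]
  show "integrable M (\<lambda>x. u x powr \<alpha> * v x powr \<beta> * w x powr \<gamma>)" by (rule H(1))
  have "(\<integral>x. ?z x \<partial>M) powr (1 - \<alpha>)
      \<le> ((\<integral>x. v x \<partial>M) powr ?b * (\<integral>x. w x \<partial>M) powr ?c) powr (1 - \<alpha>)"
    using zle z(2) a1 by (intro powr_mono2) (auto intro: Bochner_Integration.integral_nonneg)
  also have "\<dots> = (\<integral>x. v x \<partial>M) powr \<beta> * (\<integral>x. w x \<partial>M) powr \<gamma>"
    using a1 by (simp add: powr_mult powr_powr)
  finally show "(\<integral>x. u x powr \<alpha> * v x powr \<beta> * w x powr \<gamma> \<partial>M)
      \<le> (\<integral>x. u x \<partial>M) powr \<alpha> * (\<integral>x. v x \<partial>M) powr \<beta> * (\<integral>x. w x \<partial>M) powr \<gamma>"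
    using H(2) by (smt (verit, best) mult.assoc mult_left_mono powr_ge_zero)
qed

text \<open>Positive arguments are convexity of the power function on the open half line; a
  vanishing argument reduces to t^p <= t on [0, 1].\<close>

lemma powr_convex_combination:
  fixes a b t p :: real
  assumes "1 \<le> p" "0 \<le> a" "0 \<le> b" "0 \<le> t" "t \<le> 1"
  shows "(t * a + (1 - t) * b) powr p \<le> t * a powr p + (1 - t) * b powr p"
proof -
  have aux: "t * c powr p \<ge> (t * c) powr p" if "0 \<le> t" "t \<le> 1" "0 \<le> c" for t c :: real
  proof (cases "t = 0")
    case False
    then have "t powr p \<le> t powr 1" using that assms by (intro powr_mono') auto
    then show ?thesis using that False by (auto simp: powr_mult intro!: mult_right_mono)
  qed auto
  show ?thesis
  proof (cases "a = 0 \<or> b = 0")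
    case True
    then show ?thesis using aux[of t a] aux[of "1 - t" b] assms by auto
  next
    case False
    then show ?thesis
      using convex_onD[OF powr_convex[OF assms(1)], of t b a] assms by (auto simp: algebra_simps)
  qed
qed

lemma powr_add_le:
  fixes a b p :: real
  assumes "1 \<le> p" "0 \<le> a" "0 \<le> b"
  shows "(a + b) powr p \<le> 2 powr p * (a powr p + b powr p)"
proof -
  have "(a + b) powr p \<le> (2 * max a b) powr p" using assms by (intro powr_mono2) auto
  also have "\<dots> = 2 powr p * (max a b) powr p" using assms by (simp add: powr_mult)
  also have "\<dots> \<le> 2 powr p * (a powr p + b powr p)" by (simp add: max_def)
  finally show ?thesis .
qed

section \<open>Norm calculus and completeness of the spaces L_p\<close>

lemma LpD: "g \<in> Lp p \<Longrightarrow> g \<in> borel_measurable borel" "g \<in> Lp p \<Longrightarrow> integrable lborel (\<lambda>x. \<bar>g x\<bar> powr p)"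
  by (auto simp: Lp_def)

lemma Lp_bound:
  assumes "g \<in> borel_measurable borel" "h \<in> Lp p" "0 \<le> p" "AE x in lborel. \<bar>g x\<bar> \<le> c * \<bar>h x\<bar>"
  shows "g \<in> Lp p"
proof -
  have [measurable]: "g \<in> borel_measurable borel" "h \<in> borel_measurable borel" using assms LpD by auto
  have "integrable lborel (\<lambda>x. \<bar>g x\<bar> powr p)"
  proof (rule Bochner_Integration.integrable_bound[of lborel "\<lambda>x. \<bar>c\<bar> powr p * \<bar>h x\<bar> powr p"])
    show "AE x in lborel. norm (\<bar>g x\<bar> powr p) \<le> norm (\<bar>c\<bar> powr p * \<bar>h x\<bar> powr p)"
      using assms(4)
    proof eventually_elim
      case (elim x)
      have "\<bar>g x\<bar> powr p \<le> (\<bar>c\<bar> * \<bar>h x\<bar>) powr p"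
        using elim assms(3) by (intro powr_mono2) (auto simp: abs_mult[symmetric])
      then show ?case by (simp add: powr_mult)
    qed
  qed (use assms LpD in auto)
  then show ?thesis by (simp add: Lp_def)
qed

lemma Lp_zero [simp]: "(\<lambda>x. 0) \<in> Lp p" by (simp add: Lp_def)

lemma Lp_scale: "g \<in> Lp p \<Longrightarrow> (\<lambda>x. c * g x) \<in> Lp p"
  by (auto simp: Lp_def abs_mult powr_mult)

lemma Lp_abs: "g \<in> Lp p \<Longrightarrow> (\<lambda>x. \<bar>g x\<bar>) \<in> Lp p"
  by (auto simp: Lp_def)

lemma Lp_add: assumes "1 \<le> p" "g \<in> Lp p" "h \<in> Lp p" shows "(\<lambda>x. g x + h x) \<in> Lp p"
proof -
  have [measurable]: "g \<in> borel_measurable borel" "h \<in> borel_measurable borel" using assms LpD by auto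
  have "integrable lborel (\<lambda>x. \<bar>g x + h x\<bar> powr p)"
  proof (rule Bochner_Integration.integrable_bound[of lborel "\<lambda>x. 2 powr p * (\<bar>g x\<bar> powr p + \<bar>h x\<bar> powr p)"])
    show "AE x in lborel. norm (\<bar>g x + h x\<bar> powr p) \<le> norm (2 powr p * (\<bar>g x\<bar> powr p + \<bar>h x\<bar> powr p))"
    proof (rule AE_I2)
      fix x
      have "\<bar>g x + h x\<bar> powr p \<le> (\<bar>g x\<bar> + \<bar>h x\<bar>) powr p" using assms by (intro powr_mono2) auto
      also have "\<dots> \<le> 2 powr p * (\<bar>g x\<bar> powr p + \<bar>h x\<bar> powr p)" using powr_add_le[OF assms(1)] by simp
      finally show "norm (\<bar>g x + h x\<bar> powr p) \<le> norm (2 powr p * (\<bar>g x\<bar> powr p + \<bar>h x\<bar> powr p))" by simp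
    qed
  qed (use assms LpD in auto)
  then show ?thesis by (simp add: Lp_def)
qed

lemma Lp_lincomb: "1 \<le> p \<Longrightarrow> g \<in> Lp p \<Longrightarrow> h \<in> Lp p \<Longrightarrow> (\<lambda>x. a * g x + b * h x) \<in> Lp p"
  by (intro Lp_add Lp_scale)

lemma Lp_diff: "1 \<le> p \<Longrightarrow> g \<in> Lp p \<Longrightarrow> h \<in> Lp p \<Longrightarrow> (\<lambda>x. g x - h x) \<in> Lp p"
  using Lp_lincomb[of p g h 1 "-1"] by simp

lemma Lp_sum: "1 \<le> p \<Longrightarrow> (\<And>i. i \<in> I \<Longrightarrow> g i \<in> Lp p) \<Longrightarrow> (\<lambda>x. \<Sum>i\<in>I. g i x) \<in> Lp p"
  by (induction I rule: infinite_finite_induct) (auto intro: Lp_add)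

lemma Lp_norm_nonneg [simp]: "0 \<le> Lp_norm p g" by (simp add: Lp_norm_def)

lemma Lp_norm_zero [simp]: "Lp_norm p (\<lambda>x. 0) = 0" by (simp add: Lp_norm_def)

lemma Lp_norm_abs: "Lp_norm p (\<lambda>x. \<bar>g x\<bar>) = Lp_norm p g" by (simp add: Lp_norm_def)

lemma Lp_norm_powr: "0 < p \<Longrightarrow> Lp_norm p g powr p = (LINT x|lborel. \<bar>g x\<bar> powr p)"
  by (simp add: Lp_norm_def powr_powr integral_nonneg_AE)

lemma Lp_norm_le_iff:
  assumes "0 < p" "0 \<le> c"
  shows "Lp_norm p g \<le> c \<longleftrightarrow> (LINT x|lborel. \<bar>g x\<bar> powr p) \<le> c powr p"
proof
  assume "Lp_norm p g \<le> c"
  then have "Lp_norm p g powr p \<le> c powr p" using assms by (intro powr_mono2) auto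
  then show "(LINT x|lborel. \<bar>g x\<bar> powr p) \<le> c powr p" using assms Lp_norm_powr by simp
next
  assume "(LINT x|lborel. \<bar>g x\<bar> powr p) \<le> c powr p"
  then have "(LINT x|lborel. \<bar>g x\<bar> powr p) powr (1 / p) \<le> (c powr p) powr (1 / p)"
    using assms by (intro powr_mono2) (auto intro: Bochner_Integration.integral_nonneg)
  then show "Lp_norm p g \<le> c" using assms by (simp add: Lp_norm_def powr_powr)
qed

lemma Lp_norm_cong_AE:
  assumes "g \<in> borel_measurable borel" "h \<in> borel_measurable borel" "AE x in lborel. g x = h x"
  shows "Lp_norm p g = Lp_norm p h"
proof -
  have "(LINT x|lborel. \<bar>g x\<bar> powr p) = (LINT x|lborel. \<bar>h x\<bar> powr p)"
    by (rule integral_cong_AE) (use assms in auto)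
  then show ?thesis by (simp add: Lp_norm_def)
qed

lemma Lp_norm_eq_0_iff:
  assumes "g \<in> Lp p"
  shows "Lp_norm p g = 0 \<longleftrightarrow> (AE x in lborel. g x = 0)"
proof -
  have "Lp_norm p g = 0 \<longleftrightarrow> (LINT x|lborel. \<bar>g x\<bar> powr p) = 0" by (simp add: Lp_norm_def)
  also have "\<dots> \<longleftrightarrow> (AE x in lborel. \<bar>g x\<bar> powr p = 0)"
    by (rule integral_nonneg_eq_0_iff_AE) (use LpD[OF assms] in auto)
  finally show ?thesis by simp
qed

lemma Lp_norm_scale: assumes "0 < p" shows "Lp_norm p (\<lambda>x. c * g x) = \<bar>c\<bar> * Lp_norm p g"
  using assms by (simp add: Lp_norm_def abs_mult powr_mult powr_powr)

text \<open>Write g + h = (a + b) (t g/a + (1 - t) h/b) with the norms a, b and t = a/(a + b).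
  Convexity of the power function turns this into a convex combination of p-th powers of functions
  of norm 1. A vanishing norm is treated apart because of the division.\<close>

lemma Minkowski:
  assumes p: "1 \<le> p" and g: "g \<in> Lp p" and h: "h \<in> Lp p"
  shows "Lp_norm p (\<lambda>x. g x + h x) \<le> Lp_norm p g + Lp_norm p h"
proof -
  have [measurable]: "g \<in> borel_measurable borel" "h \<in> borel_measurable borel" using g h LpD by auto
  let ?a = "Lp_norm p g" and ?b = "Lp_norm p h"
  consider "?a = 0" | "?b = 0" | "?a > 0" "?b > 0" using Lp_norm_nonneg by (metis less_eq_real_def)
  then show ?thesis
  proof cases
    case 1
    then have "AE x in lborel. g x + h x = h x" using Lp_norm_eq_0_iff[OF g] by auto
    then have "Lp_norm p (\<lambda>x. g x + h x) = ?b" by (intro Lp_norm_cong_AE) auto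
    then show ?thesis by simp
  next
    case 2
    then have "AE x in lborel. g x + h x = g x" using Lp_norm_eq_0_iff[OF h] by auto
    then have "Lp_norm p (\<lambda>x. g x + h x) = ?a" by (intro Lp_norm_cong_AE) auto
    then show ?thesis by simp
  next
    case 3
    let ?t = "?a / (?a + ?b)" and ?s = "?a + ?b"
    have t: "0 \<le> ?t" "?t \<le> 1" "1 - ?t = ?b / ?s" using 3 by (auto simp: field_simps)
    have pt: "\<bar>g x + h x\<bar> powr p
        \<le> ?s powr p * (?t * (\<bar>g x\<bar> powr p / ?a powr p) + (1 - ?t) * (\<bar>h x\<bar> powr p / ?b powr p))" for x
    proof -
      have "\<bar>g x + h x\<bar> \<le> ?s * (?t * (\<bar>g x\<bar> / ?a) + (1 - ?t) * (\<bar>h x\<bar> / ?b))"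
      proof -
        have gen: "s * (t * (x / a) + (1 - t) * (y / b)) = (s * t) * x / a + (s * (1 - t)) * y / b"
          for s t a b x y :: real
          by (simp add: algebra_simps add_divide_distrib diff_divide_distrib)
        have st: "?s * ?t = ?a" "?s * (1 - ?t) = ?b" unfolding t(3) using 3 by auto
        have "?s * (?t * (\<bar>g x\<bar> / ?a) + (1 - ?t) * (\<bar>h x\<bar> / ?b)) = \<bar>g x\<bar> + \<bar>h x\<bar>"
          unfolding gen st using 3 by simp
        then show ?thesis using abs_triangle_ineq[of "g x" "h x"] by simp
      qed
      then have "\<bar>g x + h x\<bar> powr p \<le> (?s * (?t * (\<bar>g x\<bar> / ?a) + (1 - ?t) * (\<bar>h x\<bar> / ?b))) powr p"
        using p by (intro powr_mono2) auto
      also have "\<dots> = ?s powr p * (?t * (\<bar>g x\<bar> / ?a) + (1 - ?t) * (\<bar>h x\<bar> / ?b)) powr p"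
        using t 3 by (subst powr_mult) auto
      also have "\<dots> \<le> ?s powr p * (?t * (\<bar>g x\<bar> / ?a) powr p + (1 - ?t) * (\<bar>h x\<bar> / ?b) powr p)"
        using t 3 p by (intro mult_left_mono powr_convex_combination) auto
      finally show ?thesis using 3 by (simp add: powr_divide)
    qed
    have ia: "(LINT x|lborel. \<bar>g x\<bar> powr p) = ?a powr p" "(LINT x|lborel. \<bar>h x\<bar> powr p) = ?b powr p"
      using p by (simp_all add: Lp_norm_powr)
    have "(LINT x|lborel. \<bar>g x + h x\<bar> powr p)
      \<le> (LINT x|lborel. ?s powr p * (?t * (\<bar>g x\<bar> powr p / ?a powr p) + (1 - ?t) * (\<bar>h x\<bar> powr p / ?b powr p)))"
      by (rule integral_mono) (use LpD[OF Lp_add[OF p g h]] LpD g h pt in auto)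
    also have "\<dots> = ?s powr p * (?t * (?a powr p / ?a powr p) + (1 - ?t) * (?b powr p / ?b powr p))"
      using LpD g h by (simp add: ia)
    also have "\<dots> = ?s powr p" using 3 by simp
    finally show ?thesis using p by (subst Lp_norm_le_iff) auto
  qed
qed

lemma Lp_norm_sum_le:
  assumes "1 \<le> p" "finite I" "\<And>i. i \<in> I \<Longrightarrow> g i \<in> Lp p"
  shows "Lp_norm p (\<lambda>x. \<Sum>i\<in>I. g i x) \<le> (\<Sum>i\<in>I. Lp_norm p (g i))"
  using assms(2,3)
proof (induction I rule: finite_induct)
  case (insert i I)
  have "Lp_norm p (\<lambda>x. g i x + (\<Sum>i\<in>I. g i x)) \<le> Lp_norm p (g i) + Lp_norm p (\<lambda>x. \<Sum>i\<in>I. g i x)"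
    by (rule Minkowski) (use assms insert in \<open>auto intro: Lp_sum\<close>)
  then show ?case using insert by auto
qed auto

lemma Lp_norm_diff_le:
  assumes "1 \<le> p" "g \<in> Lp p" "h \<in> Lp p"
  shows "Lp_norm p (\<lambda>x. g x - h x) \<le> Lp_norm p g + Lp_norm p h"
  using Minkowski[OF assms(1,2) Lp_scale[OF assms(3), of "-1"]] Lp_norm_scale[of p "-1" h] assms by simp

lemma Lp_of_nn_integral:
  assumes [measurable]: "g \<in> borel_measurable borel" and "0 < p" "0 \<le> c"
    and le: "(\<integral>\<^sup>+x. ennreal (\<bar>g x\<bar> powr p) \<partial>lborel) \<le> ennreal (c powr p)"
  shows "g \<in> Lp p" "Lp_norm p g \<le> c"
proof -
  have int: "integrable lborel (\<lambda>x. \<bar>g x\<bar> powr p)"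
    using le by (intro integrableI_nonneg) (auto simp: order_le_less_trans)
  then show "g \<in> Lp p" by (simp add: Lp_def)
  have "ennreal (LINT x|lborel. \<bar>g x\<bar> powr p) \<le> ennreal (c powr p)"
    using le nn_integral_eq_integral[OF int] by simp
  then show "Lp_norm p g \<le> c" using assms by (simp add: Lp_norm_le_iff)
qed

lemma Lp_nn_integral:
  assumes "g \<in> Lp p" "0 < p"
  shows "(\<integral>\<^sup>+x. ennreal (\<bar>g x\<bar> powr p) \<partial>lborel) = ennreal (Lp_norm p g powr p)"
  using nn_integral_eq_integral[OF LpD(2)[OF assms(1)]] assms by (simp add: Lp_norm_powr)

text \<open>Completeness of L_p in the form that Neumann series require. Minkowski's inequality
  bounds the partial sums of absolute values, and monotone convergence passes the bound to the p-th
  power of their supremum; its finiteness almost everywhere is absolute convergence.\<close>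

lemma Lp_suminf:
  assumes p: "1 \<le> p" and g: "\<And>n. g n \<in> Lp p" and sm: "summable (\<lambda>n. Lp_norm p (g n))"
  shows "AE x in lborel. summable (\<lambda>n. \<bar>g n x\<bar>)" (is ?A)
    and "(\<lambda>x. \<Sum>n. g n x) \<in> Lp p"
    and "Lp_norm p (\<lambda>x. \<Sum>n. g n x) \<le> (\<Sum>n. Lp_norm p (g n))"
proof -
  have [measurable]: "g n \<in> borel_measurable borel" for n using g LpD by auto
  let ?C = "\<Sum>n. Lp_norm p (g n)"
  have C0: "0 \<le> ?C" by (rule suminf_nonneg[OF sm]) auto
  define G where "G N x = (\<Sum>n<N. \<bar>g n x\<bar>)" for N x
  have Gm[measurable]: "G N \<in> borel_measurable borel" for N unfolding G_def by measurable
  have G0: "0 \<le> G N x" for N x by (simp add: G_def sum_nonneg)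
  have Gmono: "G N x \<le> G M x" if "N \<le> M" for N M x
    unfolding G_def by (rule sum_mono2) (use that in auto)
  have GL: "G N \<in> Lp p" "Lp_norm p (G N) \<le> ?C" for N
  proof -
    show "G N \<in> Lp p" unfolding G_def by (intro Lp_sum p Lp_abs g)
    have "Lp_norm p (G N) \<le> (\<Sum>n<N. Lp_norm p (\<lambda>x. \<bar>g n x\<bar>))"
      unfolding G_def by (intro Lp_norm_sum_le p Lp_abs g) auto
    also have "\<dots> \<le> ?C" unfolding Lp_norm_abs by (rule sum_le_suminf[OF sm]) auto
    finally show "Lp_norm p (G N) \<le> ?C" .
  qed
  \<comment> \<open>The supremum is taken in the extended reals, since its finiteness is still to be
    shown, and after the p-th power, so that monotone convergence applies directly.\<close>
  define S where "S x = (SUP N. ennreal (G N x powr p))" for x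
  have inc: "incseq (\<lambda>N x. ennreal (G N x powr p))"
    unfolding incseq_def le_fun_def using Gmono G0 p by (auto intro!: ennreal_leI powr_mono2)
  have "(\<integral>\<^sup>+x. S x \<partial>lborel) = (SUP N. \<integral>\<^sup>+x. ennreal (G N x powr p) \<partial>lborel)"
    unfolding S_def by (rule nn_integral_monotone_convergence_SUP[OF inc]) simp
  also have "\<dots> \<le> ennreal (?C powr p)"
  proof (rule SUP_least)
    fix N
    have "(\<integral>\<^sup>+x. ennreal (G N x powr p) \<partial>lborel) = ennreal (Lp_norm p (G N) powr p)"
      using Lp_nn_integral[OF GL(1), of N] p G0 by simp
    also have "\<dots> \<le> ennreal (?C powr p)" using GL(2) p by (intro ennreal_leI powr_mono2) auto
    finally show "(\<integral>\<^sup>+x. ennreal (G N x powr p) \<partial>lborel) \<le> ennreal (?C powr p)" .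
  qed
  finally have SI: "(\<integral>\<^sup>+x. S x \<partial>lborel) \<le> ennreal (?C powr p)" .
  have [measurable]: "S \<in> borel_measurable borel" unfolding S_def by measurable
  have "AE x in lborel. S x \<noteq> \<infinity>"
    by (rule nn_integral_PInf_AE) (use SI in \<open>auto simp: top_unique\<close>)
  then have key: "AE x in lborel. summable (\<lambda>n. \<bar>g n x\<bar>) \<and> ennreal (\<bar>\<Sum>n. g n x\<bar> powr p) \<le> S x"
  proof eventually_elim
    case (elim x)
    then obtain r where r: "S x = ennreal r" "0 \<le> r" by (cases "S x") auto
    have b: "G N x powr p \<le> r" for N
    proof -
      have "ennreal (G N x powr p) \<le> S x" unfolding S_def by (rule SUP_upper) simp
      then show ?thesis using r by simp
    qed
    have b2: "G N x \<le> r powr (1 / p)" for N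
    proof -
      have "(G N x powr p) powr (1 / p) \<le> r powr (1 / p)" using b p by (intro powr_mono2) auto
      then show ?thesis using p G0 by (simp add: powr_powr)
    qed
    have s: "summable (\<lambda>n. \<bar>g n x\<bar>)"
      by (rule summableI_nonneg_bounded[of _ "r powr (1/p)"]) (use b2 in \<open>auto simp: G_def\<close>)
    have "(\<Sum>n. \<bar>g n x\<bar>) \<le> r powr (1/p)"
      by (rule suminf_le_const[OF s]) (use b2 in \<open>auto simp: G_def\<close>)
    then have "\<bar>\<Sum>n. g n x\<bar> \<le> r powr (1/p)" using summable_rabs[OF s] by linarith
    then have "\<bar>\<Sum>n. g n x\<bar> powr p \<le> (r powr (1/p)) powr p" using p by (intro powr_mono2) auto
    then have "\<bar>\<Sum>n. g n x\<bar> powr p \<le> r" using p r by (simp add: powr_powr)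
    then show ?case using s r by simp
  qed
  then show ?A by eventually_elim auto
  have "(\<integral>\<^sup>+x. ennreal (\<bar>\<Sum>n. g n x\<bar> powr p) \<partial>lborel) \<le> (\<integral>\<^sup>+x. S x \<partial>lborel)"
    by (rule nn_integral_mono_AE) (use key in auto)
  also note SI
  finally have fin: "(\<integral>\<^sup>+x. ennreal (\<bar>\<Sum>n. g n x\<bar> powr p) \<partial>lborel) \<le> ennreal (?C powr p)" .
  show "(\<lambda>x. \<Sum>n. g n x) \<in> Lp p" "Lp_norm p (\<lambda>x. \<Sum>n. g n x) \<le> ?C"
    using Lp_of_nn_integral[OF _ _ C0 fin] p by auto
qed

subsection \<open>Test functions and weak derivatives\<close>

text \<open>The classical flat function exp(-c/t), with a power of 1/t in front so that the family
  is closed under differentiation up to linear combinations. The parameter \<open>c\<close> is kept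
  because c -> 0 makes the bumps built from it converge to an indicator function.\<close>

definition flat_exp :: "real \<Rightarrow> nat \<Rightarrow> real \<Rightarrow> real" where
  "flat_exp c i t = (if 0 < t then (1 / t) ^ i * exp (- (c / t)) else 0)"

lemma power_div_fact_le_exp:
  fixes y :: real assumes "0 \<le> y" shows "y ^ n / fact n \<le> exp y"
proof -
  have "sum (\<lambda>n. inverse (fact n) * y ^ n) {n} \<le> (\<Sum>n. inverse (fact n) * y ^ n)"
    by (rule sum_le_suminf[OF summable_exp]) (use assms in auto)
  then show ?thesis by (simp add: exp_def divide_inverse mult.commute scaleR_conv_of_real)
qed

text \<open>A single term of the exponential series, of index i + 1, beats the pole t^(-i) by one
  order; linear decay at 0 is exactly what the derivative at the origin requires.\<close>

lemma flat_exp_le: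
  assumes "0 < c" shows "flat_exp c i t \<le> fact (Suc i) / c ^ Suc i * \<bar>t\<bar>"
proof (cases "0 < t")
  case True
  have "(c / t) ^ Suc i / fact (Suc i) \<le> exp (c / t)"
    by (rule power_div_fact_le_exp) (use assms True in auto)
  then have "exp (- (c / t)) \<le> fact (Suc i) / (c / t) ^ Suc i"
    using le_imp_inverse_le[of "(c / t) ^ Suc i / fact (Suc i)" "exp (c / t)"] assms True
    by (simp add: exp_minus del: power_Suc fact_Suc)
  from mult_left_mono[OF this, of "(1 / t) ^ i"]
  have "flat_exp c i t \<le> (1 / t) ^ i * (fact (Suc i) / (c / t) ^ Suc i)"
    using True
    by (simp add: flat_exp_def del: power_Suc fact_Suc)
  also have "\<dots> = fact (Suc i) / c ^ Suc i * \<bar>t\<bar>"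
    using True assms by (simp add: power_divide)
  finally show ?thesis .
next
  case False
  have "0 \<le> fact (Suc i) / c ^ Suc i * \<bar>t\<bar>" using assms by (intro mult_nonneg_nonneg) auto
  then show ?thesis using False by (simp add: flat_exp_def)
qed

lemma flat_exp_nonneg: "0 \<le> flat_exp c i t" by (simp add: flat_exp_def)

lemma flat_exp_DERIV:
  assumes c: "0 < c"
  shows "(flat_exp c i has_real_derivative (c * flat_exp c (i + 2) t - real i * flat_exp c (i + 1) t)) (at t)"
proof -
  consider "t < 0" | "t = 0" | "0 < t" by linarith
  then show ?thesis
  proof cases
    case 1
    have "((\<lambda>_. 0) has_real_derivative 0) (at t)" by simp
    then have "(flat_exp c i has_real_derivative 0) (at t)"
      by (rule DERIV_cong_ev[THEN iffD1, rotated -1])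
        (use 1 in \<open>auto intro!: eventually_mono[OF order_tendstoD(2)[OF tendsto_ident_at 1]] eventually_nhds_in_open[of "{..<0}", THEN eventually_mono] simp: flat_exp_def\<close>)
    then show ?thesis using 1 by (simp add: flat_exp_def)
  next
    case 3
    have *: "((\<lambda>t. (1 / t) ^ i * exp (- (c / t))) has_real_derivative
        (c * flat_exp c (i + 2) t - real i * flat_exp c (i + 1) t)) (at t)"
    proof (cases i)
      case 0
      then show ?thesis using 3
        by (auto intro!: derivative_eq_intros simp: flat_exp_def field_simps power2_eq_square)
    next
      case (Suc j)
      have "((\<lambda>t. (1 / t) ^ Suc j) has_real_derivative (- real (Suc j) * (1 / t) ^ Suc (Suc j))) (at t)"
        by (rule DERIV_cong[OF DERIV_power[of _ "- 1 / t\<^sup>2"]])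
          (use 3 in \<open>auto intro!: derivative_eq_intros simp: power2_eq_square left_diff_distrib distrib_right diff_divide_distrib add_divide_distrib\<close>)
      moreover have "((\<lambda>t. exp (- (c / t))) has_real_derivative (c * (1 / t)\<^sup>2 * exp (- (c / t)))) (at t)"
        using 3 by (auto intro!: derivative_eq_intros simp: power2_eq_square)
      ultimately show ?thesis unfolding Suc
        by (rule DERIV_cong[OF DERIV_mult]) (use 3 in \<open>simp add: flat_exp_def algebra_simps power2_eq_square add_divide_distrib diff_divide_distrib\<close>)
    qed
    show ?thesis
      by (rule DERIV_cong_ev[THEN iffD1, rotated -1, OF *])
        (use 3 in \<open>auto intro!: eventually_nhds_in_open[of "{0<..}", THEN eventually_mono] simp: flat_exp_def\<close>)
  next
    case 2
    let ?C = "fact (Suc (Suc i)) / c ^ Suc (Suc i)"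
    have "((\<lambda>h. (flat_exp c i h - flat_exp c i 0) / (h - 0)) \<longlongrightarrow> 0) (at 0)"
    proof (rule Lim_null_comparison)
      have "norm ((flat_exp c i h - flat_exp c i 0) / (h - 0)) \<le> ?C * \<bar>h\<bar>" for h
      proof (cases "0 < h")
        case True
        \<comment> \<open>At the origin the difference quotient is again a member of the family,
          with index i + 1, so the linear bound makes it tend to 0.\<close>
        have "norm ((flat_exp c i h - flat_exp c i 0) / (h - 0)) = flat_exp c (Suc i) h"
          using True by (simp add: flat_exp_def)
        then show ?thesis using flat_exp_le[OF c, of "Suc i" h] by simp
      next
        case False
        have "0 \<le> ?C * \<bar>h\<bar>" using c by (intro mult_nonneg_nonneg) auto
        then show ?thesis using False by (simp add: flat_exp_def)
      qed
      then show "\<forall>\<^sub>F h in at 0. norm ((flat_exp c i h - flat_exp c i 0) / (h - 0)) \<le> ?C * \<bar>h\<bar>" by simp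
      show "((\<lambda>h. ?C * \<bar>h\<bar>) \<longlongrightarrow> 0) (at 0)" using c by (auto intro!: tendsto_eq_intros)
    qed
    then show ?thesis using 2 by (simp add: has_field_derivative_iff flat_exp_def)
  qed
qed

text \<open>A span closed under differentiation: smoothness of all orders then follows by induction
  without a formula for the n-th derivative. The two flat factors switch the product off to the left
  of \<open>a\<close> and to the right of \<open>b\<close>.\<close>

inductive bump_span :: "real \<Rightarrow> real \<Rightarrow> real \<Rightarrow> (real \<Rightarrow> real) \<Rightarrow> bool" for c a b where
  base: "bump_span c a b (\<lambda>x. flat_exp c i (x - a) * flat_exp c j (b - x))"
| lin: "bump_span c a b f \<Longrightarrow> bump_span c a b g \<Longrightarrow> bump_span c a b (\<lambda>x. u * f x + v * g x)"

lemma bump_span_deriv: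
  assumes "0 < c" "bump_span c a b f"
  shows "\<exists>f'. bump_span c a b f' \<and> (\<forall>x. (f has_real_derivative f' x) (at x))"
  using assms(2)
proof induction
  case (base i j)
  let ?T = "\<lambda>i j x. flat_exp c i (x - a) * flat_exp c j (b - x)"
  let ?f' = "\<lambda>x. 1 * (c * ?T (i + 2) j x + (- real i) * ?T (i + 1) j x)
      + 1 * ((- c) * ?T i (j + 2) x + real j * ?T i (j + 1) x)"
  have "bump_span c a b ?f'" by (intro bump_span.lin bump_span.base)
  moreover have "(?T i j has_real_derivative ?f' x) (at x)" for x
  proof -
    have 1: "((\<lambda>x. flat_exp c i (x - a)) has_real_derivative
        (c * flat_exp c (i + 2) (x - a) - real i * flat_exp c (i + 1) (x - a)) * 1) (at x)"
      by (rule DERIV_chain2[OF flat_exp_DERIV[OF assms(1)]]) (auto intro!: derivative_eq_intros)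
    have 2: "((\<lambda>x. flat_exp c j (b - x)) has_real_derivative
        (c * flat_exp c (j + 2) (b - x) - real j * flat_exp c (j + 1) (b - x)) * (-1)) (at x)"
      by (rule DERIV_chain2[OF flat_exp_DERIV[OF assms(1)]]) (auto intro!: derivative_eq_intros)
    show ?thesis by (rule DERIV_cong[OF DERIV_mult[OF 1 2]]) (simp add: algebra_simps)
  qed
  ultimately show ?case by (intro exI conjI allI)
next
  case (lin f g u v)
  then obtain f' g' where "bump_span c a b f'" "\<forall>x. (f has_real_derivative f' x) (at x)"
    "bump_span c a b g'" "\<forall>x. (g has_real_derivative g' x) (at x)" by blast
  then show ?case
    by (intro exI[of _ "\<lambda>x. u * f' x + v * g' x"] conjI bump_span.lin allI)
      (auto intro!: derivative_eq_intros)
qed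

lemma bump_span_smooth:
  assumes "0 < c" "bump_span c a b f"
  shows "((deriv ^^ n) f) differentiable (at x)"
proof -
  have "bump_span c a b ((deriv ^^ n) f)"
  proof (induction n)
    case (Suc n)
    obtain f' where f': "bump_span c a b f'" "\<forall>x. ((deriv ^^ n) f has_real_derivative f' x) (at x)"
      using bump_span_deriv[OF assms(1) Suc] by blast
    then have "deriv ((deriv ^^ n) f) = f'" by (auto intro!: ext DERIV_imp_deriv)
    then show ?case using f' by simp
  qed (use assms in simp)
  then show ?thesis using bump_span_deriv[OF assms(1)] real_differentiable_def by blast
qed

lemma compact_closure_support:
  fixes \<phi> :: "real \<Rightarrow> real"
  assumes "\<And>x. M < \<bar>x\<bar> \<Longrightarrow> \<phi> x = 0"
  shows "compact (closure {x. \<phi> x \<noteq> 0})"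
proof -
  have "bounded {x. \<phi> x \<noteq> 0}"
    by (rule bounded_subset[of "{-M..M}"]) (use assms in \<open>force simp: abs_le_iff\<close>)+
  then show ?thesis by (simp add: compact_closure)
qed

lemma test_fun_bump:
  assumes "0 < c" "a < b"
  shows "test_fun (\<lambda>x. flat_exp c 0 (x - a) * flat_exp c 0 (b - x))"
  unfolding test_fun_def
proof (intro conjI allI)
  show "((deriv ^^ n) (\<lambda>x. flat_exp c 0 (x - a) * flat_exp c 0 (b - x))) differentiable at x" for n x
    by (rule bump_span_smooth[OF assms(1) bump_span.base])
  show "compact (closure {x. flat_exp c 0 (x - a) * flat_exp c 0 (b - x) \<noteq> 0})"
    by (rule compact_closure_support[of "\<bar>a\<bar> + \<bar>b\<bar>"]) (auto simp: flat_exp_def)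
qed

lemma test_fun_support:
  assumes "test_fun \<phi>" obtains M where "0 < M" "\<And>x. M < \<bar>x\<bar> \<Longrightarrow> \<phi> x = 0"
proof -
  have "bounded {x. \<phi> x \<noteq> 0}"
    using assms unfolding test_fun_def by (meson bounded_subset closure_subset compact_imp_bounded)
  then obtain M where "\<And>x. \<phi> x \<noteq> 0 \<Longrightarrow> \<bar>x\<bar> \<le> M" unfolding bounded_iff by auto
  then have "\<And>x. max M 1 < \<bar>x\<bar> \<Longrightarrow> \<phi> x = 0" by force
  then show ?thesis using that[of "max M 1"] by auto
qed

lemma test_fun_DERIV: "test_fun \<phi> \<Longrightarrow> (\<phi> has_real_derivative deriv \<phi> x) (at x)"
  unfolding test_fun_def
  by (metis DERIV_deriv_iff_real_differentiable funpow_0)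

lemma test_fun_continuous: "test_fun \<phi> \<Longrightarrow> continuous_on A \<phi>"
  by (meson DERIV_isCont continuous_at_imp_continuous_on test_fun_DERIV)

lemma test_fun_deriv: assumes "test_fun \<phi>" shows "test_fun (deriv \<phi>)"
proof -
  obtain M where M: "\<And>x. M < \<bar>x\<bar> \<Longrightarrow> \<phi> x = 0" using test_fun_support[OF assms] by metis
  have "deriv \<phi> x = 0" if "M < \<bar>x\<bar>" for x
  proof -
    have "(\<phi> has_real_derivative 0) (at x)"
      by (rule DERIV_cong_ev[THEN iffD1, rotated -1, of "\<lambda>_. 0"])
        (use that M in \<open>auto intro!: eventually_nhds_in_open[of "{x. M < \<bar>x\<bar>}", THEN eventually_mono] open_Collect_less continuous_intros\<close>)
    then show ?thesis by (rule DERIV_imp_deriv)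
  qed
  then have "compact (closure {x. deriv \<phi> x \<noteq> 0})" by (rule compact_closure_support[of M]) auto
  moreover have "((deriv ^^ n) (deriv \<phi>)) differentiable at x" for n x
    using assms unfolding test_fun_def by (metis comp_apply funpow_Suc_right)
  ultimately show ?thesis by (simp add: test_fun_def)
qed

lemma test_fun_integrable: assumes "test_fun \<phi>" shows "integrable lborel \<phi>"
proof -
  obtain M where M: "\<And>x. M < \<bar>x\<bar> \<Longrightarrow> \<phi> x = 0" using test_fun_support[OF assms] by metis
  have "set_integrable lborel {-M..M} \<phi>"
    by (rule borel_integrable_compact[folded set_integrable_def, of "{-M..M}"]) (auto intro: test_fun_continuous assms)
  moreover have "(\<lambda>x. indicator {-M..M} x *\<^sub>R \<phi> x) = \<phi>" using M by (force simp: indicator_def)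
  ultimately show ?thesis by (simp add: set_integrable_def)
qed

lemma test_fun_lincomb:
  assumes "test_fun \<phi>" "test_fun \<psi>" shows "test_fun (\<lambda>x. u * \<phi> x + v * \<psi> x)"
proof -
  have d: "(deriv ^^ n) (\<lambda>x. u * \<phi> x + v * \<psi> x) = (\<lambda>x. u * (deriv ^^ n) \<phi> x + v * (deriv ^^ n) \<psi> x)" for n
  proof (induction n)
    case (Suc n)
    have D: "((deriv ^^ n) \<phi> has_real_derivative (deriv ^^ Suc n) \<phi> x) (at x)"
      "((deriv ^^ n) \<psi> has_real_derivative (deriv ^^ Suc n) \<psi> x) (at x)" for x
      using assms by (simp_all add: test_fun_def DERIV_deriv_iff_real_differentiable)
    show ?case unfolding funpow.simps comp_apply Suc
      by (rule ext, rule DERIV_imp_deriv) (use D in \<open>auto intro!: derivative_eq_intros\<close>)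
  qed simp
  obtain M where M: "\<And>x. M < \<bar>x\<bar> \<Longrightarrow> \<phi> x = 0" using test_fun_support[OF assms(1)] by metis
  obtain N where N: "\<And>x. N < \<bar>x\<bar> \<Longrightarrow> \<psi> x = 0" using test_fun_support[OF assms(2)] by metis
  have "compact (closure {x. u * \<phi> x + v * \<psi> x \<noteq> 0})"
    by (rule compact_closure_support[of "max M N"]) (use M N in auto)
  then show ?thesis using assms by (auto simp: test_fun_def d)
qed

text \<open>A primitive vanishing to the left of the support is constant to the right of it, and
  that constant is the integral; mean zero is therefore what makes the primitive compactly
  supported.\<close>

lemma test_fun_antiderivative:
  assumes "test_fun \<psi>" "(LINT x|lborel. \<psi> x) = 0"
  obtains \<phi> where "test_fun \<phi>" "deriv \<phi> = \<psi>"
proof -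
  obtain M where M: "0 < M" "\<And>x. M < \<bar>x\<bar> \<Longrightarrow> \<psi> x = 0" using test_fun_support[OF assms(1)] by metis
  have "\<exists>F. \<forall>x. (F has_vector_derivative \<psi> x) (at x)"
    using einterval_antiderivative[of "-\<infinity>" \<infinity> \<psi>] test_fun_continuous[OF assms(1), of UNIV]
    by (simp add: continuous_on_eq_continuous_at)
  then obtain F where F: "\<And>x. (F has_vector_derivative \<psi> x) (at x)" by blast
  have FD: "(F has_real_derivative \<psi> x) (at x)" for x
    using F by (simp add: has_real_derivative_iff_has_vector_derivative)
  define \<phi> where "\<phi> x = F x - F (- M - 1)" for x
  have D: "(\<phi> has_real_derivative \<psi> x) (at x)" for x
    unfolding \<phi>_def using FD by (auto intro!: derivative_eq_intros)
  then have d: "deriv \<phi> = \<psi>" by (auto intro!: ext DERIV_imp_deriv)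
  have L: "\<phi> x = 0" if "x < - M" for x
  proof -
    have "\<exists>c. \<forall>y\<in>{..<-M}. \<phi> y = c"
    proof (rule has_field_derivative_zero_constant)
      show "(\<phi> has_real_derivative 0) (at y within {..<-M})" if "y \<in> {..<-M}" for y
        using D[of y] M(2)[of y] that M(1) by (auto intro: has_field_derivative_at_within)
    qed auto
    then have "\<phi> x = \<phi> (- M - 1)" using that by force
    then show ?thesis by (simp add: \<phi>_def)
  qed
  have R: "\<phi> x = 0" if "M < x" for x
  proof -
    have "\<exists>c. \<forall>y\<in>{M<..}. \<phi> y = c"
    proof (rule has_field_derivative_zero_constant)
      show "(\<phi> has_real_derivative 0) (at y within {M<..})" if "y \<in> {M<..}" for y
        using D[of y] M(2)[of y] that M(1) by (auto intro: has_field_derivative_at_within)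
    qed auto
    then have "\<phi> x = \<phi> (M + 1)" using that by force
    also have "\<dots> = \<phi> (M + 1) - \<phi> (- M - 1)" using L by simp
    also have "\<dots> = (LBINT x. \<psi> x * indicator {-M - 1..M + 1} x)"
      by (rule integral_FTC_Icc_real[symmetric])
        (use M(1) D DERIV_isCont[OF test_fun_DERIV[OF assms(1)]] in \<open>auto\<close>)
    also have "\<dots> = (LINT x|lborel. \<psi> x)"
      by (rule Bochner_Integration.integral_cong) (use M in \<open>force simp: indicator_def\<close>)+
    finally show ?thesis using assms by simp
  qed
  have "compact (closure {x. \<phi> x \<noteq> 0})"
  proof (rule compact_closure_support[of M])
    fix x assume "M < \<bar>x\<bar>"
    then have "x < - M \<or> M < x" by auto
    then show "\<phi> x = 0" using L R by blast
  qed
  moreover have "((deriv ^^ n) \<phi>) differentiable at x" for n x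
  proof (cases n)
    case 0
    then show ?thesis using D real_differentiable_def by auto
  next
    case (Suc m)
    then show ?thesis using assms d by (simp add: funpow_swap1 test_fun_def)
  qed
  ultimately show ?thesis using that d by (auto simp: test_fun_def)
qed

section \<open>The fundamental lemma, the du Bois-Reymond lemma and primitives of weak
  derivatives\<close>

definition loc_integrable :: "(real \<Rightarrow> real) \<Rightarrow> bool" where
  "loc_integrable u \<longleftrightarrow> (\<forall>K. compact K \<longrightarrow> set_integrable lborel K u)"

lemma loc_integrable_measurable: 
  assumes "loc_integrable u" shows "u \<in> borel_measurable borel"
proof -
  have m: "(\<lambda>x. indicator {- real n..real n} x *\<^sub>R u x) \<in> borel_measurable borel" for n
    using assms borel_measurable_integrable unfolding loc_integrable_def set_integrable_def by fastforce
  show ?thesis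
  proof (rule borel_measurable_LIMSEQ_real[OF _ m])
    fix x :: real
    obtain N :: nat where "\<bar>x\<bar> \<le> real N" using real_arch_simple by blast
    then have "\<forall>\<^sub>F n in sequentially. indicator {- real n..real n} x *\<^sub>R u x = u x"
      by (intro eventually_sequentiallyI[of N]) (auto simp: indicator_def)
    then show "(\<lambda>n. indicator {- real n..real n} x *\<^sub>R u x) \<longlonglongrightarrow> u x" by (rule tendsto_eventually)
  qed
qed

lemma loc_integrable_diff: "loc_integrable u \<Longrightarrow> loc_integrable v \<Longrightarrow> loc_integrable (\<lambda>x. u x - v x)"
  unfolding loc_integrable_def by (auto intro: set_integral_diff)

lemma loc_integrable_continuous:
  assumes "continuous_on UNIV u" shows "loc_integrable u"
  unfolding loc_integrable_def set_integrable_def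
proof (intro allI impI)
  fix K :: "real set" assume "compact K"
  then show "integrable lborel (\<lambda>x. indicator K x *\<^sub>R u x)"
    by (rule borel_integrable_compact) (use continuous_on_subset[OF assms] in auto)
qed

lemma loc_integrable_mult_test:
  assumes "loc_integrable u" "test_fun \<phi>" shows "integrable lborel (\<lambda>x. u x * \<phi> x)"
proof -
  obtain M where M: "\<And>x. M < \<bar>x\<bar> \<Longrightarrow> \<phi> x = 0" using test_fun_support[OF assms(2)] by metis
  have "bounded (\<phi> ` {-M..M})"
    by (intro compact_imp_bounded compact_continuous_image test_fun_continuous assms) auto
  then obtain B where "\<forall>x\<in>{-M..M}. \<bar>\<phi> x\<bar> \<le> B" unfolding bounded_iff by auto
  then have B: "\<And>x. x \<in> {-M..M} \<Longrightarrow> \<bar>\<phi> x\<bar> \<le> B" by blast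
  have i: "integrable lborel (\<lambda>x. B * (indicator {-M..M} x *\<^sub>R u x))"
    using assms(1) unfolding loc_integrable_def set_integrable_def by auto
  show ?thesis
  proof (rule Bochner_Integration.integrable_bound[OF i])
    show "(\<lambda>x. u x * \<phi> x) \<in> borel_measurable lborel"
      using loc_integrable_measurable[OF assms(1)] borel_measurable_integrable[OF test_fun_integrable[OF assms(2)]] by simp
    show "AE x in lborel. norm (u x * \<phi> x) \<le> norm (B * (indicator {-M..M} x *\<^sub>R u x))"
    proof (rule AE_I2)
      fix x
      show "norm (u x * \<phi> x) \<le> norm (B * (indicator {-M..M} x *\<^sub>R u x))"
      proof (cases "x \<in> {-M..M}")
        case True
        then have "\<bar>\<phi> x\<bar> \<le> \<bar>B\<bar>" using B by force
        then show ?thesis using True by (simp add: abs_mult mult.commute mult_right_mono)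
      next
        case False
        then have "\<phi> x = 0" using M by force
        then show ?thesis by simp
      qed
    qed
  qed
qed

text \<open>The positive and negative parts, taken as densities, assign the same finite mass to
  every closed interval. These intervals form an intersection-stable generator that exhausts the
  line, so the two measures coincide, and with them the densities almost everywhere.\<close>

lemma AE_eq_0_of_interval_integrals:
  assumes loc: "loc_integrable u"
    and z: "\<And>a b. a \<le> b \<Longrightarrow> (LINT x:{a..b}|lborel. u x) = 0"
  shows "AE x in lborel. u x = 0"
proof -
  have [measurable]: "u \<in> borel_measurable borel" by (rule loc_integrable_measurable[OF loc])
  let ?P = "\<lambda>x. ennreal (u x)" and ?N = "\<lambda>x. ennreal (- u x)"
  have emeas: "emeasure (density lborel ?P) {a..b} = emeasure (density lborel ?N) {a..b} \<and>
      emeasure (density lborel ?P) {a..b} \<noteq> \<infinity>" for a b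
  proof -
    have si: "set_integrable lborel {a..b} u" using loc by (auto simp: loc_integrable_def)
    have int: "integrable lborel (\<lambda>x. max 0 (indicator {a..b} x * u x))"
      "integrable lborel (\<lambda>x. max 0 (- (indicator {a..b} x * u x)))"
      using si by (auto simp: set_integrable_def)
    have 1: "emeasure (density lborel ?P) {a..b} = ennreal (LINT x|lborel. max 0 (indicator {a..b} x * u x))"
      unfolding nn_integral_eq_integral[OF int(1), symmetric, simplified]
      by (subst emeasure_density) (auto simp: max_def ennreal_neg intro!: nn_integral_cong split: split_indicator)
    have 2: "emeasure (density lborel ?N) {a..b} = ennreal (LINT x|lborel. max 0 (- (indicator {a..b} x * u x)))"
      unfolding nn_integral_eq_integral[OF int(2), symmetric, simplified]
      by (subst emeasure_density) (auto simp: max_def ennreal_neg intro!: nn_integral_cong split: split_indicator)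
    have "(LINT x|lborel. max 0 (indicator {a..b} x * u x)) - (LINT x|lborel. max 0 (- (indicator {a..b} x * u x)))
      = (LINT x|lborel. max 0 (indicator {a..b} x * u x) - max 0 (- (indicator {a..b} x * u x)))"
      using int by simp
    also have "\<dots> = (LINT x:{a..b}|lborel. u x)"
      unfolding set_lebesgue_integral_def by (rule Bochner_Integration.integral_cong) auto
    also have "\<dots> = 0" using z[of a b] by (cases "a \<le> b") (auto simp: set_lebesgue_integral_def)
    finally show ?thesis using 1 2 by simp
  qed
  have "density lborel ?P = density lborel ?N"
  proof (rule measure_eqI_generator_eq[where \<Omega> = UNIV and A = "\<lambda>n::nat. {- real n..real n}" and E = "range (\<lambda>(a,b::real). {a..b})"])
    show "Int_stable (range (\<lambda>(a,b::real). {a..b}))"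
      by (auto simp: Int_stable_def Int_atLeastAtMost)
    show "sets (density lborel ?P) = sigma_sets UNIV (range (\<lambda>(a, b). {a..b}))"
      "sets (density lborel ?N) = sigma_sets UNIV (range (\<lambda>(a, b). {a..b}))"
      by (simp_all add: borel_eq_atLeastAtMost)
    show "(\<Union>i::nat. {- real i..real i}) = UNIV"
      by (auto, metis abs_le_iff minus_le_iff real_arch_simple)
    show "emeasure (density lborel ?P) {- real i..real i} \<noteq> \<infinity>" for i :: nat using emeas by blast
  qed (use emeas in auto)
  then have "AE x in lborel. ?P x = ?N x" by (subst (asm) sigma_finite_measure.density_unique_iff[OF sigma_finite_lborel]) auto
  then show ?thesis
  proof eventually_elim
    case (elim x)
    then show ?case by (cases "0 \<le> u x") (auto simp: ennreal_neg)
  qed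
qed

text \<open>Bumps with parameter c = 1/(n + 1) stay below 1, vanish outside (a, b) and tend to 1
  inside; dominated convergence yields vanishing interval integrals.\<close>

lemma fundamental_lemma:
  assumes loc: "loc_integrable u"
    and z: "\<And>\<phi>. test_fun \<phi> \<Longrightarrow> (LINT x|lborel. u x * \<phi> x) = 0"
  shows "AE x in lborel. u x = 0"
proof (rule AE_eq_0_of_interval_integrals[OF loc])
  have [measurable]: "u \<in> borel_measurable borel" by (rule loc_integrable_measurable[OF loc])
  fix a b :: real assume "a \<le> b"
  show "(LINT x:{a..b}|lborel. u x) = 0"
  proof (cases "a = b")
    case True
    have "AE x in lborel. indicator {a..b} x *\<^sub>R u x = 0"
      using AE_lborel_singleton[of a] by eventually_elim (use True in auto)
    then show ?thesis unfolding set_lebesgue_integral_def by (rule integral_eq_zero_AE)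
  next
    case False
    then have ab: "a < b" using \<open>a \<le> b\<close> by simp
    let ?\<phi> = "\<lambda>n x. flat_exp (1 / Suc n) 0 (x - a) * flat_exp (1 / Suc n) 0 (b - x)"
    have t: "test_fun (?\<phi> n)" for n by (rule test_fun_bump) (use ab in auto)
    have "(\<lambda>n. LINT x|lborel. u x * ?\<phi> n x) \<longlonglongrightarrow> (LINT x|lborel. indicator {a..b} x *\<^sub>R u x)"
    proof (rule integral_dominated_convergence[where w = "\<lambda>x. indicator {a..b} x * \<bar>u x\<bar>"])
      show "(\<lambda>x. u x * ?\<phi> n x) \<in> borel_measurable lborel" for n
        using loc_integrable_mult_test[OF loc t] by blast
      have "set_integrable lborel {a..b} u" using loc by (auto simp: loc_integrable_def)
      then show "integrable lborel (\<lambda>x. indicator {a..b} x * \<bar>u x\<bar>)"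
        using set_integrable_abs by (force simp: set_integrable_def)
      show "AE x in lborel. (\<lambda>n. u x * ?\<phi> n x) \<longlonglongrightarrow> indicator {a..b} x *\<^sub>R u x"
        using AE_lborel_singleton[of a] AE_lborel_singleton[of b]
      proof eventually_elim
        case (elim x)
        show ?case
        proof (cases "x \<in> {a..b}")
          case True
          have "(\<lambda>n. u x * (exp (- ((1 / Suc n) / (x - a))) * exp (- ((1 / Suc n) / (b - x)))))
             \<longlonglongrightarrow> u x * (exp (- (0 / (x - a))) * exp (- (0 / (b - x))))"
            by (intro tendsto_intros LIMSEQ_Suc[OF lim_1_over_n]) (use elim in auto)
          then show ?thesis using True elim by (simp add: flat_exp_def)
        qed (auto simp: flat_exp_def)
      qed
      show "AE x in lborel. norm (u x * ?\<phi> n x) \<le> indicator {a..b} x * \<bar>u x\<bar>" for n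
      proof (rule AE_I2)
        fix x
        have "\<bar>u x\<bar> * (exp (- ((1 / Suc n) / (x - a))) * exp (- ((1 / Suc n) / (b - x)))) \<le> \<bar>u x\<bar> * (1 * 1)" if "a < x" "x < b"
          using that by (intro mult_left_mono mult_mono) auto
        then show "norm (u x * ?\<phi> n x) \<le> indicator {a..b} x * \<bar>u x\<bar>"
          by (auto simp: flat_exp_def indicator_def abs_mult)
      qed
    qed auto
    then have "(\<lambda>n. 0::real) \<longlonglongrightarrow> (LINT x|lborel. indicator {a..b} x *\<^sub>R u x)" unfolding z[OF t] .
    from LIMSEQ_unique[OF this tendsto_const] show ?thesis by (simp add: set_lebesgue_integral_def)
  qed
qed

text \<open>Additivity comes from interval integrals. Continuity is imported from the indefinite
  Henstock-Kurzweil integral on each window [x - 1, x + 1], with which the primitive agrees up to a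
  constant.\<close>

lemma loc_integrable_primitive:
  assumes loc: "loc_integrable g"
  obtains F where "continuous_on UNIV F" "\<And>a b. a \<le> b \<Longrightarrow> F b - F a = (LINT t:{a..b}|lborel. g t)"
proof -
  have si: "interval_lebesgue_integrable lborel (ereal a) (ereal b) g" for a b
  proof -
    have "set_integrable lborel {c<..<d} g" for c d
      by (rule set_integrable_subset[of _ "{c..d}"]) (use loc in \<open>auto simp: loc_integrable_def\<close>)
    then show ?thesis by (simp add: interval_lebesgue_integrable_def)
  qed
  define F where "F x = (LBINT t=0..x. g t)" for x :: real
  have d: "F b - F a = (LINT t:{a..b}|lborel. g t)" if "a \<le> b" for a b
  proof -
    have si': "interval_lebesgue_integrable lborel (min (ereal 0) (min (ereal a) (ereal b))) (max (ereal 0) (max (ereal a) (ereal b))) g"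
      using si[of "min 0 (min a b)" "max 0 (max a b)"] by (simp add: min_def max_def zero_ereal_def split: if_splits)
    have "(LBINT t=ereal 0..a. g t) + (LBINT t=a..b. g t) = (LBINT t=ereal 0..b. g t)"
      using si' by (intro interval_integral_sum) (auto simp: min.assoc max.assoc)
    then show ?thesis using that by (simp add: F_def interval_integral_Icc zero_ereal_def)
  qed
  have c: "isCont F x" for x
  proof -
    have "set_integrable lborel {x-1..x+1} g" using loc by (auto simp: loc_integrable_def)
    then have hk: "g integrable_on {x-1..x+1}" by (rule set_borel_integral_eq_integral(1))
    have "continuous_on {x-1..x+1} (\<lambda>y. integral {x-1..y} g)" by (rule indefinite_integral_continuous_1[OF hk])
    then have co: "continuous_on {x-1..x+1} (\<lambda>y. integral {x-1..y} g + F (x - 1))" by (intro continuous_intros)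
    have eq: "integral {x-1..y} g + F (x - 1) = F y" if "y \<in> {x-1..x+1}" for y
    proof -
      have "set_integrable lborel {x-1..y} g" using loc by (auto simp: loc_integrable_def)
      then have "(LINT t:{x-1..y}|lborel. g t) = integral {x-1..y} g"
        by (simp add: set_borel_integral_eq_integral)
      then show ?thesis using d[of "x - 1" y] that by simp
    qed
    have "continuous_on {x-1..x+1} F" by (rule continuous_on_cong[OF refl eq, THEN iffD1, OF _ co])
    then show ?thesis by (rule continuous_on_interior) (auto simp: interior_atLeastAtMost_real)
  qed
  show ?thesis by (rule that[of F]) (use c d in \<open>auto simp: continuous_at_imp_continuous_on\<close>)
qed

lemma integrable_tensor:
  fixes f g :: "real \<Rightarrow> real"
  assumes f: "integrable lborel f" and g: "integrable lborel g"
  shows "integrable (lborel \<Otimes>\<^sub>M lborel) (\<lambda>(x, y). f x * g y)"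
proof (rule lborel_pair.Fubini_integrable)
  have [measurable]: "f \<in> borel_measurable borel" "g \<in> borel_measurable borel" using f g by auto
  show "(\<lambda>(x, y). f x * g y) \<in> borel_measurable (lborel \<Otimes>\<^sub>M lborel)" by measurable
  have "(\<lambda>x. LINT y|lborel. norm (f x * g y)) = (\<lambda>x. \<bar>f x\<bar> * (LINT y|lborel. \<bar>g y\<bar>))"
    by (simp add: abs_mult)
  then show "integrable lborel (\<lambda>x. LINT y|lborel. norm (case (x, y) of (x, y) \<Rightarrow> f x * g y))"
    using f by simp
qed (use g in auto)

text \<open>The primitive is only known to be continuous here, so the product rule is replaced by
  Fubini for g(x) \<phi>'(t) on the triangle -L <= x <= t <= L: one order of integration produces -g
  \<phi>, the other (F(t) - F(-L)) \<phi>'(t).\<close>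

lemma primitive_by_parts:
  assumes loc: "loc_integrable g" and cF: "continuous_on UNIV F"
    and F: "\<And>a b. a \<le> b \<Longrightarrow> F b - F a = (LINT t:{a..b}|lborel. g t)"
    and t: "test_fun \<phi>"
  shows "(LINT x|lborel. F x * deriv \<phi> x) = - (LINT x|lborel. g x * \<phi> x)"
proof -
  have [measurable]: "g \<in> borel_measurable borel" by (rule loc_integrable_measurable[OF loc])
  note t' = test_fun_deriv[OF t]
  have [measurable]: "deriv \<phi> \<in> borel_measurable borel" "\<phi> \<in> borel_measurable borel"
    using borel_measurable_integrable[OF test_fun_integrable] t t' by auto
  obtain M where M: "0 < M" "\<And>x. M < \<bar>x\<bar> \<Longrightarrow> \<phi> x = 0" using test_fun_support[OF t] by metis
  obtain N where N: "0 < N" "\<And>x. N < \<bar>x\<bar> \<Longrightarrow> deriv \<phi> x = 0" using test_fun_support[OF t'] by metis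
  \<comment> \<open>One unit beyond both supports, so that \<phi> and its derivative vanish at the
    end points themselves.\<close>
  define L where "L = max M N + 1"
  have L: "\<And>x. L \<le> \<bar>x\<bar> \<Longrightarrow> \<phi> x = 0" "\<And>x. L \<le> \<bar>x\<bar> \<Longrightarrow> deriv \<phi> x = 0" "0 < L"
    using M N by (auto simp: L_def)
  have FTC: "(LBINT x. deriv \<phi> x * indicator {a..b} x) = \<phi> b - \<phi> a" if "a \<le> b" for a b
    by (rule integral_FTC_Icc_real)
      (use that t test_fun_DERIV test_fun_continuous[OF t', of UNIV] in \<open>auto intro: has_field_derivative_at_within simp: continuous_on_eq_continuous_at\<close>)
  let ?h = "\<lambda>x t. indicator {-L..L} x * g x * (deriv \<phi> t * indicator {x..L} t)"
  have gL: "integrable lborel (\<lambda>x. indicator {-L..L} x * g x)"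
    using loc by (auto simp: loc_integrable_def set_integrable_def)
  have int: "integrable (lborel \<Otimes>\<^sub>M lborel) (\<lambda>(x, t). ?h x t)"
  proof (rule Bochner_Integration.integrable_bound)
    show "integrable (lborel \<Otimes>\<^sub>M lborel) (\<lambda>(x, t). (indicator {-L..L} x * g x) * deriv \<phi> t)"
      by (rule integrable_tensor[OF gL test_fun_integrable[OF t']])
    show "AE z in lborel \<Otimes>\<^sub>M lborel. norm (case z of (x, t) \<Rightarrow> ?h x t) \<le> norm (case z of (x, t) \<Rightarrow> (indicator {-L..L} x * g x) * deriv \<phi> t)"
      by (auto simp: indicator_def)
    have e: "(\<lambda>(x, t). ?h x t) = (\<lambda>z. indicator {-L..L} (fst z) * g (fst z) * (deriv \<phi> (snd z) * (if fst z \<le> snd z \<and> snd z \<le> L then 1 else 0)))"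
      by (auto simp: indicator_def)
    show "(\<lambda>(x, t). ?h x t) \<in> borel_measurable (lborel \<Otimes>\<^sub>M lborel)" unfolding e by measurable
  qed
  have 1: "(LINT x|lborel. (LINT t|lborel. ?h x t)) = - (LINT x|lborel. g x * \<phi> x)"
  proof -
    have "(LINT t|lborel. ?h x t) = - (g x * \<phi> x)" for x
    proof (cases "x \<in> {-L..L}")
      case True
      then have "(LINT t|lborel. deriv \<phi> t * indicator {x..L} t) = - \<phi> x" using FTC[of x L] L(1)[of L] L(3) by simp
      then show ?thesis using True by simp
    next
      case False
      then have "L \<le> \<bar>x\<bar>" by auto
      then show ?thesis using L(1)[of x] False by simp
    qed
    then show ?thesis by simp
  qed
  have 2: "(LINT t|lborel. (LINT x|lborel. ?h x t)) = (LINT t|lborel. F t * deriv \<phi> t - F (- L) * deriv \<phi> t)"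
  proof (rule Bochner_Integration.integral_cong[OF refl])
    fix t
    show "(LINT x|lborel. ?h x t) = F t * deriv \<phi> t - F (- L) * deriv \<phi> t"
    proof (cases "t \<in> {-L<..<L}")
      case True
      have "(LINT x|lborel. ?h x t) = (LINT x|lborel. deriv \<phi> t * (indicator {-L..t} x *\<^sub>R g x))"
        by (rule Bochner_Integration.integral_cong) (use True in \<open>auto simp: indicator_def\<close>)
      also have "\<dots> = deriv \<phi> t * (F t - F (-L))"
        using F[of "-L" t] True by (simp add: set_lebesgue_integral_def)
      finally show ?thesis by (simp add: algebra_simps)
    next
      case False
      then show ?thesis using L(2)[of t] by (auto simp: abs_if split: if_splits)
    qed
  qed
  have z: "(LINT t|lborel. deriv \<phi> t) = 0"
  proof -
    have "(LINT t|lborel. deriv \<phi> t) = (LBINT x. deriv \<phi> x * indicator {-L..L} x)"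
      by (rule Bochner_Integration.integral_cong) (use L(2) in \<open>force simp: indicator_def\<close>)+
    then show ?thesis using FTC[of "-L" L] L(1)[of L] L(1)[of "-L"] L(3) by simp
  qed
  have iF: "integrable lborel (\<lambda>t. F t * deriv \<phi> t)"
    by (rule loc_integrable_mult_test[OF loc_integrable_continuous[OF cF] t'])
  have "(LINT t|lborel. F t * deriv \<phi> t - F (- L) * deriv \<phi> t) = (LINT t|lborel. F t * deriv \<phi> t)"
    using iF test_fun_integrable[OF t'] z by simp
  then show ?thesis using 1 2 lborel_pair.Fubini_integral[OF int] by simp
qed

text \<open>Any test function becomes mean free after subtracting a multiple of a fixed bump, and
  mean-free test functions are derivatives. Testing with them shows that u minus its average against
  the bump is orthogonal to all test functions.\<close>

theorem du_Bois_Reymond: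
  assumes loc: "loc_integrable u"
    and z: "\<And>\<phi>. test_fun \<phi> \<Longrightarrow> (LINT x|lborel. u x * deriv \<phi> x) = 0"
  obtains c where "AE x in lborel. u x = c"
proof -
  let ?\<eta>0 = "\<lambda>x. flat_exp 1 0 (x - 0) * flat_exp 1 0 (1 - x)"
  have t0: "test_fun ?\<eta>0" by (rule test_fun_bump) auto
  have "(LINT x|lborel. ?\<eta>0 x) \<noteq> 0"
  proof
    assume "(LINT x|lborel. ?\<eta>0 x) = 0"
    then have "AE x in lborel. ?\<eta>0 x = 0"
      using integral_nonneg_eq_0_iff_AE[OF test_fun_integrable[OF t0]] by (auto simp: flat_exp_nonneg)
    then have "AE x in lborel. x \<notin> {0<..<1::real}" by eventually_elim (auto simp: flat_exp_def)
    then have "emeasure lborel {0<..<1::real} = 0"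
      by (subst (asm) AE_iff_measurable[of "{0<..<1}"]) auto
    then show False by simp
  qed
  then obtain d where d: "d = (LINT x|lborel. ?\<eta>0 x)" "d \<noteq> 0" by blast
  define c where "c = (LINT x|lborel. u x * ?\<eta>0 x) / d"
  have "AE x in lborel. u x - c = 0"
  proof (rule fundamental_lemma)
    have lc: "loc_integrable (\<lambda>x. c)" by (rule loc_integrable_continuous) auto
    then show "loc_integrable (\<lambda>x. u x - c)" by (rule loc_integrable_diff[OF loc])
    fix \<psi> assume t: "test_fun \<psi>"
    let ?m = "LINT x|lborel. \<psi> x"
    let ?\<chi> = "\<lambda>x. 1 * \<psi> x + (- ?m / d) * ?\<eta>0 x"
    have tc: "test_fun ?\<chi>" by (rule test_fun_lincomb[OF t t0])
    have "(LINT x|lborel. ?\<chi> x) = 0"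
      using test_fun_integrable[OF t] test_fun_integrable[OF t0] d by simp
    then obtain \<phi> where "test_fun \<phi>" "deriv \<phi> = ?\<chi>" using test_fun_antiderivative[OF tc] by metis
    then have "(LINT x|lborel. u x * ?\<chi> x) = 0" using z by metis
    moreover have "(LINT x|lborel. u x * ?\<chi> x) = (LINT x|lborel. u x * \<psi> x + (- ?m / d) * (u x * ?\<eta>0 x))"
      by (rule Bochner_Integration.integral_cong) (auto simp: algebra_simps)
    moreover have "\<dots> = (LINT x|lborel. u x * \<psi> x) - c * ?m"
      using loc_integrable_mult_test[OF loc t] loc_integrable_mult_test[OF loc t0] by (simp add: c_def)
    moreover have "(LINT x|lborel. (u x - c) * \<psi> x) = (LINT x|lborel. u x * \<psi> x - c * \<psi> x)"
      by (simp add: algebra_simps)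
    moreover have "\<dots> = (LINT x|lborel. u x * \<psi> x) - c * ?m"
      using loc_integrable_mult_test[OF loc t] test_fun_integrable[OF t] by simp
    ultimately show "(LINT x|lborel. (u x - c) * \<psi> x) = 0" by simp
  qed
  then have "AE x in lborel. u x = c" by eventually_elim simp
  then show ?thesis using that by blast
qed

lemma weak_deriv_loc_integrable:
  assumes "weak_deriv f g" shows "loc_integrable f" "loc_integrable g"
  using assms by (auto simp: weak_deriv_def loc_integrable_def)

text \<open>The primitive of g has the same weak derivative as f, so their difference is constant by
  du Bois-Reymond, and the constant is absorbed in the primitive.\<close>

theorem weak_deriv_primitive:
  assumes w: "weak_deriv f g"
  obtains F where "continuous_on UNIV F" "\<And>a b. a \<le> b \<Longrightarrow> F b - F a = (LINT t:{a..b}|lborel. g t)"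
    "AE x in lborel. f x = F x"
proof -
  note loc = weak_deriv_loc_integrable[OF w]
  obtain F where F: "continuous_on UNIV F" "\<And>a b. a \<le> b \<Longrightarrow> F b - F a = (LINT t:{a..b}|lborel. g t)"
    using loc_integrable_primitive[OF loc(2)] by metis
  note lF = loc_integrable_continuous[OF F(1)]
  have "(LINT x|lborel. (f x - F x) * deriv \<phi> x) = 0" if t: "test_fun \<phi>" for \<phi>
  proof -
    have "(LINT x|lborel. (f x - F x) * deriv \<phi> x) = (LINT x|lborel. f x * deriv \<phi> x - F x * deriv \<phi> x)"
      by (simp add: algebra_simps)
    also have "\<dots> = (LINT x|lborel. f x * deriv \<phi> x) - (LINT x|lborel. F x * deriv \<phi> x)"
      using loc_integrable_mult_test[OF _ test_fun_deriv[OF t]] loc(1) lF by simp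
    also have "\<dots> = 0"
      using w t primitive_by_parts[OF loc(2) F t] by (simp add: weak_deriv_def)
    finally show ?thesis .
  qed
  then obtain c where c: "AE x in lborel. f x - F x = c"
    using du_Bois_Reymond[OF loc_integrable_diff[OF loc(1) lF]] by metis
  show ?thesis
  proof (rule that[of "\<lambda>x. F x + c"])
    show "continuous_on UNIV (\<lambda>x. F x + c)" by (intro continuous_intros F)
    show "AE x in lborel. f x = F x + c" using c by eventually_elim auto
  qed (use F in auto)
qed

theorem weak_deriv_unique:
  assumes "weak_deriv f g" "weak_deriv f h"
  shows "AE x in lborel. g x = h x"
proof -
  note loc = weak_deriv_loc_integrable(2)[OF assms(1)] weak_deriv_loc_integrable(2)[OF assms(2)]
  have "AE x in lborel. g x - h x = 0"
  proof (rule fundamental_lemma[OF loc_integrable_diff[OF loc]])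
    fix \<phi> assume t: "test_fun \<phi>"
    have "(LINT x|lborel. (g x - h x) * \<phi> x) = (LINT x|lborel. g x * \<phi> x - h x * \<phi> x)"
      by (simp add: algebra_simps)
    also have "\<dots> = (LINT x|lborel. g x * \<phi> x) - (LINT x|lborel. h x * \<phi> x)"
      using loc_integrable_mult_test loc t by simp
    also have "\<dots> = 0" using assms t by (auto simp: weak_deriv_def)
    finally show "(LINT x|lborel. (g x - h x) * \<phi> x) = 0" .
  qed
  then show ?thesis by eventually_elim simp
qed

subsection \<open>Hoelder regularity of the weak derivative\<close>

lemma Lp_loc_integrable: assumes "1 \<le> p" "g \<in> Lp p" shows "loc_integrable g"
  unfolding loc_integrable_def set_integrable_def
proof (intro allI impI)
  fix K :: "real set" assume K: "compact K"
  have [measurable]: "g \<in> borel_measurable borel" using assms LpD by auto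
  have [measurable]: "K \<in> sets borel" using K by (simp add: borel_compact)
  have Kf: "emeasure lborel K < \<infinity>" using emeasure_compact_finite[OF K] by simp
  have le: "\<bar>t\<bar> \<le> 1 + \<bar>t\<bar> powr p" for t :: real
  proof (cases "\<bar>t\<bar> \<le> 1")
    case False
    then have "\<bar>t\<bar> powr 1 \<le> \<bar>t\<bar> powr p" using assms by (intro powr_mono) auto
    then show ?thesis using False by simp
  qed (simp add: add_increasing2)
  show "integrable lborel (\<lambda>x. indicator K x *\<^sub>R g x)"
  proof (rule Bochner_Integration.integrable_bound[of lborel "\<lambda>x. indicator K x + \<bar>g x\<bar> powr p"])
    show "integrable lborel (\<lambda>x. indicator K x + \<bar>g x\<bar> powr p)"
      using LpD[OF assms(2)] Kf by (intro Bochner_Integration.integrable_add) auto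
    show "AE x in lborel. norm (indicator K x *\<^sub>R g x) \<le> norm (indicator K x + \<bar>g x\<bar> powr p)"
      using le by (auto simp: indicator_def)
  qed simp
qed

lemma integral_tensor:
  fixes f g :: "real \<Rightarrow> real"
  assumes f: "integrable lborel f" and g: "integrable lborel g"
  shows "(LINT z|(lborel \<Otimes>\<^sub>M lborel). f (fst z) * g (snd z)) = (LINT x|lborel. f x) * (LINT x|lborel. g x)"
proof -
  have "(LINT z|(lborel \<Otimes>\<^sub>M lborel). f (fst z) * g (snd z)) = (LINT z|(lborel \<Otimes>\<^sub>M lborel). (case z of (x, y) \<Rightarrow> f x * g y))"
    by (simp add: case_prod_beta)
  also have "\<dots> = (LINT x|lborel. LINT y|lborel. f x * g y)"
    using lborel_pair.integral_fst'[OF integrable_tensor[OF f g]] by simp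
  finally show ?thesis by simp
qed

lemma integrable_tensor_fst_snd:
  fixes f g :: "real \<Rightarrow> real"
  assumes f: "integrable lborel f" and g: "integrable lborel g"
  shows "integrable (lborel \<Otimes>\<^sub>M lborel) (\<lambda>z. f (fst z) * g (snd z))"
  using integrable_tensor[OF f g] by (simp add: case_prod_beta')

text \<open>Below the threshold t the first term suffices, above it the second does. With a well
  chosen t this linear inequality replaces Hoelder's inequality for double averages.\<close>

lemma le_add_powr_mult:
  fixes d t p :: real
  assumes "0 \<le> d" "0 < t" "1 \<le> p"
  shows "d \<le> t + d powr p * t powr (1 - p)"
proof (cases "d \<le> t")
  case True
  then show ?thesis by (simp add: add_increasing2)
next
  case False
  then have "(d / t) powr 1 \<le> (d / t) powr p" using assms by (intro powr_mono) auto
  then have "d / t \<le> d powr p / t powr p" using assms False by (simp add: powr_divide)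
  then have "d \<le> d powr p * (t / t powr p)" using assms by (simp add: field_simps)
  also have "t / t powr p = t powr (1 - p)" using assms by (simp add: powr_diff)
  finally show ?thesis using assms by simp
qed

text \<open>Setting for Morrey's embedding in Campanato's form: \<sigma> = s - 1 is the smoothness
  of the derivative g, and \<sigma> - 1/p the Hoelder exponent to be reached. The argument runs
  through means of g over intervals, which are difference quotients of F.\<close>

locale gagliardo =
  fixes p \<sigma> :: real and g F :: "real \<Rightarrow> real"
  assumes p: "1 < p" and sg: "1 / p < \<sigma>"
    and gLp: "g \<in> Lp p"
    and gag: "integrable (lborel \<Otimes>\<^sub>M lborel) (\<lambda>(x, y). \<bar>g x - g y\<bar> powr p / \<bar>x - y\<bar> powr (1 + \<sigma> * p))"
    and prim: "\<And>a b. a \<le> b \<Longrightarrow> F b - F a = (LINT t:{a..b}|lborel. g t)"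
begin

definition \<gamma> where "\<gamma> = \<sigma> - 1 / p"
definition S where "S = (LINT z|(lborel \<Otimes>\<^sub>M lborel). (case z of (x, y) \<Rightarrow> \<bar>g x - g y\<bar> powr p / \<bar>x - y\<bar> powr (1 + \<sigma> * p)))"
text \<open>The mean of g over [x, x + r], written through the primitive so that its limit as r -> 0
  is at the same time a derivative of F.\<close>

definition Q where "Q x r = (F (x + r) - F x) / r"

lemma \<gamma>_pos: "0 < \<gamma>" using sg by (simp add: \<gamma>_def)
lemma \<sigma>_pos: "0 < \<sigma>" using sg p by (smt (verit) divide_pos_pos)

lemma [measurable]: "g \<in> borel_measurable borel" using gLp LpD by auto

lemma g_loc: "loc_integrable g" using Lp_loc_integrable[OF _ gLp] p by simp

lemma S_nonneg: "0 \<le> S"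
  unfolding S_def by (rule Bochner_Integration.integral_nonneg) auto

text \<open>The difference of the means is the mean of g(u) - g(v) over I x J. Since J lies in I, |u
  - v| <= r, so the Gagliardo integrand controls |g(u) - g(v)|^p with the factor r^(1 + \<sigma> p).
  The threshold r^\<gamma> balances both contributions, because 1 + \<sigma> p + \<gamma> (1 - p) -
  2 = \<gamma>. The factor 4 stems from r <= 4 q.\<close>

lemma step:
  assumes r: "0 < q" "r \<le> 4 * q" "x \<le> y" "y + q \<le> x + r"
  shows "\<bar>Q x r - Q y q\<bar> \<le> (1 + 4 * S) * r powr \<gamma>"
proof -
  have rq: "q \<le> r" "0 < r" using r by auto
  let ?I = "{x..x + r}" and ?J = "{y..y + q}"
  let ?M = "lborel \<Otimes>\<^sub>M lborel :: (real \<times> real) measure"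
  let ?t = "r powr \<gamma>"
  let ?c = "r powr (1 + \<sigma> * p) * ?t powr (1 - p)"
  let ?G = "\<lambda>(x, y). \<bar>g x - g y\<bar> powr p / \<bar>x - y\<bar> powr (1 + \<sigma> * p)"
  have iI: "integrable lborel (\<lambda>u. indicator ?I u * g u)" and iJ: "integrable lborel (\<lambda>u. indicator ?J u * g u)"
    using g_loc by (auto simp: loc_integrable_def set_integrable_def)
  have cI: "integrable lborel (indicator ?I :: real \<Rightarrow> real)" and cJ: "integrable lborel (indicator ?J :: real \<Rightarrow> real)"
    by (simp_all add: emeasure_lborel_Icc_eq)
  let ?h = "\<lambda>z. (indicator ?I (fst z) * g (fst z)) * indicator ?J (snd z) - indicator ?I (fst z) * (indicator ?J (snd z) * g (snd z))"
  note T1 = integrable_tensor_fst_snd[OF iI cJ] and T2 = integrable_tensor_fst_snd[OF cI iJ]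
    and T3 = integrable_tensor_fst_snd[OF cI cJ]
  have hi: "integrable ?M ?h" using T1 T2 by (rule Bochner_Integration.integrable_diff)
  have vI: "(LINT u|lborel. indicator ?I u) = r" "(LINT u|lborel. indicator ?J u) = q" using rq r by auto
  have "(LINT z|?M. ?h z) = (LINT u|lborel. indicator ?I u * g u) * q - r * (LINT u|lborel. indicator ?J u * g u)"
    using T1 T2 integral_tensor[OF iI cJ] integral_tensor[OF cI iJ] vI by simp
  also have "\<dots> = (F (x + r) - F x) * q - r * (F (y + q) - F y)"
    using prim[of x "x + r"] prim[of y "y + q"] rq r by (simp add: set_lebesgue_integral_def)
  also have "\<dots> = (r * q) * (Q x r - Q y q)"
    using rq r by (simp add: Q_def field_simps)
  finally have hval: "(LINT z|?M. ?h z) = (r * q) * (Q x r - Q y q)" .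
  have pt: "\<bar>?h z\<bar> \<le> ?t * (indicator ?I (fst z) * indicator ?J (snd z)) + ?c * ?G z" for z
  proof -
    obtain u v where z: "z = (u, v)" by fastforce
    have G0: "0 \<le> ?c * ?G z" by (simp add: z)
    show ?thesis
    proof (cases "u \<in> ?I \<and> v \<in> ?J")
      case True
      then have d: "\<bar>u - v\<bar> \<le> r" using r by auto
      have "\<bar>g u - g v\<bar> powr p \<le> r powr (1 + \<sigma> * p) * ?G z"
      proof (cases "u = v")
        case False
        have "\<bar>u - v\<bar> powr (1 + \<sigma> * p) \<le> r powr (1 + \<sigma> * p)"
          using d \<sigma>_pos p by (intro powr_mono2) auto
        then have "?G z * \<bar>u - v\<bar> powr (1 + \<sigma> * p) \<le> ?G z * r powr (1 + \<sigma> * p)"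
          by (intro mult_left_mono) (auto simp: z)
        then show ?thesis using False by (simp add: z mult.commute)
      qed (simp add: z)
      then have "\<bar>g u - g v\<bar> powr p * ?t powr (1 - p) \<le> (r powr (1 + \<sigma> * p) * ?G z) * ?t powr (1 - p)"
        by (intro mult_right_mono) auto
      moreover have "\<bar>g u - g v\<bar> \<le> ?t + \<bar>g u - g v\<bar> powr p * ?t powr (1 - p)"
        by (rule le_add_powr_mult) (use rq p in auto)
      ultimately have "\<bar>g u - g v\<bar> \<le> ?t + ?c * ?G z" by (simp add: mult_ac)
      then show ?thesis using True by (simp add: z)
    next
      case False
      then show ?thesis using G0 by (auto simp: z indicator_def)
    qed
  qed
  have "r * q * \<bar>Q x r - Q y q\<bar> = \<bar>LINT z|?M. ?h z\<bar>" using rq r by (simp add: hval abs_mult)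
  also have "\<dots> \<le> (LINT z|?M. \<bar>?h z\<bar>)" by (rule integral_abs_bound)
  also have "\<dots> \<le> (LINT z|?M. ?t * (indicator ?I (fst z) * indicator ?J (snd z)) + ?c * ?G z)"
    by (rule integral_mono) (use hi T3 gag pt in auto)
  also have "\<dots> = ?t * (r * q) + ?c * S"
    using T3 gag integral_tensor[OF cI cJ] vI by (simp add: S_def)
  finally have "r * q * \<bar>Q x r - Q y q\<bar> \<le> ?t * (r * q) + ?c * S" .
  then have "\<bar>Q x r - Q y q\<bar> \<le> ?t + ?c * S / (r * q)"
    using rq r by (simp add: field_simps)
  also have "?c * S / (r * q) \<le> ?c * S * (4 / r\<^sup>2)"
  proof -
    have "1 / (r * q) \<le> 4 / r\<^sup>2" using rq r by (simp add: field_simps power2_eq_square)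
    then have "?c * S * (1 / (r * q)) \<le> ?c * S * (4 / r\<^sup>2)" using S_nonneg by (intro mult_left_mono) auto
    then show ?thesis by simp
  qed
  also have "?c * S * (4 / r\<^sup>2) = 4 * S * r powr \<gamma>"
  proof -
    have 1: "?t powr (1 - p) = r powr (\<gamma> * (1 - p))" by (simp only: powr_powr)
    have 2: "r\<^sup>2 = r powr 2" using rq by simp
    have "?c / r\<^sup>2 = r powr (1 + \<sigma> * p + \<gamma> * (1 - p) - 2)"
      unfolding 1 2 by (simp only: powr_add[symmetric] powr_diff[symmetric])
    also have "1 + \<sigma> * p + \<gamma> * (1 - p) - 2 = \<gamma>" using p by (simp add: \<gamma>_def field_simps)
    finally have 3: "?c / r\<^sup>2 = r powr \<gamma>" .
    have "?c * S * (4 / r\<^sup>2) = 4 * S * (?c / r\<^sup>2)"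
      by (simp only: times_divide_eq_left times_divide_eq_right mult_ac)
    then show ?thesis unfolding 3 .
  qed
  finally show ?thesis by (simp add: algebra_simps)
qed

definition \<theta> :: real where "\<theta> = 2 powr (- \<gamma>)"
text \<open>The limit of the dyadic means as a telescoping series, hence given at every point; it
  turns out to be the continuous representative of g.\<close>

definition G where "G x = Q x 1 + (\<Sum>n. Q x ((1/2) ^ Suc n) - Q x ((1/2) ^ n))"
definition C where "C = 1 + 4 * S"
text \<open>One comparison with a dyadic length costs C \<theta>^n and the tail of the series C
  \<theta>^n/(1 - \<theta>); the factor 2^\<gamma> converts \<theta>^n = (2^(-n))^\<gamma> into
  r^\<gamma>, as 2^(-n) < 2 r.\<close>

definition K where "K = (C + C / (1 - \<theta>)) * 2 powr \<gamma>"

lemma \<theta>: "0 < \<theta>" "\<theta> < 1"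
  using \<gamma>_pos powr_less_cancel_iff[of 2 "-\<gamma>" 0] by (auto simp: \<theta>_def)

lemma C_pos: "0 < C" using S_nonneg by (simp add: C_def)
lemma K_pos: "0 < K" using C_pos \<theta> by (simp add: K_def add_pos_pos)

lemma half_powr: "((1/2) ^ n) powr \<gamma> = \<theta> ^ n"
proof -
  have "(1/2::real) ^ n = 2 powr (- real n)"
    by (simp add: powr_minus powr_realpow power_one_over inverse_eq_divide)
  then have "((1/2::real) ^ n) powr \<gamma> = 2 powr (- \<gamma> * real n)" by (simp add: powr_powr mult.commute)
  also have "\<dots> = \<theta> powr real n" by (simp add: \<theta>_def powr_powr)
  finally show ?thesis using \<theta> by (simp add: powr_realpow)
qed

lemma dyadic: "\<bar>Q x ((1/2) ^ n) - G x\<bar> \<le> C / (1 - \<theta>) * \<theta> ^ n"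
proof -
  let ?a = "\<lambda>n. Q x ((1/2) ^ Suc n) - Q x ((1/2) ^ n)"
  have a: "\<bar>?a n\<bar> \<le> C * \<theta> ^ n" for n
  proof -
    have "\<bar>Q x ((1/2) ^ n) - Q x ((1/2) ^ Suc n)\<bar> \<le> (1 + 4 * S) * ((1/2) ^ n) powr \<gamma>"
      by (rule step) auto
    then show ?thesis by (simp only: half_powr C_def abs_minus_commute)
  qed
  have sg: "summable (\<lambda>k. C * \<theta> ^ (k + n))" unfolding power_add
    by (intro summable_mult summable_mult2 summable_geometric) (use \<theta> in auto)
  have sa: "summable ?a"
    by (rule summable_comparison_test'[of "\<lambda>n. C * \<theta> ^ n" 0]) (use a \<theta> in \<open>auto simp: summable_geometric\<close>)
  have san: "summable (\<lambda>k. \<bar>?a (k + n)\<bar>)"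
    by (rule summable_comparison_test'[OF sg, of 0]) (use a in auto)
  have "(\<Sum>k<n. ?a k) = Q x ((1/2) ^ n) - Q x 1"
    using sum_lessThan_telescope[of "\<lambda>n. Q x ((1/2) ^ n)" n] by simp
  then have "G x - Q x ((1/2) ^ n) = (\<Sum>k. ?a (k + n))"
    using suminf_minus_initial_segment[OF sa, of n] by (simp add: G_def)
  then have "\<bar>G x - Q x ((1/2) ^ n)\<bar> \<le> (\<Sum>k. \<bar>?a (k + n)\<bar>)" using summable_rabs[OF san] by simp
  also have "\<dots> \<le> (\<Sum>k. C * \<theta> ^ (k + n))" by (rule suminf_le[OF _ san sg]) (use a in auto)
  also have "\<dots> = C * \<theta> ^ n * (\<Sum>k. \<theta> ^ k)"
  proof -
    have "(\<Sum>k. C * \<theta> ^ n * \<theta> ^ k) = C * \<theta> ^ n * (\<Sum>k. \<theta> ^ k)"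
      by (rule suminf_mult) (use \<theta> in \<open>simp add: summable_geometric\<close>)
    then show ?thesis by (simp only: power_add mult_ac)
  qed
  also have "\<dots> = C / (1 - \<theta>) * \<theta> ^ n" using \<theta> by (simp add: suminf_geometric)
  finally show ?thesis by (simp add: abs_minus_commute)
qed

text \<open>Choose n with 2^(-n-1) < r <= 2^(-n): the intervals of length r and 2^(-n) at x are
  nested with comparable lengths, so a single comparison reduces to dyadic lengths.\<close>

lemma quotient_bound: assumes r: "0 < r" "r \<le> 1" shows "\<bar>Q x r - G x\<bar> \<le> K * r powr \<gamma>"
proof -
  have ex: "\<exists>n. (1/2::real) ^ Suc n < r"
  proof -
    obtain m where "(1/2::real) ^ m < r" using real_arch_pow_inv[OF r(1), of "1/2"] by auto
    moreover have "(1/2::real) ^ Suc m \<le> (1/2) ^ m" by simp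
    ultimately show ?thesis using order_le_less_trans by blast
  qed
  define n where "n = (LEAST n. (1/2::real) ^ Suc n < r)"
  have n: "(1/2::real) ^ Suc n < r" "\<And>m. m < n \<Longrightarrow> \<not> (1/2::real) ^ Suc m < r"
    using LeastI_ex[OF ex] not_less_Least[where P = "\<lambda>n. (1/2::real) ^ Suc n < r"] unfolding n_def by blast+
  \<comment> \<open>Minimality of n, applied to n - 1; for n = 0 the bound is the hypothesis r <=
    1.\<close>
  have n2: "r \<le> (1/2) ^ n"
    using n(2)[of "n - 1"] r by (cases n) auto
  have "\<bar>Q x ((1/2) ^ n) - Q x r\<bar> \<le> (1 + 4 * S) * ((1/2) ^ n) powr \<gamma>"
    by (rule step) (use n n2 r in auto)
  then have "\<bar>Q x ((1/2) ^ n) - Q x r\<bar> \<le> C * \<theta> ^ n" by (simp only: half_powr C_def)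
  then have "\<bar>Q x r - G x\<bar> \<le> (C + C / (1 - \<theta>)) * \<theta> ^ n"
    using dyadic[of x n] by (simp add: distrib_right)
  also have "\<dots> \<le> (C + C / (1 - \<theta>)) * (2 * r) powr \<gamma>"
  proof (rule mult_left_mono)
    show "\<theta> ^ n \<le> (2 * r) powr \<gamma>" unfolding half_powr[symmetric]
      by (rule powr_mono2) (use n \<gamma>_pos in auto)
    show "0 \<le> C + C / (1 - \<theta>)" using C_pos \<theta> by (simp add: add_nonneg_nonneg)
  qed
  also have "\<dots> = K * r powr \<gamma>" using r by (simp add: K_def powr_mult)
  finally show ?thesis .
qed

definition K2 where "K2 = (2 * K + C) * 2 powr \<gamma> "

lemma K2: "0 < K2" "K \<le> K2"
proof -
  have 1: "1 \<le> 2 powr \<gamma>" using \<gamma>_pos by (simp add: ge_one_powr_ge_zero)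
  show "0 < K2" using K_pos C_pos by (simp add: K2_def add_pos_pos)
  have "K * 1 \<le> (2 * K + C) * 2 powr \<gamma>" using K_pos C_pos 1 by (intro mult_mono) auto
  then show "K \<le> K2" by (simp add: K2_def)
qed

text \<open>With r = y - x the interval [y, y + r] is the right half of [x, x + 2 r], so the two
  points are linked through means over nested intervals. The restriction on y - x gives 2 r <= 1, as
  \<open>quotient_bound\<close> at x requires.\<close>

lemma local_Holder: assumes "x < y" "y - x \<le> 1/2" shows "\<bar>G x - G y\<bar> \<le> K2 * (y - x) powr \<gamma>"
proof -
  let ?r = "y - x"
  have 1: "\<bar>Q x (2 * ?r) - Q y ?r\<bar> \<le> C * (2 * ?r) powr \<gamma>"
    unfolding C_def by (rule step) (use assms in auto)
  have 2: "\<bar>Q x (2 * ?r) - G x\<bar> \<le> K * (2 * ?r) powr \<gamma>" by (rule quotient_bound) (use assms in auto)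
  have 3: "\<bar>Q y ?r - G y\<bar> \<le> K * ?r powr \<gamma>" by (rule quotient_bound) (use assms in auto)
  have "?r powr \<gamma> \<le> (2 * ?r) powr \<gamma>" using assms \<gamma>_pos by (intro powr_mono2) auto
  then have "K * ?r powr \<gamma> \<le> K * (2 * ?r) powr \<gamma>" using K_pos by (intro mult_left_mono) auto
  then have "\<bar>G x - G y\<bar> \<le> (2 * K + C) * (2 * ?r) powr \<gamma>" using 1 2 3 by (simp add: algebra_simps)
  moreover have "(2 * ?r) powr \<gamma> = 2 powr \<gamma> * ?r powr \<gamma>" using assms by (subst powr_mult) auto
  ultimately show ?thesis by (simp only: K2_def mult.assoc)
qed

lemma F_DERIV: "(F has_real_derivative G x) (at x)"
proof -
  have "((\<lambda>h. (F (x + h) - F x) / h - G x) \<longlongrightarrow> 0) (at 0)"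
  proof (rule Lim_null_comparison)
    have b: "norm ((F (x + h) - F x) / h - G x) \<le> 2 * K2 * \<bar>h\<bar> powr \<gamma>" if h: "h \<noteq> 0" "\<bar>h\<bar> < 1/2" for h
    proof (cases "0 < h")
      case True
      then have "\<bar>Q x h - G x\<bar> \<le> K * h powr \<gamma>" using quotient_bound h by auto
      also have "\<dots> \<le> (2 * K2) * h powr \<gamma>" using K2 by (intro mult_right_mono) auto
      finally show ?thesis using True by (simp add: Q_def)
    next
      case False
      then have n: "h < 0" using h by simp
      have 1: "\<bar>Q (x + h) (-h) - G (x + h)\<bar> \<le> K * (-h) powr \<gamma>" by (rule quotient_bound) (use n h in auto)
      have 2: "\<bar>G (x + h) - G x\<bar> \<le> K2 * (-h) powr \<gamma>" using local_Holder[of "x + h" x] n h by simp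
      have 3: "K * (-h) powr \<gamma> \<le> K2 * (-h) powr \<gamma>" using K2 by (intro mult_right_mono) auto
      \<comment> \<open>The estimates concern quotients to the right, so for a negative increment
        the base point moves to x + h and the Hoelder bound leads back to x.\<close>
      have "Q (x + h) (-h) = (F (x + h) - F x) / h" using n by (simp add: Q_def field_simps)
      then show ?thesis using 1 2 3 n unfolding real_norm_def abs_of_neg[OF n] by linarith
    qed
    show "\<forall>\<^sub>F h in at 0. norm ((F (x + h) - F x) / h - G x) \<le> 2 * K2 * \<bar>h\<bar> powr \<gamma>"
      unfolding eventually_at by (rule exI[of _ "1/2"]) (use b in auto)
    have "((\<lambda>h::real. \<bar>h\<bar> powr \<gamma>) \<longlongrightarrow> 0) (at 0)"
      using \<gamma>_pos tendsto_powr'[of "\<lambda>h::real. \<bar>h\<bar>" 0 "at 0" "\<lambda>_. \<gamma>" \<gamma>] by (auto intro!: tendsto_eq_intros)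
    then show "((\<lambda>h. 2 * K2 * \<bar>h\<bar> powr \<gamma>) \<longlongrightarrow> 0) (at 0)"
      using tendsto_mult_right_zero by blast
  qed
  then show ?thesis unfolding DERIV_def by (simp add: LIM_zero_iff)
qed

definition B where "B = 1 + (LINT x|lborel. \<bar>g x\<bar> powr p) + K"

lemma unit_interval_bound:
  assumes "h \<in> Lp p" shows "(LINT t:{x..x+1}|lborel. \<bar>h t\<bar>) \<le> 1 + (LINT x|lborel. \<bar>h x\<bar> powr p)"
proof -
  have le: "\<bar>t\<bar> \<le> 1 + \<bar>t\<bar> powr p" for t :: real using le_add_powr_mult[of "\<bar>t\<bar>" 1 p] p by simp
  have i: "integrable lborel (\<lambda>t. indicator {x..x+1} t + \<bar>h t\<bar> powr p)"
    using LpD[OF assms] by (intro Bochner_Integration.integrable_add) auto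
  have "set_integrable lborel {x..x+1} h" using Lp_loc_integrable[of p h] assms p by (auto simp: loc_integrable_def)
  then have i2: "integrable lborel (\<lambda>t. indicator {x..x+1} t *\<^sub>R \<bar>h t\<bar>)" using set_integrable_abs unfolding set_integrable_def by blast
  have "(LINT t:{x..x+1}|lborel. \<bar>h t\<bar>) \<le> (LINT t|lborel. indicator {x..x+1} t + \<bar>h t\<bar> powr p)"
    unfolding set_lebesgue_integral_def
    by (rule integral_mono[OF i2 i]) (use le in \<open>auto simp: indicator_def\<close>)
  also have "\<dots> = 1 + (LINT x|lborel. \<bar>h x\<bar> powr p)" using LpD[OF assms] by simp
  finally show ?thesis .
qed

lemma G_bound: "\<bar>G x\<bar> \<le> B"
proof -
  have si: "set_integrable lborel {x..x+1} g" using g_loc by (auto simp: loc_integrable_def)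
  have "\<bar>Q x 1\<bar> = \<bar>LINT t:{x..x+1}|lborel. g t\<bar>" using prim[of x "x + 1"] by (simp add: Q_def)
  also have "\<dots> \<le> (LINT t:{x..x+1}|lborel. \<bar>g t\<bar>)"
    unfolding set_lebesgue_integral_def by (rule order_trans[OF integral_abs_bound]) (simp add: abs_mult)
  also have "\<dots> \<le> 1 + (LINT x|lborel. \<bar>g x\<bar> powr p)" by (rule unit_interval_bound[OF gLp])
  finally show ?thesis using quotient_bound[of 1 x] by (simp add: B_def)
qed

lemma B_pos: "0 < B"
proof -
  have "0 \<le> (LINT x|lborel. \<bar>g x\<bar> powr p)" by (rule Bochner_Integration.integral_nonneg) auto
  then show ?thesis using K_pos unfolding B_def by linarith
qed

lemma Holder: "\<bar>G x - G y\<bar> \<le> (K2 + 2 * B * 2 powr \<gamma>) * \<bar>x - y\<bar> powr \<gamma>"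
proof -
  have *: "\<bar>G x - G y\<bar> \<le> (K2 + 2 * B * 2 powr \<gamma>) * (y - x) powr \<gamma>" if "x < y" for x y
  proof (cases "y - x \<le> 1/2")
    case True
    have "\<bar>G x - G y\<bar> \<le> K2 * (y - x) powr \<gamma>" by (rule local_Holder[OF that True])
    also have "\<dots> \<le> (K2 + 2 * B * 2 powr \<gamma>) * (y - x) powr \<gamma>" using B_pos by (intro mult_right_mono) auto
    finally show ?thesis .
  next
    case False
    have "1 powr \<gamma> \<le> (2 * (y - x)) powr \<gamma>" using False \<gamma>_pos by (intro powr_mono2) auto
    also have "(2 * (y - x)) powr \<gamma> = 2 powr \<gamma> * (y - x) powr \<gamma>" using that by (subst powr_mult) auto
    finally have "1 \<le> 2 powr \<gamma> * (y - x) powr \<gamma>" by simp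
    then have "2 * B * 1 \<le> 2 * B * (2 powr \<gamma> * (y - x) powr \<gamma>)" using B_pos by (intro mult_left_mono) auto
    moreover have "\<bar>G x - G y\<bar> \<le> 2 * B" using G_bound[of x] G_bound[of y] by linarith
    moreover have "0 \<le> K2 * (y - x) powr \<gamma>" using K2 by simp
    ultimately show ?thesis by (simp add: algebra_simps)
  qed
  consider "x < y" | "x = y" | "y < x" by linarith
  then show ?thesis using *[of x y] *[of y x] by cases (auto simp: abs_minus_commute)
qed

lemma G_cont: "isCont G x"
proof -
  let ?L = "K2 + 2 * B * 2 powr \<gamma>"
  have "((\<lambda>y. \<bar>y - x\<bar> powr \<gamma>) \<longlongrightarrow> 0) (at x)"
    using \<gamma>_pos tendsto_powr'[of "\<lambda>y. \<bar>y - x\<bar>" 0 "at x" "\<lambda>_. \<gamma>" \<gamma>] by (auto intro!: tendsto_eq_intros)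
  then have "((\<lambda>y. ?L * \<bar>y - x\<bar> powr \<gamma>) \<longlongrightarrow> 0) (at x)" using tendsto_mult_right_zero by blast
  then have "((\<lambda>y. G y - G x) \<longlongrightarrow> 0) (at x)"
    by (rule Lim_null_comparison[rotated]) (use Holder in auto)
  then show ?thesis by (simp add: isCont_def LIM_zero_iff)
qed

text \<open>F is a primitive of both, of g by assumption and of G by differentiability; equal
  interval integrals identify them.\<close>

lemma g_eq_G: "AE x in lborel. g x = G x"
proof -
  have lG: "loc_integrable G" by (rule loc_integrable_continuous) (use G_cont continuous_at_imp_continuous_on in blast)
  have "AE x in lborel. g x - G x = 0"
  proof (rule AE_eq_0_of_interval_integrals[OF loc_integrable_diff[OF g_loc lG]])
    fix a b :: real assume ab: "a \<le> b"
    have s: "set_integrable lborel {a..b} g" "set_integrable lborel {a..b} G"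
      using g_loc lG by (auto simp: loc_integrable_def)
    have "(LBINT x. G x * indicator {a..b} x) = F b - F a"
      by (rule integral_FTC_Icc_real[OF ab]) (use F_DERIV G_cont in auto)
    then have "(LINT t:{a..b}|lborel. G t) = F b - F a" by (simp add: set_lebesgue_integral_def mult.commute)
    then show "(LINT x:{a..b}|lborel. g x - G x) = 0" using prim[OF ab] s by (simp add: set_integral_diff)
  qed
  then show ?thesis by eventually_elim simp
qed

lemma G_Lp: "G \<in> Lp p"
proof (rule Lp_bound[OF _ gLp, of _ 1])
  show "G \<in> borel_measurable borel"
    by (intro borel_measurable_continuous_onI continuous_at_imp_continuous_on ballI G_cont)
  show "AE x in lborel. \<bar>G x\<bar> \<le> 1 * \<bar>g x\<bar>" using g_eq_G by eventually_elim simp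
qed (use p in auto)

lemma G_gagliardo: "integrable (lborel \<Otimes>\<^sub>M lborel) (\<lambda>(x, y). \<bar>G x - G y\<bar> powr p / \<bar>x - y\<bar> powr (1 + \<sigma> * p))"
proof -
  have [measurable]: "G \<in> borel_measurable borel" using G_Lp LpD by auto
  have "AE z in lborel \<Otimes>\<^sub>M lborel. g (fst z) = G (fst z) \<and> g (snd z) = G (snd z)"
  proof (rule lborel_pair.AE_pair_measure)
    show "{z \<in> space (lborel \<Otimes>\<^sub>M lborel). g (fst z) = G (fst z) \<and> g (snd z) = G (snd z)} \<in> sets (lborel \<Otimes>\<^sub>M lborel)"
      by measurable
    show "AE x in lborel. AE y in lborel. g (fst (x, y)) = G (fst (x, y)) \<and> g (snd (x, y)) = G (snd (x, y))"
      using g_eq_G by eventually_elim (use g_eq_G in auto)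
  qed
  then have "AE z in lborel \<Otimes>\<^sub>M lborel. (case z of (x, y) \<Rightarrow> \<bar>g x - g y\<bar> powr p / \<bar>x - y\<bar> powr (1 + \<sigma> * p))
     = (case z of (x, y) \<Rightarrow> \<bar>G x - G y\<bar> powr p / \<bar>x - y\<bar> powr (1 + \<sigma> * p))"
    by eventually_elim (auto simp: case_prod_beta)
  then show ?thesis using gag by (subst (asm) integrable_cong_AE) auto
qed

text \<open>A Lipschitz function stays within B of its values on the adjacent unit interval, and its
  mean there is controlled by the integral of |F|^p.\<close>

lemma F_bound: assumes "F \<in> Lp p" shows "\<bar>F x\<bar> \<le> 1 + (LINT x|lborel. \<bar>F x\<bar> powr p) + B"
proof -
  have lip: "\<bar>F x - F y\<bar> \<le> B * \<bar>x - y\<bar>" for x y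
    using field_differentiable_bound[of UNIV F G B x y] F_DERIV G_bound by auto
  have s: "set_integrable lborel {x..x+1} F" using Lp_loc_integrable[of p F] assms p by (auto simp: loc_integrable_def)
  then have i2: "integrable lborel (\<lambda>t. indicator {x..x+1} t *\<^sub>R \<bar>F t\<bar>)" using set_integrable_abs unfolding set_integrable_def by blast
  have "\<bar>F x\<bar> = (LINT t|lborel. \<bar>F x\<bar> * indicator {x..x+1} t)" by simp
  also have "\<dots> \<le> (LINT t|lborel. indicator {x..x+1} t *\<^sub>R \<bar>F t\<bar> + B * indicator {x..x+1} t)"
  proof (rule integral_mono)
    fix t
    show "\<bar>F x\<bar> * indicator {x..x + 1} t \<le> indicator {x..x + 1} t *\<^sub>R \<bar>F t\<bar> + B * indicator {x..x+1} t"
    proof (cases "t \<in> {x..x+1}")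
      case True
      then have "B * \<bar>x - t\<bar> \<le> B * 1" using B_pos by (intro mult_left_mono) auto
      then show ?thesis using lip[of x t] True by simp
    qed simp
  qed (use i2 in auto)
  also have "\<dots> = (LINT t:{x..x+1}|lborel. \<bar>F t\<bar>) + B" using i2 by (simp add: set_lebesgue_integral_def)
  finally show ?thesis using unit_interval_bound[OF assms, of x] by simp
qed

end

text \<open>Membership in the Sobolev space provides some weak derivative g, whereas
  \<open>f'\<close> is an arbitrary one. Uniqueness identifies them almost everywhere, so a single
  C^1 representative F with derivative G serves both; L collects all bounds in one constant.\<close>

theorem sobolev_slobodeckij_C1:
  assumes p: "1 < p" and s: "1 + 1 / p < s" and W: "sobolev_slobodeckij s p f" and w: "weak_deriv f f'"
  obtains F G \<gamma> L where "0 < \<gamma>" "0 < L" "\<And>x. (F has_real_derivative G x) (at x)"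
    "\<And>x y. \<bar>G x - G y\<bar> \<le> L * \<bar>x - y\<bar> powr \<gamma>" "\<And>x. \<bar>G x\<bar> \<le> L" "\<And>x. \<bar>F x\<bar> \<le> L"
    "AE x in lborel. f x = F x" "AE x in lborel. f' x = G x" "F \<in> Lp p" "G \<in> Lp p"
    "integrable (lborel \<Otimes>\<^sub>M lborel) (\<lambda>(x, y). \<bar>G x - G y\<bar> powr p / \<bar>x - y\<bar> powr (1 + (s - 1) * p))"
proof -
  obtain g where g: "weak_deriv f g" "g \<in> Lp p"
    "integrable (lborel \<Otimes>\<^sub>M lborel) (\<lambda>(x, y). \<bar>g x - g y\<bar> powr p / \<bar>x - y\<bar> powr (1 + (s - 1) * p))"
    and f: "f \<in> Lp p"
    using W by (auto simp: sobolev_slobodeckij_def)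
  obtain F where F: "continuous_on UNIV F" "\<And>a b. a \<le> b \<Longrightarrow> F b - F a = (LINT t:{a..b}|lborel. g t)"
    "AE x in lborel. f x = F x" using weak_deriv_primitive[OF g(1)] by metis
  interpret gagliardo p "s - 1" g F
    by unfold_locales (use p s g F in auto)
  have FLp: "F \<in> Lp p"
  proof (rule Lp_bound[OF _ f, of _ 1])
    show "F \<in> borel_measurable borel" by (rule borel_measurable_continuous_onI[OF F(1)])
    show "AE x in lborel. \<bar>F x\<bar> \<le> 1 * \<bar>f x\<bar>" using F(3) by eventually_elim simp
  qed (use p in auto)
  let ?b = "1 + (LINT x|lborel. \<bar>F x\<bar> powr p) + B"
  let ?L = "?b + (K2 + 2 * B * 2 powr \<gamma>)"
  have "0 \<le> (LINT x|lborel. \<bar>F x\<bar> powr p)" by (rule Bochner_Integration.integral_nonneg) auto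
  then have pos: "B \<le> ?b" "0 < ?b" "0 \<le> K2 + 2 * B * 2 powr \<gamma>"
    using B_pos K2 by (linarith, linarith, simp add: add_nonneg_nonneg)
  show ?thesis
  proof (rule that[of \<gamma> ?L F G])
    show "\<bar>G x - G y\<bar> \<le> ?L * \<bar>x - y\<bar> powr \<gamma>" for x y
      by (rule order_trans[OF Holder]) (use pos in \<open>auto intro!: mult_right_mono\<close>)
    show "\<bar>G x\<bar> \<le> ?L" for x using G_bound[of x] pos by linarith
    show "\<bar>F x\<bar> \<le> ?L" for x using F_bound[OF FLp, of x] pos by linarith
    show "AE x in lborel. f' x = G x" using weak_deriv_unique[OF w g(1)] g_eq_G by eventually_elim simp
    show "0 < ?L" using pos by linarith
  qed (use \<gamma>_pos F_DERIV F(3) FLp G_Lp G_gagliardo in auto)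
qed

subsection \<open>Integral operators with weighted kernels\<close>

lemma integrable_conv:
  fixes f g :: "real \<Rightarrow> real"
  assumes f: "integrable lborel f" and g: "integrable lborel g"
  shows "integrable (lborel \<Otimes>\<^sub>M lborel) (\<lambda>z. f (snd z) * g (fst z - snd z))"
proof -
  have [measurable]: "f \<in> borel_measurable borel" "g \<in> borel_measurable borel" using f g by auto
  have m: "(\<lambda>z. f (snd z) * g (fst z - snd z)) \<in> borel_measurable (lborel \<Otimes>\<^sub>M lborel)"
    by measurable
  show ?thesis
  proof (rule integrableI_bounded[OF m])
    have "(\<integral>\<^sup>+z. ennreal (norm (f (snd z) * g (fst z - snd z))) \<partial>(lborel \<Otimes>\<^sub>M lborel))
       = (\<integral>\<^sup>+y. \<integral>\<^sup>+x. ennreal \<bar>f y\<bar> * ennreal \<bar>g (x - y)\<bar> \<partial>lborel \<partial>lborel)"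
      by (subst lborel_pair.nn_integral_snd[symmetric]) (simp_all add: abs_mult ennreal_mult)
    also have "\<dots> = (\<integral>\<^sup>+y. ennreal \<bar>f y\<bar> * (\<integral>\<^sup>+x. ennreal \<bar>g x\<bar> \<partial>lborel) \<partial>lborel)"
    proof (rule nn_integral_cong)
      fix y :: real
      have "(\<integral>\<^sup>+x. ennreal \<bar>g (x - y)\<bar> \<partial>lborel) = (\<integral>\<^sup>+x. ennreal \<bar>g x\<bar> \<partial>lborel)"
        using nn_integral_real_affine[of "\<lambda>x. ennreal \<bar>g x\<bar>" 1 "-y"] by simp
      then show "(\<integral>\<^sup>+x. ennreal \<bar>f y\<bar> * ennreal \<bar>g (x - y)\<bar> \<partial>lborel) = ennreal \<bar>f y\<bar> * (\<integral>\<^sup>+x. ennreal \<bar>g x\<bar> \<partial>lborel)"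
        by (simp add: nn_integral_cmult)
    qed
    also have "\<dots> = (\<integral>\<^sup>+y. ennreal \<bar>f y\<bar> \<partial>lborel) * (\<integral>\<^sup>+x. ennreal \<bar>g x\<bar> \<partial>lborel)"
      by (rule nn_integral_multc) measurable
    also have "\<dots> < \<infinity>"
      using f g by (auto simp: integrable_iff_bounded ennreal_mult_less_top)
    finally show "(\<integral>\<^sup>+z. ennreal (norm (f (snd z) * g (fst z - snd z))) \<partial>(lborel \<Otimes>\<^sub>M lborel)) < \<infinity>" .
  qed
qed

lemma integral_translate:
  fixes g :: "real \<Rightarrow> real" shows "(LINT x|lborel. g (x - y)) = (LINT x|lborel. g x)"
  using lborel_integral_real_affine[of 1 g "-y"] by simp

lemma integral_reflect:
  fixes g :: "real \<Rightarrow> real" shows "(LINT y|lborel. g (x - y)) = (LINT y|lborel. g y)"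
  using lborel_integral_real_affine[of "-1" g x] by simp

lemma integrable_reflect:
  fixes g :: "real \<Rightarrow> real" assumes "integrable lborel g" shows "integrable lborel (\<lambda>y. g (x - y))"
  using lborel_integrable_real_affine[OF assms, of "-1" x] by simp

lemma integral_conv:
  fixes f g :: "real \<Rightarrow> real"
  assumes f: "integrable lborel f" and g: "integrable lborel g"
  shows "(LINT x|lborel. LINT s|lborel. f s * g (x - s)) = (LINT x|lborel. f x) * (LINT x|lborel. g x)"
proof -
  have i: "integrable (lborel \<Otimes>\<^sub>M lborel) (\<lambda>(x, s). f s * g (x - s))"
    using integrable_conv[OF f g] by (simp add: case_prod_beta')
  have "(LINT x|lborel. LINT s|lborel. f s * g (x - s)) = (LINT s|lborel. LINT x|lborel. f s * g (x - s))"
    using lborel_pair.Fubini_integral[OF i] by simp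
  also have "\<dots> = (LINT s|lborel. f s * (LINT x|lborel. g x))" by (simp add: integral_translate)
  finally show ?thesis by simp
qed

definition kop :: "(real \<Rightarrow> real \<Rightarrow> real) \<Rightarrow> (real \<Rightarrow> real) \<Rightarrow> real \<Rightarrow> real" where
  "kop k w x = (LINT s|lborel. k x s * w s)"

text \<open>Kernels are measured in L_p of the plane with weight \<eta>(x - s)^(2 - p).
  Integrability of \<eta> yields boundedness on L_p and on L_2. The bound \<open>eta_loc\<close> on
  the weight away from the diagonal and from infinity is what allows kernels to be approximated
  there by step functions.\<close>

locale kernel_weight =
  fixes p :: real and \<eta> :: "real \<Rightarrow> real"
  assumes p: "2 < p"
    and eta_meas [measurable]: "\<eta> \<in> borel_measurable borel"
    and eta_nonneg: "\<And>y. 0 \<le> \<eta> y" and eta_pos: "\<And>y. y \<noteq> 0 \<Longrightarrow> 0 < \<eta> y"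
    and eta_int: "integrable lborel \<eta>"
    and eta_loc: "\<And>\<delta>. 0 < \<delta> \<Longrightarrow> \<exists>B. \<forall>y. \<delta> \<le> \<bar>y\<bar> \<and> \<bar>y\<bar> \<le> 1 / \<delta> \<longrightarrow> \<eta> y powr (2 - p) \<le> B"
begin

definition dens :: "(real \<Rightarrow> real \<Rightarrow> real) \<Rightarrow> real \<times> real \<Rightarrow> real" where
  "dens k z = \<bar>k (fst z) (snd z)\<bar> powr p * \<eta> (fst z - snd z) powr (2 - p)"

definition kfin :: "(real \<Rightarrow> real \<Rightarrow> real) \<Rightarrow> bool" where
  "kfin k \<longleftrightarrow> (\<lambda>z. k (fst z) (snd z)) \<in> borel_measurable (borel \<Otimes>\<^sub>M borel)
     \<and> integrable (lborel \<Otimes>\<^sub>M lborel) (dens k)"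

definition kmass :: "(real \<Rightarrow> real \<Rightarrow> real) \<Rightarrow> real" where
  "kmass k = (LINT z|(lborel \<Otimes>\<^sub>M lborel). dens k z)"

definition c0 where "c0 = (LINT y|lborel. \<eta> y)"

text \<open>The constant produced by Hoelder's inequality; it dominates the operator norm on L_p and
  on L_2 simultaneously.\<close>

definition knorm :: "(real \<Rightarrow> real \<Rightarrow> real) \<Rightarrow> real" where
  "knorm k = kmass k powr (1 / p) * c0 powr ((p - 2) / p)"

lemma dens_nonneg: "0 \<le> dens k z" by (simp add: dens_def)
lemma kmass_nonneg: "0 \<le> kmass k" unfolding kmass_def by (rule Bochner_Integration.integral_nonneg) (simp add: dens_nonneg)
lemma c0_nonneg: "0 \<le> c0" unfolding c0_def by (rule Bochner_Integration.integral_nonneg) (simp add: eta_nonneg)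
lemma knorm_nonneg: "0 \<le> knorm k" by (simp add: knorm_def)

lemma eta_reflect: "integrable lborel (\<lambda>s. \<eta> (x - s))" "(LINT s|lborel. \<eta> (x - s)) = c0"
  using integrable_reflect[OF eta_int] integral_reflect[of \<eta> x] by (auto simp: c0_def)

lemma kfin_section:
  assumes "kfin k"
  shows "AE x in lborel. integrable lborel (\<lambda>s. dens k (x, s))"
    and "integrable lborel (\<lambda>x. LINT s|lborel. dens k (x, s))"
    and "(LINT x|lborel. LINT s|lborel. dens k (x, s)) = kmass k"
proof -
  have i: "integrable (lborel \<Otimes>\<^sub>M lborel) (dens k)" using assms by (simp add: kfin_def)
  have i': "integrable (lborel \<Otimes>\<^sub>M lborel) (\<lambda>(x, s). dens k (x, s))" using i by (simp add: case_prod_beta')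
  show "AE x in lborel. integrable lborel (\<lambda>s. dens k (x, s))" by (rule lborel_pair.AE_integrable_fst'[OF i])
  show "integrable lborel (\<lambda>x. LINT s|lborel. dens k (x, s))" by (rule lborel_pair.integrable_fst'[OF i])
  show "(LINT x|lborel. LINT s|lborel. dens k (x, s)) = kmass k"
    unfolding kmass_def by (rule lborel_pair.integral_fst'[OF i])
qed

lemma kop_measurable:
  assumes "kfin k" "w \<in> borel_measurable borel"
  shows "kop k w \<in> borel_measurable borel"
proof -
  have [measurable]: "(\<lambda>z. k (fst z) (snd z)) \<in> borel_measurable (borel \<Otimes>\<^sub>M borel)" "w \<in> borel_measurable borel"
    using assms by (auto simp: kfin_def)
  have "(\<lambda>z. k (fst z) (snd z) * w (snd z)) \<in> borel_measurable (borel \<Otimes>\<^sub>M lborel)"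
    by measurable
  then have "(\<lambda>x. LINT s|lborel. k x s * w s) \<in> borel_measurable borel"
    by (intro lborel.borel_measurable_lebesgue_integral) (simp add: case_prod_beta')
  then show ?thesis by (simp add: kop_def[abs_def])
qed

lemma k_section_measurable:
  assumes "kfin k" shows "k x \<in> borel_measurable borel"
proof -
  have [measurable]: "(\<lambda>z. k (fst z) (snd z)) \<in> borel_measurable (borel \<Otimes>\<^sub>M borel)"
    using assms by (auto simp: kfin_def)
  have "(\<lambda>s. (\<lambda>z. k (fst z) (snd z)) (x, s)) \<in> borel_measurable borel" by measurable
  then show ?thesis by simp
qed

text \<open>Off the diagonal |k w| = \<open>dens\<close>^(1/p) |w| \<eta>^((p - 2)/p), because
  \<eta> is positive there and its powers cancel; the three-factor Hoelder inequality applies to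
  this product.\<close>

lemma kop_pointwise_p:
  assumes k: "kfin k" and w: "w \<in> Lp p" and x: "integrable lborel (\<lambda>s. dens k (x, s))"
  shows "integrable lborel (\<lambda>s. k x s * w s)"
    and "\<bar>kop k w x\<bar> \<le> (LINT s|lborel. dens k (x, s)) powr (1/p) * Lp_norm p w * c0 powr ((p - 2) / p)"
proof -
  have [measurable]: "w \<in> borel_measurable borel" "k x \<in> borel_measurable borel"
    using w k LpD k_section_measurable by auto
  have ex: "0 < 1/p" "0 < (p - 2) / p" "1/p + 1/p + (p - 2)/p = 1" using p by (auto simp: field_simps)
  let ?h = "\<lambda>s. dens k (x, s) powr (1/p) * (\<bar>w s\<bar> powr p) powr (1/p) * \<eta> (x - s) powr ((p - 2) / p)"
  note H = Holder3[OF ex(1,1,2,3) x dens_nonneg LpD(2)[OF w] powr_ge_zero eta_reflect(1) eta_nonneg, of x]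
  have ae: "AE s in lborel. ?h s = \<bar>k x s * w s\<bar>"
    using AE_lborel_singleton[of x]
  proof eventually_elim
    case (elim s)
    have e: "0 < \<eta> (x - s)" using elim eta_pos by auto
    have "dens k (x, s) powr (1 / p) = \<bar>k x s\<bar> * \<eta> (x - s) powr ((2 - p) / p)"
      using p by (simp add: dens_def powr_mult powr_powr)
    moreover have "\<eta> (x - s) powr ((2 - p) / p) * \<eta> (x - s) powr ((p - 2) / p) = 1"
      using e p by (simp add: powr_add[symmetric] add_divide_distrib[symmetric])
    moreover have "(\<bar>w s\<bar> powr p) powr (1/p) = \<bar>w s\<bar>" using p by (simp add: powr_powr)
    ultimately show ?case by (simp add: mult_ac abs_mult)
  qed
  have ia: "integrable lborel (\<lambda>s. \<bar>k x s * w s\<bar>)"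
    by (rule integrable_cong_AE_imp[OF H(1)]) (use ae in auto)
  then show i: "integrable lborel (\<lambda>s. k x s * w s)" by (subst (asm) integrable_abs_iff) auto
  have "\<bar>kop k w x\<bar> \<le> (LINT s|lborel. \<bar>k x s * w s\<bar>)" unfolding kop_def by (rule integral_abs_bound)
  also have "\<dots> = (LINT s|lborel. ?h s)"
    by (rule integral_cong_AE) (use ae H(1) in auto)
  also have "\<dots> \<le> (LINT s|lborel. dens k (x, s)) powr (1/p) * (LINT s|lborel. \<bar>w s\<bar> powr p) powr (1/p) * c0 powr ((p - 2)/p)"
    using H(2) by (simp add: eta_reflect)
  finally show "\<bar>kop k w x\<bar> \<le> (LINT s|lborel. dens k (x, s)) powr (1/p) * Lp_norm p w * c0 powr ((p - 2) / p)"
    by (simp add: Lp_norm_def)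
qed

lemma kop_Lp_p:
  assumes k: "kfin k" and w: "w \<in> Lp p"
  shows "kop k w \<in> Lp p" "Lp_norm p (kop k w) \<le> knorm k * Lp_norm p w"
proof -
  have [measurable]: "kop k w \<in> borel_measurable borel" using kop_measurable k w LpD by auto
  note sec = kfin_section[OF k]
  let ?a = "\<lambda>x. LINT s|lborel. dens k (x, s)"
  let ?C = "Lp_norm p w powr p * c0 powr (p - 2)"
  have a0: "0 \<le> ?a x" for x by (rule Bochner_Integration.integral_nonneg) (simp add: dens_nonneg)
  have le: "AE x in lborel. \<bar>kop k w x\<bar> powr p \<le> ?a x * ?C"
    using sec(1)
  proof eventually_elim
    case (elim x)
    have "\<bar>kop k w x\<bar> powr p \<le> (?a x powr (1/p) * Lp_norm p w * c0 powr ((p - 2) / p)) powr p"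
      using kop_pointwise_p(2)[OF k w elim] p by (intro powr_mono2) auto
    also have "\<dots> = ?a x * ?C" using p a0 by (simp add: powr_mult powr_powr)
    finally show ?case .
  qed
  have int: "integrable lborel (\<lambda>x. ?a x * ?C)" using sec(2) by simp
  have i: "integrable lborel (\<lambda>x. \<bar>kop k w x\<bar> powr p)"
    by (rule Bochner_Integration.integrable_bound[OF int]) (use le in \<open>auto\<close>)
  then show "kop k w \<in> Lp p" by (simp add: Lp_def)
  have "(LINT x|lborel. \<bar>kop k w x\<bar> powr p) \<le> (LINT x|lborel. ?a x * ?C)"
    by (rule integral_mono_AE[OF i int le])
  also have "\<dots> = kmass k * ?C" using sec(3) by simp
  also have "\<dots> = (knorm k * Lp_norm p w) powr p"
    using p kmass_nonneg by (simp add: knorm_def powr_mult powr_powr)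
  finally show "Lp_norm p (kop k w) \<le> knorm k * Lp_norm p w"
    using p knorm_nonneg by (subst Lp_norm_le_iff) auto
qed

lemma L2_iff: "w \<in> Lp 2 \<longleftrightarrow> w \<in> borel_measurable borel \<and> integrable lborel (\<lambda>x. (w x)\<^sup>2)"
  by (simp add: Lp_def)

text \<open>Young's convolution inequality for L_2 and L_1, by Cauchy-Schwarz with respect to the
  measure \<eta>(x - s) ds.\<close>

lemma conv_eta_L2:
  assumes w: "w \<in> Lp 2"
  shows "AE x in lborel. integrable lborel (\<lambda>s. \<bar>w s\<bar> * \<eta> (x - s))"
    and "integrable lborel (\<lambda>x. (LINT s|lborel. \<bar>w s\<bar> * \<eta> (x - s))\<^sup>2)"
    and "(LINT x|lborel. (LINT s|lborel. \<bar>w s\<bar> * \<eta> (x - s))\<^sup>2) \<le> c0\<^sup>2 * Lp_norm 2 w powr 2"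
proof -
  have [measurable]: "w \<in> borel_measurable borel" using w by (simp add: L2_iff)
  let ?q = "\<lambda>s. \<bar>w s\<bar> powr 2"
  note i = integrable_conv[OF LpD(2)[OF w] eta_int]
  have ae: "AE x in lborel. integrable lborel (\<lambda>s. ?q s * \<eta> (x - s))"
    using lborel_pair.AE_integrable_fst'[OF i] by simp
  have pw: "integrable lborel (\<lambda>s. \<bar>w s\<bar> * \<eta> (x - s)) \<and>
      (LINT s|lborel. \<bar>w s\<bar> * \<eta> (x - s))\<^sup>2 \<le> (LINT s|lborel. ?q s * \<eta> (x - s)) * c0"
    if x: "integrable lborel (\<lambda>s. ?q s * \<eta> (x - s))" for x
  proof -
    have ex: "0 < (1/2::real)" "1/2 + 1/2 = (1::real)" by auto
    have n: "0 \<le> ?q s * \<eta> (x - s)" for s by (simp add: eta_nonneg)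
    have e: "(?q s * \<eta> (x - s)) powr (1/2) * \<eta> (x - s) powr (1/2) = \<bar>w s\<bar> * \<eta> (x - s)" for s
    proof -
      have "\<eta> (x - s) powr (1/2) * \<eta> (x - s) powr (1/2) = \<eta> (x - s)"
        by (simp only: powr_add[symmetric] ex(2)) (simp add: eta_nonneg)
      then show ?thesis by (simp add: powr_mult powr_powr mult.assoc)
    qed
    note H = Holder2[OF ex(1,1,2) x n eta_reflect(1) eta_nonneg, of x, unfolded e]
    have 0: "0 \<le> (LINT s|lborel. ?q s * \<eta> (x - s))" by (rule Bochner_Integration.integral_nonneg) (simp add: eta_nonneg)
    have 1: "0 \<le> (LINT s|lborel. \<bar>w s\<bar> * \<eta> (x - s))" by (rule Bochner_Integration.integral_nonneg) (simp add: eta_nonneg)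
    have "(LINT s|lborel. \<bar>w s\<bar> * \<eta> (x - s))\<^sup>2 \<le> ((LINT s|lborel. ?q s * \<eta> (x - s)) powr (1/2) * c0 powr (1/2))\<^sup>2"
      using H(2) 1 unfolding eta_reflect by (intro power_mono) auto
    also have "\<dots> = (LINT s|lborel. ?q s * \<eta> (x - s)) * c0"
      using 0 c0_nonneg by (simp add: power_mult_distrib powr_half_sqrt)
    finally show ?thesis using H(1) by simp
  qed
  show "AE x in lborel. integrable lborel (\<lambda>s. \<bar>w s\<bar> * \<eta> (x - s))"
    using ae by eventually_elim (use pw in auto)
  have int: "integrable lborel (\<lambda>x. (LINT s|lborel. ?q s * \<eta> (x - s)) * c0)"
    using lborel_pair.integrable_fst'[OF i] by simp
  have m: "(\<lambda>x. LINT s|lborel. \<bar>w s\<bar> * \<eta> (x - s)) \<in> borel_measurable borel"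
    by (rule lborel.borel_measurable_lebesgue_integral) measurable
  have ile: "AE x in lborel. (LINT s|lborel. \<bar>w s\<bar> * \<eta> (x - s))\<^sup>2 \<le> (LINT s|lborel. ?q s * \<eta> (x - s)) * c0"
    using ae by eventually_elim (use pw in auto)
  show i2: "integrable lborel (\<lambda>x. (LINT s|lborel. \<bar>w s\<bar> * \<eta> (x - s))\<^sup>2)"
    by (rule Bochner_Integration.integrable_bound[OF int]) (use m ile in \<open>auto\<close>)
  have "(LINT x|lborel. (LINT s|lborel. \<bar>w s\<bar> * \<eta> (x - s))\<^sup>2) \<le> (LINT x|lborel. (LINT s|lborel. ?q s * \<eta> (x - s)) * c0)"
    by (rule integral_mono_AE[OF i2 int ile])
  also have "\<dots> = (LINT x|lborel. LINT s|lborel. ?q s * \<eta> (x - s)) * c0" by simp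
  also have "\<dots> = (LINT x|lborel. ?q x) * c0 * c0"
    unfolding integral_conv[OF LpD(2)[OF w] eta_int] by (simp add: c0_def)
  also have "\<dots> = c0\<^sup>2 * Lp_norm 2 w powr 2" by (subst Lp_norm_powr) (simp_all add: power2_eq_square)
  finally show "(LINT x|lborel. (LINT s|lborel. \<bar>w s\<bar> * \<eta> (x - s))\<^sup>2) \<le> c0\<^sup>2 * Lp_norm 2 w powr 2" .
qed

text \<open>The same cancellation of powers of \<eta>, now with |w| split as |w|^(2/p) |w|^((p -
  2)/p): the first factor is integrated as w^2 against ds, the second as |w| against \<eta>(x - s)
  ds.\<close>

lemma kop_pointwise_2:
  assumes k: "kfin k" and w: "w \<in> Lp 2" and x: "integrable lborel (\<lambda>s. dens k (x, s))"
    and xw: "integrable lborel (\<lambda>s. \<bar>w s\<bar> * \<eta> (x - s))"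
  shows "integrable lborel (\<lambda>s. k x s * w s)"
    and "\<bar>kop k w x\<bar> \<le> (LINT s|lborel. dens k (x, s)) powr (1/p) * (Lp_norm 2 w powr 2) powr (1/p)
      * (LINT s|lborel. \<bar>w s\<bar> * \<eta> (x - s)) powr ((p - 2) / p)"
proof -
  have [measurable]: "w \<in> borel_measurable borel" "k x \<in> borel_measurable borel"
    using w k LpD k_section_measurable by auto
  have ex: "0 < 1/p" "0 < (p - 2) / p" "1/p + 1/p + (p - 2)/p = 1" using p by (auto simp: field_simps)
  let ?h = "\<lambda>s. dens k (x, s) powr (1/p) * (\<bar>w s\<bar> powr 2) powr (1/p) * (\<bar>w s\<bar> * \<eta> (x - s)) powr ((p - 2) / p)"
  have n: "0 \<le> \<bar>w s\<bar> * \<eta> (x - s)" for s by (simp add: eta_nonneg)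
  note H = Holder3[OF ex(1,1,2,3) x dens_nonneg LpD(2)[OF w] powr_ge_zero xw n]
  have ae: "AE s in lborel. ?h s = \<bar>k x s * w s\<bar>"
    using AE_lborel_singleton[of x]
  proof eventually_elim
    case (elim s)
    have e: "0 < \<eta> (x - s)" using elim eta_pos by auto
    have 1: "dens k (x, s) powr (1 / p) = \<bar>k x s\<bar> * \<eta> (x - s) powr ((2 - p) / p)"
      using p by (simp add: dens_def powr_mult powr_powr)
    have 2: "\<eta> (x - s) powr ((2 - p) / p) * \<eta> (x - s) powr ((p - 2) / p) = 1"
      using e p by (simp add: powr_add[symmetric] add_divide_distrib[symmetric])
    have "(\<bar>w s\<bar> powr 2) powr (1/p) * \<bar>w s\<bar> powr ((p - 2) / p) = \<bar>w s\<bar> powr (2 * (1/p) + (p - 2) / p)"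
      by (simp only: powr_powr powr_add)
    also have "2 * (1/p) + (p - 2) / p = 1" using p by (simp add: field_simps)
    finally have 3: "(\<bar>w s\<bar> powr 2) powr (1/p) * \<bar>w s\<bar> powr ((p - 2) / p) = \<bar>w s\<bar>" by simp
    have "?h s = \<bar>k x s\<bar> * (\<eta> (x - s) powr ((2 - p) / p) * \<eta> (x - s) powr ((p - 2) / p))
       * ((\<bar>w s\<bar> powr 2) powr (1/p) * \<bar>w s\<bar> powr ((p - 2) / p))"
      unfolding 1 by (simp add: powr_mult eta_nonneg mult_ac)
    then show ?case unfolding 2 3 by (simp add: abs_mult)
  qed
  have ia: "integrable lborel (\<lambda>s. \<bar>k x s * w s\<bar>)"
    by (rule integrable_cong_AE_imp[OF H(1)]) (use ae in auto)
  then show i: "integrable lborel (\<lambda>s. k x s * w s)" by (subst (asm) integrable_abs_iff) auto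
  have "\<bar>kop k w x\<bar> \<le> (LINT s|lborel. \<bar>k x s * w s\<bar>)" unfolding kop_def by (rule integral_abs_bound)
  also have "\<dots> = (LINT s|lborel. ?h s)"
    by (rule integral_cong_AE) (use ae H(1) in auto)
  finally show "\<bar>kop k w x\<bar> \<le> (LINT s|lborel. dens k (x, s)) powr (1/p) * (Lp_norm 2 w powr 2) powr (1/p)
      * (LINT s|lborel. \<bar>w s\<bar> * \<eta> (x - s)) powr ((p - 2) / p)"
    using H(2) by (subst Lp_norm_powr) auto
qed

text \<open>Squaring the pointwise bound and applying Hoelder in x with exponents 2/p and (p - 2)/p
  leaves the kernel mass and the L_2 norm of a convolution. The powers of the norm of w add up to 2,
  so the constant is again \<open>knorm\<close>.\<close>

lemma kop_Lp_2:
  assumes k: "kfin k" and w: "w \<in> Lp 2"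
  shows "kop k w \<in> Lp 2" "Lp_norm 2 (kop k w) \<le> knorm k * Lp_norm 2 w"
proof -
  have [measurable]: "kop k w \<in> borel_measurable borel" using kop_measurable k w LpD by auto
  note sec = kfin_section[OF k] and cv = conv_eta_L2[OF w]
  let ?a = "\<lambda>x. LINT s|lborel. dens k (x, s)" and ?W = "\<lambda>x. LINT s|lborel. \<bar>w s\<bar> * \<eta> (x - s)"
  let ?N = "Lp_norm 2 w"
  let ?C = "(?N powr 2) powr (2/p)"
  have a0: "0 \<le> ?a x" for x by (rule Bochner_Integration.integral_nonneg) (simp add: dens_nonneg)
  have ex: "0 < 2/p" "0 < (p - 2)/p" "2/p + (p - 2)/p = 1" using p by (auto simp: field_simps)
  note H = Holder2[OF ex sec(2) a0 cv(2) zero_le_power2]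
  let ?h = "\<lambda>x. ?a x powr (2/p) * (?W x)\<^sup>2 powr ((p - 2)/p)"
  have W0: "0 \<le> ?W x" for x by (rule Bochner_Integration.integral_nonneg) (simp add: eta_nonneg)
  have le: "AE x in lborel. \<bar>kop k w x\<bar> powr 2 \<le> ?h x * ?C"
    using sec(1) cv(1)
  proof eventually_elim
    case (elim x)
    have "\<bar>kop k w x\<bar> powr 2 \<le> (?a x powr (1/p) * (?N powr 2) powr (1/p) * ?W x powr ((p - 2) / p)) powr 2"
      using kop_pointwise_2(2)[OF k w elim] by (intro powr_mono2) auto
    also have "\<dots> = (?a x powr (1/p)) powr 2 * ((?N powr 2) powr (1/p)) powr 2 * (?W x powr ((p - 2) / p)) powr 2"
      by (simp only: powr_mult)
    also have "(?a x powr (1/p)) powr 2 = ?a x powr (2/p)" by (simp only: powr_powr) simp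
    also have "((?N powr 2) powr (1/p)) powr 2 = ?C" by (simp only: powr_powr) simp
    also have "(?W x powr ((p - 2) / p)) powr 2 = (?W x)\<^sup>2 powr ((p - 2)/p)"
    proof -
      have "(?W x)\<^sup>2 = ?W x powr 2" using W0[of x] by simp
      then show ?thesis by (simp only: powr_powr mult.commute)
    qed
    finally show ?case by (simp only: mult_ac)
  qed
  have int: "integrable lborel (\<lambda>x. ?h x * ?C)" using H(1) by simp
  have i: "integrable lborel (\<lambda>x. \<bar>kop k w x\<bar> powr 2)"
    by (rule Bochner_Integration.integrable_bound[OF int]) (use le in \<open>auto\<close>)
  then show "kop k w \<in> Lp 2" by (simp add: Lp_def)
  have "(LINT x|lborel. \<bar>kop k w x\<bar> powr 2) \<le> (LINT x|lborel. ?h x * ?C)"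
    by (rule integral_mono_AE[OF i int le])
  also have "\<dots> = (LINT x|lborel. ?h x) * ?C" by simp
  also have "\<dots> \<le> (kmass k powr (2/p) * (c0\<^sup>2 * ?N powr 2) powr ((p - 2)/p)) * ?C"
  proof (rule mult_right_mono)
    have "(LINT x|lborel. ?h x) \<le> kmass k powr (2/p) * (LINT x|lborel. (?W x)\<^sup>2) powr ((p - 2)/p)"
      using H(2) sec(3) by simp
    also have "\<dots> \<le> kmass k powr (2/p) * (c0\<^sup>2 * ?N powr 2) powr ((p - 2)/p)"
      using cv(3) p by (intro mult_left_mono powr_mono2) (auto intro: Bochner_Integration.integral_nonneg)
    finally show "(LINT x|lborel. ?h x) \<le> kmass k powr (2/p) * (c0\<^sup>2 * ?N powr 2) powr ((p - 2)/p)" .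
  qed simp
  also have "\<dots> = (knorm k * ?N) powr 2"
  proof -
    have c: "c0\<^sup>2 = c0 powr 2" using c0_nonneg by simp
    have N: "(?N powr 2) powr ((p - 2)/p) * (?N powr 2) powr (2/p) = ?N powr 2"
      using ex(3) by (simp add: powr_add[symmetric] add.commute)
    have "(kmass k powr (2/p) * (c0\<^sup>2 * ?N powr 2) powr ((p - 2)/p)) * ?C
        = kmass k powr (2/p) * (c0 powr 2) powr ((p - 2)/p) * ((?N powr 2) powr ((p - 2)/p) * (?N powr 2) powr (2/p))"
      unfolding c powr_mult by (simp only: mult_ac)
    also have "\<dots> = kmass k powr (2/p) * (c0 powr 2) powr ((p - 2)/p) * ?N powr 2" unfolding N ..
    also have "\<dots> = (kmass k powr (1/p)) powr 2 * (c0 powr ((p - 2)/p)) powr 2 * ?N powr 2"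
      unfolding powr_powr by (simp add: mult.commute)
    also have "\<dots> = (knorm k * ?N) powr 2" unfolding knorm_def powr_mult by (simp only: mult_ac)
    finally show ?thesis .
  qed
  finally show "Lp_norm 2 (kop k w) \<le> knorm k * ?N"
    using knorm_nonneg by (subst Lp_norm_le_iff) auto
qed

lemma AE_kop_integrable:
  assumes k: "kfin k" and q: "q = p \<or> q = 2" and w: "w \<in> Lp q"
  shows "AE x in lborel. integrable lborel (\<lambda>s. k x s * w s)"
proof (cases "q = p")
  case True
  show ?thesis using kfin_section(1)[OF k] by eventually_elim (use kop_pointwise_p(1)[OF k] w True in auto)
next
  case False
  then have "w \<in> Lp 2" using q w by auto
  then show ?thesis using kfin_section(1)[OF k] conv_eta_L2(1)[of w]
    by (auto elim!: eventually_elim2 intro: kop_pointwise_2(1)[OF k])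
qed

lemma kop_Lp:
  assumes k: "kfin k" and q: "q = p \<or> q = 2" and w: "w \<in> Lp q"
  shows "kop k w \<in> Lp q" "Lp_norm q (kop k w) \<le> knorm k * Lp_norm q w"
  using kop_Lp_p[OF k, of w] kop_Lp_2[OF k, of w] q w by auto

lemma kop_bounded_op:
  assumes k: "kfin k" and q: "q = p \<or> q = 2"
  shows "bounded_op_Lp q (kop k)"
  unfolding bounded_op_Lp_def
proof (intro conjI ballI allI impI)
  fix g h assume g: "g \<in> Lp q" and h: "h \<in> Lp q"
  note ms = k_section_measurable[OF k] LpD(1)[OF g] LpD(1)[OF h]
  show "AE x in lborel. kop k g x = kop k h x" if "AE x in lborel. g x = h x"
  proof (rule AE_I2)
    fix x
    show "kop k g x = kop k h x" unfolding kop_def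
    proof (rule integral_cong_AE)
      show "AE s in lborel. k x s * g s = k x s * h s" using that by eventually_elim simp
    qed (use ms in auto)
  qed
  fix a b
  show "AE x in lborel. kop k (\<lambda>y. a * g y + b * h y) x = a * kop k g x + b * kop k h x"
    using AE_kop_integrable[OF k q g] AE_kop_integrable[OF k q h]
  proof eventually_elim
    case (elim x)
    have "(LINT s|lborel. k x s * (a * g s + b * h s)) = (LINT s|lborel. a * (k x s * g s) + b * (k x s * h s))"
      by (simp add: algebra_simps)
    also have "\<dots> = a * (LINT s|lborel. k x s * g s) + b * (LINT s|lborel. k x s * h s)" using elim by simp
    finally show ?case by (simp add: kop_def)
  qed
next
  show "\<exists>C. \<forall>g\<in>Lp q. Lp_norm q (kop k g) \<le> C * Lp_norm q g" using kop_Lp[OF k q] by blast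
qed (use kop_Lp[OF k q] in auto)

end

subsection \<open>Finite rank approximation\<close>

definition bounded_support :: "(real \<Rightarrow> real) \<Rightarrow> bool" where
  "bounded_support h \<longleftrightarrow> h \<in> borel_measurable borel \<and> (\<exists>M. \<forall>x. \<bar>h x\<bar> \<le> M \<and> (M < \<bar>x\<bar> \<longrightarrow> h x = 0))"

lemma bounded_support_Lp:
  assumes "bounded_support h" "0 < q" shows "h \<in> Lp q"
proof -
  obtain M where m[measurable]: "h \<in> borel_measurable borel" and M: "\<And>x. \<bar>h x\<bar> \<le> M" "\<And>x. M < \<bar>x\<bar> \<Longrightarrow> h x = 0"
    using assms by (auto simp: bounded_support_def)
  have "integrable lborel (\<lambda>x. \<bar>h x\<bar> powr q)"
  proof (rule Bochner_Integration.integrable_bound[of lborel "\<lambda>x. M powr q * indicator {-M..M} x"])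
    show "integrable lborel (\<lambda>x. M powr q * indicator {- M..M} x :: real)"
      by (simp add: emeasure_lborel_Icc_eq)
    show "AE x in lborel. norm (\<bar>h x\<bar> powr q) \<le> norm (M powr q * indicator {- M..M} x)"
    proof (rule AE_I2)
      fix x show "norm (\<bar>h x\<bar> powr q) \<le> norm (M powr q * indicator {- M..M} x)"
        using M(1)[of x] M(2)[of x] assms(2) by (cases "x \<in> {-M..M}") (auto intro!: powr_mono2)
    qed
  qed measurable
  then show ?thesis by (simp add: Lp_def)
qed

lemma bounded_support_pairing:
  assumes h: "bounded_support h" and q: "1 < q"
  obtains C where "0 \<le> C" "\<And>w. w \<in> Lp q \<Longrightarrow> integrable lborel (\<lambda>x. h x * w x)"
    "\<And>w. w \<in> Lp q \<Longrightarrow> \<bar>LINT x|lborel. h x * w x\<bar> \<le> C * Lp_norm q w"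
proof -
  let ?q = "q / (q - 1)"
  have ex: "0 < 1 / ?q" "0 < 1 / q" "1 / ?q + 1 / q = 1" using q by (auto simp: field_simps)
  have hq: "h \<in> Lp ?q" using h q by (intro bounded_support_Lp) auto
  let ?C = "(LINT x|lborel. \<bar>h x\<bar> powr ?q) powr (1 / ?q)"
  have e: "(\<bar>h x\<bar> powr ?q) powr (1 / ?q) * (\<bar>w x\<bar> powr q) powr (1 / q) = \<bar>h x * w x\<bar>" for w x
    using q by (simp add: powr_powr abs_mult)
  have main: "integrable lborel (\<lambda>x. h x * w x) \<and> \<bar>LINT x|lborel. h x * w x\<bar> \<le> ?C * Lp_norm q w" if w: "w \<in> Lp q" for w
  proof -
    have [measurable]: "h \<in> borel_measurable borel" "w \<in> borel_measurable borel" using hq w LpD by auto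
    note H = Holder2[OF ex LpD(2)[OF hq] powr_ge_zero LpD(2)[OF w] powr_ge_zero, unfolded e]
    have i: "integrable lborel (\<lambda>x. h x * w x)" using H(1) by (subst (asm) integrable_abs_iff) auto
    have "\<bar>LINT x|lborel. h x * w x\<bar> \<le> (LINT x|lborel. \<bar>h x * w x\<bar>)" by (rule integral_abs_bound)
    from order_trans[OF this H(2)] i show ?thesis by (simp add: Lp_norm_def)
  qed
  show ?thesis by (rule that[of ?C]) (use main in auto)
qed

context kernel_weight
begin

text \<open>A quasi-triangle inequality for the p-th power mass; the factor 2^p is harmless because
  only two errors are ever added.\<close>

lemma kfin_add:
  assumes f: "kfin f" and g: "kfin g"
  shows "kfin (\<lambda>x s. f x s + g x s)" "kmass (\<lambda>x s. f x s + g x s) \<le> 2 powr p * (kmass f + kmass g)"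
proof -
  have [measurable]: "(\<lambda>z. f (fst z) (snd z)) \<in> borel_measurable (borel \<Otimes>\<^sub>M borel)" "(\<lambda>z. g (fst z) (snd z)) \<in> borel_measurable (borel \<Otimes>\<^sub>M borel)"
    using f g by (auto simp: kfin_def)
  have i: "integrable (lborel \<Otimes>\<^sub>M lborel) (dens f)" "integrable (lborel \<Otimes>\<^sub>M lborel) (dens g)"
    using f g by (auto simp: kfin_def)
  have m: "dens (\<lambda>x s. f x s + g x s) \<in> borel_measurable (lborel \<Otimes>\<^sub>M lborel)"
    unfolding dens_def[abs_def] by measurable
  have le: "dens (\<lambda>x s. f x s + g x s) z \<le> 2 powr p * (dens f z + dens g z)" for z
  proof -
    have "\<bar>f (fst z) (snd z) + g (fst z) (snd z)\<bar> powr p \<le> (\<bar>f (fst z) (snd z)\<bar> + \<bar>g (fst z) (snd z)\<bar>) powr p"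
      using p by (intro powr_mono2) auto
    also have "\<dots> \<le> 2 powr p * (\<bar>f (fst z) (snd z)\<bar> powr p + \<bar>g (fst z) (snd z)\<bar> powr p)"
      using p by (intro powr_add_le) auto
    finally have "dens (\<lambda>x s. f x s + g x s) z
       \<le> 2 powr p * (\<bar>f (fst z) (snd z)\<bar> powr p + \<bar>g (fst z) (snd z)\<bar> powr p) * \<eta> (fst z - snd z) powr (2 - p)"
      unfolding dens_def by (intro mult_right_mono) auto
    then show ?thesis by (simp add: dens_def algebra_simps)
  qed
  have i2: "integrable (lborel \<Otimes>\<^sub>M lborel) (\<lambda>z. 2 powr p * (dens f z + dens g z))" using i by auto
  have i3: "integrable (lborel \<Otimes>\<^sub>M lborel) (dens (\<lambda>x s. f x s + g x s))"
    by (rule Bochner_Integration.integrable_bound[OF i2 m]) (use le dens_nonneg in \<open>auto intro!: AE_I2 order_trans[OF _ abs_ge_self]\<close>)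
  show "kfin (\<lambda>x s. f x s + g x s)" using i3 by (simp add: kfin_def)
  have "kmass (\<lambda>x s. f x s + g x s) \<le> (LINT z|(lborel \<Otimes>\<^sub>M lborel). 2 powr p * (dens f z + dens g z))"
    unfolding kmass_def by (rule integral_mono[OF i3 i2 le])
  also have "\<dots> = 2 powr p * (kmass f + kmass g)" using i by (simp add: kmass_def)
  finally show "kmass (\<lambda>x s. f x s + g x s) \<le> 2 powr p * (kmass f + kmass g)" .
qed

lemma AE_off_diagonal: "AE z in lborel \<Otimes>\<^sub>M lborel. fst z \<noteq> (snd z :: real)"
proof (rule lborel_pair.AE_pair_measure)
  have "AE y in lborel. x \<noteq> (y::real)" for x using AE_lborel_singleton[of x] by eventually_elim auto
  then show "AE x in lborel. AE y in lborel. fst (x, y) \<noteq> (snd (x, y) :: real)" by simp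
qed measurable

text \<open>A continuous cutoff that vanishes for large arguments and in the strip |x - s| <= 1/n,
  and tends to 1 off the diagonal. Its product with a kernel that is continuous off the diagonal is
  continuous with compact support.\<close>

definition cut :: "nat \<Rightarrow> real \<times> real \<Rightarrow> real" where
  "cut n z = max 0 (min 1 (real n - max \<bar>fst z\<bar> \<bar>snd z\<bar>)) * max 0 (min 1 (real n * \<bar>fst z - snd z\<bar> - 1))"

lemma cut_cont: "continuous_on A (cut n)"
  unfolding cut_def by (intro continuous_intros)

lemma cut_range: "0 \<le> cut n z" "cut n z \<le> 1"
  by (auto simp: cut_def intro!: mult_le_one)

lemma cut_eventually_1: assumes "fst z \<noteq> snd z" shows "\<forall>\<^sub>F n in sequentially. cut n z = 1"
proof -
  obtain N1 where N1: "max \<bar>fst z\<bar> \<bar>snd z\<bar> + 1 \<le> real N1" using real_arch_simple by blast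
  obtain N2 where N2: "2 / \<bar>fst z - snd z\<bar> \<le> real N2" using real_arch_simple by blast
  show ?thesis
  proof (rule eventually_sequentiallyI[of "max N1 N2"])
    fix n assume n: "max N1 N2 \<le> n"
    have "2 / \<bar>fst z - snd z\<bar> \<le> real n" using N2 n by linarith
    then have "2 \<le> real n * \<bar>fst z - snd z\<bar>" using assms by (simp add: field_simps)
    moreover have "max \<bar>fst z\<bar> \<bar>snd z\<bar> + 1 \<le> real n" using N1 n by linarith
    ultimately show "cut n z = 1" by (simp add: cut_def)
  qed
qed

lemma cut_approx:
  assumes k: "kfin k"
  shows "kfin (\<lambda>x s. k x s - cut n (x, s) * k x s)" "(\<lambda>n. kmass (\<lambda>x s. k x s - cut n (x, s) * k x s)) \<longlonglongrightarrow> 0"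
proof -
  have [measurable]: "(\<lambda>z. k (fst z) (snd z)) \<in> borel_measurable (borel \<Otimes>\<^sub>M borel)" using k by (auto simp: kfin_def)
  have i: "integrable (lborel \<Otimes>\<^sub>M lborel) (dens k)" using k by (auto simp: kfin_def)
  have [measurable]: "cut n \<in> borel_measurable (borel \<Otimes>\<^sub>M borel)" for n
    unfolding cut_def by measurable
  let ?d = "\<lambda>n. dens (\<lambda>x s. k x s - cut n (x, s) * k x s)"
  have m: "?d n \<in> borel_measurable (lborel \<Otimes>\<^sub>M lborel)" for n unfolding dens_def[abs_def] by measurable
  have e: "?d n z = \<bar>1 - cut n z\<bar> powr p * dens k z" for n z
  proof -
    have "k (fst z) (snd z) - cut n z * k (fst z) (snd z) = (1 - cut n z) * k (fst z) (snd z)" by (simp add: algebra_simps)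
    then show ?thesis by (simp add: dens_def abs_mult powr_mult)
  qed
  have le: "norm (?d n z) \<le> dens k z" for n z
  proof -
    have "\<bar>1 - cut n z\<bar> powr p \<le> 1 powr p" using cut_range[of n z] p by (intro powr_mono2) auto
    then show ?thesis unfolding e using dens_nonneg[of k z] by (simp add: abs_mult mult_left_le_one_le)
  qed
  have lim: "AE z in lborel \<Otimes>\<^sub>M lborel. (\<lambda>n. ?d n z) \<longlonglongrightarrow> 0"
    using AE_off_diagonal
  proof eventually_elim
    case (elim z)
    have "\<forall>\<^sub>F n in sequentially. ?d n z = 0" using cut_eventually_1[OF elim] by eventually_elim (use e in simp)
    then show ?case by (rule tendsto_eventually)
  qed
  have int: "integrable (lborel \<Otimes>\<^sub>M lborel) (?d n)" for n
    by (rule Bochner_Integration.integrable_bound[OF i m]) (use le dens_nonneg in \<open>auto intro!: AE_I2 order_trans[OF _ abs_ge_self]\<close>)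
  show "kfin (\<lambda>x s. k x s - cut n (x, s) * k x s)" using int by (simp add: kfin_def)
  have "(\<lambda>n. LINT z|(lborel \<Otimes>\<^sub>M lborel). ?d n z) \<longlonglongrightarrow> (LINT z|(lborel \<Otimes>\<^sub>M lborel :: (real \<times> real) measure). 0)"
    proof (rule integral_dominated_convergence[where w = "dens k"])
    show "AE z in lborel \<Otimes>\<^sub>M lborel. norm (?d m z) \<le> dens k z" for m by (rule AE_I2) (rule le)
  qed (use m i lim in simp_all)
  then show "(\<lambda>n. kmass (\<lambda>x s. k x s - cut n (x, s) * k x s)) \<longlonglongrightarrow> 0" by (simp add: kmass_def)
qed

lemma floor_grid: fixes x :: real assumes "0 < N" shows "\<bar>of_int \<lfloor>N * x\<rfloor> / N - x\<bar> \<le> 1 / N"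
proof -
  have "\<bar>of_int \<lfloor>N * x\<rfloor> - N * x\<bar> \<le> 1" by linarith
  then have "\<bar>of_int \<lfloor>N * x\<rfloor> - N * x\<bar> / N \<le> 1 / N" using assms by (intro divide_right_mono) auto
  moreover have "of_int \<lfloor>N * x\<rfloor> / N - x = (of_int \<lfloor>N * x\<rfloor> - N * x) / N" using assms by (simp add: field_simps)
  ultimately show ?thesis using assms by simp
qed

definition grid :: "(real \<times> real \<Rightarrow> real) \<Rightarrow> real \<Rightarrow> real \<Rightarrow> real \<Rightarrow> real" where
  "grid f N x s = f (of_int \<lfloor>N * x\<rfloor> / N, of_int \<lfloor>N * s\<rfloor> / N)"

text \<open>A mesh of width 1/N moves each variable by at most \<delta>/4, so the function and its
  samples both live where |x - s| >= \<delta>/2. There \<open>eta_loc\<close> bounds the weight, and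
  dominated convergence applies on a bounded square.\<close>

lemma grid_approx:
  fixes f :: "real \<times> real \<Rightarrow> real"
  assumes cont: "continuous_on UNIV f" and pos: "0 < M" "0 < \<delta>"
    and supp: "\<And>x s. f (x, s) \<noteq> 0 \<Longrightarrow> \<bar>x\<bar> < M \<and> \<bar>s\<bar> < M \<and> \<delta> < \<bar>x - s\<bar>"
    and N: "\<And>m. N m \<ge> 1" "\<And>m. N m \<ge> 4 / \<delta>" "filterlim N at_top sequentially"
  shows "kfin (\<lambda>x s. f (x, s) - grid f (N m) x s)" "(\<lambda>m. kmass (\<lambda>x s. f (x, s) - grid f (N m) x s)) \<longlonglongrightarrow> 0"
proof -
  have [measurable]: "f \<in> borel_measurable (borel \<Otimes>\<^sub>M borel)"
    using borel_measurable_continuous_onI[OF cont] by (simp add: borel_prod)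
  have gm[measurable]: "(\<lambda>z. grid f (N m) (fst z) (snd z)) \<in> borel_measurable (borel \<Otimes>\<^sub>M borel)" for m
    unfolding grid_def by measurable
  have Npos: "0 < N m" for m using N(1)[of m] by linarith
  have "bounded (f ` ({-M..M} \<times> {-M..M}))"
    by (intro compact_imp_bounded compact_continuous_image compact_Times continuous_on_subset[OF cont]) auto
  then obtain B where B0: "\<forall>z\<in>{-M..M} \<times> {-M..M}. \<bar>f z\<bar> \<le> B" unfolding bounded_iff by auto
  have "\<bar>f z\<bar> \<le> \<bar>B\<bar>" for z
  proof (cases "f z = 0")
    case False
    then have "z \<in> {-M..M} \<times> {-M..M}" using supp[of "fst z" "snd z"] by (cases z) auto
    then show ?thesis using B0 by force
  qed auto
  then obtain B where B: "\<And>z. \<bar>f z\<bar> \<le> B" "0 \<le> B" by (meson abs_ge_zero)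
  \<comment> \<open>The annulus in \<open>eta_loc\<close> has radii \<delta> and 1/\<delta>, so the
    lower bound \<delta>/2 and the upper bound 2 M + 2 on |x - s| are encoded in one
    parameter.\<close>
  let ?\<delta> = "min (\<delta> / 2) (1 / (2 * M + 2))"
  obtain E where E: "\<And>y. ?\<delta> \<le> \<bar>y\<bar> \<Longrightarrow> \<bar>y\<bar> \<le> 1 / ?\<delta> \<Longrightarrow> \<eta> y powr (2 - p) \<le> E"
    using eta_loc[of ?\<delta>] pos by auto
  let ?d = "\<lambda>m. dens (\<lambda>x s. f (x, s) - grid f (N m) x s)"
  let ?Q = "{- M - 1..M + 1} :: real set"
  let ?D = "\<lambda>z. (2 * B) powr p * \<bar>E\<bar> * (indicator ?Q (fst z) * indicator ?Q (snd z))"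
  have iD: "integrable (lborel \<Otimes>\<^sub>M lborel) ?D"
    by (intro integrable_mult_right integrable_tensor_fst_snd) (auto simp: emeasure_lborel_Icc_eq)
  have m: "?d m \<in> borel_measurable (lborel \<Otimes>\<^sub>M lborel)" for m unfolding dens_def[abs_def] by measurable
  have le: "norm (?d m z) \<le> ?D z" for m z
  proof -
    obtain x s where z: "z = (x, s)" by fastforce
    let ?x = "of_int \<lfloor>N m * x\<rfloor> / N m" and ?s = "of_int \<lfloor>N m * s\<rfloor> / N m"
    show ?thesis
    proof (cases "f (x, s) = 0 \<and> f (?x, ?s) = 0")
      case True
      then show ?thesis by (simp add: z dens_def grid_def)
    next
      case False
      have Nm: "1 / N m \<le> 1" "1 / N m \<le> \<delta> / 4" 
        using N(1)[of m] N(2)[of m] pos Npos[of m] by (auto simp: field_simps)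
      have c: "\<bar>?x - x\<bar> \<le> 1 / N m" "\<bar>?s - s\<bar> \<le> 1 / N m" using floor_grid Npos by auto
      have q: "\<bar>x\<bar> \<le> M + 1 \<and> \<bar>s\<bar> \<le> M + 1 \<and> \<delta> / 2 \<le> \<bar>x - s\<bar>"
      proof (cases "f (x, s) = 0")
        case False
        then show ?thesis using supp[of x s] pos by auto
      next
        case True
        then have "f (?x, ?s) \<noteq> 0" using False by simp
        from supp[OF this] show ?thesis using c Nm by linarith
      qed
      have "1 / ?\<delta> \<ge> 1 / (1 / (2 * M + 2))" using pos by (intro divide_left_mono) (auto simp: min_def)
      moreover have "1 / (1 / (2 * M + 2)) = 2 * M + 2" by simp
      ultimately have "\<bar>x - s\<bar> \<le> 1 / ?\<delta>" using q by linarith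
      then have "\<eta> (x - s) powr (2 - p) \<le> E" by (rule E[rotated]) (use q in \<open>auto simp: min_le_iff_disj\<close>)
      then have eb: "\<eta> (x - s) powr (2 - p) \<le> \<bar>E\<bar>" by linarith
      have "\<bar>f (x, s) - f (?x, ?s)\<bar> \<le> 2 * B" using B(1)[of "(x, s)"] B(1)[of "(?x, ?s)"] by linarith
      then have "\<bar>f (x, s) - f (?x, ?s)\<bar> powr p \<le> (2 * B) powr p" using p by (intro powr_mono2) auto
      then have "\<bar>f (x, s) - f (?x, ?s)\<bar> powr p * \<eta> (x - s) powr (2 - p) \<le> (2 * B) powr p * \<bar>E\<bar>"
        using eb by (intro mult_mono) auto
      then show ?thesis using q by (auto simp: z dens_def grid_def indicator_def abs_le_iff)
    qed
  qed
  have lim: "AE z in lborel \<Otimes>\<^sub>M lborel. (\<lambda>m. ?d m z) \<longlonglongrightarrow> 0"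
  proof (rule AE_I2)
    fix z :: "real \<times> real"
    obtain x s where z: "z = (x, s)" by fastforce
    have g: "(\<lambda>m. of_int \<lfloor>N m * y\<rfloor> / N m) \<longlonglongrightarrow> y" for y
    proof -
      have "(\<lambda>m. 1 / N m) \<longlonglongrightarrow> 0" using N(3) by (intro tendsto_divide_0[OF tendsto_const] filterlim_at_top_imp_at_infinity)
      then have "(\<lambda>m. of_int \<lfloor>N m * y\<rfloor> / N m - y) \<longlonglongrightarrow> 0"
        by (rule Lim_null_comparison[rotated]) (use floor_grid Npos in auto)
      then show ?thesis by (simp add: LIM_zero_iff)
    qed
    have "(\<lambda>m. f (of_int \<lfloor>N m * x\<rfloor> / N m, of_int \<lfloor>N m * s\<rfloor> / N m)) \<longlonglongrightarrow> f (x, s)"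
      by (rule isCont_tendsto_compose[OF _ tendsto_Pair[OF g g]]) (use cont in \<open>simp add: continuous_on_eq_continuous_at\<close>)
    then have "(\<lambda>m. \<bar>f (x, s) - grid f (N m) x s\<bar>) \<longlonglongrightarrow> \<bar>f (x, s) - f (x, s)\<bar>"
      unfolding grid_def by (intro tendsto_intros)
    then have "(\<lambda>m. \<bar>f (x, s) - grid f (N m) x s\<bar> powr p) \<longlonglongrightarrow> 0 powr p"
      using p by (intro tendsto_powr') auto
    then have "(\<lambda>m. \<bar>f (x, s) - grid f (N m) x s\<bar> powr p * \<eta> (x - s) powr (2 - p)) \<longlonglongrightarrow> 0 powr p * \<eta> (x - s) powr (2 - p)"
      by (intro tendsto_mult tendsto_const)
    then show "(\<lambda>m. ?d m z) \<longlonglongrightarrow> 0" by (simp add: z dens_def)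
  qed
  have int: "integrable (lborel \<Otimes>\<^sub>M lborel) (?d m)" for m
    by (rule Bochner_Integration.integrable_bound[OF iD m]) (use le in \<open>auto intro!: AE_I2 order_trans[OF _ abs_ge_self]\<close>)
  show "kfin (\<lambda>x s. f (x, s) - grid f (N m) x s)" using int by (simp add: kfin_def)
  have "(\<lambda>m. LINT z|(lborel \<Otimes>\<^sub>M lborel). ?d m z) \<longlonglongrightarrow> (LINT z|(lborel \<Otimes>\<^sub>M lborel :: (real \<times> real) measure). 0)"
    proof (rule integral_dominated_convergence[where w = "?D"])
    show "AE z in lborel \<Otimes>\<^sub>M lborel. norm (?d m z) \<le> ?D z" for m by (rule AE_I2) (rule le)
  qed (use m iD lim in simp_all)
  then show "(\<lambda>m. kmass (\<lambda>x s. f (x, s) - grid f (N m) x s)) \<longlonglongrightarrow> 0" by (simp add: kmass_def)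
qed

text \<open>A sampled kernel is constant on mesh squares, and the indicator of a square is a product
  of functions of one variable; bounded support leaves finitely many squares.\<close>

lemma grid_finite_rank:
  assumes N: "1 \<le> N" and supp: "\<And>x s. f (x, s) \<noteq> 0 \<Longrightarrow> \<bar>x\<bar> < M \<and> \<bar>s\<bar> < M"
  obtains I :: "(int \<times> int) set" and a b where "finite I" "\<And>i. i \<in> I \<Longrightarrow> bounded_support (a i)"
    "\<And>i. i \<in> I \<Longrightarrow> bounded_support (b i)" "\<And>x s. grid f N x s = (\<Sum>i\<in>I. a i x * b i s)"
proof -
  define K where "K = \<lceil>N * M\<rceil>"
  define I where "I = {-K..K} \<times> {-K..K}"
  define b0 where "b0 j x = (if \<lfloor>N * x\<rfloor> = j then 1 else 0 :: real)" for j :: int and x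
  have bs: "bounded_support (\<lambda>x. c * b0 j x)" for j c
  proof -
    have "\<bar>x\<bar> \<le> \<bar>of_int j\<bar> + 1" if "\<lfloor>N * x\<rfloor> = j" for x
    proof -
      have "\<bar>N * x\<bar> \<le> \<bar>of_int j\<bar> + 1" using that by linarith
      moreover have "\<bar>x\<bar> \<le> \<bar>N * x\<bar>" using N by (simp add: abs_mult mult_le_cancel_right1)
      ultimately show ?thesis by linarith
    qed
    then have "\<forall>x. \<bar>c * b0 j x\<bar> \<le> \<bar>c\<bar> + (\<bar>of_int j\<bar> + 1) \<and> (\<bar>c\<bar> + (\<bar>of_int j\<bar> + 1) < \<bar>x\<bar> \<longrightarrow> c * b0 j x = 0)"
      by (fastforce simp: b0_def)
    moreover have "(\<lambda>x. c * b0 j x) \<in> borel_measurable borel" unfolding b0_def by measurable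
    ultimately show ?thesis unfolding bounded_support_def by blast
  qed
  let ?f = "\<lambda>ij. f (of_int (fst ij) / N, of_int (snd ij) / N)"
  show ?thesis
  proof (rule that[of I "\<lambda>ij x. ?f ij * b0 (fst ij) x" "\<lambda>ij s. 1 * b0 (snd ij) s"])
    show "finite I" by (simp add: I_def)
    fix x s
    let ?ij = "(\<lfloor>N * x\<rfloor>, \<lfloor>N * s\<rfloor>)"
    have "(\<Sum>ij\<in>I. (?f ij * b0 (fst ij) x) * (1 * b0 (snd ij) s)) = (\<Sum>ij\<in>I. if ij = ?ij then ?f ij else 0)"
      by (rule sum.cong) (auto simp: b0_def)
    also have "\<dots> = (if ?ij \<in> I then ?f ?ij else 0)" by (subst sum.delta) (auto simp: I_def)
    also have "\<dots> = ?f ?ij"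
    proof (cases "?f ?ij = 0")
      case False
      then have "f (of_int \<lfloor>N * x\<rfloor> / N, of_int \<lfloor>N * s\<rfloor> / N) \<noteq> 0" by simp
      from supp[OF this] have s: "\<bar>of_int \<lfloor>N * x\<rfloor> / N\<bar> < M" "\<bar>of_int \<lfloor>N * s\<rfloor> / N\<bar> < M" by blast+
      have "\<bar>i\<bar> \<le> K" if "\<bar>of_int i / N\<bar> < M" for i
      proof -
        have "\<bar>of_int i\<bar> < N * M" using that N by (simp add: abs_divide field_simps)
        then show ?thesis unfolding K_def by linarith
      qed
      then have "\<bar>\<lfloor>N * x\<rfloor>\<bar> \<le> K" "\<bar>\<lfloor>N * s\<rfloor>\<bar> \<le> K" using s by auto
      then have "?ij \<in> I" unfolding I_def by auto
      then show ?thesis by simp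
    qed auto
    finally show "grid f N x s = (\<Sum>ij\<in>I. (?f ij * b0 (fst ij) x) * (1 * b0 (snd ij) s))" by (simp add: grid_def)
  qed (rule bs)+
qed

theorem finite_rank_approx:
  assumes k: "kfin k" and cont: "\<And>x s. x \<noteq> s \<Longrightarrow> isCont (\<lambda>z. k (fst z) (snd z)) (x, s)" and e: "0 < e"
  obtains I :: "(int \<times> int) set" and a b where "finite I" "\<And>i. i \<in> I \<Longrightarrow> bounded_support (a i)"
    "\<And>i. i \<in> I \<Longrightarrow> bounded_support (b i)"
    "kfin (\<lambda>x s. k x s - (\<Sum>i\<in>I. a i x * b i s))" "kmass (\<lambda>x s. k x s - (\<Sum>i\<in>I. a i x * b i s)) < e"
proof -
  \<comment> \<open>Cutting off and sampling each cost less than this, and \<open>kfin_add\<close>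
    multiplies their sum by 2^p.\<close>
  let ?e = "e / (2 * 2 powr p)"
  have e': "0 < ?e" using e by simp
  have "\<forall>\<^sub>F n in sequentially. kmass (\<lambda>x s. k x s - cut n (x, s) * k x s) < ?e"
    using order_tendstoD(2)[OF cut_approx(2)[OF k] e'] .
  then have "\<forall>\<^sub>F n in sequentially. 1 \<le> n \<and> kmass (\<lambda>x s. k x s - cut n (x, s) * k x s) < ?e"
    using eventually_ge_at_top[of 1] by eventually_elim auto
  then obtain n where n: "1 \<le> n" "kmass (\<lambda>x s. k x s - cut n (x, s) * k x s) < ?e"
    using eventually_happens'[OF sequentially_bot] by blast
  define f where "f z = cut n z * k (fst z) (snd z)" for z
  have np: "0 < real n" using n by simp
  have supp: "\<bar>x\<bar> < real n \<and> \<bar>s\<bar> < real n \<and> 1 / real n < \<bar>x - s\<bar>" if "f (x, s) \<noteq> 0" for x s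
  proof -
    have c: "cut n (x, s) \<noteq> 0" using that by (auto simp: f_def)
    then have "real n - max \<bar>x\<bar> \<bar>s\<bar> > 0" "real n * \<bar>x - s\<bar> - 1 > 0"
      by (auto simp: cut_def max_def min_def split: if_splits)
    then show ?thesis using np by (auto simp: field_simps)
  qed
  have fcont: "continuous_on UNIV f"
  proof (intro continuous_at_imp_continuous_on ballI)
    fix z :: "real \<times> real"
    obtain x s where z: "z = (x, s)" by fastforce
    show "isCont f z"
    proof (cases "x = s")
      case False
      have "isCont (cut n) z" using cut_cont[of UNIV n] unfolding continuous_on_eq_continuous_at[OF open_UNIV] by blast
      then show ?thesis unfolding f_def using cont[OF False] z by (intro continuous_mult) auto
    next
      case True
      \<comment> \<open>Near the diagonal the cutoff makes f vanish identically, so continuity there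
        does not depend on the behaviour of k.\<close>
      let ?U = "{z. \<bar>fst z - snd z\<bar> < 1 / real n}"
      have "open ?U" by (intro open_Collect_less continuous_intros)
      moreover have "z \<in> ?U" using True z np by simp
      moreover have "f w = 0" if "w \<in> ?U" for w using supp[of "fst w" "snd w"] that by (cases w) force
      ultimately have "\<forall>\<^sub>F w in nhds z. f w = 0" unfolding eventually_nhds by blast
      then show ?thesis by (subst isCont_cong[of _ "\<lambda>_. 0"]) auto
    qed
  qed
  define N where "N m = real m + (1 + 4 * real n)" for m
  have N: "N m \<ge> 1" "N m \<ge> 4 / (1 / real n)" for m by (auto simp: N_def)
  have Nl: "filterlim N at_top sequentially"
    unfolding N_def by (rule filterlim_at_top_mono[OF filterlim_real_sequentially]) auto
  have d: "0 < 1 / real n" using np by simp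
  note ga = grid_approx[OF fcont np d supp N Nl]
  have "\<forall>\<^sub>F m in sequentially. kmass (\<lambda>x s. f (x, s) - grid f (N m) x s) < ?e"
    using order_tendstoD(2)[OF ga(2) e'] .
  then obtain m where m: "kmass (\<lambda>x s. f (x, s) - grid f (N m) x s) < ?e"
    using eventually_happens'[OF sequentially_bot] by blast
  have supp': "\<bar>x\<bar> < real n \<and> \<bar>s\<bar> < real n" if "f (x, s) \<noteq> 0" for x s using supp[OF that] by blast
  obtain I :: "(int \<times> int) set" and a b where I: "finite I" "\<And>i. i \<in> I \<Longrightarrow> bounded_support (a i)"
    "\<And>i. i \<in> I \<Longrightarrow> bounded_support (b i)" and F: "\<And>x s. grid f (N m) x s = (\<Sum>i\<in>I. a i x * b i s)"
    by (rule grid_finite_rank[of "N m" f "real n", OF N(1) supp']) (assumption, rule that)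
  have eq: "(k x s - cut n (x, s) * k x s) + (f (x, s) - grid f (N m) x s) = k x s - (\<Sum>i\<in>I. a i x * b i s)" for x s
    by (simp add: F f_def)
  note A = kfin_add[OF cut_approx(1)[OF k, of n] ga(1)[of m], unfolded eq]
  show ?thesis
  proof (rule that[OF I A(1)])
    have "kmass (\<lambda>x s. k x s - (\<Sum>i\<in>I. a i x * b i s)) \<le> 2 powr p * (kmass (\<lambda>x s. k x s - cut n (x, s) * k x s) + kmass (\<lambda>x s. f (x, s) - grid f (N m) x s))"
      by (rule A(2))
    also have "\<dots> < 2 powr p * (?e + ?e)" using n m by (intro mult_strict_left_mono add_strict_mono) auto
    also have "\<dots> = e" by simp
    finally show "kmass (\<lambda>x s. k x s - (\<Sum>i\<in>I. a i x * b i s)) < e" .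
  qed auto
qed

end

subsection \<open>Fredholm alternative\<close>

text \<open>Gaussian elimination by induction on the index set: injectivity provides a pivot in
  column \<open>k\<close>, a swap moves it to row \<open>k\<close>, and the reduced system inherits
  injectivity because each of its null vectors extends to one of the full system.\<close>

lemma square_system_solvable:
  fixes M :: "'i \<Rightarrow> 'i \<Rightarrow> real"
  assumes "finite I" and inj: "\<And>c. (\<forall>i\<in>I. (\<Sum>j\<in>I. M i j * c j) = 0) \<Longrightarrow> \<forall>i\<in>I. c i = 0"
  shows "\<exists>c. \<forall>i\<in>I. (\<Sum>j\<in>I. M i j * c j) = b i"
  using assms
proof (induction I arbitrary: M b rule: finite_induct)
  case empty
  then show ?case by simp
next
  case (insert k J)
  let ?I = "insert k J"
  have "\<exists>r\<in>?I. M r k \<noteq> 0"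
  proof (rule ccontr)
    assume "\<not> (\<exists>r\<in>?I. M r k \<noteq> 0)"
    then have z: "\<And>r. r \<in> ?I \<Longrightarrow> M r k = 0" by auto
    have "\<forall>i\<in>?I. (\<Sum>j\<in>?I. M i j * (if j = k then 1 else 0)) = 0"
    proof
      fix i assume "i \<in> ?I"
      then show "(\<Sum>j\<in>?I. M i j * (if j = k then 1 else 0)) = 0"
        using z by (intro sum.neutral) auto
    qed
    then have "\<forall>i\<in>?I. (if i = k then 1 else 0 :: real) = 0" by (rule insert.prems)
    then show False by auto
  qed
  then obtain r where r: "r \<in> ?I" "M r k \<noteq> 0" by blast
  define \<sigma> where "\<sigma> i = (if i = k then r else if i = r then k else i)" for i
  have s2: "\<sigma> (\<sigma> i) = i" for i by (auto simp: \<sigma>_def)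
  have sI: "\<sigma> i \<in> ?I" if "i \<in> ?I" for i using that r by (auto simp: \<sigma>_def)
  define M1 where "M1 i j = M (\<sigma> i) j" for i j
  define b1 where "b1 i = b (\<sigma> i)" for i
  have piv: "M1 k k \<noteq> 0" using r by (simp add: M1_def \<sigma>_def)
  have row: "(\<forall>i\<in>?I. P (\<sigma> i)) \<Longrightarrow> (\<forall>i\<in>?I. P i)" for P using sI s2 by metis
  define f where "f i = M1 i k / M1 k k" for i
  define M' where "M' i j = M1 i j - f i * M1 k j" for i j
  \<comment> \<open>Back substitution: the unknown with index \<open>k\<close> is chosen to satisfy
    the pivot row with right-hand side \<open>\<beta>\<close>.\<close>
  define ext where "ext \<beta> c j = (if j = k then (\<beta> - (\<Sum>j\<in>J. M1 k j * c j)) / M1 k k else c j)" for \<beta> :: real and c :: "'i \<Rightarrow> real" and j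
  have ext_sum: "(\<Sum>j\<in>?I. M1 i j * ext \<beta> c j) = (\<Sum>j\<in>J. M' i j * c j) + f i * \<beta>" for i \<beta> c
  proof -
    have "(\<Sum>j\<in>J. M1 i j * ext \<beta> c j) = (\<Sum>j\<in>J. M1 i j * c j)"
      by (rule sum.cong) (use insert.hyps in \<open>auto simp: ext_def\<close>)
    then have "(\<Sum>j\<in>?I. M1 i j * ext \<beta> c j) = M1 i k * ext \<beta> c k + (\<Sum>j\<in>J. M1 i j * c j)"
      using insert.hyps by simp
    also have "M1 i k * ext \<beta> c k = f i * \<beta> - f i * (\<Sum>j\<in>J. M1 k j * c j)"
      using piv by (simp add: ext_def f_def field_simps)
    also have "f i * (\<Sum>j\<in>J. M1 k j * c j) = (\<Sum>j\<in>J. f i * M1 k j * c j)"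
      by (simp add: sum_distrib_left mult.assoc)
    finally show ?thesis by (simp add: M'_def left_diff_distrib sum_subtractf)
  qed
  have kz: "M' k j = 0" for j using piv by (simp add: M'_def f_def)
  have fk: "f k = 1" using piv by (simp add: f_def)
  have inj': "\<forall>i\<in>J. c i = 0" if c: "\<forall>i\<in>J. (\<Sum>j\<in>J. M' i j * c j) = 0" for c
  proof -
    have "\<forall>i\<in>?I. (\<Sum>j\<in>?I. M (\<sigma> i) j * ext 0 c j) = 0"
      using ext_sum[of _ 0 c] c kz by (auto simp: M1_def[symmetric])
    then have "\<forall>i\<in>?I. (\<Sum>j\<in>?I. M i j * ext 0 c j) = 0" by (rule row)
    then have e: "\<forall>i\<in>?I. ext 0 c i = 0" by (rule insert.prems)
    show ?thesis
    proof
      fix i assume "i \<in> J"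
      then show "c i = 0" using e insert.hyps by (auto simp: ext_def split: if_splits)
    qed
  qed
  obtain c where c: "\<forall>i\<in>J. (\<Sum>j\<in>J. M' i j * c j) = b1 i - f i * b1 k"
    using insert.IH[of M' "\<lambda>i. b1 i - f i * b1 k", OF inj'] by blast
  have "\<forall>i\<in>?I. (\<Sum>j\<in>?I. M (\<sigma> i) j * ext (b1 k) c j) = b (\<sigma> i)"
  proof
    fix i assume "i \<in> ?I"
    then have "(\<Sum>j\<in>?I. M1 i j * ext (b1 k) c j) = b1 i"
      using ext_sum[of i "b1 k" c] c kz fk by auto
    then show "(\<Sum>j\<in>?I. M (\<sigma> i) j * ext (b1 k) c j) = b (\<sigma> i)" by (simp add: M1_def b1_def)
  qed
  then have "\<forall>i\<in>?I. (\<Sum>j\<in>?I. M i j * ext (b1 k) c j) = b i" by (rule row)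
  then show ?case by blast
qed

section \<open>Bounded operators on L_p, Neumann series and finite rank perturbations\<close>

lemma bounded_op_Lp_D:
  assumes "bounded_op_Lp p T"
  shows "g \<in> Lp p \<Longrightarrow> T g \<in> Lp p"
    and "g \<in> Lp p \<Longrightarrow> h \<in> Lp p \<Longrightarrow> AE x in lborel. g x = h x \<Longrightarrow> AE x in lborel. T g x = T h x"
    and "g \<in> Lp p \<Longrightarrow> h \<in> Lp p \<Longrightarrow> AE x in lborel. T (\<lambda>y. a * g y + b * h y) x = a * T g x + b * T h x"
  using assms unfolding bounded_op_Lp_def by blast+

lemma bounded_op_Lp_bound:
  assumes "bounded_op_Lp p T" obtains C where "0 \<le> C" "\<And>g. g \<in> Lp p \<Longrightarrow> Lp_norm p (T g) \<le> C * Lp_norm p g"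
proof -
  obtain C where C: "\<And>g. g \<in> Lp p \<Longrightarrow> Lp_norm p (T g) \<le> C * Lp_norm p g"
    using assms unfolding bounded_op_Lp_def by blast
  have "Lp_norm p (T g) \<le> \<bar>C\<bar> * Lp_norm p g" if "g \<in> Lp p" for g
    using C[OF that] mult_right_mono[OF abs_ge_self[of C] Lp_norm_nonneg[of p g]] by linarith
  then show ?thesis using that[of "\<bar>C\<bar>"] by auto
qed

lemma bounded_op_Lp_scale:
  assumes "bounded_op_Lp p T" "g \<in> Lp p"
  shows "AE x in lborel. T (\<lambda>y. c * g y) x = c * T g x"
  using bounded_op_Lp_D(3)[OF assms(1,2,2), of c 0] by simp

lemma bounded_op_Lp_id: "bounded_op_Lp p (\<lambda>g. g)"
  by (auto simp: bounded_op_Lp_def intro!: exI[of _ 1])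

lemma bounded_op_Lp_zero: "bounded_op_Lp p (\<lambda>g x. 0)"
  by (auto simp: bounded_op_Lp_def intro!: exI[of _ 0])

lemma bounded_op_Lp_lincomb:
  assumes p: "1 \<le> p" and S: "bounded_op_Lp p S" and T: "bounded_op_Lp p T"
  shows "bounded_op_Lp p (\<lambda>g x. u * S g x + v * T g x)"
  unfolding bounded_op_Lp_def
proof (intro conjI ballI allI impI)
  fix g h assume g: "g \<in> Lp p" and h: "h \<in> Lp p"
  show "AE x in lborel. u * S g x + v * T g x = u * S h x + v * T h x" if "AE x in lborel. g x = h x"
    using bounded_op_Lp_D(2)[OF S g h that] bounded_op_Lp_D(2)[OF T g h that] by eventually_elim simp
  show "AE x in lborel. u * S (\<lambda>y. a * g y + b * h y) x + v * T (\<lambda>y. a * g y + b * h y) x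
      = a * (u * S g x + v * T g x) + b * (u * S h x + v * T h x)" for a b
    using bounded_op_Lp_D(3)[OF S g h, of a b] bounded_op_Lp_D(3)[OF T g h, of a b]
    by eventually_elim (simp add: algebra_simps)
next
  obtain C where C: "0 \<le> C" "\<And>g. g \<in> Lp p \<Longrightarrow> Lp_norm p (S g) \<le> C * Lp_norm p g" by (rule bounded_op_Lp_bound[OF S]) blast
  obtain D where D: "0 \<le> D" "\<And>g. g \<in> Lp p \<Longrightarrow> Lp_norm p (T g) \<le> D * Lp_norm p g" by (rule bounded_op_Lp_bound[OF T]) blast
  have "Lp_norm p (\<lambda>x. u * S g x + v * T g x) \<le> (\<bar>u\<bar> * C + \<bar>v\<bar> * D) * Lp_norm p g" if g: "g \<in> Lp p" for g
  proof -
    have "Lp_norm p (\<lambda>x. u * S g x + v * T g x) \<le> Lp_norm p (\<lambda>x. u * S g x) + Lp_norm p (\<lambda>x. v * T g x)"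
      using p g bounded_op_Lp_D(1)[OF S] bounded_op_Lp_D(1)[OF T] by (intro Minkowski Lp_scale) auto
    also have "\<dots> = \<bar>u\<bar> * Lp_norm p (S g) + \<bar>v\<bar> * Lp_norm p (T g)" using p by (simp add: Lp_norm_scale)
    also have "\<dots> \<le> \<bar>u\<bar> * (C * Lp_norm p g) + \<bar>v\<bar> * (D * Lp_norm p g)"
      using C D g by (intro add_mono mult_left_mono) auto
    finally show ?thesis by (simp add: algebra_simps)
  qed
  then show "\<exists>C. \<forall>g\<in>Lp p. Lp_norm p (\<lambda>x. u * S g x + v * T g x) \<le> C * Lp_norm p g" by blast
qed (use p bounded_op_Lp_D(1)[OF S] bounded_op_Lp_D(1)[OF T] in \<open>auto intro: Lp_lincomb\<close>)

lemma bounded_op_Lp_sum: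
  assumes "1 \<le> p" "finite I" "\<And>i. i \<in> I \<Longrightarrow> bounded_op_Lp p (T i)"
  shows "bounded_op_Lp p (\<lambda>g x. \<Sum>i\<in>I. T i g x)"
  using assms(2,3)
proof (induction I rule: finite_induct)
  case empty
  then show ?case by (simp add: bounded_op_Lp_zero)
next
  case (insert i I)
  then show ?case using bounded_op_Lp_lincomb[OF assms(1), of "T i" "\<lambda>g x. \<Sum>i\<in>I. T i g x" 1 1] by simp
qed

text \<open>The inverse constructed below contains terms that send g to the pairing of b with R g,
  times a; their boundedness comes from Hoelder's inequality for the pairing with b.\<close>

lemma bounded_op_Lp_rank1:
  assumes p: "1 < p" and R: "bounded_op_Lp p R" and b: "bounded_support b" and a: "a \<in> Lp p"
  shows "bounded_op_Lp p (\<lambda>g x. (LINT y|lborel. b y * R g y) * a x)"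
proof -
  obtain C where C: "0 \<le> C" "\<And>w. w \<in> Lp p \<Longrightarrow> integrable lborel (\<lambda>x. b x * w x)"
    "\<And>w. w \<in> Lp p \<Longrightarrow> \<bar>LINT x|lborel. b x * w x\<bar> \<le> C * Lp_norm p w"
    using bounded_support_pairing[OF b p] by blast
  obtain D where D: "0 \<le> D" "\<And>g. g \<in> Lp p \<Longrightarrow> Lp_norm p (R g) \<le> D * Lp_norm p g" by (rule bounded_op_Lp_bound[OF R]) blast
  have bm[measurable]: "b \<in> borel_measurable borel" using b by (simp add: bounded_support_def)
  note RL = bounded_op_Lp_D(1)[OF R]
  have Rm: "R g \<in> borel_measurable borel" if "g \<in> Lp p" for g using RL[OF that] LpD by auto
  show ?thesis
    unfolding bounded_op_Lp_def
  proof (intro conjI ballI allI impI)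
    fix g h assume g: "g \<in> Lp p" and h: "h \<in> Lp p"
    note [measurable] = Rm[OF g] Rm[OF h]
    show "AE x in lborel. (LINT y|lborel. b y * R g y) * a x = (LINT y|lborel. b y * R h y) * a x" if "AE x in lborel. g x = h x"
    proof -
      have "(LINT y|lborel. b y * R g y) = (LINT y|lborel. b y * R h y)"
        by (rule integral_cong_AE) (use bounded_op_Lp_D(2)[OF R g h that] in auto)
      then show ?thesis by simp
    qed
    fix u v
    have gh: "(\<lambda>y. u * g y + v * h y) \<in> Lp p" using p g h by (intro Lp_lincomb) auto
    note [measurable] = Rm[OF gh]
    have "(LINT y|lborel. b y * R (\<lambda>y. u * g y + v * h y) y) = (LINT y|lborel. u * (b y * R g y) + v * (b y * R h y))"
    proof (rule integral_cong_AE)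
      show "AE y in lborel. b y * R (\<lambda>y. u * g y + v * h y) y = u * (b y * R g y) + v * (b y * R h y)"
        using bounded_op_Lp_D(3)[OF R g h, of u v] by eventually_elim (simp add: algebra_simps)
    qed auto
    also have "\<dots> = u * (LINT y|lborel. b y * R g y) + v * (LINT y|lborel. b y * R h y)"
      using C(2)[OF RL[OF g]] C(2)[OF RL[OF h]] by simp
    finally show "AE x in lborel. (LINT y|lborel. b y * R (\<lambda>y. u * g y + v * h y) y) * a x
        = u * ((LINT y|lborel. b y * R g y) * a x) + v * ((LINT y|lborel. b y * R h y) * a x)"
      by (simp add: algebra_simps)
  next
    have "Lp_norm p (\<lambda>x. (LINT y|lborel. b y * R g y) * a x) \<le> (C * D * Lp_norm p a) * Lp_norm p g" if g: "g \<in> Lp p" for g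
    proof -
      have "\<bar>LINT y|lborel. b y * R g y\<bar> \<le> C * (D * Lp_norm p g)"
        using C(3)[OF RL[OF g]] mult_left_mono[OF D(2)[OF g] C(1)] by linarith
      then have "\<bar>LINT y|lborel. b y * R g y\<bar> * Lp_norm p a \<le> C * (D * Lp_norm p g) * Lp_norm p a"
        by (intro mult_right_mono) auto
      moreover have "Lp_norm p (\<lambda>x. (LINT y|lborel. b y * R g y) * a x) = \<bar>LINT y|lborel. b y * R g y\<bar> * Lp_norm p a"
        using p by (intro Lp_norm_scale) simp
      ultimately show ?thesis by (simp only: mult_ac)
    qed
    then show "\<exists>C. \<forall>g\<in>Lp p. Lp_norm p (\<lambda>x. (LINT y|lborel. b y * R g y) * a x) \<le> C * Lp_norm p g" by blast
  qed (use a Lp_scale in auto)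
qed

lemma bounded_op_Lp_apply_sum:
  assumes p: "1 \<le> p" and T: "bounded_op_Lp p T" and I: "finite I" and g: "\<And>i. i \<in> I \<Longrightarrow> g i \<in> Lp p"
  shows "AE x in lborel. T (\<lambda>y. \<Sum>i\<in>I. c i * g i y) x = (\<Sum>i\<in>I. c i * T (g i) x)"
  using I g
proof (induction I rule: finite_induct)
  case empty
  then show ?case using bounded_op_Lp_scale[OF T, of "\<lambda>_. 0" 0] by simp
next
  case (insert i I)
  have s: "(\<lambda>y. \<Sum>i\<in>I. c i * g i y) \<in> Lp p" using insert p by (intro Lp_sum Lp_scale) auto
  have "AE x in lborel. T (\<lambda>y. c i * g i y + 1 * (\<Sum>i\<in>I. c i * g i y)) x = c i * T (g i) x + 1 * T (\<lambda>y. \<Sum>i\<in>I. c i * g i y) x"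
    by (rule bounded_op_Lp_D(3)[OF T]) (use insert s in auto)
  moreover have "AE x in lborel. T (\<lambda>y. \<Sum>i\<in>I. c i * g i y) x = (\<Sum>i\<in>I. c i * T (g i) x)" using insert by auto
  ultimately show ?case by eventually_elim (use insert.hyps in simp)
qed

text \<open>The inverse of \<lambda> - S as a pointwise series. Its values make no reference to an
  exponent, so the same function represents the inverse in L_p and in L_2 whenever \<open>h\<close>
  lies in both.\<close>

definition neumann :: "((real \<Rightarrow> real) \<Rightarrow> real \<Rightarrow> real) \<Rightarrow> real \<Rightarrow> (real \<Rightarrow> real) \<Rightarrow> real \<Rightarrow> real" where
  "neumann S lam h x = (\<Sum>n. inverse (lam ^ Suc n) * (S ^^ n) h x)"

locale contraction =
  fixes p lam \<theta> :: real and S :: "(real \<Rightarrow> real) \<Rightarrow> real \<Rightarrow> real"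
  assumes p: "1 \<le> p" and S: "bounded_op_Lp p S" and \<theta>: "0 \<le> \<theta>" "\<theta> < \<bar>lam\<bar>"
    and S_le: "\<And>g. g \<in> Lp p \<Longrightarrow> Lp_norm p (S g) \<le> \<theta> * Lp_norm p g"
begin

lemma lam_nz: "lam \<noteq> 0" "0 < \<bar>lam\<bar>" using \<theta> by auto

lemma kernel_trivial:
  assumes v: "v \<in> Lp p" and e: "AE x in lborel. lam * v x = S v x"
  shows "AE x in lborel. v x = 0"
proof -
  have m: "v \<in> borel_measurable borel" "S v \<in> borel_measurable borel"
    using v bounded_op_Lp_D(1)[OF S v] LpD by auto
  have "\<bar>lam\<bar> * Lp_norm p v = Lp_norm p (\<lambda>x. lam * v x)" using p by (simp add: Lp_norm_scale)
  also have "\<dots> = Lp_norm p (S v)" by (rule Lp_norm_cong_AE) (use m e in auto)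
  also have "\<dots> \<le> \<theta> * Lp_norm p v" by (rule S_le[OF v])
  finally have "(\<bar>lam\<bar> - \<theta>) * Lp_norm p v \<le> 0" by (simp add: algebra_simps)
  then have "Lp_norm p v = 0" using \<theta> Lp_norm_nonneg[of p v] by (simp add: mult_le_0_iff)
  then show ?thesis using Lp_norm_eq_0_iff[OF v] by simp
qed

context fixes h assumes h: "h \<in> Lp p"
begin

definition t where "t n x = inverse (lam ^ Suc n) * (S ^^ n) h x"

lemma iter: "(S ^^ n) h \<in> Lp p" "Lp_norm p ((S ^^ n) h) \<le> \<theta> ^ n * Lp_norm p h"
proof (induction n)
  case (Suc n)
  { case 1 show ?case using bounded_op_Lp_D(1)[OF S Suc(1)] by simp }
  { case 2
    have "Lp_norm p (S ((S ^^ n) h)) \<le> \<theta> * Lp_norm p ((S ^^ n) h)" by (rule S_le[OF Suc(1)])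
    also have "\<dots> \<le> \<theta> * (\<theta> ^ n * Lp_norm p h)" using Suc(2) \<theta> by (intro mult_left_mono) auto
    finally show ?case by simp }
qed (use h in auto)

lemma t_Lp: "t n \<in> Lp p" unfolding t_def by (intro Lp_scale iter)

lemma t_norm: "Lp_norm p (t n) \<le> Lp_norm p h / \<bar>lam\<bar> * (\<theta> / \<bar>lam\<bar>) ^ n"
proof -
  have "Lp_norm p (t n) = inverse (\<bar>lam\<bar> ^ Suc n) * Lp_norm p ((S ^^ n) h)"
    unfolding t_def using p by (subst Lp_norm_scale) (auto simp: power_abs abs_mult)
  also have "\<dots> \<le> inverse (\<bar>lam\<bar> ^ Suc n) * (\<theta> ^ n * Lp_norm p h)"
    by (intro mult_left_mono iter) auto
  also have "\<dots> = Lp_norm p h / \<bar>lam\<bar> * (\<theta> / \<bar>lam\<bar>) ^ n" using lam_nz by (simp add: power_divide field_simps)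
  finally show ?thesis .
qed

lemma ratio: "0 \<le> \<theta> / \<bar>lam\<bar>" "\<theta> / \<bar>lam\<bar> < 1" using \<theta> by auto

lemma summable_bound: "summable (\<lambda>n. Lp_norm p h / \<bar>lam\<bar> * (\<theta> / \<bar>lam\<bar>) ^ n)"
  using ratio by (intro summable_mult summable_geometric) auto

lemma t_summable: "summable (\<lambda>n. Lp_norm p (t n))"
  by (rule summable_comparison_test'[OF summable_bound, of 0]) (use t_norm in auto)

lemma neumann_eq: "neumann S lam h = (\<lambda>x. \<Sum>n. t n x)" by (auto simp: neumann_def t_def)

lemma neumann_Lp: "neumann S lam h \<in> Lp p"
  unfolding neumann_eq by (rule Lp_suminf(2)[OF p t_Lp t_summable])

lemma neumann_norm: "Lp_norm p (neumann S lam h) \<le> (\<Sum>n. (\<theta> / \<bar>lam\<bar>) ^ n) / \<bar>lam\<bar> * Lp_norm p h"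
proof -
  have "Lp_norm p (neumann S lam h) \<le> (\<Sum>n. Lp_norm p (t n))"
    unfolding neumann_eq by (rule Lp_suminf(3)[OF p t_Lp t_summable])
  also have "\<dots> \<le> (\<Sum>n. Lp_norm p h / \<bar>lam\<bar> * (\<theta> / \<bar>lam\<bar>) ^ n)"
    by (rule suminf_le[OF t_norm t_summable summable_bound])
  also have "\<dots> = Lp_norm p h / \<bar>lam\<bar> * (\<Sum>n. (\<theta> / \<bar>lam\<bar>) ^ n)"
    by (rule suminf_mult) (use ratio in \<open>auto intro: summable_geometric\<close>)
  finally show ?thesis by (simp add: mult_ac)
qed

lemma partial_sum_Lp: "(\<lambda>x. \<Sum>n<N. t n x) \<in> Lp p"
  using p by (intro Lp_sum t_Lp)

lemma neumann_tail: "(\<lambda>N. Lp_norm p (\<lambda>x. neumann S lam h x - (\<Sum>n<N. t n x))) \<longlonglongrightarrow> 0"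
proof (rule Lim_null_comparison)
  have "Lp_norm p (\<lambda>x. neumann S lam h x - (\<Sum>n<N. t n x)) \<le> (\<Sum>n. Lp_norm p (t (n + N)))" for N
  proof -
    have sN: "summable (\<lambda>n. Lp_norm p (t (n + N)))" using t_summable by (rule summable_ignore_initial_segment)
    note L = Lp_suminf[OF p t_Lp sN]
    have "AE x in lborel. neumann S lam h x - (\<Sum>n<N. t n x) = (\<Sum>n. t (n + N) x)"
      using Lp_suminf(1)[OF p t_Lp t_summable]
    proof eventually_elim
      case (elim x)
      then show ?case unfolding neumann_eq
        using suminf_minus_initial_segment[OF summable_rabs_cancel[OF elim], of N] by simp
    qed
    then have "Lp_norm p (\<lambda>x. neumann S lam h x - (\<Sum>n<N. t n x)) = Lp_norm p (\<lambda>x. \<Sum>n. t (n + N) x)"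
      using LpD(1)[OF neumann_Lp] LpD(1)[OF partial_sum_Lp[of N]] LpD(1)[OF L(2)]
      by (intro Lp_norm_cong_AE) auto
    then show ?thesis using L(3) by simp
  qed
  then show "\<forall>\<^sub>F N in sequentially. norm (Lp_norm p (\<lambda>x. neumann S lam h x - (\<Sum>n<N. t n x))) \<le> (\<Sum>n. Lp_norm p (t (n + N)))" by simp
  show "(\<lambda>N. \<Sum>n. Lp_norm p (t (n + N))) \<longlonglongrightarrow> 0" by (rule suminf_exist_split2[OF t_summable])
qed

text \<open>Applying S to a partial sum shifts it: S W_N = \<lambda> W_(N+1) - h. The residual is
  therefore bounded by tails of the series, and S never has to be applied termwise to the infinite
  sum.\<close>

lemma neumann_solves: "AE x in lborel. lam * neumann S lam h x - S (neumann S lam h) x = h x"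
proof -
  let ?w = "neumann S lam h"
  let ?W = "\<lambda>N x. \<Sum>n<N. t n x"
  let ?E = "\<lambda>N. Lp_norm p (\<lambda>x. ?w x - ?W N x)"
  have SW: "AE x in lborel. S (?W N) x = lam * ?W (Suc N) x - h x" for N
  proof -
    have e: "inverse (lam ^ Suc n) * S ((S ^^ n) h) x = lam * t (Suc n) x" for n x
      using lam_nz by (simp add: t_def field_simps)
    have "AE x in lborel. S (\<lambda>x. \<Sum>n\<in>{..<N}. inverse (lam ^ Suc n) * (S ^^ n) h x) x = (\<Sum>n\<in>{..<N}. inverse (lam ^ Suc n) * S ((S ^^ n) h) x)"
      by (rule bounded_op_Lp_apply_sum[OF p S]) (auto intro: iter)
    then show ?thesis
    proof eventually_elim
      case (elim x)
      have "(\<Sum>n\<in>{..<N}. inverse (lam ^ Suc n) * S ((S ^^ n) h) x) = lam * (\<Sum>n<N. t (Suc n) x)"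
        unfolding e by (simp add: sum_distrib_left)
      also have "(\<Sum>n<N. t (Suc n) x) = ?W (Suc N) x - t 0 x" by (subst sum.lessThan_Suc_shift) simp
      also have "lam * (?W (Suc N) x - t 0 x) = lam * ?W (Suc N) x - h x" using lam_nz by (simp add: t_def algebra_simps)
      finally show ?case using elim by (simp add: t_def)
    qed
  qed
  let ?r = "\<lambda>x. lam * ?w x - S ?w x - h x"
  note wL = neumann_Lp and SwL = bounded_op_Lp_D(1)[OF S neumann_Lp]
  have rL: "?r \<in> Lp p" using p h wL SwL by (intro Lp_diff Lp_scale) auto
  have le: "Lp_norm p ?r \<le> \<bar>lam\<bar> * ?E (Suc N) + \<theta> * ?E N" for N
  proof -
    have d: "(\<lambda>x. ?w x - ?W N x) \<in> Lp p" for N using p wL partial_sum_Lp by (intro Lp_diff) auto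
    note Sd = bounded_op_Lp_D(1)[OF S d]
    have "AE x in lborel. S (\<lambda>x. 1 * ?w x + (- 1) * ?W N x) x = 1 * S ?w x + (- 1) * S (?W N) x"
      by (rule bounded_op_Lp_D(3)[OF S wL partial_sum_Lp])
    then have "AE x in lborel. ?r x = lam * (?w x - ?W (Suc N) x) - S (\<lambda>x. ?w x - ?W N x) x"
      using SW[of N] by eventually_elim (simp add: algebra_simps)
    then have "Lp_norm p ?r = Lp_norm p (\<lambda>x. lam * (?w x - ?W (Suc N) x) - S (\<lambda>x. ?w x - ?W N x) x)"
      using LpD(1)[OF rL] LpD(1)[OF Sd] LpD(1)[OF Lp_scale[OF d[of "Suc N"], of lam]] by (intro Lp_norm_cong_AE) auto
    also have "\<dots> \<le> Lp_norm p (\<lambda>x. lam * (?w x - ?W (Suc N) x)) + Lp_norm p (S (\<lambda>x. ?w x - ?W N x))"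
      by (rule Lp_norm_diff_le[OF p Lp_scale[OF d] Sd])
    also have "\<dots> \<le> \<bar>lam\<bar> * ?E (Suc N) + \<theta> * ?E N"
      using p S_le[OF d[of N]] Lp_norm_scale[of p lam "\<lambda>x. ?w x - ?W (Suc N) x"] by simp
    finally show ?thesis .
  qed
  have "(\<lambda>N. \<bar>lam\<bar> * ?E (Suc N) + \<theta> * ?E N) \<longlonglongrightarrow> \<bar>lam\<bar> * 0 + \<theta> * 0"
    by (intro tendsto_intros LIMSEQ_Suc[OF neumann_tail] neumann_tail)
  then have "Lp_norm p ?r \<le> 0" using le by (intro LIMSEQ_le_const[of _ 0]) auto
  then have "Lp_norm p ?r = 0" using Lp_norm_nonneg[of p ?r] by linarith
  then have "AE x in lborel. ?r x = 0" using Lp_norm_eq_0_iff[OF rL] by simp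
  then show ?thesis by eventually_elim simp
qed

end

lemma neumann_unique:
  assumes w: "w \<in> Lp p" and h: "h \<in> Lp p" and e: "AE x in lborel. lam * w x - S w x = h x"
  shows "AE x in lborel. w x = neumann S lam h x"
proof -
  let ?v = "\<lambda>x. 1 * w x + (-1) * neumann S lam h x"
  have v: "?v \<in> Lp p" using p w neumann_Lp[OF h] by (intro Lp_lincomb)
  have "AE x in lborel. S ?v x = 1 * S w x + (-1) * S (neumann S lam h) x"
    by (rule bounded_op_Lp_D(3)[OF S w neumann_Lp[OF h]])
  then have "AE x in lborel. lam * ?v x = S ?v x"
    using e neumann_solves[OF h] by eventually_elim (simp add: algebra_simps)
  then have "AE x in lborel. ?v x = 0" by (rule kernel_trivial[OF v])
  then show ?thesis by eventually_elim simp
qed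

lemma neumann_bounded_op: "bounded_op_Lp p (neumann S lam)"
  unfolding bounded_op_Lp_def
proof (intro conjI ballI allI impI)
  fix g h assume g: "g \<in> Lp p" and h: "h \<in> Lp p"
  show "AE x in lborel. neumann S lam g x = neumann S lam h x" if "AE x in lborel. g x = h x"
  proof (rule neumann_unique[OF neumann_Lp[OF g] h])
    show "AE x in lborel. lam * neumann S lam g x - S (neumann S lam g) x = h x"
      using neumann_solves[OF g] that by eventually_elim simp
  qed
  fix a b
  let ?w = "\<lambda>x. a * neumann S lam g x + b * neumann S lam h x" and ?h = "\<lambda>x. a * g x + b * h x"
  have "AE x in lborel. ?w x = neumann S lam ?h x"
  proof (rule neumann_unique)
    show "?w \<in> Lp p" "?h \<in> Lp p" using p g h neumann_Lp by (auto intro: Lp_lincomb)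
    show "AE x in lborel. lam * ?w x - S ?w x = ?h x"
      using neumann_solves[OF g] neumann_solves[OF h] bounded_op_Lp_D(3)[OF S neumann_Lp[OF g] neumann_Lp[OF h], of a b]
      by eventually_elim (simp add: algebra_simps)
  qed
  then show "AE x in lborel. neumann S lam ?h x = ?w x" by eventually_elim simp
next
  show "\<exists>C. \<forall>g\<in>Lp p. Lp_norm p (neumann S lam g) \<le> C * Lp_norm p g" using neumann_norm by blast
qed (rule neumann_Lp)

end

text \<open>Injectivity is assumed only for functions lying in L_p and L_2 at once; that S is a
  contraction on both spaces is what removes the second requirement.\<close>

locale finite_rank_perturbation =
  P: contraction p lam \<theta> S + Q: contraction 2 lam \<theta> S for p lam \<theta> :: real and S +
  fixes T :: "(real \<Rightarrow> real) \<Rightarrow> real \<Rightarrow> real" and I :: "'i set" and a b :: "'i \<Rightarrow> real \<Rightarrow> real"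
  assumes p1: "1 < p" and T: "bounded_op_Lp p T" and I: "finite I"
    and a: "\<And>i. i \<in> I \<Longrightarrow> bounded_support (a i)" and b: "\<And>i. i \<in> I \<Longrightarrow> bounded_support (b i)"
    and T_eq: "\<And>w. w \<in> Lp p \<Longrightarrow> AE x in lborel. T w x = S w x + (\<Sum>i\<in>I. (LINT y|lborel. b i y * w y) * a i x)"
    and inj: "\<And>w. w \<in> Lp p \<Longrightarrow> w \<in> Lp 2 \<Longrightarrow> AE x in lborel. lam * w x = T w x \<Longrightarrow> AE x in lborel. w x = 0"
begin

abbreviation R where "R \<equiv> neumann S lam"

lemma a_Lp: "i \<in> I \<Longrightarrow> a i \<in> Lp p" "i \<in> I \<Longrightarrow> a i \<in> Lp 2"
  using a p1 bounded_support_Lp by auto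

text \<open>The equation says that \<lambda> w - S w is a combination of the \<open>a i\<close>, so
  w is the Neumann series of that combination. As the \<open>a i\<close> also lie in L_2, so does
  this representative of w, and the restricted injectivity applies.\<close>

lemma injective:
  assumes w: "w \<in> Lp p" and e: "AE x in lborel. lam * w x = T w x"
  shows "AE x in lborel. w x = 0"
proof -
  let ?h = "\<lambda>x. \<Sum>i\<in>I. (LINT y|lborel. b i y * w y) * a i x"
  have hp: "?h \<in> Lp p" "?h \<in> Lp 2" using p1 a_Lp by (auto intro!: Lp_sum Lp_scale)
  have "AE x in lborel. lam * w x - S w x = ?h x" using e T_eq[OF w] by eventually_elim simp
  then have wR: "AE x in lborel. w x = R ?h x" by (rule P.neumann_unique[OF w hp(1)])
  note R = P.neumann_Lp[OF hp(1)] Q.neumann_Lp[OF hp(2)]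
  have "AE x in lborel. R ?h x = 0"
  proof (rule inj[OF R])
    show "AE x in lborel. lam * R ?h x = T (R ?h) x"
      using e wR bounded_op_Lp_D(2)[OF T w R(1) wR] by eventually_elim simp
  qed
  then show ?thesis using wR by eventually_elim simp
qed

lemma pair_integrable: "i \<in> I \<Longrightarrow> w \<in> Lp p \<Longrightarrow> integrable lborel (\<lambda>x. b i x * w x)"
  using bounded_support_pairing[OF b p1] by metis

lemma pair_lincomb:
  assumes i: "i \<in> I" and w: "w \<in> Lp p"
  shows "(LINT y|lborel. b i y * (w y + (\<Sum>j\<in>I. c j * R (a j) y))) = (LINT y|lborel. b i y * w y) + (\<Sum>j\<in>I. c j * (LINT y|lborel. b i y * R (a j) y))"
proof -
  have "(LINT y|lborel. b i y * (w y + (\<Sum>j\<in>I. c j * R (a j) y))) = (LINT y|lborel. b i y * w y + (\<Sum>j\<in>I. c j * (b i y * R (a j) y)))"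
    by (simp add: distrib_left sum_distrib_left mult_ac)
  also have "\<dots> = (LINT y|lborel. b i y * w y) + (LINT y|lborel. (\<Sum>j\<in>I. c j * (b i y * R (a j) y)))"
    using pair_integrable[OF i w] pair_integrable[OF i P.neumann_Lp[OF a_Lp(1)]]
    by (intro Bochner_Integration.integral_add Bochner_Integration.integrable_sum) auto
  also have "(LINT y|lborel. (\<Sum>j\<in>I. c j * (b i y * R (a j) y))) = (\<Sum>j\<in>I. c j * (LINT y|lborel. b i y * R (a j) y))"
    using pair_integrable[OF i P.neumann_Lp[OF a_Lp(1)]]
    by (subst Bochner_Integration.integral_sum) auto
  finally show ?thesis .
qed

lemma resolvent_lincomb:
  assumes g: "g \<in> Lp p"
  defines "w \<equiv> \<lambda>x c. R g x + (\<Sum>j\<in>I. c j * R (a j) x)"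
  shows "(\<lambda>x. w x c) \<in> Lp p" "AE x in lborel. lam * w x c - S (\<lambda>x. w x c) x = g x + (\<Sum>j\<in>I. c j * a j x)"
proof -
  have s: "(\<lambda>x. \<Sum>j\<in>I. c j * R (a j) x) \<in> Lp p" using p1 P.neumann_Lp a_Lp by (intro Lp_sum Lp_scale) auto
  show "(\<lambda>x. w x c) \<in> Lp p" unfolding w_def using p1 P.neumann_Lp[OF g] s by (intro Lp_add) auto
  have 1: "AE x in lborel. S (\<lambda>x. 1 * R g x + 1 * (\<Sum>j\<in>I. c j * R (a j) x)) x = 1 * S (R g) x + 1 * S (\<lambda>x. \<Sum>j\<in>I. c j * R (a j) x) x"
    by (rule bounded_op_Lp_D(3)[OF P.S P.neumann_Lp[OF g] s])
  have 2: "AE x in lborel. S (\<lambda>x. \<Sum>j\<in>I. c j * R (a j) x) x = (\<Sum>j\<in>I. c j * S (R (a j)) x)"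
    by (rule bounded_op_Lp_apply_sum[OF P.p P.S I]) (use P.neumann_Lp a_Lp in auto)
  have 3: "AE x in lborel. \<forall>j\<in>I. lam * R (a j) x - S (R (a j)) x = a j x"
    using I P.neumann_solves a_Lp by (subst AE_finite_all) auto
  show "AE x in lborel. lam * w x c - S (\<lambda>x. w x c) x = g x + (\<Sum>j\<in>I. c j * a j x)"
    using 1 2 3 P.neumann_solves[OF g]
  proof eventually_elim
    case (elim x)
    have "(\<Sum>j\<in>I. c j * a j x) = (\<Sum>j\<in>I. c j * (lam * R (a j) x - S (R (a j)) x))"
      by (rule sum.cong) (use elim in auto)
    also have "\<dots> = lam * (\<Sum>j\<in>I. c j * R (a j) x) - (\<Sum>j\<in>I. c j * S (R (a j)) x)"
      by (simp add: sum_distrib_left sum_subtractf algebra_simps)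
    finally show ?case using elim by (simp add: w_def algebra_simps)
  qed
qed

text \<open>The solution is sought as R g plus a combination of the R a_j. Matching coefficients
  gives a square system whose matrix is the identity minus the pairings of b_i with R a_j. A null
  vector would produce a kernel element of \<lambda> - T from which its coefficients are recovered
  by pairing with the b_i, so injectivity makes the system solvable.\<close>

theorem isomorphism: "isom_Lp p (\<lambda>w x. lam * w x - T w x)"
proof -
  define A where "A i j = (if i = j then 1 else 0) - (LINT y|lborel. b i y * R (a j) y)" for i j
  have Asum: "(\<Sum>j\<in>I. A i j * c j) = c i - (\<Sum>j\<in>I. c j * (LINT y|lborel. b i y * R (a j) y))" if "i \<in> I" for i c
  proof -
    have "(\<Sum>j\<in>I. A i j * c j) = (\<Sum>j\<in>I. (if i = j then c j else 0) - c j * (LINT y|lborel. b i y * R (a j) y))"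
      by (rule sum.cong) (auto simp: A_def algebra_simps)
    then show ?thesis using that I by (simp add: sum_subtractf)
  qed
  have Ainj: "\<forall>i\<in>I. c i = 0" if c: "\<forall>i\<in>I. (\<Sum>j\<in>I. A i j * c j) = 0" for c
  proof -
    let ?w = "\<lambda>x. R (\<lambda>_. 0) x + (\<Sum>j\<in>I. c j * R (a j) x)"
    note w = resolvent_lincomb[OF Lp_zero, of c]
    have R0: "AE x in lborel. R (\<lambda>_. 0) x = 0"
      using bounded_op_Lp_scale[OF P.neumann_bounded_op Lp_zero, of 0] by simp
    have bw: "(LINT y|lborel. b i y * ?w y) = c i" if "i \<in> I" for i
    proof -
      have "(LINT y|lborel. b i y * R (\<lambda>_. 0) y) = 0"
        by (rule integral_eq_zero_AE) (use R0 in auto)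
      then show ?thesis using pair_lincomb[OF that P.neumann_Lp[OF Lp_zero], of c] c Asum[OF that, of c] that by simp
    qed
    have "AE x in lborel. lam * ?w x = T ?w x"
      using w(2) T_eq[OF w(1)] by eventually_elim (simp add: bw)
    then have "AE x in lborel. ?w x = 0" by (rule injective[OF w(1)])
    then have "(LINT y|lborel. b i y * ?w y) = 0" for i
      by (intro integral_eq_zero_AE) auto
    then show ?thesis using bw by auto
  qed
  \<comment> \<open>The columns of the inverse matrix are fixed once, independently of g, so that
    the coefficients and hence the inverse operator depend linearly on g.\<close>
  have "\<forall>k. \<exists>c. \<forall>i\<in>I. (\<Sum>j\<in>I. A i j * c j) = (if i = k then 1 else 0)"
    by (intro allI square_system_solvable[OF I]) (rule Ainj)
  then obtain N where N: "\<And>k i. i \<in> I \<Longrightarrow> (\<Sum>j\<in>I. A i j * N k j) = (if i = k then 1 else 0)" by metis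
  let ?l = "\<lambda>k g. LINT y|lborel. b k y * R g y"
  define c where "c g j = (\<Sum>k\<in>I. ?l k g * N k j)" for g j
  have Ac: "(\<Sum>j\<in>I. A i j * c g j) = ?l i g" if i: "i \<in> I" for i g
  proof -
    have "(\<Sum>j\<in>I. A i j * c g j) = (\<Sum>j\<in>I. \<Sum>k\<in>I. ?l k g * (A i j * N k j))"
      by (simp add: c_def sum_distrib_left mult_ac)
    also have "\<dots> = (\<Sum>k\<in>I. ?l k g * (\<Sum>j\<in>I. A i j * N k j))"
      by (subst sum.swap) (simp add: sum_distrib_left)
    also have "\<dots> = ?l i g" using i I by (simp add: N if_distrib cong: if_cong)
    finally show ?thesis .
  qed
  define V where "V g x = R g x + (\<Sum>j\<in>I. c g j * R (a j) x)" for g x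
  have V_op: "bounded_op_Lp p V"
  proof -
    have 1: "bounded_op_Lp p (\<lambda>g x. \<Sum>j\<in>I. \<Sum>k\<in>I. ?l k g * (N k j * R (a j) x))"
      using p1 I b a_Lp P.neumann_Lp
      by (intro bounded_op_Lp_sum bounded_op_Lp_rank1 P.neumann_bounded_op Lp_scale) auto
    have "V = (\<lambda>g x. 1 * R g x + 1 * (\<Sum>j\<in>I. \<Sum>k\<in>I. ?l k g * (N k j * R (a j) x)))"
      by (intro ext) (simp add: V_def c_def sum_distrib_left sum_distrib_right mult_ac)
    then show ?thesis using bounded_op_Lp_lincomb[OF P.p P.neumann_bounded_op 1, of 1 1] by simp
  qed
  have S_op: "bounded_op_Lp p (\<lambda>w x. lam * w x - T w x)"
    using bounded_op_Lp_lincomb[OF P.p bounded_op_Lp_id T, of lam "-1"] by simp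
  have right: "AE x in lborel. lam * V g x - T (V g) x = g x" if g: "g \<in> Lp p" for g
  proof -
    note w = resolvent_lincomb[OF g, of "c g"]
    have bw: "(LINT y|lborel. b i y * V g y) = c g i" if "i \<in> I" for i
      unfolding V_def using pair_lincomb[OF that P.neumann_Lp[OF g], of "c g"] Asum[OF that, of "c g"] Ac[OF that, of g] by simp
    have VL: "V g \<in> Lp p" by (rule bounded_op_Lp_D(1)[OF V_op g])
    have "AE x in lborel. lam * V g x - S (V g) x = g x + (\<Sum>j\<in>I. c g j * a j x)"
      using w(2) by (simp add: V_def[abs_def])
    then show ?thesis using T_eq[OF VL] by eventually_elim (simp add: bw)
  qed
  \<comment> \<open>A right inverse of an injective operator is also a left inverse.\<close>
  have left: "AE x in lborel. V (\<lambda>x. lam * g x - T g x) x = g x" if g: "g \<in> Lp p" for g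
  proof -
    let ?h = "\<lambda>x. lam * g x - T g x"
    have h: "?h \<in> Lp p" by (rule bounded_op_Lp_D(1)[OF S_op g])
    have Vh: "V ?h \<in> Lp p" by (rule bounded_op_Lp_D(1)[OF V_op h])
    let ?v = "\<lambda>x. 1 * V ?h x + (-1) * g x"
    have v: "?v \<in> Lp p" by (rule Lp_lincomb[OF P.p Vh g])
    have "AE x in lborel. T ?v x = 1 * T (V ?h) x + (-1) * T g x" by (rule bounded_op_Lp_D(3)[OF T Vh g])
    then have "AE x in lborel. lam * ?v x = T ?v x"
      using right[OF h] by eventually_elim (simp add: algebra_simps)
    then have "AE x in lborel. ?v x = 0" by (rule injective[OF v])
    then show ?thesis by eventually_elim simp
  qed
  show ?thesis unfolding isom_Lp_def using S_op V_op left right by blast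
qed

end

subsection \<open>Dense subspaces\<close>

lemma integrable_of_integrable_on:
  fixes f :: "real \<Rightarrow> real"
  assumes "f integrable_on A" "\<And>x. x \<in> A \<Longrightarrow> 0 \<le> f x" "f \<in> borel_measurable borel" "A \<in> sets borel"
  shows "integrable lborel (\<lambda>x. indicator A x * f x)"
proof -
  have "f absolutely_integrable_on A" by (rule nonnegative_absolutely_integrable_1[OF assms(1,2)])
  then have "integrable (completion lborel) (\<lambda>x. indicator A x * f x)"
    by (simp add: set_integrable_def)
  moreover have "(\<lambda>x. indicator A x * f x) \<in> borel_measurable lborel" using assms by measurable
  ultimately show ?thesis by (simp add: integrable_completion)
qed

text \<open>Separate powers near 0 and at infinity prescribe local integrability and decay
  independently. At 0 the value is 0 for every \<open>a\<close>, since \<open>0 powr a = 0\<close>,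
  so pointwise majorants with a nonpositive exponent exclude the origin.\<close>

definition two_power :: "real \<Rightarrow> real \<Rightarrow> real \<Rightarrow> real" where
  "two_power a b y = (if \<bar>y\<bar> < 1 then \<bar>y\<bar> powr a else \<bar>y\<bar> powr b)"

lemma two_power_measurable [measurable]: "two_power a b \<in> borel_measurable borel"
  unfolding two_power_def[abs_def] by measurable

lemma two_power_nonneg: "0 \<le> two_power a b y" by (simp add: two_power_def)

lemma two_power_pos: "y \<noteq> 0 \<Longrightarrow> 0 < two_power a b y" by (simp add: two_power_def)

lemma two_power_powr: "two_power a b y powr c = two_power (a * c) (b * c) y"
  by (simp add: two_power_def powr_powr)

lemma two_power_integrable:
  assumes "-1 < a" "b < -1" shows "integrable lborel (two_power a b)"
proof -
  let ?h = "\<lambda>y. indicator {0..1} y * y powr a + indicator {1..} y * y powr b :: real"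
  have i: "integrable lborel ?h"
    using assms has_integral_powr_to_inf[of b 1]
    by (intro Bochner_Integration.integrable_add integrable_of_integrable_on integrable_on_powr_from_0) (auto simp: integrable_on_def)
  have i': "integrable lborel (\<lambda>y. ?h (0 + (-1) * y))" by (rule lborel_integrable_real_affine[OF i]) simp
  show ?thesis
  proof (rule Bochner_Integration.integrable_bound[OF Bochner_Integration.integrable_add[OF i i']])
    show "AE y in lborel. norm (two_power a b y) \<le> norm (?h y + ?h (0 + (-1) * y))"
      by (rule AE_I2) (auto simp: two_power_def indicator_def abs_if)
  qed simp
qed

lemma Lp_dominated_convergence:
  assumes q: "1 \<le> q" and D: "D \<in> Lp q" and u: "\<And>n. u n \<in> borel_measurable borel" and v: "v \<in> borel_measurable borel"
    and lim: "AE x in lborel. (\<lambda>n. u n x) \<longlonglongrightarrow> v x"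
    and b: "\<And>n. AE x in lborel. \<bar>u n x\<bar> \<le> \<bar>D x\<bar>" and bv: "AE x in lborel. \<bar>v x\<bar> \<le> \<bar>D x\<bar>"
  shows "(\<lambda>n. Lp_norm q (\<lambda>x. v x - u n x)) \<longlonglongrightarrow> 0"
proof -
  note [measurable] = u v LpD(1)[OF D]
  have "(\<lambda>n. LINT x|lborel. \<bar>v x - u n x\<bar> powr q) \<longlonglongrightarrow> (LINT x|(lborel :: real measure). 0 :: real)"
  proof (rule integral_dominated_convergence[where w = "\<lambda>x. (2 * \<bar>D x\<bar>) powr q"])
    show "integrable lborel (\<lambda>x. (2 * \<bar>D x\<bar>) powr q)" using LpD(2)[OF D] by (simp add: powr_mult)
    show "AE x in lborel. (\<lambda>n. \<bar>v x - u n x\<bar> powr q) \<longlonglongrightarrow> 0"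
      using lim
    proof eventually_elim
      case (elim x)
      have "(\<lambda>n. \<bar>v x - u n x\<bar>) \<longlonglongrightarrow> \<bar>v x - v x\<bar>" by (intro tendsto_intros elim)
      then have "(\<lambda>n. \<bar>v x - u n x\<bar> powr q) \<longlonglongrightarrow> 0 powr q" using q by (intro tendsto_powr') auto
      then show ?case by simp
    qed
    show "AE x in lborel. norm (\<bar>v x - u n x\<bar> powr q) \<le> (2 * \<bar>D x\<bar>) powr q" for n
      using b[of n] bv
    proof eventually_elim
      case (elim x)
      then have "\<bar>v x - u n x\<bar> \<le> 2 * \<bar>D x\<bar>" by linarith
      then show ?case using q by (simp add: powr_mono2)
    qed
  qed auto
  then have "(\<lambda>n. (LINT x|lborel. \<bar>v x - u n x\<bar> powr q) powr (1 / q)) \<longlonglongrightarrow> 0 powr (1/q)"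
    using q by (intro tendsto_powr') (auto intro!: always_eventually Bochner_Integration.integral_nonneg)
  then show ?thesis by (simp add: Lp_norm_def)
qed

lemma bounded_support_dense:
  assumes q: "1 \<le> q" and w: "w \<in> Lp q" and e: "0 < e"
  obtains v where "bounded_support v" "Lp_norm q (\<lambda>x. w x - v x) < e"
proof -
  have [measurable]: "w \<in> borel_measurable borel" using LpD[OF w] by simp
  define v where "v n x = (if \<bar>x\<bar> \<le> real n \<and> \<bar>w x\<bar> \<le> real n then w x else 0)" for n x
  have m[measurable]: "v n \<in> borel_measurable borel" for n unfolding v_def by measurable
  have "(\<lambda>n. Lp_norm q (\<lambda>x. w x - v n x)) \<longlonglongrightarrow> 0"
  proof (rule Lp_dominated_convergence[OF q w])
    show "AE x in lborel. (\<lambda>n. v n x) \<longlonglongrightarrow> w x"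
    proof (rule AE_I2)
      fix x
      obtain N where "max \<bar>x\<bar> \<bar>w x\<bar> \<le> real N" using real_arch_simple by blast
      then show "(\<lambda>n. v n x) \<longlonglongrightarrow> w x"
        by (intro tendsto_eventually eventually_sequentiallyI[of N]) (auto simp: v_def)
    qed
  qed (auto simp: v_def)
  from order_tendstoD(2)[OF this e] obtain n where n: "Lp_norm q (\<lambda>x. w x - v n x) < e"
    using eventually_happens'[OF sequentially_bot] by blast
  have "bounded_support (v n)"
    unfolding bounded_support_def by (intro conjI exI[of _ "real n"]) (auto simp: v_def)
  then show ?thesis using that n by blast
qed

text \<open>The notion \<open>measurable_on\<close> supplies continuous functions converging to v
  off a negligible set. Truncating them by the bound of v and multiplying by a cutoff around its
  support gives a common majorant.\<close>

lemma continuous_bounded_support_dense: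
  assumes q: "1 \<le> q" and v: "bounded_support v" and e: "0 < e"
  obtains u where "bounded_support u" "continuous_on UNIV u" "Lp_norm q (\<lambda>x. v x - u x) < e"
proof -
  obtain M0 where vm[measurable]: "v \<in> borel_measurable borel" and M0: "\<And>x. \<bar>v x\<bar> \<le> M0" "\<And>x. M0 < \<bar>x\<bar> \<Longrightarrow> v x = 0"
    using v by (auto simp: bounded_support_def)
  define M where "M = \<bar>M0\<bar>"
  have M: "0 \<le> M" "\<bar>v x\<bar> \<le> M" "M < \<bar>x\<bar> \<Longrightarrow> v x = 0" for x
    using M0(1)[of x] M0(2)[of x] by (auto simp: M_def)
  have "v measurable_on UNIV"
    by (rule lebesgue_measurable_imp_measurable_on) (auto intro: measurable_completion)
  then obtain N g where N: "negligible N" and g: "\<And>n. continuous_on UNIV (g n)"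
      "\<And>x. x \<notin> N \<Longrightarrow> (\<lambda>n. g n x) \<longlonglongrightarrow> v x"
    unfolding measurable_on_def by auto
  define u where "u n x = max (- M) (min M (g n x)) * max 0 (min 1 (M + 1 - \<bar>x\<bar>))" for n x
  have uc: "continuous_on UNIV (u n)" for n
    unfolding u_def by (intro continuous_intros g)
  have ub: "\<bar>u n x\<bar> \<le> M" for n x
  proof -
    have "\<bar>u n x\<bar> \<le> M * 1" unfolding u_def abs_mult using M by (intro mult_mono) auto
    then show ?thesis by simp
  qed
  have u0: "u n x = 0" if "M + 1 < \<bar>x\<bar>" for n x using that by (simp add: u_def)
  have bs: "bounded_support (u n)" for n
    unfolding bounded_support_def
    by (intro conjI exI[of _ "M + 1"] borel_measurable_continuous_onI uc)
      (use order_trans[OF ub, of "M + 1"] u0 in auto)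
  let ?D = "\<lambda>x. M * indicator {- M - 1..M + 1} x :: real"
  have D: "?D \<in> Lp q"
    by (rule bounded_support_Lp) (use M q in \<open>auto simp: bounded_support_def indicator_def intro!: exI[of _ "M + 1"]\<close>)
  have "(\<lambda>n. Lp_norm q (\<lambda>x. v x - u n x)) \<longlonglongrightarrow> 0"
  proof (rule Lp_dominated_convergence[OF q D])
    show "u n \<in> borel_measurable borel" for n using uc by (rule borel_measurable_continuous_onI)
    have "AE x in lebesgue. x \<notin> N" using N AE_not_in negligible_iff_null_sets by blast
    then have "AE x in lebesgue. (\<lambda>n. u n x) \<longlonglongrightarrow> v x"
    proof eventually_elim
      case (elim x)
      have "(\<lambda>n. u n x) \<longlonglongrightarrow> max (- M) (min M (v x)) * max 0 (min 1 (M + 1 - \<bar>x\<bar>))"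
        unfolding u_def by (intro tendsto_intros g elim)
      moreover have "max (- M) (min M (v x)) * max 0 (min 1 (M + 1 - \<bar>x\<bar>)) = v x"
      proof (cases "M < \<bar>x\<bar>")
        case True
        then show ?thesis using M by simp
      next
        case False
        then have "max (- M) (min M (v x)) = v x" "max 0 (min 1 (M + 1 - \<bar>x\<bar>)) = 1"
          using M(2)[of x] by linarith+
        then show ?thesis by simp
      qed
      ultimately show ?case by simp
    qed
    then show "AE x in lborel. (\<lambda>n. u n x) \<longlonglongrightarrow> v x" by (simp add: AE_completion_iff)
    show "AE x in lborel. \<bar>u n x\<bar> \<le> \<bar>?D x\<bar>" for n
      using ub[of n] u0[of _ n] M(1) by (auto intro!: AE_I2 simp: indicator_def abs_le_iff not_le)
    show "AE x in lborel. \<bar>v x\<bar> \<le> \<bar>?D x\<bar>"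
      using M by (auto intro!: AE_I2 simp: indicator_def abs_le_iff not_le)
  qed auto
  from order_tendstoD(2)[OF this e] obtain n where "Lp_norm q (\<lambda>x. v x - u n x) < e"
    using eventually_happens'[OF sequentially_bot] by blast
  then show ?thesis using that bs uc by blast
qed

definition lipschitz_support :: "(real \<Rightarrow> real) \<Rightarrow> bool" where
  "lipschitz_support \<phi> \<longleftrightarrow> (\<exists>K R. (\<forall>x y. \<bar>\<phi> x - \<phi> y\<bar> \<le> K * \<bar>x - y\<bar>) \<and> (\<forall>x. R < \<bar>x\<bar> \<longrightarrow> \<phi> x = 0))"

text \<open>Difference quotients of a primitive V of u with step 1/(n + 1): they are Lipschitz
  because V is; by the mean value theorem they are values of u at nearby points, hence keep its
  bound and enlarge its support by at most 1; and they converge to u pointwise.\<close>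

lemma lipschitz_support_dense_aux:
  assumes q: "1 \<le> q" and u: "bounded_support u" "continuous_on UNIV u" and e: "0 < e"
  obtains \<phi> where "bounded_support \<phi>" "lipschitz_support \<phi>" "Lp_norm q (\<lambda>x. u x - \<phi> x) < e"
proof -
  obtain M0 where um[measurable]: "u \<in> borel_measurable borel" and M0: "\<And>x. \<bar>u x\<bar> \<le> M0" "\<And>x. M0 < \<bar>x\<bar> \<Longrightarrow> u x = 0"
    using u by (auto simp: bounded_support_def)
  define M where "M = \<bar>M0\<bar>"
  have M: "0 \<le> M" "\<bar>u x\<bar> \<le> M" "M < \<bar>x\<bar> \<Longrightarrow> u x = 0" for x
    using M0(1)[of x] M0(2)[of x] by (auto simp: M_def)
  have "\<exists>V. \<forall>x. (V has_vector_derivative u x) (at x)"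
    using einterval_antiderivative[of "-\<infinity>" \<infinity> u] u(2) by (simp add: continuous_on_eq_continuous_at)
  then obtain V where "\<And>x. (V has_vector_derivative u x) (at x)" by blast
  then have V: "\<And>x. (V has_real_derivative u x) (at x)" by (simp add: has_real_derivative_iff_has_vector_derivative)
  have Vl: "\<bar>V x - V y\<bar> \<le> M * \<bar>x - y\<bar>" for x y
    using field_differentiable_bound[of UNIV V u M x y] V M by auto
  define \<phi> where "\<phi> n x = real (Suc n) * (V (x + 1 / real (Suc n)) - V x)" for n x
  have lip: "\<bar>\<phi> n x - \<phi> n y\<bar> \<le> real (Suc n) * (2 * M) * \<bar>x - y\<bar>" for n x y
  proof -
    have "\<bar>\<phi> n x - \<phi> n y\<bar> = real (Suc n) * \<bar>(V (x + 1 / real (Suc n)) - V (y + 1 / real (Suc n))) - (V x - V y)\<bar>"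
    proof -
      have "\<phi> n x - \<phi> n y = real (Suc n) * ((V (x + 1 / real (Suc n)) - V (y + 1 / real (Suc n))) - (V x - V y))"
        unfolding \<phi>_def by (simp only: right_diff_distrib)
      then show ?thesis by (simp only: abs_mult abs_of_nat)
    qed
    also have "\<dots> \<le> real (Suc n) * (M * \<bar>x - y\<bar> + M * \<bar>x - y\<bar>)"
    proof (rule mult_left_mono)
      have "\<bar>V (x + 1 / real (Suc n)) - V (y + 1 / real (Suc n))\<bar> \<le> M * \<bar>x - y\<bar>"
        using Vl[of "x + 1 / real (Suc n)" "y + 1 / real (Suc n)"] by simp
      then show "\<bar>(V (x + 1 / real (Suc n)) - V (y + 1 / real (Suc n))) - (V x - V y)\<bar> \<le> M * \<bar>x - y\<bar> + M * \<bar>x - y\<bar>"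
        using Vl[of x y] by linarith
    qed simp
    finally show ?thesis by (simp add: algebra_simps)
  qed
  have val: "\<exists>\<xi>. x < \<xi> \<and> \<xi> < x + 1 / real (Suc n) \<and> \<phi> n x = u \<xi>" for n x
  proof -
    obtain \<xi> where "x < \<xi>" "\<xi> < x + 1 / real (Suc n)" "V (x + 1 / real (Suc n)) - V x = (x + 1 / real (Suc n) - x) * u \<xi>"
      using MVT2[of x "x + 1 / real (Suc n)" V u] V by auto
    then show ?thesis by (intro exI[of _ \<xi>]) (auto simp: \<phi>_def)
  qed
  have b: "\<bar>\<phi> n x\<bar> \<le> M" for n x using val[of x n] M by metis
  have z: "\<phi> n x = 0" if "M + 1 < \<bar>x\<bar>" for n x
  proof -
    obtain \<xi> where \<xi>: "x < \<xi>" "\<xi> < x + 1 / real (Suc n)" "\<phi> n x = u \<xi>" using val by metis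
    have "1 / real (Suc n) \<le> 1" by simp
    then have "M < \<bar>\<xi>\<bar>" using \<xi> that by linarith
    then show ?thesis using \<xi> M by simp
  qed
  have \<phi>m: "\<phi> n \<in> borel_measurable borel" for n
  proof -
    have "continuous_on UNIV V" using V DERIV_isCont continuous_at_imp_continuous_on by blast
    then have [measurable]: "V \<in> borel_measurable borel" by (rule borel_measurable_continuous_onI)
    show ?thesis unfolding \<phi>_def by measurable
  qed
  have bs: "bounded_support (\<phi> n)" for n
    unfolding bounded_support_def
    by (intro conjI exI[of _ "M + 1"] \<phi>m) (use order_trans[OF b, of "M + 1"] z in auto)
  have ls: "lipschitz_support (\<phi> n)" for n unfolding lipschitz_support_def using lip z by blast
  let ?D = "\<lambda>x. M * indicator {- M - 1..M + 1} x :: real"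
  have D: "?D \<in> Lp q"
    by (rule bounded_support_Lp) (use M q in \<open>auto simp: bounded_support_def indicator_def intro!: exI[of _ "M + 1"]\<close>)
  have "(\<lambda>n. Lp_norm q (\<lambda>x. u x - \<phi> n x)) \<longlonglongrightarrow> 0"
  proof (rule Lp_dominated_convergence[OF q D \<phi>m um])
    have lim: "(\<lambda>n. \<phi> n x) \<longlonglongrightarrow> u x" for x
    proof -
      have "((\<lambda>h. (V (x + h) - V x) / h) \<longlongrightarrow> u x) (at 0)" using V[of x] by (simp add: DERIV_def)
      moreover have "filterlim (\<lambda>n. 1 / real (Suc n)) (at 0) sequentially"
        using LIMSEQ_Suc[OF lim_1_over_n[where 'a = real]] by (simp add: filterlim_at del: of_nat_Suc)
      ultimately have "(\<lambda>n. (V (x + 1 / real (Suc n)) - V x) / (1 / real (Suc n))) \<longlonglongrightarrow> u x"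
        by (rule filterlim_compose)
      then show ?thesis by (simp add: \<phi>_def mult.commute)
    qed
    then show "AE x in lborel. (\<lambda>n. \<phi> n x) \<longlonglongrightarrow> u x" by simp
    show "AE x in lborel. \<bar>\<phi> n x\<bar> \<le> \<bar>?D x\<bar>" for n
      using b[of n] z[of _ n] M(1) by (auto intro!: AE_I2 simp: indicator_def abs_le_iff not_le)
    show "AE x in lborel. \<bar>u x\<bar> \<le> \<bar>?D x\<bar>"
      using M by (auto intro!: AE_I2 simp: indicator_def abs_le_iff not_le)
  qed
  from order_tendstoD(2)[OF this e] obtain n where "Lp_norm q (\<lambda>x. u x - \<phi> n x) < e"
    using eventually_happens'[OF sequentially_bot] by blast
  then show ?thesis using that bs ls by blast
qed

text \<open>Lipschitz densities are regular enough for the Cauchy integral to have boundary values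
  at every point; by density they suffice for the L_2 estimate.\<close>

theorem lipschitz_support_dense:
  assumes q: "1 \<le> q" and w: "w \<in> Lp q" and e: "0 < e"
  obtains \<phi> where "bounded_support \<phi>" "lipschitz_support \<phi>" "Lp_norm q (\<lambda>x. w x - \<phi> x) < e"
proof -
  have e3: "0 < e / 3" using e by simp
  obtain v where v: "bounded_support v" "Lp_norm q (\<lambda>x. w x - v x) < e / 3" by (rule bounded_support_dense[OF q w e3])
  obtain u where u: "bounded_support u" "continuous_on UNIV u" "Lp_norm q (\<lambda>x. v x - u x) < e / 3"
    by (rule continuous_bounded_support_dense[OF q v(1) e3])
  obtain \<phi> where \<phi>: "bounded_support \<phi>" "lipschitz_support \<phi>" "Lp_norm q (\<lambda>x. u x - \<phi> x) < e / 3"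
    by (rule lipschitz_support_dense_aux[OF q u(1,2) e3])
  have L: "v \<in> Lp q" "u \<in> Lp q" "\<phi> \<in> Lp q" using v u \<phi> q bounded_support_Lp by auto
  have "Lp_norm q (\<lambda>x. ((w x - v x) + (v x - u x)) + (u x - \<phi> x)) \<le> Lp_norm q (\<lambda>x. (w x - v x) + (v x - u x)) + Lp_norm q (\<lambda>x. u x - \<phi> x)"
    by (rule Minkowski[OF q]) (use q w L in \<open>auto intro!: Lp_add Lp_diff\<close>)
  also have "Lp_norm q (\<lambda>x. (w x - v x) + (v x - u x)) \<le> Lp_norm q (\<lambda>x. w x - v x) + Lp_norm q (\<lambda>x. v x - u x)"
    by (rule Minkowski[OF q]) (use q w L in \<open>auto intro!: Lp_diff\<close>)
  finally have "Lp_norm q (\<lambda>x. w x - \<phi> x) < e" using v u \<phi> by simp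
  then show ?thesis using that \<phi> by blast
qed

subsection \<open>Cauchy integrals along a graph\<close>

lemma AE_off_diagonal_real: "AE z in lborel. fst z \<noteq> (snd z :: real)"
proof -
  have "AE z in lborel \<Otimes>\<^sub>M lborel. fst z \<noteq> (snd z :: real)"
  proof (rule lborel_pair.AE_pair_measure)
    have "AE y in lborel. x \<noteq> (y::real)" for x using AE_lborel_singleton[of x] by eventually_elim auto
    then show "AE x in lborel. AE y in lborel. fst (x, y) \<noteq> (snd (x, y) :: real)" by simp
  qed measurable
  then show ?thesis unfolding lborel_prod .
qed

text \<open>Within one open half plane two arguments differ by less than \<pi>, so the difference of
  principal logarithms stays in the strip where Ln inverts exp.\<close>

lemma Ln_diff_eq_Ln_divide:
  assumes "0 < Im z \<and> 0 < Im w \<or> Im z < 0 \<and> Im w < 0"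
  shows "Ln z - Ln w = Ln (z / w)"
proof -
  have nz: "z \<noteq> 0" "w \<noteq> 0" using assms by auto
  have b: "- pi < Im (Ln z)" "Im (Ln z) \<le> pi" "- pi < Im (Ln w)" "Im (Ln w) \<le> pi"
    using nz mpi_less_Im_Ln Im_Ln_le_pi by auto
  have "\<bar>Im (Ln z - Ln w)\<bar> < pi"
  proof (cases "0 < Im z")
    case True
    then have "0 < Im (Ln z) \<and> Im (Ln z) < pi" "0 < Im (Ln w) \<and> Im (Ln w) < pi"
      using assms nz Im_Ln_pos_lt by auto
    then show ?thesis unfolding minus_complex.sel by linarith
  next
    case False
    then have "Im z < 0" "Im w < 0" using assms by auto
    then have "Im (Ln z) < 0" "Im (Ln w) < 0" using b Im_Ln_pos_le[of z] Im_Ln_pos_le[of w] nz by auto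
    then show ?thesis using b unfolding minus_complex.sel by linarith
  qed
  then have "Ln (exp (Ln z - Ln w)) = Ln z - Ln w" by (intro Ln_exp) auto
  moreover have "exp (Ln z - Ln w) = z / w" using nz by (simp add: exp_diff)
  ultimately show ?thesis by simp
qed

locale graph =
  fixes F G :: "real \<Rightarrow> real" and \<gamma> L :: real
  assumes gam: "0 < \<gamma>" and Lpos: "0 < L" and DF: "\<And>x. (F has_real_derivative G x) (at x)"
    and HG: "\<And>x y. \<bar>G x - G y\<bar> \<le> L * \<bar>x - y\<bar> powr \<gamma>" and BG: "\<And>x. \<bar>G x\<bar> \<le> L"
begin

lemma F_lip: "\<bar>F x - F y\<bar> \<le> L * \<bar>x - y\<bar>"
  using field_differentiable_bound[of UNIV F G L x y] DF BG by auto

lemma F_cont: "isCont F x" using DF DERIV_isCont by blast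

lemma G_cont: "isCont G x"
proof -
  have "((\<lambda>y. \<bar>y - x\<bar> powr \<gamma>) \<longlongrightarrow> 0) (at x)"
    using gam tendsto_powr'[of "\<lambda>y. \<bar>y - x\<bar>" 0 "at x" "\<lambda>_. \<gamma>" \<gamma>] by (auto intro!: tendsto_eq_intros)
  then have "((\<lambda>y. L * \<bar>y - x\<bar> powr \<gamma>) \<longlongrightarrow> 0) (at x)" using tendsto_mult_right_zero by blast
  then have "((\<lambda>y. G y - G x) \<longlongrightarrow> 0) (at x)"
    by (rule Lim_null_comparison[rotated]) (use HG in auto)
  then show ?thesis by (simp add: isCont_def LIM_zero_iff)
qed

lemma F_meas [measurable]: "F \<in> borel_measurable borel"
  using F_cont by (intro borel_measurable_continuous_onI continuous_at_imp_continuous_on) auto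

lemma G_meas [measurable]: "G \<in> borel_measurable borel"
  using G_cont by (intro borel_measurable_continuous_onI continuous_at_imp_continuous_on) auto

lemma F_mvt: "\<exists>\<xi>. \<bar>\<xi> - x\<bar> \<le> \<bar>x - s\<bar> \<and> \<bar>\<xi> - s\<bar> \<le> \<bar>x - s\<bar> \<and> F x - F s = G \<xi> * (x - s)"
proof -
  consider "x < s" | "x = s" | "s < x" by linarith
  then show ?thesis
  proof cases
    case 1
    then obtain \<xi> where "x < \<xi>" "\<xi> < s" "F s - F x = (s - x) * G \<xi>" using MVT2[of x s F G] DF by auto
    then show ?thesis by (intro exI[of _ \<xi>]) (auto simp: algebra_simps)
  next
    case 3
    then obtain \<xi> where "s < \<xi>" "\<xi> < x" "F x - F s = (x - s) * G \<xi>" using MVT2[of s x F G] DF by auto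
    then show ?thesis by (intro exI[of _ \<xi>]) (auto simp: algebra_simps)
  qed auto
qed

text \<open>Expansions at both ends are recorded: the one at x for the kernel of A(f), the one at s
  for the double layer kernel in the jump formula.\<close>

lemma F_taylor: "\<bar>(x - s) * G x - (F x - F s)\<bar> \<le> L * \<bar>x - s\<bar> powr \<gamma> * \<bar>x - s\<bar>"
  "\<bar>(x - s) * G s - (F x - F s)\<bar> \<le> L * \<bar>x - s\<bar> powr \<gamma> * \<bar>x - s\<bar>"
proof -
  obtain \<xi> where \<xi>: "\<bar>\<xi> - x\<bar> \<le> \<bar>x - s\<bar>" "\<bar>\<xi> - s\<bar> \<le> \<bar>x - s\<bar>" "F x - F s = G \<xi> * (x - s)" using F_mvt by blast
  have *: "\<bar>G y - G \<xi>\<bar> \<le> L * \<bar>x - s\<bar> powr \<gamma>" if "\<bar>\<xi> - y\<bar> \<le> \<bar>x - s\<bar>" for y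
  proof -
    have "\<bar>y - \<xi>\<bar> powr \<gamma> \<le> \<bar>x - s\<bar> powr \<gamma>" using that gam by (intro powr_mono2) auto
    then show ?thesis using HG[of y \<xi>] Lpos by (meson mult_left_mono less_imp_le order_trans)
  qed
  have "(x - s) * G y - (F x - F s) = (G y - G \<xi>) * (x - s)" for y using \<xi>(3) by (simp add: algebra_simps)
  then show "\<bar>(x - s) * G x - (F x - F s)\<bar> \<le> L * \<bar>x - s\<bar> powr \<gamma> * \<bar>x - s\<bar>"
    "\<bar>(x - s) * G s - (F x - F s)\<bar> \<le> L * \<bar>x - s\<bar> powr \<gamma> * \<bar>x - s\<bar>"
    using *[of x] *[of s] \<xi> by (auto simp: abs_mult intro!: mult_right_mono)
qed

text \<open>The derivative of the parametrisation z(x) = x + i F(x) of the graph, so that tau(x) dx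
  is dz.\<close>

definition tau :: "real \<Rightarrow> complex" where "tau x = 1 + \<i> * of_real (G x)"

text \<open>With z(x) = x + i F(x) and e = 1 or e = -1 this is -i e (z(x) + i e h - z(s)): the
  difference between z(s) and a point lifted by h above or lowered by h below the graph, rotated by
  a right angle. The rotation keeps W off the negative real axis for h > 0, since Im W = 0 forces x
  = s and then W = h, so principal logarithms are available along the whole graph.\<close>

definition W :: "real \<Rightarrow> real \<Rightarrow> real \<Rightarrow> real \<Rightarrow> complex" where
  "W e h x s = of_real (e * (F x - F s) + h) - \<i> * of_real (e * (x - s))"

lemma W_sel [simp]: "Re (W e h x s) = e * (F x - F s) + h" "Im (W e h x s) = - (e * (x - s))"
  by (simp_all add: W_def)

lemma tau_sel [simp]: "Re (tau x) = 1" "Im (tau x) = G x" by (simp_all add: tau_def)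

lemma tau_nz: "tau x \<noteq> 0"
  by (metis tau_sel(1) zero_complex.simps(1) zero_neq_one)

lemma tau_norm: "1 \<le> norm (tau x)" "norm (tau x) \<le> 1 + L"
proof -
  show "1 \<le> norm (tau x)" using abs_Re_le_cmod[of "tau x"] by simp
  show "norm (tau x) \<le> 1 + L" using cmod_le[of "tau x"] BG[of x] by simp
qed

lemma tau_meas [measurable]: "tau \<in> borel_measurable borel"
  unfolding tau_def[abs_def] by measurable

lemma tau_cont: "isCont tau x"
  unfolding tau_def[abs_def] by (intro continuous_intros G_cont)

lemma W_joint_meas [measurable]:
  assumes [measurable]: "f \<in> borel_measurable M" "g \<in> borel_measurable M"
  shows "(\<lambda>z. W e h (f z) (g z)) \<in> borel_measurable M"
  unfolding W_def by measurable

lemma W_cont: "isCont (\<lambda>s. W e h x s) s" "isCont (\<lambda>x. W e h x s) x"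
  unfolding W_def using F_cont by (auto intro!: continuous_intros)

lemma W_ge: assumes "\<bar>e\<bar> = 1" shows "\<bar>x - s\<bar> \<le> norm (W e h x s)"
  using abs_Im_le_cmod[of "W e h x s"] assms by (simp add: abs_mult)

lemma W_le: assumes "\<bar>e\<bar> = 1" "0 \<le> h" shows "norm (W e h x s) \<le> (L + 1) * \<bar>x - s\<bar> + h"
proof -
  have "norm (W e h x s) \<le> \<bar>e * (F x - F s) + h\<bar> + \<bar>e * (x - s)\<bar>" using cmod_le[of "W e h x s"] by simp
  also have "\<dots> \<le> \<bar>F x - F s\<bar> + h + \<bar>x - s\<bar>"
    using assms abs_triangle_ineq[of "e * (F x - F s)" h] by (simp add: abs_mult)
  finally show ?thesis using F_lip[of x s] by (simp add: algebra_simps)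
qed

text \<open>If |x - s| >= h/(2 L), the imaginary part suffices; otherwise the Lipschitz bound leaves
  a real part of at least h/2. For h > 0 the Cauchy kernel is thus bounded.\<close>

lemma W_ge_h:
  assumes "\<bar>e\<bar> = 1" "0 < h" obtains c where "0 < c" "\<And>x s. c \<le> norm (W e h x s)"
proof (rule that[of "min (h / 2) (h / (2 * L))"])
  fix x s
  show "min (h / 2) (h / (2 * L)) \<le> norm (W e h x s)"
  proof (cases "h / (2 * L) \<le> \<bar>x - s\<bar>")
    case True
    then show ?thesis using W_ge[OF assms(1), of x s h] by linarith
  next
    case False
    then have "L * \<bar>x - s\<bar> \<le> h / 2" using Lpos by (simp add: field_simps)
    then have "\<bar>e * (F x - F s)\<bar> \<le> h / 2" using F_lip[of x s] assms by (simp add: abs_mult)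
    then have "h / 2 \<le> Re (W e h x s)" by simp
    then show ?thesis using complex_Re_le_cmod[of "W e h x s"] by linarith
  qed
qed (use assms Lpos in auto)

lemma W_slit: assumes "\<bar>e\<bar> = 1" "0 < h \<or> h = 0 \<and> x \<noteq> s" shows "W e h x s \<notin> \<real>\<^sub>\<le>\<^sub>0"
proof
  assume "W e h x s \<in> \<real>\<^sub>\<le>\<^sub>0"
  then have "Im (W e h x s) = 0" "Re (W e h x s) \<le> 0" by (auto simp: complex_nonpos_Reals_iff)
  then show False using assms by (auto simp: abs_if split: if_splits)
qed

lemma W_nz: assumes "\<bar>e\<bar> = 1" "0 < h \<or> h = 0 \<and> x \<noteq> s" shows "W e h x s \<noteq> 0"
  using W_slit[OF assms] by auto

lemma W_DERIV_s: "((\<lambda>s. W e h x s) has_vector_derivative (\<i> * of_real e * tau s)) (at s)"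
proof -
  have 1: "((\<lambda>s. e * (F x - F s) + h) has_vector_derivative - (e * G s)) (at s)"
    using DF[of s] by (auto simp: has_real_derivative_iff_has_vector_derivative[symmetric] intro!: derivative_eq_intros)
  have 2: "((\<lambda>s. e * (x - s)) has_vector_derivative - e) (at s)"
    by (auto simp: has_real_derivative_iff_has_vector_derivative[symmetric] intro!: derivative_eq_intros)
  have "((\<lambda>s. W e h x s) has_vector_derivative (of_real (- (e * G s)) - \<i> * of_real (- e))) (at s)"
    unfolding W_def
    by (intro has_vector_derivative_diff has_vector_derivative_mult_right
        bounded_linear.has_vector_derivative[OF bounded_linear_of_real] 1 2)
  then show ?thesis by (rule has_vector_derivative_eq_rhs) (simp add: complex_eq_iff)
qed

lemma W_DERIV_x: "((\<lambda>x. W e h x s) has_vector_derivative (- \<i> * of_real e * tau x)) (at x)"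
proof -
  have 1: "((\<lambda>x. e * (F x - F s) + h) has_vector_derivative (e * G x)) (at x)"
    using DF[of x] by (auto simp: has_real_derivative_iff_has_vector_derivative[symmetric] intro!: derivative_eq_intros)
  have 2: "((\<lambda>x. e * (x - s)) has_vector_derivative e) (at x)"
    by (auto simp: has_real_derivative_iff_has_vector_derivative[symmetric] intro!: derivative_eq_intros)
  have "((\<lambda>x. W e h x s) has_vector_derivative (of_real (e * G x) - \<i> * of_real e)) (at x)"
    unfolding W_def
    by (intro has_vector_derivative_diff has_vector_derivative_mult_right
        bounded_linear.has_vector_derivative[OF bounded_linear_of_real] 1 2)
  then show ?thesis by (rule has_vector_derivative_eq_rhs) (simp add: complex_eq_iff)
qed

lemma Ln_W_DERIV_s:
  assumes "\<bar>e\<bar> = 1" "0 < h \<or> h = 0 \<and> x \<noteq> s"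
  shows "((\<lambda>s. Ln (W e h x s)) has_vector_derivative (\<i> * of_real e * tau s / W e h x s)) (at s)"
  using field_vector_diff_chain_at[OF W_DERIV_s has_field_derivative_Ln[OF W_slit[OF assms]]]
  by (simp add: o_def divide_inverse)

lemma Ln_W_DERIV_x:
  assumes "\<bar>e\<bar> = 1" "0 < h \<or> h = 0 \<and> x \<noteq> s"
  shows "((\<lambda>x. Ln (W e h x s)) has_vector_derivative (- \<i> * of_real e * tau x / W e h x s)) (at x)"
  using field_vector_diff_chain_at[OF W_DERIV_x has_field_derivative_Ln[OF W_slit[OF assms]]]
  by (simp add: o_def divide_inverse)

text \<open>Boundedness near s and quadratic decay away from it; through 2 a b <= a^2 + b^2 this
  makes the product of two Cauchy kernels integrable over the line.\<close>

lemma inverse_W_sq_bound: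
  assumes e: "\<bar>e\<bar> = 1" and h: "0 < h"
  obtains C where "0 < C" "\<And>x s. x \<noteq> s \<Longrightarrow> 1 / (norm (W e h x s))\<^sup>2 \<le> C * two_power 0 (-2) (x - s)"
proof -
  obtain c where c: "0 < c" "\<And>x s. c \<le> norm (W e h x s)" using W_ge_h[OF e h] by blast
  show ?thesis
  proof (rule that[of "1 + 1 / c\<^sup>2"])
    show "0 < 1 + 1 / c\<^sup>2" by (simp add: add_pos_nonneg)
    fix x s :: real assume xs: "x \<noteq> s"
    have pos: "0 < norm (W e h x s)" using c(1) c(2)[of x s] by linarith
    show "1 / (norm (W e h x s))\<^sup>2 \<le> (1 + 1 / c\<^sup>2) * two_power 0 (-2) (x - s)"
    proof (cases "\<bar>x - s\<bar> < 1")
      case True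
      have "c\<^sup>2 \<le> (norm (W e h x s))\<^sup>2" using c by (intro power_mono) auto
      then have "1 / (norm (W e h x s))\<^sup>2 \<le> 1 / c\<^sup>2" using c(1) pos by (intro divide_left_mono) auto
      then show ?thesis using True xs by (simp add: two_power_def)
    next
      case False
      have "\<bar>x - s\<bar>\<^sup>2 \<le> (norm (W e h x s))\<^sup>2" using W_ge[OF e] by (intro power_mono) auto
      then have "1 / (norm (W e h x s))\<^sup>2 \<le> 1 / \<bar>x - s\<bar>\<^sup>2" using False pos by (intro divide_left_mono) auto
      also have "\<dots> = two_power 0 (-2) (x - s)" using False xs by (simp add: two_power_def powr_minus inverse_eq_divide)
      also have "\<dots> \<le> (1 + 1 / c\<^sup>2) * two_power 0 (-2) (x - s)"
        using two_power_nonneg[of 0 "-2" "x - s"] by (simp add: distrib_right)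
      finally show ?thesis .
    qed
  qed
qed

text \<open>Up to sign the form dz/((z - a)(z - b)) along the shifted graph, that is, the product of
  two Cauchy kernels with sources at s and t.\<close>

definition pairker :: "real \<Rightarrow> real \<Rightarrow> real \<Rightarrow> real \<Rightarrow> real \<Rightarrow> complex" where
  "pairker e h s t x = tau x / (W e h x s * W e h x t)"

lemma pairker_bound:
  assumes e: "\<bar>e\<bar> = 1" and h: "0 < h"
  obtains C where "0 < C" "\<And>s t x. x \<noteq> s \<Longrightarrow> x \<noteq> t \<Longrightarrow>
    norm (pairker e h s t x) \<le> C * (two_power 0 (-2) (x - s) + two_power 0 (-2) (x - t))"
proof -
  obtain C where C: "0 < C" "\<And>x s. x \<noteq> s \<Longrightarrow> 1 / (norm (W e h x s))\<^sup>2 \<le> C * two_power 0 (-2) (x - s)"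
    using inverse_W_sq_bound[OF e h] by blast
  show ?thesis
  proof (rule that[of "(1 + L) * C"])
    show "0 < (1 + L) * C" using C Lpos by simp
    fix s t x :: real assume ne: "x \<noteq> s" "x \<noteq> t"
    let ?a = "1 / norm (W e h x s)" and ?b = "1 / norm (W e h x t)"
    have "?a * ?b \<le> ?a\<^sup>2 + ?b\<^sup>2"
    proof -
      have "2 * (?a * ?b) \<le> ?a\<^sup>2 + ?b\<^sup>2" using sum_squares_bound[of ?a ?b] by (simp only: mult.assoc)
      moreover have "0 \<le> ?a * ?b" by simp
      ultimately show ?thesis by linarith
    qed
    also have "\<dots> \<le> C * two_power 0 (-2) (x - s) + C * two_power 0 (-2) (x - t)"
      using C(2)[OF ne(1)] C(2)[OF ne(2)] by (simp add: power_divide)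
    finally have ab: "?a * ?b \<le> C * (two_power 0 (-2) (x - s) + two_power 0 (-2) (x - t))" by (simp add: algebra_simps)
    have "norm (pairker e h s t x) = norm (tau x) * (?a * ?b)"
      by (simp add: pairker_def norm_divide norm_mult)
    also have "\<dots> \<le> (1 + L) * (C * (two_power 0 (-2) (x - s) + two_power 0 (-2) (x - t)))"
      by (rule mult_mono[OF tau_norm(2)[of x] ab]) (use Lpos in auto)
    finally show "norm (pairker e h s t x) \<le> (1 + L) * C * (two_power 0 (-2) (x - s) + two_power 0 (-2) (x - t))"
      by (simp add: mult.assoc)
  qed
qed

lemma two_power_shift:
  assumes "-1 < a" "b < -1"
  shows "integrable lborel (\<lambda>x. two_power a b (x - s))" "(LINT x|lborel. two_power a b (x - s)) = (LINT x|lborel. two_power a b x)"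
  using lborel_integrable_real_affine[OF two_power_integrable[OF assms], of 1 "-s"] integral_translate[of "two_power a b" s] by auto

lemma pairker_integrable:
  assumes e: "\<bar>e\<bar> = 1" and h: "0 < h"
  shows "integrable lborel (pairker e h s t)"
proof -
  obtain C where C: "0 < C" "\<And>s t x. x \<noteq> s \<Longrightarrow> x \<noteq> t \<Longrightarrow>
    norm (pairker e h s t x) \<le> C * (two_power 0 (-2) (x - s) + two_power 0 (-2) (x - t))"
    using pairker_bound[OF e h] by blast
  show ?thesis
  proof (rule Bochner_Integration.integrable_bound)
    show "integrable lborel (\<lambda>x. C * (two_power 0 (-2) (x - s) + two_power 0 (-2) (x - t)))"
      by (intro integrable_mult_right Bochner_Integration.integrable_add two_power_shift) auto
    show "pairker e h s t \<in> borel_measurable lborel" unfolding pairker_def[abs_def] by measurable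
    show "AE x in lborel. norm (pairker e h s t x) \<le> norm (C * (two_power 0 (-2) (x - s) + two_power 0 (-2) (x - t)))"
      using AE_lborel_singleton[of s] AE_lborel_singleton[of t]
      by eventually_elim (use C(2) in \<open>auto intro: order_trans[OF _ abs_ge_self]\<close>)
  qed
qed

text \<open>Once X_n lies beyond s and t, both values of W are in the same half plane, so the
  difference of logarithms is the logarithm of the quotient. The two values differ by a fixed
  number, so the quotient tends to 1.\<close>

lemma Ln_W_diff_at_infinity:
  assumes e: "\<bar>e\<bar> = 1" and h: "0 < h" and X: "filterlim (\<lambda>n. \<bar>X n\<bar>) at_top sequentially"
  shows "(\<lambda>n. Ln (W e h (X n) s) - Ln (W e h (X n) t)) \<longlonglongrightarrow> 0"
proof -
  let ?d = "W e h 0 s - W e h 0 t"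
  have d: "W e h x s - W e h x t = ?d" for x by (simp add: W_def algebra_simps)
  have big: "\<forall>\<^sub>F n in sequentially. \<bar>X n\<bar> > \<bar>s\<bar> + \<bar>t\<bar>" using X by (simp add: filterlim_at_top_dense)
  have Xt: "filterlim (\<lambda>n. \<bar>X n - t\<bar>) at_top sequentially"
    by (rule filterlim_at_top_mono[OF filterlim_tendsto_add_at_top[OF tendsto_const[of "- \<bar>t\<bar>"] X]])
      (intro always_eventually allI, linarith)
  have lim0: "(\<lambda>n. ?d / W e h (X n) t) \<longlonglongrightarrow> 0"
  proof (rule Lim_null_comparison)
    show "\<forall>\<^sub>F n in sequentially. norm (?d / W e h (X n) t) \<le> norm ?d / \<bar>X n - t\<bar>"
      using big
    proof eventually_elim
      case (elim n)
      then show ?case unfolding norm_divide using W_ge[OF e, of "X n" t h]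
        by (intro divide_left_mono mult_pos_pos) auto
    qed
    show "(\<lambda>n. norm ?d / \<bar>X n - t\<bar>) \<longlonglongrightarrow> 0"
      using Xt by (intro tendsto_divide_0[OF tendsto_const] filterlim_at_top_imp_at_infinity)
  qed
  have "(\<lambda>n. Ln (1 + ?d / W e h (X n) t)) \<longlonglongrightarrow> Ln (1 + 0)"
    by (intro tendsto_Ln tendsto_intros lim0) auto
  then have l: "(\<lambda>n. Ln (1 + ?d / W e h (X n) t)) \<longlonglongrightarrow> 0" by simp
  have "\<forall>\<^sub>F n in sequentially. Ln (1 + ?d / W e h (X n) t) = Ln (W e h (X n) s) - Ln (W e h (X n) t)"
    using big
  proof eventually_elim
    case (elim n)
    have nz: "W e h (X n) t \<noteq> 0" by (rule W_nz) (use e h in auto)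
    have sg: "0 < X n - s \<and> 0 < X n - t \<or> X n - s < 0 \<and> X n - t < 0" using elim by linarith
    have "e = 1 \<or> e = -1" using e by (auto simp: abs_if split: if_splits)
    then have "Ln (W e h (X n) s) - Ln (W e h (X n) t) = Ln (W e h (X n) s / W e h (X n) t)"
      using sg by (intro Ln_diff_eq_Ln_divide) auto
    also have "W e h (X n) s / W e h (X n) t = 1 + ?d / W e h (X n) t"
      using nz by (simp add: d[of "X n", symmetric] diff_divide_distrib)
    finally show ?case by simp
  qed
  then show ?thesis using l by (rule Lim_transform_eventually[rotated])
qed

text \<open>Partial fractions: 1/W_s - 1/W_t is a constant multiple of 1/(W_s W_t), with a nonzero
  constant as s and t differ. Principal logarithms give a primitive on the entire line, and its
  boundary terms vanish at infinity.\<close>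

lemma pairker_integral_0:
  assumes e: "\<bar>e\<bar> = 1" and h: "0 < h" and st: "s \<noteq> t"
  shows "(LINT x|lborel. pairker e h s t x) = 0"
proof -
  let ?f = "pairker e h s t"
  let ?d = "W e h 0 t - W e h 0 s"
  have d: "W e h x t - W e h x s = ?d" for x by (simp add: W_def algebra_simps)
  have "Im ?d \<noteq> 0" using st e by (auto simp: algebra_simps)
  then have dnz: "?d \<noteq> 0" by (metis zero_complex.simps(2))
  have enz: "complex_of_real e \<noteq> 0" using e by auto
  let ?c = "\<i> / (of_real e * ?d)"
  define P where "P x = ?c * (Ln (W e h x s) - Ln (W e h x t))" for x
  have nz: "W e h x s \<noteq> 0" "W e h x t \<noteq> 0" for x using W_nz e h by auto
  have diff_eq: "c / a - c / b = c * ((b - a) / (a * b))" if "a \<noteq> 0" "b \<noteq> 0" for a b c :: complex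
    using that by (simp add: field_simps)
  have cancel: "\<i> / (a * b) * (- \<i> * a * b * c) = c" if "a \<noteq> 0" "b \<noteq> 0" for a b c :: complex
    using that by simp
  have D: "(P has_vector_derivative ?f x) (at x)" for x
  proof -
    have "(P has_vector_derivative ?c * (- \<i> * of_real e * tau x / W e h x s - (- \<i> * of_real e * tau x / W e h x t))) (at x)"
      unfolding P_def
      by (intro has_vector_derivative_mult_right has_vector_derivative_diff Ln_W_DERIV_x) (use e h in auto)
    moreover have "?c * (- \<i> * of_real e * tau x / W e h x s - (- \<i> * of_real e * tau x / W e h x t)) = ?f x"
    proof -
      have "- \<i> * of_real e * tau x / W e h x s - (- \<i> * of_real e * tau x / W e h x t)
          = - \<i> * of_real e * tau x * ((W e h x t - W e h x s) / (W e h x s * W e h x t))"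
        by (rule diff_eq[OF nz(1)[of x] nz(2)[of x]])
      also have "\<dots> = - \<i> * of_real e * ?d * ?f x" unfolding d[of x] pairker_def by (simp add: mult_ac)
      finally show ?thesis using cancel[OF enz dnz] by simp
    qed
    ultimately show ?thesis by (rule has_vector_derivative_eq_rhs)
  qed
  have fc: "isCont ?f x" for x unfolding pairker_def[abs_def]
    using nz by (intro continuous_intros tau_cont W_cont) auto
  have int: "(LINT x|lborel. indicator {- real n..real n} x *\<^sub>R ?f x) = P (real n) - P (- real n)" for n :: nat
    by (rule integral_FTC_atLeastAtMost)
      (use D fc in \<open>auto intro: has_vector_derivative_at_within continuous_at_imp_continuous_on\<close>)
  have "(\<lambda>n. Ln (W e h (real n) s) - Ln (W e h (real n) t)) \<longlonglongrightarrow> 0"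
    by (rule Ln_W_diff_at_infinity[OF e h]) (auto intro: filterlim_real_sequentially)
  moreover have "(\<lambda>n. Ln (W e h (- real n) s) - Ln (W e h (- real n) t)) \<longlonglongrightarrow> 0"
    by (rule Ln_W_diff_at_infinity[OF e h]) (auto intro: filterlim_real_sequentially)
  ultimately have "(\<lambda>n. P (real n) - P (- real n)) \<longlonglongrightarrow> ?c * 0 - ?c * 0"
    unfolding P_def by (intro tendsto_intros)
  moreover have "(\<lambda>n. LINT x|lborel. indicator {- real n..real n} x *\<^sub>R ?f x) \<longlonglongrightarrow> (LINT x|lborel. ?f x)"
  proof (rule integral_dominated_convergence[where w = "\<lambda>x. norm (?f x)"])
    note i = pairker_integrable[OF e h, of s t]
    show "integrable lborel (\<lambda>x. norm (?f x))" using i by simp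
    show "?f \<in> borel_measurable lborel" using i by auto
    then show "(\<lambda>x. indicator {- real n..real n} x *\<^sub>R ?f x) \<in> borel_measurable lborel" for n by measurable
    show "AE x in lborel. (\<lambda>n. indicator {- real n..real n} x *\<^sub>R ?f x) \<longlonglongrightarrow> ?f x"
    proof (rule AE_I2)
      fix x :: real
      obtain N where "\<bar>x\<bar> \<le> real N" using real_arch_simple by blast
      then show "(\<lambda>n. indicator {- real n..real n} x *\<^sub>R ?f x) \<longlonglongrightarrow> ?f x"
        by (intro tendsto_eventually eventually_sequentiallyI[of N]) (auto simp: indicator_def)
    qed
    show "AE x in lborel. norm (indicator {- real n..real n} x *\<^sub>R ?f x) \<le> norm (?f x)" for n
      by (auto simp: indicator_def)
  qed
  ultimately have "(LINT x|lborel. ?f x) = ?c * 0 - ?c * 0" unfolding int by (rule LIMSEQ_unique[rotated])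
  then show ?thesis by simp
qed

text \<open>tau(x)/\<pi> times the integral of \<phi>(s)/(z(x) + i e h - z(s)). The factor tau turns
  the imaginary part of the limit kernel into \<pi> times that of A(f), and makes U^2/tau dx the
  square of the Cauchy integral times dz/\<pi>^2.\<close>

definition U :: "real \<Rightarrow> real \<Rightarrow> (real \<Rightarrow> real) \<Rightarrow> real \<Rightarrow> complex" where
  "U e h \<phi> x = (1 / pi) *\<^sub>R (LINT s|lborel. of_real (\<phi> s) * (tau x * (- \<i> * of_real e) / W e h x s))"

lemma kernel_section_integrable:
  assumes e: "\<bar>e\<bar> = 1" and h: "0 < h" and \<phi>: "integrable lborel \<phi>"
  shows "integrable lborel (\<lambda>s. complex_of_real (\<phi> s) * (tau x * (- \<i> * of_real e) / W e h x s))"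
proof -
  obtain c where c: "0 < c" "\<And>x s. c \<le> norm (W e h x s)" using W_ge_h[OF e h] by blast
  have [measurable]: "\<phi> \<in> borel_measurable borel" using \<phi> by auto
  show ?thesis
  proof (rule Bochner_Integration.integrable_bound[of lborel "\<lambda>s. (norm (tau x) / c) * \<phi> s"])
    show "integrable lborel (\<lambda>s. (norm (tau x) / c) * \<phi> s)" using \<phi> by simp
    show "AE s in lborel. norm (complex_of_real (\<phi> s) * (tau x * (- \<i> * of_real e) / W e h x s)) \<le> norm ((norm (tau x) / c) * \<phi> s)"
    proof (rule AE_I2)
      fix s
      have "norm (tau x) / norm (W e h x s) \<le> norm (tau x) / c"
        using c(1) c(2)[of x s] by (intro divide_left_mono mult_pos_pos) auto
      then have "\<bar>\<phi> s\<bar> * (norm (tau x) / norm (W e h x s)) \<le> \<bar>\<phi> s\<bar> * (norm (tau x) / c)" by (intro mult_left_mono) auto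
      then show "norm (complex_of_real (\<phi> s) * (tau x * (- \<i> * of_real e) / W e h x s)) \<le> norm ((norm (tau x) / c) * \<phi> s)"
        using e c(1) by (simp add: norm_mult norm_divide abs_mult mult.commute)
    qed
  qed measurable
qed

lemma complex_tensor:
  fixes f g :: "real \<Rightarrow> complex"
  assumes f: "integrable lborel f" and g: "integrable lborel g"
  shows "(LINT z|lborel. f (fst z) * g (snd z)) = (LINT x|lborel. f x) * (LINT x|lborel. g x)"
proof -
  have [measurable]: "f \<in> borel_measurable borel" "g \<in> borel_measurable borel" using f g by auto
  have i: "integrable (lborel \<Otimes>\<^sub>M lborel) (\<lambda>z. f (fst z) * g (snd z))"
  proof (rule Bochner_Integration.integrable_bound[OF integrable_tensor_fst_snd[of "\<lambda>x. norm (f x)" "\<lambda>x. norm (g x)"]])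
    show "AE z in lborel \<Otimes>\<^sub>M lborel. norm (f (fst z) * g (snd z)) \<le> norm (norm (f (fst z)) * norm (g (snd z)))"
      by (simp add: norm_mult)
  qed (use f g in auto)
  have "(LINT z|lborel. f (fst z) * g (snd z)) = (LINT z|(lborel \<Otimes>\<^sub>M lborel). f (fst z) * g (snd z))"
    by (simp add: lborel_prod)
  also have "\<dots> = (LINT x|lborel. LINT y|lborel. f x * g y)"
    using lborel_pair.integral_fst'[OF i] by simp
  also have "\<dots> = (LINT x|lborel. f x) * (LINT x|lborel. g x)" by simp
  finally show ?thesis .
qed

text \<open>Closing the contour at infinity: the square of a Cauchy integral shifted off the graph has
  vanishing integral against \<open>dz\<close>. After Fubini this is the vanishing of the integral of
  \<open>dz / ((z - a) (z - b))\<close>, whose primitive is a difference of logarithms.\<close>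

lemma U_square_integral_0:
  assumes e: "\<bar>e\<bar> = 1" and h: "0 < h" and \<phi>: "integrable lborel \<phi>"
  shows "(LINT x|lborel. (U e h \<phi> x)\<^sup>2 / tau x) = 0"
proof -
  have [measurable]: "\<phi> \<in> borel_measurable borel" using \<phi> by auto
  obtain C where C: "0 < C" "\<And>s t x. x \<noteq> s \<Longrightarrow> x \<noteq> t \<Longrightarrow>
    norm (pairker e h s t x) \<le> C * (two_power 0 (-2) (x - s) + two_power 0 (-2) (x - t))"
    using pairker_bound[OF e h] by blast
  let ?f = "\<lambda>z x. complex_of_real (\<phi> (fst z) * \<phi> (snd z)) * pairker e h (fst z) (snd z) x"
  let ?T = "LINT x|lborel. two_power 0 (-2) x"
  have fm: "(\<lambda>(z, x). ?f z x) \<in> borel_measurable (lborel \<Otimes>\<^sub>M lborel)"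
  proof -
    have [measurable]: "(\<lambda>z. fst (fst z)) \<in> borel_measurable (lborel \<Otimes>\<^sub>M (lborel :: real measure))"
      "(\<lambda>z. snd (fst z)) \<in> borel_measurable (lborel \<Otimes>\<^sub>M (lborel :: real measure))"
      by (auto intro!: measurable_compose[OF measurable_fst] borel_measurable_continuous_onI continuous_intros)
    show ?thesis unfolding pairker_def case_prod_beta' by measurable
  qed
  have tt: "integrable (lborel :: (real \<times> real) measure) (\<lambda>z. \<bar>\<phi> (fst z)\<bar> * \<bar>\<phi> (snd z)\<bar>)"
    using integrable_tensor_fst_snd[of "\<lambda>x. \<bar>\<phi> x\<bar>" "\<lambda>x. \<bar>\<phi> x\<bar>"] \<phi> by (simp add: lborel_prod)
  have npk: "(LINT x|lborel. norm (pairker e h s t x)) \<le> C * (?T + ?T)" for s t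
  proof -
    have "(LINT x|lborel. norm (pairker e h s t x)) \<le> (LINT x|lborel. C * (two_power 0 (-2) (x - s) + two_power 0 (-2) (x - t)))"
    proof (rule integral_mono_AE)
      show "AE x in lborel. norm (pairker e h s t x) \<le> C * (two_power 0 (-2) (x - s) + two_power 0 (-2) (x - t))"
        using AE_lborel_singleton[of s] AE_lborel_singleton[of t] by eventually_elim (use C(2) in auto)
    qed (use pairker_integrable[OF e h] two_power_shift[of 0 "-2"] in auto)
    also have "\<dots> = C * (?T + ?T)" using two_power_shift[of 0 "-2"] by simp
    finally show ?thesis .
  qed
  have int: "integrable (lborel \<Otimes>\<^sub>M lborel) (\<lambda>(z, x). ?f z x)"
  proof (rule lborel_pair.Fubini_integrable[OF fm])
    show "AE z in lborel. integrable lborel (\<lambda>x. case (z, x) of (z, x) \<Rightarrow> ?f z x)"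
      using pairker_integrable[OF e h] by auto
    have eq: "(LINT x|lborel. norm (case (z, x) of (z, x) \<Rightarrow> ?f z x)) = \<bar>\<phi> (fst z)\<bar> * \<bar>\<phi> (snd z)\<bar> * (LINT x|lborel. norm (pairker e h (fst z) (snd z) x))" for z
      by (simp add: norm_mult abs_mult)
    show "integrable lborel (\<lambda>z. LINT x|lborel. norm (case (z, x) of (z, x) \<Rightarrow> ?f z x))"
    proof (rule Bochner_Integration.integrable_bound[of lborel "\<lambda>z. C * (?T + ?T) * (\<bar>\<phi> (fst z)\<bar> * \<bar>\<phi> (snd z)\<bar>)"])
      show "integrable lborel (\<lambda>z. C * (?T + ?T) * (\<bar>\<phi> (fst z)\<bar> * \<bar>\<phi> (snd z)\<bar>))" using tt by simp
      show "(\<lambda>z. LINT x|lborel. norm (case (z, x) of (z, x) \<Rightarrow> ?f z x)) \<in> borel_measurable lborel"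
        by (rule lborel.borel_measurable_lebesgue_integral) (use fm in measurable)
      show "AE z in lborel. norm (LINT x|lborel. norm (case (z, x) of (z, x) \<Rightarrow> ?f z x)) \<le> norm (C * (?T + ?T) * (\<bar>\<phi> (fst z)\<bar> * \<bar>\<phi> (snd z)\<bar>))"
      proof (rule AE_I2)
        fix z :: "real \<times> real"
        have "\<bar>\<phi> (fst z)\<bar> * \<bar>\<phi> (snd z)\<bar> * (LINT x|lborel. norm (pairker e h (fst z) (snd z) x)) \<le> \<bar>\<phi> (fst z)\<bar> * \<bar>\<phi> (snd z)\<bar> * (C * (?T + ?T))"
          by (intro mult_left_mono npk) auto
        moreover have "0 \<le> (LINT x|lborel. norm (pairker e h (fst z) (snd z) x))" by (rule Bochner_Integration.integral_nonneg) auto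
        ultimately show "norm (LINT x|lborel. norm (case (z, x) of (z, x) \<Rightarrow> ?f z x)) \<le> norm (C * (?T + ?T) * (\<bar>\<phi> (fst z)\<bar> * \<bar>\<phi> (snd z)\<bar>))"
          unfolding eq by (simp add: mult_ac order_trans[OF _ abs_ge_self])
      qed
    qed
  qed
  have zero: "(LINT z|lborel. LINT x|lborel. ?f z x) = 0"
  proof (rule integral_eq_zero_AE)
    show "AE z in lborel. (LINT x|lborel. ?f z x) = 0"
      using AE_off_diagonal_real by eventually_elim (simp add: pairker_integral_0[OF e h])
  qed
  \<comment> \<open>Since (-i e)^2 = -1, the product of the two section kernels is -tau times the
    integrand \<open>?f\<close>; the product of the integrals is \<pi>^2 U^2.\<close>
  have inner: "(LINT z|lborel. ?f z x) = - of_real (pi\<^sup>2) * ((U e h \<phi> x)\<^sup>2 / tau x)" for x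
  proof -
    let ?k = "\<lambda>s. complex_of_real (\<phi> s) * (tau x * (- \<i> * of_real e) / W e h x s)"
    have e2: "complex_of_real e * complex_of_real e = 1" using e by (auto simp: abs_if split: if_splits)
    have gen: "(a * (t * (- \<i> * c) * v)) * (b * (t * (- \<i> * c) * w)) = - (t * ((a * b) * (t * (v * w))))"
      if "c * c = 1" for a b c t v w :: complex
    proof -
      have "(a * (t * (- \<i> * c) * v)) * (b * (t * (- \<i> * c) * w)) = (\<i> * \<i>) * (c * c) * (t * ((a * b) * (t * (v * w))))"
        by (simp only: mult_ac minus_mult_left[symmetric] minus_mult_right[symmetric] minus_minus)
      then show ?thesis unfolding that by simp
    qed
    have kk: "?k (fst z) * ?k (snd z) = - (tau x * ?f z x)" for z
      unfolding pairker_def divide_inverse inverse_mult_distrib of_real_mult by (rule gen[OF e2])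
    have "- (tau x * (LINT z|lborel. ?f z x)) = (LINT z|lborel. - (tau x * ?f z x))"
      by (simp only: Bochner_Integration.integral_minus integral_mult_right_zero)
    also have "\<dots> = (LINT z|lborel. ?k (fst z) * ?k (snd z))" unfolding kk ..
    also have "\<dots> = (LINT s|lborel. ?k s) * (LINT s|lborel. ?k s)"
      by (rule complex_tensor[OF kernel_section_integrable[OF e h \<phi>] kernel_section_integrable[OF e h \<phi>]])
    also have "(LINT s|lborel. ?k s) = of_real pi * U e h \<phi> x" by (simp add: U_def scaleR_conv_of_real)
    also have "of_real pi * U e h \<phi> x * (of_real pi * U e h \<phi> x) = of_real (pi\<^sup>2) * (U e h \<phi> x)\<^sup>2"
      by (simp only: power2_eq_square of_real_mult mult_ac)
    finally have "- (tau x * (LINT z|lborel. ?f z x)) = of_real (pi\<^sup>2) * (U e h \<phi> x)\<^sup>2" .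
    from arg_cong[OF this, of uminus]
    have "tau x * (LINT z|lborel. ?f z x) = - (of_real (pi\<^sup>2) * (U e h \<phi> x)\<^sup>2)"
      by (simp only: minus_minus)
    then have "tau x * (LINT z|lborel. ?f z x) / tau x = - (of_real (pi\<^sup>2) * (U e h \<phi> x)\<^sup>2) / tau x"
      by (simp only:)
    then show ?thesis
      by (simp only: nonzero_mult_div_cancel_left[OF tau_nz] minus_mult_left times_divide_eq_right minus_divide_left)
  qed
  have "(LINT x|lborel. LINT z|lborel. ?f z x) = 0"
    using lborel_pair.Fubini_integral[OF int] zero by simp
  then have "- of_real (pi\<^sup>2) * (LINT x|lborel. (U e h \<phi> x)\<^sup>2 / tau x) = 0"
    unfolding inner by (simp only: integral_mult_right_zero)
  then show ?thesis by (simp only: mult_eq_0_iff neg_equal_0_iff_equal of_real_eq_0_iff zero_eq_power2 pi_neq_zero power2_eq_square simp_thms)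
qed

end

section \<open>Boundary kernels on the graph and the jump of the argument\<close>

context graph
begin

definition ker0 :: "real \<Rightarrow> real \<Rightarrow> complex" where
  "ker0 x s = inverse (of_real (x - s) + \<i> * of_real (F x - F s))"

text \<open>The kernel of A(f) after the substitution s = x - y: the adjoint double layer kernel of
  the graph.\<close>

definition adl :: "real \<Rightarrow> real \<Rightarrow> real" where
  "adl x s = 1 / pi * (((x - s) * G x - (F x - F s)) / ((x - s)\<^sup>2 + (F x - F s)\<^sup>2))"

text \<open>The double layer kernel, equal to -\<pi> times \<open>adl\<close> with exchanged
  arguments. For e = 1 and h = 0 it is minus the derivative in s of the argument of W, which allows
  it to be integrated explicitly.\<close>

definition dl :: "real \<Rightarrow> real \<Rightarrow> real" where
  "dl x s = ((x - s) * G s - (F x - F s)) / ((x - s)\<^sup>2 + (F x - F s)\<^sup>2)"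

text \<open>The rotation cancels, so both sides of the graph have the same limit kernel 1/(z(x) -
  z(s)); the jump has to come from the singularity.\<close>

lemma ker0_eq: assumes "\<bar>e\<bar> = 1" shows "(- \<i> * of_real e) / W e 0 x s = ker0 x s"
proof -
  have "W e 0 x s = (- \<i> * of_real e) * (of_real (x - s) + \<i> * of_real (F x - F s))"
    by (simp add: complex_eq_iff)
  moreover have "- \<i> * complex_of_real e \<noteq> 0" using assms by auto
  ultimately show ?thesis unfolding ker0_def
    by (metis divide_inverse inverse_mult_distrib mult.assoc mult.left_neutral right_inverse)
qed

lemma Im_tau_ker0:
  "Im (tau x * ker0 x s) = pi * adl x s" "Im (tau s * ker0 x s) = dl x s"
proof -
  have i: "ker0 x s = Complex ((x - s) / ((x - s)\<^sup>2 + (F x - F s)\<^sup>2)) (- (F x - F s) / ((x - s)\<^sup>2 + (F x - F s)\<^sup>2))"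
    by (simp add: ker0_def complex_eq_iff)
  have gen: "Im (tau u * Complex (a / D) (- b / D)) = (a * G u - b) / D" for a b D u :: real
    by (simp add: diff_divide_distrib mult.commute)
  show "Im (tau x * ker0 x s) = pi * adl x s" unfolding i gen adl_def by simp
  show "Im (tau s * ker0 x s) = dl x s" unfolding i gen dl_def ..
qed

text \<open>Hoelder continuity of G gains the factor |x - s|^\<gamma> in the numerator over the
  Cauchy singularity, which leaves a locally integrable kernel.\<close>

lemma taylor_kernel_bound:
  assumes "\<bar>(x - s) * g - (F x - F s)\<bar> \<le> L * \<bar>x - s\<bar> powr \<gamma> * \<bar>x - s\<bar>"
  shows "\<bar>((x - s) * g - (F x - F s)) / ((x - s)\<^sup>2 + (F x - F s)\<^sup>2)\<bar> \<le> L * \<bar>x - s\<bar> powr (\<gamma> - 1)"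
proof (cases "x = s")
  case False
  have pw: "y powr \<gamma> * y / y\<^sup>2 = y powr (\<gamma> - 1)" if "0 < y" for y :: real
    using that by (simp add: powr_diff power2_eq_square)
  have "\<bar>(x - s) * g - (F x - F s)\<bar> / \<bar>(x - s)\<^sup>2 + (F x - F s)\<^sup>2\<bar> \<le> \<bar>(x - s) * g - (F x - F s)\<bar> / (x - s)\<^sup>2"
    using False by (intro divide_left_mono) (auto intro!: mult_pos_pos add_pos_nonneg)
  also have "\<dots> \<le> (L * \<bar>x - s\<bar> powr \<gamma> * \<bar>x - s\<bar>) / (x - s)\<^sup>2"
    by (rule divide_right_mono[OF assms]) simp
  also have "\<dots> = L * (\<bar>x - s\<bar> powr \<gamma> * \<bar>x - s\<bar> / \<bar>x - s\<bar>\<^sup>2)" by simp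
  also have "\<bar>x - s\<bar> powr \<gamma> * \<bar>x - s\<bar> / \<bar>x - s\<bar>\<^sup>2 = \<bar>x - s\<bar> powr (\<gamma> - 1)"
    by (rule pw) (use False in simp)
  finally show ?thesis by (simp add: abs_divide)
qed simp

lemma dl_bound: "\<bar>dl x s\<bar> \<le> L * \<bar>x - s\<bar> powr (\<gamma> - 1)"
  unfolding dl_def by (rule taylor_kernel_bound[OF F_taylor(2)])

lemma adl_bound: "\<bar>adl x s\<bar> \<le> L * \<bar>x - s\<bar> powr (\<gamma> - 1)"
proof -
  have "\<bar>adl x s\<bar> = 1 / pi * \<bar>((x - s) * G x - (F x - F s)) / ((x - s)\<^sup>2 + (F x - F s)\<^sup>2)\<bar>"
    unfolding adl_def abs_mult by simp
  also have "\<dots> \<le> 1 * \<bar>((x - s) * G x - (F x - F s)) / ((x - s)\<^sup>2 + (F x - F s)\<^sup>2)\<bar>"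
    using pi_ge_two by (intro mult_right_mono) (auto simp: divide_le_eq)
  finally show ?thesis using taylor_kernel_bound[OF F_taylor(1), of x s] by simp
qed

lemma adl_meas [measurable]:
  assumes [measurable]: "f \<in> borel_measurable M" "g \<in> borel_measurable M"
  shows "(\<lambda>z. adl (f z) (g z)) \<in> borel_measurable M"
  unfolding adl_def by measurable

lemma dl_meas [measurable]:
  assumes [measurable]: "f \<in> borel_measurable M" "g \<in> borel_measurable M"
  shows "(\<lambda>z. dl (f z) (g z)) \<in> borel_measurable M"
  unfolding dl_def by measurable

lemma ker0_meas [measurable]:
  assumes [measurable]: "f \<in> borel_measurable M" "g \<in> borel_measurable M"
  shows "(\<lambda>z. ker0 (f z) (g z)) \<in> borel_measurable M"
  unfolding ker0_def by measurable

lemma powr_le_two_power: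
  assumes "\<bar>y\<bar> \<le> M" "1 \<le> M"
  shows "\<bar>y\<bar> powr (\<gamma> - 1) \<le> two_power (\<gamma> - 1) (-2) y + M powr \<gamma>"
proof (cases "\<bar>y\<bar> < 1")
  case False
  have "\<bar>y\<bar> powr (\<gamma> - 1) \<le> \<bar>y\<bar> powr \<gamma>" using False by (intro powr_mono) auto
  also have "\<dots> \<le> M powr \<gamma>" using assms gam by (intro powr_mono2) auto
  finally show ?thesis using two_power_nonneg[of "\<gamma> - 1" "-2" y] by linarith
qed (simp add: two_power_def)

lemma weak_singularity_integrable:
  assumes "1 \<le> M" shows "integrable lborel (\<lambda>s. indicator {x - M..x + M} s * \<bar>x - s\<bar> powr (\<gamma> - 1))"
proof (rule Bochner_Integration.integrable_bound)
  show "integrable lborel (\<lambda>s. two_power (\<gamma> - 1) (-2) (x - s) + M powr \<gamma> * indicator {x - M..x + M} s)"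
    using gam by (intro Bochner_Integration.integrable_add integrable_reflect two_power_integrable) (auto simp: emeasure_lborel_Icc_eq)
  show "AE s in lborel. norm (indicator {x - M..x + M} s * \<bar>x - s\<bar> powr (\<gamma> - 1)) \<le> norm (two_power (\<gamma> - 1) (-2) (x - s) + M powr \<gamma> * indicator {x - M..x + M} s)"
  proof (rule AE_I2)
    fix s
    show "norm (indicator {x - M..x + M} s * \<bar>x - s\<bar> powr (\<gamma> - 1)) \<le> norm (two_power (\<gamma> - 1) (-2) (x - s) + M powr \<gamma> * indicator {x - M..x + M} s)"
    proof (cases "s \<in> {x - M..x + M}")
      case True
      then have "\<bar>x - s\<bar> \<le> M" by auto
      from powr_le_two_power[OF this assms] show ?thesis using True by simp
    qed simp
  qed
qed measurable

text \<open>The argument of \<open>z(x) - z(s)\<close> jumps by \<open>\<pi>\<close> across \<open>s = x\<close>; this produces the jump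
  term of the Plemelj formula.\<close>

lemma dl_integral:
  assumes M: "1 \<le> M"
  shows "(LINT s|lborel. indicator {x - M..x + M} s * dl x s)
    = Im (Ln (W 1 0 x (x - M)) - Ln (W 1 0 x (x + M))) + pi"
proof -
  define \<theta> where "\<theta> s = Im (Ln (W 1 0 x s))" for s
  define \<epsilon> where "\<epsilon> n = 1 / real (Suc n)" for n
  have \<epsilon>: "0 < \<epsilon> n" "\<epsilon> n \<le> 1" for n by (auto simp: \<epsilon>_def)
  have \<epsilon>0: "\<epsilon> \<longlonglongrightarrow> 0" unfolding \<epsilon>_def by (rule LIMSEQ_Suc[OF lim_1_over_n])
  have D: "(\<theta> has_real_derivative - dl x s) (at s)" if "x \<noteq> s" for s
  proof -
    have "(\<theta> has_vector_derivative Im (\<i> * of_real 1 * tau s / W 1 0 x s)) (at s)"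
      unfolding \<theta>_def
      by (rule bounded_linear.has_vector_derivative[OF bounded_linear_Im Ln_W_DERIV_s]) (use that in auto)
    moreover have "\<i> * of_real 1 * tau s / W 1 0 x s = - (tau s * ((- \<i> * of_real 1) / W 1 0 x s))" by simp
    ultimately show ?thesis
      using Im_tau_ker0(2)[of s x] by (simp only: ker0_eq abs_one has_real_derivative_iff_has_vector_derivative uminus_complex.sel)
  qed
  have c: "isCont (dl x) s" if "x \<noteq> s" for s
    unfolding dl_def[abs_def] using that F_cont G_cont
    by (intro continuous_intros) (auto simp: add_nonneg_eq_0_iff)
  let ?A = "\<lambda>n. {x - M..x - \<epsilon> n}" and ?B = "\<lambda>n. {x + \<epsilon> n..x + M}"
  have FTC: "(LINT s|lborel. dl x s * indicator {a..b} s) = \<theta> a - \<theta> b" if "a \<le> b" "x \<notin> {a..b}" for a b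
  proof -
    have "(LINT s|lborel. dl x s * indicator {a..b} s) = (- \<theta> b) - (- \<theta> a)"
    proof (rule integral_FTC_Icc_real[OF that(1)])
      fix s assume "a \<le> s" "s \<le> b"
      then have s: "x \<noteq> s" using that by auto
      show "DERIV (\<lambda>s. - \<theta> s) s :> dl x s" using DERIV_minus[OF D[OF s]] by simp
      show "isCont (dl x) s" by (rule c[OF s])
    qed
    then show ?thesis by simp
  qed
  have i: "integrable lborel (\<lambda>s. L * (indicator {x - M..x + M} s * \<bar>x - s\<bar> powr (\<gamma> - 1)))"
    by (intro integrable_mult_right weak_singularity_integrable[OF M])
  have AB: "integrable lborel (\<lambda>s. dl x s * indicator S s)" if "S \<subseteq> {x - M..x + M}" "S \<in> sets borel" for S
  proof (rule Bochner_Integration.integrable_bound[OF i])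
    show "(\<lambda>s. dl x s * indicator S s) \<in> borel_measurable lborel" using that by measurable
    show "AE s in lborel. norm (dl x s * indicator S s) \<le> norm (L * (indicator {x - M..x + M} s * \<bar>x - s\<bar> powr (\<gamma> - 1)))"
      using that dl_bound[of x] Lpos by (auto simp: indicator_def abs_mult subset_iff)
  qed
  let ?u = "\<lambda>n s. dl x s * indicator (?A n) s + dl x s * indicator (?B n) s"
  have "(\<lambda>n. LINT s|lborel. ?u n s) \<longlonglongrightarrow> (LINT s|lborel. indicator {x - M..x + M} s * dl x s)"
  proof (rule integral_dominated_convergence[OF _ _ i])
    show "AE s in lborel. (\<lambda>n. ?u n s) \<longlonglongrightarrow> indicator {x - M..x + M} s * dl x s"
      using AE_lborel_singleton[of x]
    proof eventually_elim
      case (elim s)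
      then have "0 < \<bar>s - x\<bar>" by simp
      from order_tendstoD(2)[OF \<epsilon>0 this] have "\<forall>\<^sub>F n in sequentially. ?u n s = indicator {x - M..x + M} s * dl x s"
      proof eventually_elim
        case (elim n)
        then show ?case using \<epsilon>(1)[of n] by (auto simp: indicator_def)
      qed
      then show ?case by (rule tendsto_eventually)
    qed
    show "AE s in lborel. norm (?u n s) \<le> L * (indicator {x - M..x + M} s * \<bar>x - s\<bar> powr (\<gamma> - 1))" for n
    proof (rule AE_I2)
      fix s
      have "norm (?u n s) \<le> indicator {x - M..x + M} s * \<bar>dl x s\<bar>"
        using \<epsilon>[of n] M by (auto simp: indicator_def)
      also have "\<dots> \<le> indicator {x - M..x + M} s * (L * \<bar>x - s\<bar> powr (\<gamma> - 1))"
        by (rule mult_left_mono[OF dl_bound]) simp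
      finally show "norm (?u n s) \<le> L * (indicator {x - M..x + M} s * \<bar>x - s\<bar> powr (\<gamma> - 1))"
        by (simp only: mult_ac)
    qed
  qed measurable
  moreover have "(LINT s|lborel. ?u n s) = (\<theta> (x - M) - \<theta> (x - \<epsilon> n)) + (\<theta> (x + \<epsilon> n) - \<theta> (x + M))" for n
  proof -
    have "(LINT s|lborel. ?u n s) = (LINT s|lborel. dl x s * indicator (?A n) s) + (LINT s|lborel. dl x s * indicator (?B n) s)"
      by (rule Bochner_Integration.integral_add) (use \<epsilon>[of n] M in \<open>auto intro!: AB\<close>)
    then show ?thesis using FTC[of "x - M" "x - \<epsilon> n"] FTC[of "x + \<epsilon> n" "x + M"] \<epsilon>[of n] M by simp
  qed
  moreover have "(\<lambda>n. (\<theta> (x - M) - \<theta> (x - \<epsilon> n)) + (\<theta> (x + \<epsilon> n) - \<theta> (x + M))) \<longlonglongrightarrow> (\<theta> (x - M) - \<theta> (x + M)) + pi"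
  proof -
    \<comment> \<open>Dividing W by \<epsilon> > 0 leaves its argument unchanged. The quotient tends
      to z from the right of x and to -z from the left, and the arguments of these differ by
      \<pi>.\<close>
    define z where "z = Complex (- G x) 1"
    have Q: "(\<lambda>n. (F (x + \<epsilon> n) - F x) / \<epsilon> n) \<longlonglongrightarrow> G x" "(\<lambda>n. (F (x + - \<epsilon> n) - F x) / - \<epsilon> n) \<longlonglongrightarrow> G x"
    proof -
      have d: "((\<lambda>h. (F (x + h) - F x) / h) \<longlongrightarrow> G x) (at 0)" using DF[of x] by (simp add: DERIV_def)
      have f1: "filterlim \<epsilon> (at 0) sequentially"
        using \<epsilon>0 \<epsilon>(1) by (auto simp: filterlim_at less_imp_neq[symmetric])
      have f2: "filterlim (\<lambda>n. - \<epsilon> n) (at 0) sequentially"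
        using tendsto_minus[OF \<epsilon>0] \<epsilon>(1) by (auto simp: filterlim_at less_imp_neq[symmetric])
      show "(\<lambda>n. (F (x + \<epsilon> n) - F x) / \<epsilon> n) \<longlonglongrightarrow> G x" by (rule filterlim_compose[OF d f1])
      show "(\<lambda>n. (F (x + - \<epsilon> n) - F x) / - \<epsilon> n) \<longlonglongrightarrow> G x" by (rule filterlim_compose[OF d f2])
    qed
    have "\<theta> (x + \<epsilon> n) = Im (Ln (Complex (- ((F (x + \<epsilon> n) - F x) / \<epsilon> n)) 1))" for n
    proof -
      have w: "W 1 0 x (x + \<epsilon> n) = of_real (\<epsilon> n) * Complex (- ((F (x + \<epsilon> n) - F x) / \<epsilon> n)) 1"
        using \<epsilon>(1)[of n] by (simp add: complex_eq_iff)
      show ?thesis unfolding \<theta>_def w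
        by (subst Ln_times_of_real) (use \<epsilon>(1)[of n] in \<open>auto simp: complex_eq_iff\<close>)
    qed
    moreover have "(\<lambda>n. Im (Ln (Complex (- ((F (x + \<epsilon> n) - F x) / \<epsilon> n)) 1))) \<longlonglongrightarrow> Im (Ln z)"
      unfolding z_def by (intro tendsto_Im tendsto_Ln tendsto_Complex tendsto_minus tendsto_const Q) (auto simp: complex_nonpos_Reals_iff)
    ultimately have 1: "(\<lambda>n. \<theta> (x + \<epsilon> n)) \<longlonglongrightarrow> Im (Ln z)" by simp
    have "\<theta> (x - \<epsilon> n) = Im (Ln (Complex ((F (x + - \<epsilon> n) - F x) / - \<epsilon> n) (-1)))" for n
    proof -
      have w: "W 1 0 x (x - \<epsilon> n) = of_real (\<epsilon> n) * Complex ((F (x + - \<epsilon> n) - F x) / - \<epsilon> n) (-1)"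
        using \<epsilon>(1)[of n] by (simp add: complex_eq_iff)
      show ?thesis unfolding \<theta>_def w
        by (subst Ln_times_of_real) (use \<epsilon>(1)[of n] in \<open>auto simp: complex_eq_iff\<close>)
    qed
    moreover have "(\<lambda>n. Im (Ln (Complex ((F (x + - \<epsilon> n) - F x) / - \<epsilon> n) (-1)))) \<longlonglongrightarrow> Im (Ln (Complex (G x) (-1)))"
      by (intro tendsto_Im tendsto_Ln tendsto_Complex tendsto_const Q) (auto simp: complex_nonpos_Reals_iff)
    ultimately have 2: "(\<lambda>n. \<theta> (x - \<epsilon> n)) \<longlonglongrightarrow> Im (Ln (- z))" by (simp add: z_def Complex_eq)
    have "Ln (- z) = Ln z - \<i> * pi" by (subst Ln_minus) (auto simp: z_def complex_eq_iff)
    then have "Im (Ln z) - Im (Ln (- z)) = pi" by simp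
    moreover have "(\<lambda>n. (\<theta> (x - M) - \<theta> (x - \<epsilon> n)) + (\<theta> (x + \<epsilon> n) - \<theta> (x + M))) \<longlonglongrightarrow> (\<theta> (x - M) - Im (Ln (- z))) + (Im (Ln z) - \<theta> (x + M))"
      by (intro tendsto_intros 1 2)
    ultimately show ?thesis by (simp add: algebra_simps)
  qed
  ultimately have "(LINT s|lborel. indicator {x - M..x + M} s * dl x s) = (\<theta> (x - M) - \<theta> (x + M)) + pi"
    using LIMSEQ_unique by simp
  then show ?thesis by (simp add: \<theta>_def)
qed

end

text \<open>The regularity of the density compensates the Cauchy singularity to first order, so
  boundary values exist at every point and from both sides.\<close>

locale graph_density = graph +
  fixes \<phi> :: "real \<Rightarrow> real" and K R \<Phi> :: real
  assumes lip: "\<And>x y. \<bar>\<phi> x - \<phi> y\<bar> \<le> K * \<bar>x - y\<bar>" and supp: "\<And>x. R < \<bar>x\<bar> \<Longrightarrow> \<phi> x = 0"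
    and bd: "\<And>x. \<bar>\<phi> x\<bar> \<le> \<Phi>" and R: "0 \<le> R" and K: "0 \<le> K"
begin

lemma \<Phi>: "0 \<le> \<Phi>" using bd[of 0] by linarith

lemma \<phi>_cont: "isCont \<phi> x"
proof -
  have "((\<lambda>y. K * \<bar>y - x\<bar>) \<longlongrightarrow> 0) (at x)" by (auto intro!: tendsto_eq_intros)
  then have "((\<lambda>y. \<phi> y - \<phi> x) \<longlongrightarrow> 0) (at x)"
    by (rule Lim_null_comparison[rotated]) (use lip in auto)
  then show ?thesis by (simp add: isCont_def LIM_zero_iff)
qed

lemma \<phi>_meas [measurable]: "\<phi> \<in> borel_measurable borel"
  using \<phi>_cont by (intro borel_measurable_continuous_onI continuous_at_imp_continuous_on) auto

lemma \<phi>_bounded_support: "bounded_support \<phi>"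
  unfolding bounded_support_def using supp order_trans[OF bd, of "R + \<Phi>"] R \<Phi>
  by (intro conjI exI[of _ "R + \<Phi>"]) auto

lemma \<phi>_int: "integrable lborel \<phi>"
  using bounded_support_Lp[OF \<phi>_bounded_support, of 1] integrable_abs_iff[of \<phi> lborel]
  by (simp add: Lp_def)

text \<open>Half the width of an interval that contains the support and is centred at x, as the jump
  formula demands; the extra 1 keeps its ends at distance at least 1 from x.\<close>

definition M where "M x = \<bar>x\<bar> + R + 1"

lemma M: "1 \<le> M x" using R by (simp add: M_def)

abbreviation J where "J x \<equiv> {x - M x..x + M x}"

lemma supp_J: "s \<notin> J x \<Longrightarrow> \<phi> s = 0"
  by (rule supp) (auto simp: M_def)

text \<open>Subtraction of the singularity. The subtracted term carries tau(s) and not tau(x),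
  because tau(s)/W is up to a constant the derivative in s of a logarithm and can be integrated
  exactly.\<close>

definition num where "num x s = of_real (\<phi> s) * tau x - of_real (\<phi> x) * tau s"

definition C1 where "C1 = K * (1 + L) + \<Phi> * L"

lemma C1: "0 \<le> C1" using K Lpos \<Phi> by (simp add: C1_def)

lemma num_meas [measurable]: "num x \<in> borel_measurable borel"
  unfolding num_def[abs_def] by measurable

text \<open>The density difference is Lipschitz and the tangent difference Hoelder, so both are of
  positive order in |x - s| and the quotient is only weakly singular.\<close>

lemma num_bound: assumes "x \<noteq> s" shows "norm (num x s) / \<bar>x - s\<bar> \<le> C1 * (1 + \<bar>x - s\<bar> powr (\<gamma> - 1))"
proof -
  have eq: "num x s = of_real (\<phi> s - \<phi> x) * tau x + of_real (\<phi> x) * (tau x - tau s)"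
    by (simp add: num_def algebra_simps)
  have "norm (num x s) \<le> \<bar>\<phi> s - \<phi> x\<bar> * norm (tau x) + \<bar>\<phi> x\<bar> * norm (tau x - tau s)"
    unfolding eq by (rule order_trans[OF norm_triangle_ineq]) (simp add: norm_mult flip: of_real_diff)
  also have "tau x - tau s = \<i> * of_real (G x - G s)" by (simp add: tau_def algebra_simps)
  also have "norm (\<i> * of_real (G x - G s)) = \<bar>G x - G s\<bar>" by (simp only: norm_mult norm_of_real norm_ii mult_1)
  also have "\<bar>\<phi> s - \<phi> x\<bar> * norm (tau x) + \<bar>\<phi> x\<bar> * \<bar>G x - G s\<bar> \<le> (K * \<bar>x - s\<bar>) * (1 + L) + \<Phi> * (L * \<bar>x - s\<bar> powr \<gamma>)"
    using lip[of s x] tau_norm[of x] bd[of x] HG[of x s] K Lpos \<Phi>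
    by (intro add_mono mult_mono) (auto simp: abs_minus_commute)
  finally have "norm (num x s) / \<bar>x - s\<bar> \<le> ((K * \<bar>x - s\<bar>) * (1 + L) + \<Phi> * (L * \<bar>x - s\<bar> powr \<gamma>)) / \<bar>x - s\<bar>"
    by (rule divide_right_mono) simp
  also have "\<dots> = K * (1 + L) * 1 + \<Phi> * L * \<bar>x - s\<bar> powr (\<gamma> - 1)"
    using assms by (simp add: powr_diff add_divide_distrib)
  also have "\<dots> \<le> C1 * 1 + C1 * \<bar>x - s\<bar> powr (\<gamma> - 1)"
    using K Lpos \<Phi> by (intro add_mono mult_right_mono) (auto simp: C1_def)
  finally show ?thesis by (simp add: distrib_left)
qed

text \<open>A majorant that depends neither on the height h nor on the side e, for passing to the
  boundary and for bounds uniform in h.\<close>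

definition num_majorant where "num_majorant x s = C1 * ((1 + M x powr \<gamma>) * indicator (J x) s + two_power (\<gamma> - 1) (-2) (x - s))"

lemma num_majorant_integrable: "integrable lborel (num_majorant x)"
  unfolding num_majorant_def[abs_def] using gam
  by (intro integrable_mult_right Bochner_Integration.integrable_add integrable_reflect two_power_integrable) (auto simp: emeasure_lborel_Icc_eq)

lemma num_majorant_integral: "(LINT s|lborel. num_majorant x s) = C1 * ((1 + M x powr \<gamma>) * (2 * M x) + (LINT y|lborel. two_power (\<gamma> - 1) (-2) y))"
proof -
  have i: "integrable lborel (\<lambda>s. (1 + M x powr \<gamma>) * indicator (J x) s)" by (auto simp: emeasure_lborel_Icc_eq)
  have i2: "integrable lborel (\<lambda>s. two_power (\<gamma> - 1) (-2) (x - s))"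
    using gam by (intro integrable_reflect two_power_integrable) auto
  have "(LINT s|lborel. indicator (J x) s) = 2 * M x" using M[of x] by simp
  then show ?thesis unfolding num_majorant_def using i i2 by (simp add: integral_reflect)
qed

lemma num_majorant_bound:
  assumes "x \<noteq> s" shows "indicator (J x) s * (norm (num x s) / \<bar>x - s\<bar>) \<le> num_majorant x s"
proof (cases "s \<in> J x")
  case True
  then have "\<bar>x - s\<bar> \<le> M x" by auto
  from powr_le_two_power[OF this M]
  have "C1 * (1 + \<bar>x - s\<bar> powr (\<gamma> - 1)) \<le> C1 * ((1 + M x powr \<gamma>) + two_power (\<gamma> - 1) (-2) (x - s))"
    using C1 by (intro mult_left_mono) auto
  then show ?thesis using num_bound[OF assms] True by (simp add: num_majorant_def)
next
  case False
  then show ?thesis using C1 by (simp add: num_majorant_def two_power_nonneg)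
qed

lemma num_W_bound:
  assumes "\<bar>e\<bar> = 1" "x \<noteq> s"
  shows "norm (indicator (J x) s *\<^sub>R (num x s * ((- \<i> * of_real e) / W e h x s))) \<le> num_majorant x s"
proof -
  have pos: "0 < \<bar>x - s\<bar>" "\<bar>x - s\<bar> \<le> norm (W e h x s)" using assms W_ge by auto
  have n: "norm (- \<i> * complex_of_real e) = 1" using assms by (simp add: norm_mult)
  have "norm (indicator (J x) s *\<^sub>R (num x s * ((- \<i> * of_real e) / W e h x s))) = indicator (J x) s * (norm (num x s) / norm (W e h x s))"
    using assms(1) by (simp add: norm_mult norm_divide indicator_def)
  also have "\<dots> \<le> indicator (J x) s * (norm (num x s) / \<bar>x - s\<bar>)"
    using pos by (intro mult_left_mono divide_left_mono mult_pos_pos) auto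
  finally show ?thesis using num_majorant_bound[OF assms(2)] by linarith
qed

lemma num_W_integrable:
  assumes "\<bar>e\<bar> = 1"
  shows "integrable lborel (\<lambda>s. indicator (J x) s *\<^sub>R (num x s * ((- \<i> * of_real e) / W e h x s)))"
proof (rule Bochner_Integration.integrable_bound[OF num_majorant_integrable])
  show "(\<lambda>s. indicator (J x) s *\<^sub>R (num x s * ((- \<i> * of_real e) / W e h x s))) \<in> borel_measurable lborel" by measurable
  show "AE s in lborel. norm (indicator (J x) s *\<^sub>R (num x s * ((- \<i> * of_real e) / W e h x s))) \<le> norm (num_majorant x s)"
    using AE_lborel_singleton[of x]
  proof eventually_elim
    case (elim s)
    then show ?case using num_W_bound[OF assms, of x s h] by auto
  qed
qed

definition E0 where "E0 x = (LINT s|lborel. indicator (J x) s *\<^sub>R (num x s * ker0 x s))"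
definition Lam where "Lam e h x = Ln (W e h x (x - M x)) - Ln (W e h x (x + M x))"
text \<open>The boundary value of U from the side e. The integral \<open>E0\<close> is common to
  both sides; only the logarithms in \<open>Lam\<close> see the side.\<close>

definition V where "V e x = (1 / pi) *\<^sub>R (E0 x + of_real (\<phi> x) * Lam e 0 x)"

lemma U_decomp:
  assumes e: "\<bar>e\<bar> = 1" and h: "0 < h"
  shows "U e h \<phi> x = (1 / pi) *\<^sub>R ((LINT s|lborel. indicator (J x) s *\<^sub>R (num x s * ((- \<i> * of_real e) / W e h x s))) + of_real (\<phi> x) * Lam e h x)"
proof -
  let ?q = "\<lambda>s. indicator (J x) s *\<^sub>R (- (\<i> * of_real e * tau s / W e h x s))"
  have nz: "W e h x s \<noteq> 0" for s using W_nz e h by auto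
  have cq: "isCont (\<lambda>s. - (\<i> * of_real e * tau s / W e h x s)) s" for s
    using nz by (intro continuous_intros tau_cont W_cont) auto
  have q: "(LINT s|lborel. ?q s) = Lam e h x"
  proof -
    have "(LINT s|lborel. ?q s) = (- Ln (W e h x (x + M x))) - (- Ln (W e h x (x - M x)))"
    proof (rule integral_FTC_atLeastAtMost[where F = "\<lambda>s. - Ln (W e h x s)"])
      show "((\<lambda>s. - Ln (W e h x s)) has_vector_derivative - (\<i> * of_real e * tau s / W e h x s)) (at s within J x)" for s
        by (rule has_vector_derivative_at_within, rule has_vector_derivative_minus, rule Ln_W_DERIV_s) (use e h in auto)
      show "continuous_on (J x) (\<lambda>s. - (\<i> * of_real e * tau s / W e h x s))"
        by (intro continuous_at_imp_continuous_on ballI cq)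
    qed (use M[of x] in auto)
    then show ?thesis by (simp add: Lam_def)
  qed
  have qi: "integrable lborel ?q"
    by (rule borel_integrable_compact) (auto intro!: continuous_at_imp_continuous_on cq)
  let ?A = "\<lambda>s. indicator (J x) s *\<^sub>R (num x s * ((- \<i> * of_real e) / W e h x s))"
  have gen: "a * (t * (- \<i> * c) / w) = (a * t - b * u) * ((- \<i> * c) / w) + b * (- (\<i> * c * u / w))" for a b c t u w :: complex
    by (simp add: divide_inverse algebra_simps)
  have pt: "complex_of_real (\<phi> s) * (tau x * (- \<i> * of_real e) / W e h x s) = ?A s + of_real (\<phi> x) * ?q s" for s
  proof (cases "s \<in> J x")
    case True
    then have "indicator (J x) s = (1::real)" by simp
    then show ?thesis unfolding num_def by (simp only: scaleR_one gen[of _ _ _ _ "of_real (\<phi> x)" "tau s"])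
  next
    case False
    then show ?thesis using supp_J[OF False] by simp
  qed
  have "(LINT s|lborel. complex_of_real (\<phi> s) * (tau x * (- \<i> * of_real e) / W e h x s))
      = (LINT s|lborel. ?A s) + (LINT s|lborel. of_real (\<phi> x) * ?q s)"
    unfolding pt by (rule Bochner_Integration.integral_add[OF num_W_integrable[OF e]]) (rule integrable_mult_right[OF qi])
  also have "(LINT s|lborel. of_real (\<phi> x) * ?q s) = of_real (\<phi> x) * Lam e h x"
    unfolding integral_mult_right_zero q ..
  finally show ?thesis unfolding U_def by (simp only:)
qed

lemma Lam_tendsto:
  assumes e: "\<bar>e\<bar> = 1" shows "(\<lambda>n. Lam e (1 / real (Suc n)) x) \<longlonglongrightarrow> Lam e 0 x"
proof -
  have w: "(\<lambda>n. W e (1 / real (Suc n)) x s) \<longlonglongrightarrow> W e 0 x s" for s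
    unfolding W_def by (intro tendsto_intros LIMSEQ_Suc[OF lim_1_over_n])
  show ?thesis unfolding Lam_def
    using M[of x] by (intro tendsto_diff tendsto_Ln w W_slit e) auto
qed

lemma U_tendsto:
  assumes e: "\<bar>e\<bar> = 1" shows "(\<lambda>n. U e (1 / real (Suc n)) \<phi> x) \<longlonglongrightarrow> V e x"
proof -
  have w: "(\<lambda>n. W e (1 / real (Suc n)) x s) \<longlonglongrightarrow> W e 0 x s" for s
    unfolding W_def by (intro tendsto_intros LIMSEQ_Suc[OF lim_1_over_n])
  have lim: "(\<lambda>n. LINT s|lborel. indicator (J x) s *\<^sub>R (num x s * ((- \<i> * of_real e) / W e (1 / real (Suc n)) x s))) \<longlonglongrightarrow> E0 x"
    unfolding E0_def
  proof (rule integral_dominated_convergence[OF _ _ num_majorant_integrable])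
    show "AE s in lborel. (\<lambda>n. indicator (J x) s *\<^sub>R (num x s * ((- \<i> * of_real e) / W e (1 / real (Suc n)) x s))) \<longlonglongrightarrow> indicator (J x) s *\<^sub>R (num x s * ker0 x s)"
      using AE_lborel_singleton[of x]
    proof eventually_elim
      case (elim s)
      then have "W e 0 x s \<noteq> 0" using W_nz[OF e] by auto
      then show ?case unfolding ker0_eq[OF e, symmetric] by (intro tendsto_intros w)
    qed
    show "AE s in lborel. norm (indicator (J x) s *\<^sub>R (num x s * ((- \<i> * of_real e) / W e (1 / real (Suc n)) x s))) \<le> num_majorant x s" for n
      using AE_lborel_singleton[of x]
    proof eventually_elim
      case (elim s)
      then show ?case using num_W_bound[OF e, of x s] by auto
    qed
  qed measurable
  have "(\<lambda>n. U e (1 / real (Suc n)) \<phi> x) = (\<lambda>n. (1 / pi) *\<^sub>R ((LINT s|lborel. indicator (J x) s *\<^sub>R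
      (num x s * ((- \<i> * of_real e) / W e (1 / real (Suc n)) x s))) + of_real (\<phi> x) * Lam e (1 / real (Suc n)) x))"
    by (rule ext, rule U_decomp[OF e]) simp
  then show ?thesis unfolding V_def by (simp only:) (intro tendsto_intros lim Lam_tendsto[OF e])
qed

lemma norm_Ln_bound: assumes "1 \<le> norm z" shows "norm (Ln z) \<le> norm z + pi"
proof -
  have nz: "z \<noteq> 0" using assms by auto
  have "norm (Ln z) \<le> \<bar>Re (Ln z)\<bar> + \<bar>Im (Ln z)\<bar>" by (rule cmod_le)
  moreover have "\<bar>Im (Ln z)\<bar> \<le> pi" using mpi_less_Im_Ln[OF nz] Im_Ln_le_pi[OF nz] by linarith
  moreover have "\<bar>Re (Ln z)\<bar> \<le> norm z" using assms nz ln_bound[of "norm z"] by (simp add: abs_of_nonneg)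
  ultimately show ?thesis by linarith
qed

text \<open>Uniformity in the height and the side is what makes the squares dominated by an
  integrable function as h -> 0. Near the support the decomposition with subtracted singularity is
  used, since the direct bound degenerates with h; farther out the kernel is of size 1/(|x| -
  R).\<close>

lemma U_bound:
  obtains C where "0 \<le> C" "\<And>e h x. \<bar>e\<bar> = 1 \<Longrightarrow> 0 < h \<Longrightarrow> h \<le> 1 \<Longrightarrow> norm (U e h \<phi> x) \<le> C / (1 + \<bar>x\<bar>)"
proof -
  let ?M = "2 * R + 2" and ?T = "LINT y|lborel. two_power (\<gamma> - 1) (-2) y"
  have T: "0 \<le> ?T" by (rule Bochner_Integration.integral_nonneg) (simp add: two_power_nonneg)
  let ?a = "C1 * ((1 + ?M powr \<gamma>) * (2 * ?M) + ?T) + \<Phi> * (2 * ((L + 1) * ?M + 1 + pi))"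
  let ?b = "2 * R * (\<Phi> * (1 + L))"
  have a0: "0 \<le> ?a" using C1 T R \<Phi> Lpos by (intro add_nonneg_nonneg mult_nonneg_nonneg) auto
  have b0: "0 \<le> ?b" using R \<Phi> Lpos by simp
  have le: "norm z \<le> norm (complex_of_real pi * z)" for z
  proof -
    have "1 * norm z \<le> pi * norm z" using pi_ge_two by (intro mult_right_mono) auto
    then show ?thesis by (simp add: norm_mult)
  qed
  \<comment> \<open>The factor R + 2 bounds 1 + |x| for |x| <= R + 1, and the quotient (1 +
    |x|)/(|x| - R) beyond.\<close>
  show ?thesis
  proof (rule that[of "(?a + ?b) * (R + 2)"])
    show "0 \<le> (?a + ?b) * (R + 2)" using a0 b0 R by simp
    fix e h x :: real assume e: "\<bar>e\<bar> = 1" and h: "0 < h" "h \<le> 1"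
    show "norm (U e h \<phi> x) \<le> (?a + ?b) * (R + 2) / (1 + \<bar>x\<bar>)"
    proof (cases "\<bar>x\<bar> \<le> R + 1")
      case True
      then have Mx: "M x \<le> ?M" "1 \<le> M x" using M by (auto simp: M_def)
      have ln: "norm (Ln (W e h x s)) \<le> (L + 1) * ?M + 1 + pi" if "\<bar>x - s\<bar> = M x" for s
      proof -
        have "1 \<le> norm (W e h x s)" using W_ge[OF e, of x s h] that Mx by linarith
        moreover have "norm (W e h x s) \<le> (L + 1) * ?M + 1"
        proof -
          have "(L + 1) * \<bar>x - s\<bar> \<le> (L + 1) * ?M" using that Mx Lpos by (intro mult_left_mono) auto
          then show ?thesis using W_le[OF e, of h x s] h by linarith
        qed
        ultimately show ?thesis using norm_Ln_bound[of "W e h x s"] by linarith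
      qed
      have "norm (Lam e h x) \<le> 2 * ((L + 1) * ?M + 1 + pi)"
        unfolding Lam_def using norm_triangle_ineq4[of "Ln (W e h x (x - M x))" "Ln (W e h x (x + M x))"]
          ln[of "x - M x"] ln[of "x + M x"] Mx by auto
      then have 1: "norm (of_real (\<phi> x) * Lam e h x) \<le> \<Phi> * (2 * ((L + 1) * ?M + 1 + pi))"
        unfolding norm_mult using bd[of x] \<Phi> by (intro mult_mono) auto
      have "norm (LINT s|lborel. indicator (J x) s *\<^sub>R (num x s * ((- \<i> * of_real e) / W e h x s))) \<le> (LINT s|lborel. num_majorant x s)"
      proof (rule order_trans[OF integral_norm_bound integral_mono_AE])
        show "AE s in lborel. norm (indicator (J x) s *\<^sub>R (num x s * ((- \<i> * of_real e) / W e h x s))) \<le> num_majorant x s"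
          using AE_lborel_singleton[of x]
        proof eventually_elim
          case (elim s)
          then show ?case using num_W_bound[OF e, of x s] by auto
        qed
      qed (rule integrable_norm[OF num_W_integrable[OF e]], rule num_majorant_integrable)
      also have "\<dots> \<le> C1 * ((1 + ?M powr \<gamma>) * (2 * ?M) + ?T)"
        unfolding num_majorant_integral using C1 Mx gam
        by (intro mult_left_mono add_mono mult_mono powr_mono2) auto
      finally have 2: "norm (LINT s|lborel. indicator (J x) s *\<^sub>R (num x s * ((- \<i> * of_real e) / W e h x s))) \<le> C1 * ((1 + ?M powr \<gamma>) * (2 * ?M) + ?T)" .
      have "norm (complex_of_real pi * U e h \<phi> x) \<le> ?a"
        unfolding U_decomp[OF e h(1)] using norm_triangle_mono[OF 2 1] by (simp add: scaleR_conv_of_real)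
      then have "norm (U e h \<phi> x) \<le> ?a + ?b" using le[of "U e h \<phi> x"] b0 by linarith
      also have "\<dots> \<le> (?a + ?b) * ((R + 2) / (1 + \<bar>x\<bar>))"
      proof -
        have "1 \<le> (R + 2) / (1 + \<bar>x\<bar>)" using True R by (simp add: field_simps)
        then have "(?a + ?b) * 1 \<le> (?a + ?b) * ((R + 2) / (1 + \<bar>x\<bar>))" using a0 b0 by (intro mult_left_mono) auto
        then show ?thesis by simp
      qed
      finally show ?thesis by simp
    next
      case False
      let ?g = "\<lambda>s. complex_of_real (\<phi> s) * (tau x * (- \<i> * of_real e) / W e h x s)"
      let ?d = "\<Phi> * (1 + L) / (\<bar>x\<bar> - R)"
      have "norm (LINT s|lborel. ?g s) \<le> (LINT s|lborel. ?d * indicator {-R..R} s)"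
      proof (rule order_trans[OF integral_norm_bound integral_mono])
        show "integrable lborel (\<lambda>s. norm (?g s))" using kernel_section_integrable[OF e h(1) \<phi>_int, of x] by simp
        fix s
        show "norm (?g s) \<le> ?d * indicator {-R..R} s"
        proof (cases "\<bar>s\<bar> \<le> R")
          case True
          have d: "\<bar>x\<bar> - R \<le> norm (W e h x s)" using W_ge[OF e, of x s h] True by linarith
          have "norm (?g s) = \<bar>\<phi> s\<bar> * norm (tau x) / norm (W e h x s)"
            using e by (simp add: norm_mult norm_divide)
          also have "\<dots> \<le> (\<Phi> * (1 + L)) / (\<bar>x\<bar> - R)"
            using d False bd[of s] tau_norm[of x] \<Phi> Lpos by (intro frac_le mult_mono) auto
          finally show ?thesis using True by (auto simp: indicator_def abs_le_iff)
        next
          case False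
          then show ?thesis using supp[of s] by (auto simp: indicator_def)
        qed
      qed (auto simp: emeasure_lborel_Icc_eq)
      also have "\<dots> = ?b / (\<bar>x\<bar> - R)" using R by simp
      finally have "norm (complex_of_real pi * U e h \<phi> x) \<le> ?b / (\<bar>x\<bar> - R)"
        by (simp add: U_def scaleR_conv_of_real)
      then have "norm (U e h \<phi> x) \<le> ?b / (\<bar>x\<bar> - R)" using le[of "U e h \<phi> x"] by linarith
      also have "\<dots> = ?b * (1 / (\<bar>x\<bar> - R))" by simp
      also have "\<dots> \<le> (?a + ?b) * ((R + 2) / (1 + \<bar>x\<bar>))"
      proof (rule mult_mono)
        have t: "1 \<le> \<bar>x\<bar> - R" using False by simp
        have "(R + 1) * 1 \<le> (R + 1) * (\<bar>x\<bar> - R)" using t R by (intro mult_left_mono) auto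
        then have "1 + \<bar>x\<bar> \<le> (R + 2) * (\<bar>x\<bar> - R)" by (simp add: algebra_simps)
        then show "1 / (\<bar>x\<bar> - R) \<le> (R + 2) / (1 + \<bar>x\<bar>)" using t by (simp add: field_simps)
      qed (use a0 b0 R False in auto)
      finally show ?thesis by simp
    qed
  qed
qed

lemma adl_integrable: "integrable lborel (\<lambda>s. adl x s * \<phi> s)"
proof (rule Bochner_Integration.integrable_bound)
  show "integrable lborel (\<lambda>s. L * \<Phi> * (indicator (J x) s * \<bar>x - s\<bar> powr (\<gamma> - 1)))"
    by (intro integrable_mult_right weak_singularity_integrable M)
  show "AE s in lborel. norm (adl x s * \<phi> s) \<le> norm (L * \<Phi> * (indicator (J x) s * \<bar>x - s\<bar> powr (\<gamma> - 1)))"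
  proof (rule AE_I2)
    fix s
    show "norm (adl x s * \<phi> s) \<le> norm (L * \<Phi> * (indicator (J x) s * \<bar>x - s\<bar> powr (\<gamma> - 1)))"
    proof (cases "s \<in> J x")
      case True
      have "\<bar>adl x s\<bar> * \<bar>\<phi> s\<bar> \<le> (L * \<bar>x - s\<bar> powr (\<gamma> - 1)) * \<Phi>"
        using adl_bound[of x s] bd[of s] Lpos by (intro mult_mono) auto
      then show ?thesis using True Lpos \<Phi> by (simp add: abs_mult mult_ac)
    qed (use supp_J in simp)
  qed
qed measurable

lemma dl_J_integrable: "integrable lborel (\<lambda>s. indicator (J x) s * dl x s)"
proof (rule Bochner_Integration.integrable_bound)
  show "integrable lborel (\<lambda>s. L * (indicator (J x) s * \<bar>x - s\<bar> powr (\<gamma> - 1)))"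
    by (intro integrable_mult_right weak_singularity_integrable M)
  show "AE s in lborel. norm (indicator (J x) s * dl x s) \<le> norm (L * (indicator (J x) s * \<bar>x - s\<bar> powr (\<gamma> - 1)))"
    using dl_bound[of x] Lpos by (auto simp: indicator_def abs_mult)
qed measurable

text \<open>Plemelj's formula for e = 1. The subtracted term contributes -\<phi>(x) times the
  integral of the double layer kernel, that is -\<phi>(x) (Im Lam + \<pi>). The logarithmic part
  cancels against \<open>Lam\<close> in V, and after division by \<pi> the jump -\<phi>(x)
  remains.\<close>

lemma Im_V1: "Im (V 1 x) = kop adl \<phi> x - \<phi> x"
proof -
  have int: "integrable lborel (\<lambda>s. indicator (J x) s *\<^sub>R (num x s * ker0 x s))"
    using num_W_integrable[of 1 x 0] unfolding ker0_eq[of 1, OF abs_one] by simp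
  have pt: "Im (indicator (J x) s *\<^sub>R (num x s * ker0 x s)) = pi * (adl x s * \<phi> s) - \<phi> x * (indicator (J x) s * dl x s)" for s
  proof (cases "s \<in> J x")
    case True
    have "num x s * ker0 x s = of_real (\<phi> s) * (tau x * ker0 x s) - of_real (\<phi> x) * (tau s * ker0 x s)"
      by (simp add: num_def algebra_simps)
    then have "Im (num x s * ker0 x s) = \<phi> s * Im (tau x * ker0 x s) - \<phi> x * Im (tau s * ker0 x s)"
      by (simp only: minus_complex.sel Im_complex_of_real Re_complex_of_real times_complex.sel(2) mult_zero_left add_0_right)
    then show ?thesis using True unfolding Im_tau_ker0 by simp
  next
    case False
    then show ?thesis using supp_J[OF False] by simp
  qed
  have "Im (E0 x) = (LINT s|lborel. Im (indicator (J x) s *\<^sub>R (num x s * ker0 x s)))"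
    unfolding E0_def by (rule integral_bounded_linear[OF bounded_linear_Im int, symmetric])
  also have "\<dots> = pi * kop adl \<phi> x - \<phi> x * (LINT s|lborel. indicator (J x) s * dl x s)"
    unfolding pt kop_def using adl_integrable[of x] dl_J_integrable[of x] by simp
  also have "(LINT s|lborel. indicator (J x) s * dl x s) = Im (Lam 1 0 x) + pi"
    unfolding Lam_def by (rule dl_integral[OF M])
  finally have "Im (E0 x + of_real (\<phi> x) * Lam 1 0 x) = pi * (kop adl \<phi> x - \<phi> x)"
    by (simp add: algebra_simps)
  then show ?thesis by (simp add: V_def)
qed

text \<open>At h = 0 the values of W for the two sides are negatives of each other, and the
  principal logarithm changes by i \<pi> with opposite signs at the two ends of J. The resulting 2 i
  \<pi> in \<open>Lam\<close> is the jump.\<close>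

lemma V_minus: "V (-1) x = V 1 x + 2 * \<i> * of_real (\<phi> x)"
proof -
  have W: "W (-1) 0 x s = - W 1 0 x s" for s by (simp add: complex_eq_iff)
  have Mp: "0 < M x" using M[of x] by linarith
  have n: "W 1 0 x (x - M x) \<noteq> 0" "W 1 0 x (x + M x) \<noteq> 0" using Mp by (auto simp: complex_eq_iff)
  have "Ln (- W 1 0 x (x - M x)) = Ln (W 1 0 x (x - M x)) + \<i> * pi"
    using Ln_minus[OF n(1)] Mp by simp
  moreover have "Ln (- W 1 0 x (x + M x)) = Ln (W 1 0 x (x + M x)) - \<i> * pi"
    using Ln_minus[OF n(2)] Mp by simp
  ultimately have "Lam (-1) 0 x = Lam 1 0 x + 2 * \<i> * pi" unfolding Lam_def W by simp
  then show ?thesis by (simp add: V_def algebra_simps scaleR_conv_of_real)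
qed

definition B where "B x = Re (V 1 x)"

lemma V_eq: assumes "\<bar>e\<bar> = 1" shows "V e x = Complex (B x) (kop adl \<phi> x - e * \<phi> x)"
proof -
  have "e = 1 \<or> e = -1" using assms by (auto simp: abs_if split: if_splits)
  then show ?thesis using Im_V1[of x] V_minus[of x] by (auto simp: complex_eq_iff B_def)
qed

end

subsection \<open>Rellich identities and coercivity\<close>

context graph_density
begin

lemma U_meas [measurable]: "U e h \<phi> \<in> borel_measurable borel"
proof -
  have "(\<lambda>x. LINT s|lborel. of_real (\<phi> s) * (tau x * (- \<i> * of_real e) / W e h x s)) \<in> borel_measurable borel"
    by (rule lborel.borel_measurable_lebesgue_integral) measurable
  then show ?thesis unfolding U_def[abs_def] by (rule borel_measurable_scaleR[OF borel_measurable_const])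
qed

lemma V_meas [measurable]: "\<bar>e\<bar> = 1 \<Longrightarrow> V e \<in> borel_measurable borel"
  by (rule borel_measurable_LIMSEQ_metric[OF U_meas U_tendsto])

text \<open>The origin is an exception because the majorant vanishes there, by
  \<open>0 powr 0 = 0\<close>.\<close>

lemma square_majorant:
  "AE x in lborel. (C / (1 + \<bar>x\<bar>))\<^sup>2 \<le> C\<^sup>2 * two_power 0 (-2) x"
  using AE_lborel_singleton[of 0]
proof eventually_elim
  case (elim x)
  have "1 / (1 + \<bar>x\<bar>)\<^sup>2 \<le> two_power 0 (-2) x"
  proof (cases "\<bar>x\<bar> < 1")
    case True
    have "1\<^sup>2 \<le> (1 + \<bar>x\<bar>)\<^sup>2" by (rule power_mono) auto
    then show ?thesis using True elim by (simp add: two_power_def divide_le_eq)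
  next
    case False
    have "\<bar>x\<bar>\<^sup>2 \<le> (1 + \<bar>x\<bar>)\<^sup>2" by (rule power_mono) auto
    then have "1 / (1 + \<bar>x\<bar>)\<^sup>2 \<le> 1 / \<bar>x\<bar>\<^sup>2" using False elim by (intro divide_left_mono mult_pos_pos) auto
    then show ?thesis using False elim by (simp add: two_power_def powr_minus inverse_eq_divide)
  qed
  then have "C\<^sup>2 * (1 / (1 + \<bar>x\<bar>)\<^sup>2) \<le> C\<^sup>2 * two_power 0 (-2) x" by (rule mult_left_mono) simp
  then show ?case by (simp add: power_divide)
qed

definition Q where "Q x = two_power 0 (-2) x"

lemma Q: "integrable lborel (\<lambda>x. C * Q x)"
  unfolding Q_def by (intro integrable_mult_right two_power_integrable) auto

lemma V_bound:
  obtains C where "0 \<le> C" "\<And>e x. \<bar>e\<bar> = 1 \<Longrightarrow> norm (V e x) \<le> C / (1 + \<bar>x\<bar>)"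
    "\<And>e n x. \<bar>e\<bar> = 1 \<Longrightarrow> norm (U e (1 / real (Suc n)) \<phi> x) \<le> C / (1 + \<bar>x\<bar>)"
proof -
  obtain C where C: "0 \<le> C" "\<And>e h x. \<bar>e\<bar> = 1 \<Longrightarrow> 0 < h \<Longrightarrow> h \<le> 1 \<Longrightarrow> norm (U e h \<phi> x) \<le> C / (1 + \<bar>x\<bar>)"
    using U_bound by blast
  have u: "norm (U e (1 / real (Suc n)) \<phi> x) \<le> C / (1 + \<bar>x\<bar>)" if "\<bar>e\<bar> = 1" for e n x
    by (rule C(2)[OF that]) auto
  have "norm (V e x) \<le> C / (1 + \<bar>x\<bar>)" if "\<bar>e\<bar> = 1" for e x
    by (rule LIMSEQ_le_const2[OF tendsto_norm[OF U_tendsto[OF that]]]) (use u[OF that] in auto)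
  then show ?thesis using that C(1) u by blast
qed

lemma V_square_integral_0:
  assumes e: "\<bar>e\<bar> = 1"
  shows "integrable lborel (\<lambda>x. (V e x)\<^sup>2 / tau x)" "(LINT x|lborel. (V e x)\<^sup>2 / tau x) = 0"
proof -
  obtain C where C: "0 \<le> C" "\<And>e x. \<bar>e\<bar> = 1 \<Longrightarrow> norm (V e x) \<le> C / (1 + \<bar>x\<bar>)"
    "\<And>e n x. \<bar>e\<bar> = 1 \<Longrightarrow> norm (U e (1 / real (Suc n)) \<phi> x) \<le> C / (1 + \<bar>x\<bar>)" using V_bound by blast
  note [measurable] = V_meas[OF e]
  have n: "norm (z\<^sup>2 / tau x) \<le> (C / (1 + \<bar>x\<bar>))\<^sup>2" if "norm z \<le> C / (1 + \<bar>x\<bar>)" for z x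
  proof -
    have "norm (z\<^sup>2 / tau x) \<le> (norm z)\<^sup>2 / 1"
      unfolding norm_divide norm_power using tau_norm(1)[of x] by (intro divide_left_mono) auto
    also have "\<dots> \<le> (C / (1 + \<bar>x\<bar>))\<^sup>2" using that by (simp add: power_mono)
    finally show ?thesis .
  qed
  have bV: "AE x in lborel. norm ((V e x)\<^sup>2 / tau x) \<le> C\<^sup>2 * Q x"
    using square_majorant[of C] by eventually_elim (use order_trans[OF n[OF C(2)[OF e]]] in \<open>auto simp: Q_def\<close>)
  have bU: "AE x in lborel. norm ((U e (1 / real (Suc m)) \<phi> x)\<^sup>2 / tau x) \<le> C\<^sup>2 * Q x" for m
    using square_majorant[of C] by eventually_elim (use order_trans[OF n[OF C(3)[OF e]]] in \<open>auto simp: Q_def\<close>)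
  show "integrable lborel (\<lambda>x. (V e x)\<^sup>2 / tau x)"
  proof (rule Bochner_Integration.integrable_bound[OF Q[of "C\<^sup>2"]])
    show "AE x in lborel. norm ((V e x)\<^sup>2 / tau x) \<le> norm (C\<^sup>2 * Q x)"
      using bV by eventually_elim (auto intro: order_trans[OF _ abs_ge_self])
  qed measurable
  have "(\<lambda>m. LINT x|lborel. (U e (1 / real (Suc m)) \<phi> x)\<^sup>2 / tau x) \<longlonglongrightarrow> (LINT x|lborel. (V e x)\<^sup>2 / tau x)"
  proof (rule integral_dominated_convergence[OF _ _ Q[of "C\<^sup>2"] _ bU])
    show "AE x in lborel. (\<lambda>m. (U e (1 / real (Suc m)) \<phi> x)\<^sup>2 / tau x) \<longlonglongrightarrow> (V e x)\<^sup>2 / tau x"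
      by (intro AE_I2 tendsto_divide tendsto_power U_tendsto e tendsto_const tau_nz)
  qed measurable
  moreover have "(LINT x|lborel. (U e (1 / real (Suc m)) \<phi> x)\<^sup>2 / tau x) = 0" for m
    by (rule U_square_integral_0[OF e _ \<phi>_int]) simp
  ultimately have "(\<lambda>_. 0) \<longlonglongrightarrow> (LINT x|lborel. (V e x)\<^sup>2 / tau x)" by (simp only:)
  then show "(LINT x|lborel. (V e x)\<^sup>2 / tau x) = 0" by (rule LIMSEQ_unique[OF _ tendsto_const])
qed

text \<open>1/|tau|^2, the weight that appears when the real part of V^2/tau is expressed through
  real functions.\<close>

definition m where "m x = 1 / (1 + (G x)\<^sup>2)"
definition A where "A x = kop adl \<phi> x"

lemma m: "0 < m x" "m x \<le> 1" "1 \<le> (1 + L\<^sup>2) * m x"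
proof -
  have p: "0 < 1 + (G x)\<^sup>2" by (simp add: add_pos_nonneg)
  show "0 < m x" using p by (simp add: m_def)
  show "m x \<le> 1" using p by (simp add: m_def divide_le_eq)
  have "(G x)\<^sup>2 \<le> L\<^sup>2" using BG[of x] Lpos by (intro abs_le_square_iff[THEN iffD1]) auto
  then show "1 \<le> (1 + L\<^sup>2) * m x" using p by (simp add: m_def le_divide_eq)
qed

lemma Re_V_square:
  assumes "\<bar>e\<bar> = 1"
  shows "Re ((V e x)\<^sup>2 / tau x) = m x * ((B x)\<^sup>2 - (A x - e * \<phi> x)\<^sup>2 + 2 * G x * B x * (A x - e * \<phi> x))"
proof -
  have "Re (z\<^sup>2 / tau x) = m x * ((Re z)\<^sup>2 - (Im z)\<^sup>2 + 2 * G x * Re z * Im z)" for z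
  proof -
    have "Re (z\<^sup>2 / tau x) = (Re (z\<^sup>2) * 1 + Im (z\<^sup>2) * G x) / (1\<^sup>2 + (G x)\<^sup>2)"
      by (simp add: Re_divide)
    also have "Re (z\<^sup>2) * 1 + Im (z\<^sup>2) * G x = (Re z)\<^sup>2 - (Im z)\<^sup>2 + 2 * G x * Re z * Im z"
      by (simp add: Re_power2 Im_power2 algebra_simps)
    also have "\<dots> / (1\<^sup>2 + (G x)\<^sup>2) = m x * \<dots>" by (simp add: m_def)
    finally show ?thesis .
  qed
  then show ?thesis by (simp add: V_eq[OF assms] A_def)
qed

lemma products_integrable:
  shows "integrable lborel (\<lambda>x. m x * (B x)\<^sup>2)" "integrable lborel (\<lambda>x. m x * (A x)\<^sup>2)" "integrable lborel (\<lambda>x. m x * (\<phi> x)\<^sup>2)"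
    "integrable lborel (\<lambda>x. m x * (A x * \<phi> x))" "integrable lborel (\<lambda>x. m x * (G x * B x * A x))" "integrable lborel (\<lambda>x. m x * (G x * B x * \<phi> x))"
    "integrable lborel (\<lambda>x. (A x)\<^sup>2)" "integrable lborel (\<lambda>x. (\<phi> x)\<^sup>2)" "integrable lborel (\<lambda>x. A x * \<phi> x)"
proof -
  obtain C where C: "0 \<le> C" "\<And>e x. \<bar>e\<bar> = 1 \<Longrightarrow> norm (V e x) \<le> C / (1 + \<bar>x\<bar>)"
    "\<And>e n x. \<bar>e\<bar> = 1 \<Longrightarrow> norm (U e (1 / real (Suc n)) \<phi> x) \<le> C / (1 + \<bar>x\<bar>)" using V_bound by blast
  let ?c = "\<lambda>x. C / (1 + \<bar>x\<bar>)"
  have c0: "0 \<le> ?c x" for x using C(1) by simp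
  have b1: "\<bar>B x\<bar> \<le> ?c x" for x
    unfolding B_def by (rule order_trans[OF abs_Re_le_cmod C(2)]) simp
  have im: "\<bar>A x - \<phi> x\<bar> \<le> ?c x" "\<bar>A x + \<phi> x\<bar> \<le> ?c x" for x
  proof -
    have "\<bar>Im (V 1 x)\<bar> \<le> ?c x" "\<bar>Im (V (-1) x)\<bar> \<le> ?c x"
      by (rule order_trans[OF abs_Im_le_cmod C(2)], simp)+
    moreover have "V 1 x = Complex (B x) (A x - 1 * \<phi> x)" "V (-1) x = Complex (B x) (A x - (-1) * \<phi> x)"
      unfolding A_def by (rule V_eq, simp)+
    ultimately show "\<bar>A x - \<phi> x\<bar> \<le> ?c x" "\<bar>A x + \<phi> x\<bar> \<le> ?c x" by simp_all
  qed
  have b2: "\<bar>A x\<bar> \<le> ?c x" "\<bar>\<phi> x\<bar> \<le> ?c x" for x using im[of x] by linarith+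
  have Bm[measurable]: "B \<in> borel_measurable borel" unfolding B_def[abs_def] using V_meas[of 1] by measurable
  have Am[measurable]: "A \<in> borel_measurable borel"
  proof -
    have "(\<lambda>x. Im (V 1 x) + \<phi> x) \<in> borel_measurable borel" using V_meas[of 1] by measurable
    moreover have "(\<lambda>x. Im (V 1 x) + \<phi> x) = A" unfolding Im_V1 A_def[abs_def] by simp
    ultimately show ?thesis by simp
  qed
  have mm[measurable]: "m \<in> borel_measurable borel" unfolding m_def[abs_def] by measurable
  have key: "integrable lborel (\<lambda>x. k x * (u x * v x))"
    if [measurable]: "k \<in> borel_measurable borel" "u \<in> borel_measurable borel" "v \<in> borel_measurable borel"
      and "\<And>x. \<bar>k x\<bar> \<le> D" "\<And>x. \<bar>u x\<bar> \<le> ?c x" "\<And>x. \<bar>v x\<bar> \<le> ?c x" for k u v :: "real \<Rightarrow> real" and D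
  proof (rule Bochner_Integration.integrable_bound[OF Q[of "D * C\<^sup>2"]])
    have D: "0 \<le> D" using that(4)[of 0] by linarith
    show "AE x in lborel. norm (k x * (u x * v x)) \<le> norm (D * C\<^sup>2 * Q x)"
      using square_majorant[of C]
    proof eventually_elim
      case (elim x)
      have "\<bar>k x\<bar> * (\<bar>u x\<bar> * \<bar>v x\<bar>) \<le> D * (?c x * ?c x)"
        using that(4,5,6) c0 D by (intro mult_mono) auto
      also have "\<dots> \<le> D * (C\<^sup>2 * two_power 0 (-2) x)" using elim D by (intro mult_left_mono) (auto simp: power2_eq_square)
      finally have "\<bar>k x * (u x * v x)\<bar> \<le> D * C\<^sup>2 * Q x" by (simp only: abs_mult Q_def mult_ac)
      then show ?case unfolding real_norm_def by (rule order_trans[OF _ abs_ge_self])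
    qed
  qed measurable
  have k1: "\<bar>m x\<bar> \<le> 1" for x using m(1,2)[of x] by simp
  have k2: "\<bar>m x * G x\<bar> \<le> 1 * L" for x unfolding abs_mult using k1[of x] BG[of x] by (intro mult_mono) auto
  have k3: "\<bar>1 :: real\<bar> \<le> 1" for x :: real by simp
  have mG: "(\<lambda>x. m x * G x) \<in> borel_measurable borel" by measurable
  show "integrable lborel (\<lambda>x. m x * (B x)\<^sup>2)" "integrable lborel (\<lambda>x. m x * (A x)\<^sup>2)" "integrable lborel (\<lambda>x. m x * (\<phi> x)\<^sup>2)"
    unfolding power2_eq_square
    by (rule key[OF mm Bm Bm k1 b1 b1], rule key[OF mm Am Am k1 b2(1) b2(1)], rule key[OF mm \<phi>_meas \<phi>_meas k1 b2(2) b2(2)])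
  show "integrable lborel (\<lambda>x. m x * (A x * \<phi> x))" by (rule key[OF mm Am \<phi>_meas k1 b2])
  show "integrable lborel (\<lambda>x. m x * (G x * B x * A x))" using key[OF mG Bm Am k2 b1 b2(1)] by (simp only: mult.assoc)
  show "integrable lborel (\<lambda>x. m x * (G x * B x * \<phi> x))" using key[OF mG Bm \<phi>_meas k2 b1 b2(2)] by (simp only: mult.assoc)
  show "integrable lborel (\<lambda>x. (A x)\<^sup>2)" unfolding power2_eq_square
    using key[OF borel_measurable_const Am Am k3 b2(1) b2(1)] by (simp only: mult_1)
  show "integrable lborel (\<lambda>x. (\<phi> x)\<^sup>2)" unfolding power2_eq_square
    using key[OF borel_measurable_const \<phi>_meas \<phi>_meas k3 b2(2) b2(2)] by (simp only: mult_1)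
  show "integrable lborel (\<lambda>x. A x * \<phi> x)" using key[OF borel_measurable_const Am \<phi>_meas k3 b2] by (simp only: mult_1)
qed

text \<open>Real parts of the vanishing integrals of V^2/tau. With V = B + i (A - e \<phi>) and e^2
  = 1 they are affine in e, so the cases e = 1 and e = -1 separate the part even in e, the first
  identity, from the odd part, the second.\<close>

lemma Rellich_identities:
  "(LINT x|lborel. m x * (B x)\<^sup>2) - (LINT x|lborel. m x * (A x)\<^sup>2) - (LINT x|lborel. m x * (\<phi> x)\<^sup>2)
     + 2 * (LINT x|lborel. m x * (G x * B x * A x)) = 0"
  "(LINT x|lborel. m x * (A x * \<phi> x)) = (LINT x|lborel. m x * (G x * B x * \<phi> x))"
proof -
  note pi = products_integrable(1-6)
  have e: "(LINT x|lborel. m x * (B x)\<^sup>2) - (LINT x|lborel. m x * (A x)\<^sup>2) + 2 * e * (LINT x|lborel. m x * (A x * \<phi> x))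
     - (LINT x|lborel. m x * (\<phi> x)\<^sup>2) + 2 * (LINT x|lborel. m x * (G x * B x * A x)) - 2 * e * (LINT x|lborel. m x * (G x * B x * \<phi> x)) = 0"
    if e: "\<bar>e\<bar> = 1" for e
  proof -
    have e2: "e * e = 1" using e by (auto simp: abs_if split: if_splits)
    have "0 = Re (LINT x|lborel. (V e x)\<^sup>2 / tau x)" using V_square_integral_0(2)[OF e] by simp
    also have "\<dots> = (LINT x|lborel. Re ((V e x)\<^sup>2 / tau x))"
      by (rule integral_bounded_linear[OF bounded_linear_Re V_square_integral_0(1)[OF e], symmetric])
    also have "\<dots> = (LINT x|lborel. m x * (B x)\<^sup>2 - m x * (A x)\<^sup>2 + 2 * e * (m x * (A x * \<phi> x))
       - m x * (\<phi> x)\<^sup>2 + 2 * (m x * (G x * B x * A x)) - 2 * e * (m x * (G x * B x * \<phi> x)))"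
    proof (rule Bochner_Integration.integral_cong[OF refl])
      fix x
      have sq: "(A x - e * \<phi> x)\<^sup>2 = (A x)\<^sup>2 - 2 * e * (A x * \<phi> x) + (e * e) * (\<phi> x)\<^sup>2"
        by (simp add: power2_eq_square algebra_simps)
      show "Re ((V e x)\<^sup>2 / tau x) = m x * (B x)\<^sup>2 - m x * (A x)\<^sup>2 + 2 * e * (m x * (A x * \<phi> x))
       - m x * (\<phi> x)\<^sup>2 + 2 * (m x * (G x * B x * A x)) - 2 * e * (m x * (G x * B x * \<phi> x))"
        unfolding Re_V_square[OF e] sq e2 by (simp add: algebra_simps)
    qed
    also have "\<dots> = (LINT x|lborel. m x * (B x)\<^sup>2) - (LINT x|lborel. m x * (A x)\<^sup>2) + 2 * e * (LINT x|lborel. m x * (A x * \<phi> x))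
     - (LINT x|lborel. m x * (\<phi> x)\<^sup>2) + 2 * (LINT x|lborel. m x * (G x * B x * A x)) - 2 * e * (LINT x|lborel. m x * (G x * B x * \<phi> x))"
      using pi by simp
    finally show ?thesis by simp
  qed
  from e[of 1] e[of "-1"]
  show "(LINT x|lborel. m x * (B x)\<^sup>2) - (LINT x|lborel. m x * (A x)\<^sup>2) - (LINT x|lborel. m x * (\<phi> x)\<^sup>2)
     + 2 * (LINT x|lborel. m x * (G x * B x * A x)) = 0"
    "(LINT x|lborel. m x * (A x * \<phi> x)) = (LINT x|lborel. m x * (G x * B x * \<phi> x))"
    by simp_all
qed

text \<open>Half of \<alpha> must exceed 4 L^2, so that \<alpha> b^2/2 absorbs the multiple of b^2
  that Young's inequality produces from the mixed term g b f.\<close>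

definition \<alpha> where "\<alpha> = 8 * L\<^sup>2 + 1"
text \<open>The coefficients of r^2 collected: 4 from the product r f, \<alpha> from the first
  bracket, 2 \<alpha> L^2 from the product g b r.\<close>

definition N where "N = 4 + \<alpha> + 2 * \<alpha> * L\<^sup>2"

text \<open>With b = B, g = G, f = \<phi> and r = A - lam \<phi>, both brackets integrate to zero
  against \<open>m\<close>: after inserting A = r + lam f, the first is the first Rellich identity
  plus 2 lam times the second, and the other is the second identity. The first bracket controls b^2,
  and its term (lam^2 - 1) f^2 is nonnegative because |lam| >= 1; the second one, multiplied by the
  sign of lam, supplies 2 |lam| f^2. Completing squares absorbs the mixed terms.\<close>

lemma pointwise_coercivity:
  fixes lam b g f r :: real
  assumes lam: "1 \<le> \<bar>lam\<bar>" and g: "\<bar>g\<bar> \<le> L"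
  shows "f\<^sup>2 \<le> N * r\<^sup>2 + \<alpha> * (b\<^sup>2 + (lam\<^sup>2 - 1) * f\<^sup>2 - r\<^sup>2 + 2 * g * b * r)
    + 2 * sgn lam * (lam * f\<^sup>2 + r * f - g * b * f)"
proof -
  have gL: "g\<^sup>2 \<le> L\<^sup>2" using g Lpos by (intro abs_le_square_iff[THEN iffD1]) auto
  have a: "0 \<le> \<alpha>" "\<alpha> = 8 * L\<^sup>2 + 1" by (simp_all add: \<alpha>_def)
  define s where "s = sgn lam"
  have s: "s\<^sup>2 = 1" "s * lam = \<bar>lam\<bar>" using lam by (auto simp: s_def sgn_if)
  have l: "1 \<le> lam\<^sup>2" using lam abs_le_square_iff[of 1 lam] by simp
  have t1: "0 \<le> f\<^sup>2 / 4 + 2 * s * r * f + 4 * r\<^sup>2"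
  proof -
    have "(f / 2 + 2 * s * r)\<^sup>2 = f\<^sup>2 / 4 + 2 * s * r * f + 4 * s\<^sup>2 * r\<^sup>2" by (simp add: power2_eq_square algebra_simps)
    then show ?thesis using zero_le_power2[of "f / 2 + 2 * s * r"] s by simp
  qed
  have t2: "0 \<le> f\<^sup>2 / 4 - 2 * s * g * b * f + 4 * L\<^sup>2 * b\<^sup>2"
  proof -
    have "(f / 2 - 2 * s * g * b)\<^sup>2 = f\<^sup>2 / 4 - 2 * s * g * b * f + 4 * s\<^sup>2 * (g\<^sup>2 * b\<^sup>2)" by (simp add: power2_eq_square algebra_simps)
    moreover have "g\<^sup>2 * b\<^sup>2 \<le> L\<^sup>2 * b\<^sup>2" using gL by (intro mult_right_mono) auto
    ultimately show ?thesis using zero_le_power2[of "f / 2 - 2 * s * g * b"] s by simp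
  qed
  have t3: "0 \<le> \<alpha> / 2 * b\<^sup>2 + 2 * \<alpha> * g * b * r + 2 * \<alpha> * L\<^sup>2 * r\<^sup>2"
  proof -
    have "\<alpha> / 2 * (b + 2 * g * r)\<^sup>2 = \<alpha> / 2 * b\<^sup>2 + 2 * \<alpha> * g * b * r + 2 * \<alpha> * (g\<^sup>2 * r\<^sup>2)" by (simp add: power2_eq_square algebra_simps)
    moreover have "0 \<le> \<alpha> / 2 * (b + 2 * g * r)\<^sup>2" using a(1) by simp
    moreover have "2 * \<alpha> * (g\<^sup>2 * r\<^sup>2) \<le> 2 * \<alpha> * (L\<^sup>2 * r\<^sup>2)" using gL a(1) by (intro mult_left_mono mult_right_mono) auto
    ultimately show ?thesis by (simp add: mult.assoc)
  qed
  have t4: "0 \<le> \<alpha> * ((lam\<^sup>2 - 1) * f\<^sup>2)" using a(1) l by simp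
  have t5: "f\<^sup>2 \<le> \<bar>lam\<bar> * f\<^sup>2" using lam by (simp add: mult_right_mono mult_le_cancel_right1)
  have t6: "\<alpha> / 2 * b\<^sup>2 - 4 * L\<^sup>2 * b\<^sup>2 \<ge> 0" unfolding a(2) by (simp add: algebra_simps)
  have e1: "\<alpha> * (b\<^sup>2 + (lam\<^sup>2 - 1) * f\<^sup>2 - r\<^sup>2 + 2 * g * b * r) = \<alpha> * b\<^sup>2 + \<alpha> * ((lam\<^sup>2 - 1) * f\<^sup>2) - \<alpha> * r\<^sup>2 + 2 * \<alpha> * g * b * r"
    by (simp add: algebra_simps)
  have e2: "2 * s * (lam * f\<^sup>2 + r * f - g * b * f) = 2 * (\<bar>lam\<bar> * f\<^sup>2) + 2 * s * r * f - 2 * s * g * b * f"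
    unfolding s(2)[symmetric] by (simp add: algebra_simps)
  have e3: "N * r\<^sup>2 = 4 * r\<^sup>2 + \<alpha> * r\<^sup>2 + 2 * \<alpha> * L\<^sup>2 * r\<^sup>2" by (simp add: N_def algebra_simps)
  have p: "0 \<le> f\<^sup>2" by simp
  show ?thesis unfolding s_def[symmetric] e1 e2 e3 using t1 t2 t3 t4 t5 t6 p by linarith
qed

theorem coercivity:
  assumes lam: "1 \<le> \<bar>lam\<bar>"
  shows "(LINT x|lborel. (\<phi> x)\<^sup>2) \<le> (1 + L\<^sup>2) * N * (LINT x|lborel. (A x - lam * \<phi> x)\<^sup>2)"
proof -
  note P = products_integrable
  let ?r = "\<lambda>x. A x - lam * \<phi> x"
  have N: "0 \<le> N" by (simp add: N_def \<alpha>_def)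
  have ri: "integrable lborel (\<lambda>x. (?r x)\<^sup>2)"
  proof -
    have "integrable lborel (\<lambda>x. (A x)\<^sup>2 - 2 * lam * (A x * \<phi> x) + lam\<^sup>2 * (\<phi> x)\<^sup>2)" using P by simp
    then show ?thesis by (simp add: power2_eq_square algebra_simps)
  qed
  let ?q1 = "\<lambda>x. m x * (B x)\<^sup>2 - m x * (A x)\<^sup>2 - m x * (\<phi> x)\<^sup>2 + 2 * (m x * (G x * B x * A x))"
  let ?q2 = "\<lambda>x. m x * (A x * \<phi> x) - m x * (G x * B x * \<phi> x)"
  have q: "integrable lborel ?q1" "integrable lborel ?q2" "(LINT x|lborel. ?q1 x) = 0" "(LINT x|lborel. ?q2 x) = 0"
    using P Rellich_identities by simp_all
  \<comment> \<open>The coefficient 2 \<alpha> lam comes from rewriting the first bracket in terms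
    of A, and 2 sgn lam from the second bracket.\<close>
  let ?rhs = "\<lambda>x. N * (?r x)\<^sup>2 + (\<alpha> * ?q1 x + (2 * \<alpha> * lam + 2 * sgn lam) * ?q2 x)"
  have pt: "m x * (\<phi> x)\<^sup>2 \<le> ?rhs x" for x
  proof -
    have "m x * (\<phi> x)\<^sup>2 \<le> m x * (N * (?r x)\<^sup>2 + \<alpha> * ((B x)\<^sup>2 + (lam\<^sup>2 - 1) * (\<phi> x)\<^sup>2 - (?r x)\<^sup>2 + 2 * G x * B x * ?r x)
    + 2 * sgn lam * (lam * (\<phi> x)\<^sup>2 + ?r x * \<phi> x - G x * B x * \<phi> x))"
      using m(1)[of x] by (intro mult_left_mono pointwise_coercivity[OF lam BG]) auto
    also have "\<dots> = m x * (N * (?r x)\<^sup>2) + (\<alpha> * ?q1 x + (2 * \<alpha> * lam + 2 * sgn lam) * ?q2 x)"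
      by (simp add: power2_eq_square algebra_simps)
    also have "m x * (N * (?r x)\<^sup>2) \<le> N * (?r x)\<^sup>2" using m(1,2)[of x] N by (intro mult_left_le_one_le) auto
    finally show ?thesis by simp
  qed
  have "(LINT x|lborel. (\<phi> x)\<^sup>2) \<le> (LINT x|lborel. (1 + L\<^sup>2) * (m x * (\<phi> x)\<^sup>2))"
  proof (rule integral_mono)
    fix x
    have "1 * (\<phi> x)\<^sup>2 \<le> ((1 + L\<^sup>2) * m x) * (\<phi> x)\<^sup>2" using m(3)[of x] by (intro mult_right_mono) auto
    then show "(\<phi> x)\<^sup>2 \<le> (1 + L\<^sup>2) * (m x * (\<phi> x)\<^sup>2)" by (simp add: mult.assoc)
  qed (use P in auto)
  also have "\<dots> = (1 + L\<^sup>2) * (LINT x|lborel. m x * (\<phi> x)\<^sup>2)" by simp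
  also have "\<dots> \<le> (1 + L\<^sup>2) * (LINT x|lborel. ?rhs x)"
    by (rule mult_left_mono[OF integral_mono[OF P(3) _ pt]], intro Bochner_Integration.integrable_add integrable_mult_right ri q, simp)
  also have "(LINT x|lborel. ?rhs x) = N * (LINT x|lborel. (?r x)\<^sup>2) + (\<alpha> * (LINT x|lborel. ?q1 x) + (2 * \<alpha> * lam + 2 * sgn lam) * (LINT x|lborel. ?q2 x))"
    by (subst Bochner_Integration.integral_add, intro integrable_mult_right ri, intro Bochner_Integration.integrable_add integrable_mult_right q,
        subst Bochner_Integration.integral_add, intro integrable_mult_right q, intro integrable_mult_right q,
        simp only: integral_mult_right_zero)
  also have "\<dots> = N * (LINT x|lborel. (?r x)\<^sup>2)" unfolding q by simp
  finally show ?thesis by (simp add: mult.assoc)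
qed

end

subsection \<open>The kernel of the singular integral operator\<close>

locale sobolev_graph = graph +
  fixes p \<sigma> :: real
  assumes p: "2 < p" and sg: "1 / p < \<sigma>" and FLp: "F \<in> Lp p" and GLp: "G \<in> Lp p"
    and gag: "integrable (lborel \<Otimes>\<^sub>M lborel) (\<lambda>(x, y). \<bar>G x - G y\<bar> powr p / \<bar>x - y\<bar> powr (1 + \<sigma> * p))"
begin

text \<open>The exponents are dictated by the two regimes of the kernel. Near the diagonal
  |\<open>adl\<close>|^p is at most |y|^(-p) times an averaged p-th power of differences of G, and
  \<open>wt\<close>^(2 - p) = |y|^((1 - \<sigma>) p - 1) completes this to the Gagliardo weight
  |y|^(-1 - \<sigma> p). Far away the factor |y|^(p - 3/2) leaves |y|^(-3/2), which is integrable.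
  The weight \<open>wt\<close> itself is integrable at 0 because \<sigma> p > 1, and at infinity
  because 3/2 < 2.\<close>

definition wt :: "real \<Rightarrow> real" where
  "wt = two_power (- ((1 - \<sigma>) * p - 1) / (p - 2)) (- (p - 3/2) / (p - 2))"

lemma wt_powr: "wt y powr (2 - p) = two_power ((1 - \<sigma>) * p - 1) (p - 3/2) y"
proof -
  have "- c / (p - 2) * (2 - p) = c" for c using p by (simp add: field_simps)
  then show ?thesis unfolding wt_def two_power_powr by (simp only:)
qed

lemma powr_le_on_annulus:
  fixes \<delta> y c :: real
  assumes "0 < \<delta>" "\<delta> \<le> 1" "\<delta> \<le> \<bar>y\<bar>" "\<bar>y\<bar> \<le> 1 / \<delta>"
  shows "\<bar>y\<bar> powr c \<le> (1 / \<delta>) powr \<bar>c\<bar>"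
proof (cases "0 \<le> c")
  case True
  then show ?thesis using assms by (auto intro: powr_mono2)
next
  case False
  have "\<bar>y\<bar> powr c \<le> \<delta> powr c" using assms False by (intro powr_mono2') auto
  also have "\<dots> = (1 / \<delta>) powr \<bar>c\<bar>" using assms False by (simp add: powr_divide powr_minus inverse_eq_divide)
  finally show ?thesis .
qed

sublocale kernel_weight p wt
proof
  show "2 < p" by (rule p)
  show "wt \<in> borel_measurable borel" unfolding wt_def by measurable
  show "0 \<le> wt y" for y unfolding wt_def by (rule two_power_nonneg)
  show "0 < wt y" if "y \<noteq> 0" for y unfolding wt_def using that by (rule two_power_pos)
  show "integrable lborel wt" unfolding wt_def
  proof (rule two_power_integrable)
    have "1 < \<sigma> * p" using sg p by (simp add: field_simps)
    then show "- 1 < - ((1 - \<sigma>) * p - 1) / (p - 2)" using p by (simp add: field_simps)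
    show "- (p - 3/2) / (p - 2) < - 1" using p by (simp add: field_simps)
  qed
  fix \<delta> :: real assume \<delta>: "0 < \<delta>"
  let ?B = "(1 / \<delta>) powr \<bar>(1 - \<sigma>) * p - 1\<bar> + (1 / \<delta>) powr \<bar>p - 3/2\<bar>"
  show "\<exists>B. \<forall>y. \<delta> \<le> \<bar>y\<bar> \<and> \<bar>y\<bar> \<le> 1 / \<delta> \<longrightarrow> wt y powr (2 - p) \<le> B"
  proof (intro exI[of _ ?B] allI impI)
    fix y assume y: "\<delta> \<le> \<bar>y\<bar> \<and> \<bar>y\<bar> \<le> 1 / \<delta>"
    then have "\<delta> \<le> 1 / \<delta>" by linarith
    then have "\<delta> * \<delta> \<le> 1" using \<delta> by (simp add: field_simps)
    then have d1: "\<delta> \<le> 1" using \<delta> by (metis mult_le_one mult_less_cancel_left2 not_le order_less_imp_le less_le_trans mult_strict_mono zero_less_one mult_1)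
    have "\<bar>y\<bar> powr c \<le> (1 / \<delta>) powr \<bar>c\<bar>" for c by (rule powr_le_on_annulus[OF \<delta> d1]) (use y in auto)
    from this[of "(1 - \<sigma>) * p - 1"] this[of "p - 3/2"]
    show "wt y powr (2 - p) \<le> ?B" unfolding wt_powr two_power_def
      by (auto intro: add_increasing add_increasing2)
  qed
qed

lemma Jensen_unit_interval:
  fixes h :: "real \<Rightarrow> real"
  assumes h: "\<And>t. 0 \<le> h t" and c: "continuous_on {0..1} h"
  shows "(LINT t|lborel. indicator {0..1} t * h t) powr p \<le> (LINT t|lborel. indicator {0..1} t * h t powr p)"
proof -
  have ex: "0 < 1 / p" "0 < 1 - 1 / p" "1 / p + (1 - 1 / p) = 1" using p by auto
  have i: "integrable lborel (\<lambda>t. indicator {0..1} t * h t powr p)"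
  proof -
    have "continuous_on {0..1} (\<lambda>t. h t powr p)"
      by (rule continuous_on_powr'[OF c continuous_on_const]) (use h p in auto)
    from borel_integrable_compact[OF _ this] show ?thesis by simp
  qed
  have i1: "integrable lborel (indicator {0..1} :: real \<Rightarrow> real)" by (simp add: emeasure_lborel_Icc_eq)
  have n: "0 \<le> indicator {0..1} t * h t powr p" "0 \<le> (indicator {0..1} t :: real)" for t :: real by auto
  have e: "(indicator {0..1} t * h t powr p) powr (1/p) * indicator {0..1} t powr (1 - 1/p) = indicator {0..1} t * h t" for t
    using p h[of t] by (cases "t \<in> {0..1}") (auto simp: powr_powr)
  have "(LINT t|lborel. indicator {0..1} t * h t) \<le> (LINT t|lborel. indicator {0..1} t * h t powr p) powr (1/p) * (LINT t|lborel. indicator {0..1::real} t :: real) powr (1 - 1/p)"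
    using Holder2(2)[OF ex i n(1) i1 n(2), unfolded e] .
  also have "(LINT t|lborel. indicator {0..1::real} t :: real) = 1" by simp
  finally have le: "(LINT t|lborel. indicator {0..1} t * h t) \<le> (LINT t|lborel. indicator {0..1} t * h t powr p) powr (1/p)" by simp
  have "0 \<le> (LINT t|lborel. indicator {0..1} t * h t)" by (rule Bochner_Integration.integral_nonneg) (use h in auto)
  then have "(LINT t|lborel. indicator {0..1} t * h t) powr p \<le> ((LINT t|lborel. indicator {0..1} t * h t powr p) powr (1/p)) powr p"
    using le p by (intro powr_mono2) auto
  also have "\<dots> = (LINT t|lborel. indicator {0..1} t * h t powr p)"
    using p by (simp add: powr_powr Bochner_Integration.integral_nonneg)
  finally show ?thesis .
qed

text \<open>The fundamental theorem along t -> x - t y turns the Taylor remainder into an average of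
  differences of G, from which Jensen's inequality can pass to p-th powers.\<close>

lemma remainder_integral:
  "\<bar>y * G x - (F x - F (x - y))\<bar> \<le> \<bar>y\<bar> * (LINT t|lborel. indicator {0..1} t * \<bar>G x - G (x - t * y)\<bar>)"
proof -
  have Gc: "isCont (\<lambda>t. G (x - t * y)) t" for t
    by (rule isCont_o2[OF _ G_cont]) (intro continuous_intros)
  have D: "((\<lambda>t. t * y * G x + F (x - t * y)) has_real_derivative y * (G x - G (x - t * y))) (at t)" for t
  proof -
    have "((\<lambda>t. F (x - t * y)) has_real_derivative G (x - t * y) * (- y)) (at t)"
      by (rule DERIV_chain2[OF DF]) (auto intro!: derivative_eq_intros)
    then show ?thesis by (auto intro!: derivative_eq_intros simp: algebra_simps)
  qed
  have "(LBINT t. y * (G x - G (x - t * y)) * indicator {0..1} t) = (1 * y * G x + F (x - 1 * y)) - (0 * y * G x + F (x - 0 * y))"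
    by (rule integral_FTC_Icc_real[where F = "\<lambda>t. t * y * G x + F (x - t * y)"]) (use D Gc in \<open>auto intro!: continuous_intros\<close>)
  then have "y * G x - (F x - F (x - y)) = (LBINT t. y * (G x - G (x - t * y)) * indicator {0..1} t)" by simp
  also have "\<bar>\<dots>\<bar> \<le> (LBINT t. \<bar>y * (G x - G (x - t * y)) * indicator {0..1} t\<bar>)" by (rule integral_abs_bound)
  also have "\<dots> = (LBINT t. \<bar>y\<bar> * (indicator {0..1} t * \<bar>G x - G (x - t * y)\<bar>))"
    by (rule Bochner_Integration.integral_cong) (auto simp: abs_mult indicator_def)
  also have "\<dots> = \<bar>y\<bar> * (LINT t|lborel. indicator {0..1} t * \<bar>G x - G (x - t * y)\<bar>)" by simp
  finally show ?thesis .
qed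

lemma adl_abs_le: "\<bar>adl x s\<bar> \<le> \<bar>(x - s) * G x - (F x - F s)\<bar> / (x - s)\<^sup>2"
proof (cases "x = s")
  case False
  have "\<bar>adl x s\<bar> = \<bar>(x - s) * G x - (F x - F s)\<bar> * (1 / (pi * ((x - s)\<^sup>2 + (F x - F s)\<^sup>2)))"
    by (simp add: adl_def abs_mult abs_divide)
  also have "\<dots> \<le> \<bar>(x - s) * G x - (F x - F s)\<bar> * (1 / (x - s)\<^sup>2)"
  proof (intro mult_left_mono divide_left_mono)
    have "1 * (x - s)\<^sup>2 \<le> pi * ((x - s)\<^sup>2 + (F x - F s)\<^sup>2)" using pi_ge_two by (intro mult_mono) auto
    then show "(x - s)\<^sup>2 \<le> pi * ((x - s)\<^sup>2 + (F x - F s)\<^sup>2)" by simp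
  qed (use False in \<open>auto intro!: mult_pos_pos add_pos_nonneg\<close>)
  finally show ?thesis by simp
qed (simp add: adl_def)

definition H :: "real \<Rightarrow> real \<Rightarrow> real" where "H x v = \<bar>G x - G (x - v)\<bar> powr p"

lemma H_meas [measurable]:
  assumes [measurable]: "f \<in> borel_measurable M" "g \<in> borel_measurable M"
  shows "(\<lambda>z. H (f z) (g z)) \<in> borel_measurable M"
  unfolding H_def by measurable

text \<open>Jensen's inequality moves the p-th power inside the average, and the powers of |x - s|
  combine to the Gagliardo exponent.\<close>

lemma adl_local:
  assumes "x \<noteq> s" "\<bar>x - s\<bar> < 1"
  shows "dens adl (x, s) \<le> \<bar>x - s\<bar> powr (- \<sigma> * p - 1) * (LINT t|lborel. indicator {0..1} t * H x (t * (x - s)))"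
proof -
  let ?y = "x - s"
  let ?I = "LINT t|lborel. indicator {0..1} t * \<bar>G x - G (x - t * ?y)\<bar>"
  have I0: "0 \<le> ?I" by (rule Bochner_Integration.integral_nonneg) auto
  have "\<bar>adl x s\<bar> \<le> (\<bar>?y\<bar> * ?I) / ?y\<^sup>2"
    using remainder_integral[of ?y x] by (intro order_trans[OF adl_abs_le divide_right_mono]) auto
  also have "\<dots> = ?I / \<bar>?y\<bar>"
  proof -
    have sq: "?y\<^sup>2 = \<bar>?y\<bar> * \<bar>?y\<bar>" by (simp add: power2_eq_square)
    have gen: "a * i / (a * a) = i / a" if "a \<noteq> 0" for a i :: real using that by simp
    show ?thesis unfolding sq by (rule gen) (use assms in simp)
  qed
  finally have "\<bar>adl x s\<bar> powr p \<le> (?I / \<bar>?y\<bar>) powr p" using p by (intro powr_mono2) auto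
  also have "\<dots> = ?I powr p * \<bar>?y\<bar> powr (- p)" using I0 by (simp add: powr_divide powr_minus_divide)
  also have "\<dots> \<le> (LINT t|lborel. indicator {0..1} t * H x (t * ?y)) * \<bar>?y\<bar> powr (- p)"
  proof (rule mult_right_mono)
    have "isCont (\<lambda>t. G (x - t * ?y)) t" for t
      by (rule isCont_o2[OF _ G_cont]) (intro continuous_intros)
    then have "continuous_on {0..1} (\<lambda>t. \<bar>G x - G (x - t * ?y)\<bar>)"
      by (intro continuous_at_imp_continuous_on ballI continuous_intros)
    from Jensen_unit_interval[OF _ this]
    show "?I powr p \<le> (LINT t|lborel. indicator {0..1} t * H x (t * ?y))" by (simp add: H_def)
  qed simp
  finally have 1: "\<bar>adl x s\<bar> powr p * wt ?y powr (2 - p)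
      \<le> (LINT t|lborel. indicator {0..1} t * H x (t * ?y)) * \<bar>?y\<bar> powr (- p) * wt ?y powr (2 - p)"
    by (rule mult_right_mono) simp
  have 2: "\<bar>?y\<bar> powr (- p) * wt ?y powr (2 - p) = \<bar>?y\<bar> powr (- \<sigma> * p - 1)"
  proof -
    have "- p + ((1 - \<sigma>) * p - 1) = - \<sigma> * p - 1" by (simp add: algebra_simps)
    moreover have "wt ?y powr (2 - p) = \<bar>?y\<bar> powr ((1 - \<sigma>) * p - 1)"
      using assms unfolding wt_powr two_power_def by simp
    ultimately show ?thesis by (simp only: powr_add[symmetric])
  qed
  have "\<bar>adl x s\<bar> powr p * wt ?y powr (2 - p) \<le> (LINT t|lborel. indicator {0..1} t * H x (t * ?y)) * \<bar>?y\<bar> powr (- \<sigma> * p - 1)"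
    using 1 unfolding mult.assoc 2 .
  then show ?thesis by (simp only: dens_def fst_conv snd_conv mult.commute)
qed

text \<open>At distance at least 1 the three terms can be estimated separately; multiplying |F(x)| +
  |F(s)| by |x - s| >= 1 gives all of them the same decay.\<close>

lemma adl_far:
  assumes "1 \<le> \<bar>x - s\<bar>"
  shows "dens adl (x, s) \<le> 2 powr p * (2 powr p) * (\<bar>G x\<bar> powr p + \<bar>F x\<bar> powr p + \<bar>F s\<bar> powr p) * two_power 0 (-3/2) (x - s)"
proof -
  let ?y = "x - s"
  let ?S = "\<bar>G x\<bar> + (\<bar>F x\<bar> + \<bar>F s\<bar>)"
  have "\<bar>?y * G x - (F x - F s)\<bar> \<le> \<bar>?y\<bar> * \<bar>G x\<bar> + (\<bar>F x\<bar> + \<bar>F s\<bar>)"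
    using abs_triangle_ineq4[of "?y * G x" "F x - F s"] abs_triangle_ineq4[of "F x" "F s"] by (simp add: abs_mult)
  also have "\<bar>F x\<bar> + \<bar>F s\<bar> \<le> \<bar>?y\<bar> * (\<bar>F x\<bar> + \<bar>F s\<bar>)" using mult_right_mono[OF assms, of "\<bar>F x\<bar> + \<bar>F s\<bar>"] by simp
  finally have "\<bar>?y * G x - (F x - F s)\<bar> \<le> \<bar>?y\<bar> * ?S" by (simp add: distrib_left)
  then have "\<bar>adl x s\<bar> \<le> (\<bar>?y\<bar> * ?S) / ?y\<^sup>2"
    by (intro order_trans[OF adl_abs_le divide_right_mono]) auto
  also have "\<dots> = ?S / \<bar>?y\<bar>"
  proof -
    have sq: "?y\<^sup>2 = \<bar>?y\<bar> * \<bar>?y\<bar>" by (simp add: power2_eq_square)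
    have gen: "a * i / (a * a) = i / a" if "a \<noteq> 0" for a i :: real using that by simp
    show ?thesis unfolding sq by (rule gen) (use assms in linarith)
  qed
  finally have "\<bar>adl x s\<bar> powr p \<le> (?S / \<bar>?y\<bar>) powr p" using p by (intro powr_mono2) auto
  also have "\<dots> = ?S powr p * \<bar>?y\<bar> powr (- p)" by (simp add: powr_divide powr_minus_divide)
  also have "\<dots> \<le> 2 powr p * (2 powr p) * (\<bar>G x\<bar> powr p + \<bar>F x\<bar> powr p + \<bar>F s\<bar> powr p) * \<bar>?y\<bar> powr (- p)"
  proof (rule mult_right_mono)
    show "?S powr p \<le> 2 powr p * (2 powr p) * (\<bar>G x\<bar> powr p + \<bar>F x\<bar> powr p + \<bar>F s\<bar> powr p)"
    proof -
    have "?S powr p \<le> 2 powr p * (\<bar>G x\<bar> powr p + (\<bar>F x\<bar> + \<bar>F s\<bar>) powr p)" using p by (intro powr_add_le) auto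
    also have "(\<bar>F x\<bar> + \<bar>F s\<bar>) powr p \<le> 2 powr p * (\<bar>F x\<bar> powr p + \<bar>F s\<bar> powr p)" using p by (intro powr_add_le) auto
    also have "\<bar>G x\<bar> powr p \<le> 2 powr p * \<bar>G x\<bar> powr p" using p ge_one_powr_ge_zero[of 2 p] by (simp add: mult_le_cancel_right1)
    finally show ?thesis by (simp add: algebra_simps)
    qed
  qed simp
  finally have "\<bar>adl x s\<bar> powr p * wt ?y powr (2 - p)
     \<le> 2 powr p * (2 powr p) * (\<bar>G x\<bar> powr p + \<bar>F x\<bar> powr p + \<bar>F s\<bar> powr p) * \<bar>?y\<bar> powr (- p) * wt ?y powr (2 - p)"
    by (intro mult_right_mono) auto
  moreover have "\<bar>?y\<bar> powr (- p) * wt ?y powr (2 - p) = two_power 0 (-3/2) ?y"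
    using assms by (simp add: wt_powr two_power_def powr_add[symmetric])
  ultimately show ?thesis by (simp add: dens_def mult.assoc)
qed

lemma nn_translate_reflect:
  fixes f :: "real \<Rightarrow> ennreal" assumes [measurable]: "f \<in> borel_measurable borel"
  shows "(\<integral>\<^sup>+s. f s \<partial>lborel) = (\<integral>\<^sup>+y. f (x - y) \<partial>lborel)"
  using nn_integral_real_affine[of f "-1" x] by simp

lemma gagliardo_finite: "(\<integral>\<^sup>+v. \<integral>\<^sup>+x. ennreal (\<bar>v\<bar> powr (- \<sigma> * p - 1) * H x v) \<partial>lborel \<partial>lborel) < \<infinity>"
proof -
  have "(\<integral>\<^sup>+v. \<integral>\<^sup>+x. ennreal (\<bar>v\<bar> powr (- \<sigma> * p - 1) * H x v) \<partial>lborel \<partial>lborel)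
     = (\<integral>\<^sup>+x. \<integral>\<^sup>+v. ennreal (\<bar>v\<bar> powr (- \<sigma> * p - 1) * H x v) \<partial>lborel \<partial>lborel)"
    by (rule lborel_pair.Fubini') measurable
  also have "\<dots> = (\<integral>\<^sup>+x. \<integral>\<^sup>+y. ennreal (\<bar>G x - G y\<bar> powr p / \<bar>x - y\<bar> powr (1 + \<sigma> * p)) \<partial>lborel \<partial>lborel)"
  proof (rule nn_integral_cong)
    fix x :: real
    have e: "- \<sigma> * p - 1 = - (1 + \<sigma> * p)" by simp
    show "(\<integral>\<^sup>+v. ennreal (\<bar>v\<bar> powr (- \<sigma> * p - 1) * H x v) \<partial>lborel) = (\<integral>\<^sup>+y. ennreal (\<bar>G x - G y\<bar> powr p / \<bar>x - y\<bar> powr (1 + \<sigma> * p)) \<partial>lborel)"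
      unfolding e powr_minus H_def by (subst (2) nn_translate_reflect[of _ x]) (simp_all add: divide_inverse mult.commute)
  qed
  also have "\<dots> = (\<integral>\<^sup>+z. ennreal (\<bar>G (fst z) - G (snd z)\<bar> powr p / \<bar>fst z - snd z\<bar> powr (1 + \<sigma> * p)) \<partial>(lborel \<Otimes>\<^sub>M lborel))"
    by (subst lborel.nn_integral_fst[symmetric]) auto
  also have "\<dots> < \<infinity>"
    using gag by (auto simp: integrable_iff_bounded case_prod_beta')
  finally show ?thesis .
qed

text \<open>After exchanging the integrals, the substitution v = t y turns the contribution of the
  parameter t into the Gagliardo seminorm times t^(\<sigma> p), a factor at most 1.\<close>

lemma local_part_finite:
  "(\<integral>\<^sup>+x. \<integral>\<^sup>+y. ennreal (\<bar>y\<bar> powr (- \<sigma> * p - 1) * (LINT t|lborel. indicator {0..1} t * H x (t * y))) \<partial>lborel \<partial>lborel) < \<infinity>"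
proof -
  let ?S = "\<integral>\<^sup>+v. \<integral>\<^sup>+x. ennreal (\<bar>v\<bar> powr (- \<sigma> * p - 1) * H x v) \<partial>lborel \<partial>lborel"
  let ?k = "\<lambda>x y t. ennreal (\<bar>y\<bar> powr (- \<sigma> * p - 1) * (indicator {0..1} t * H x (t * y)))"
  have inner: "ennreal (\<bar>y\<bar> powr (- \<sigma> * p - 1) * (LINT t|lborel. indicator {0..1} t * H x (t * y))) = (\<integral>\<^sup>+t. ?k x y t \<partial>lborel)" for x y
  proof -
    have "isCont (\<lambda>t. G (x - t * y)) t" for t
      by (rule isCont_o2[OF _ G_cont]) (intro continuous_intros)
    then have "continuous_on {0..1} (\<lambda>t. H x (t * y))"
      unfolding H_def using p by (intro continuous_on_powr' continuous_at_imp_continuous_on ballI continuous_intros) auto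
    from borel_integrable_compact[OF _ this]
    have "integrable lborel (\<lambda>t. indicator {0..1} t * H x (t * y))" by simp
    then have i: "integrable lborel (\<lambda>t. \<bar>y\<bar> powr (- \<sigma> * p - 1) * (indicator {0..1} t * H x (t * y)))" by simp
    show ?thesis by (subst nn_integral_eq_integral[OF i]) (auto simp: H_def)
  qed
  have le: "(\<integral>\<^sup>+y. \<integral>\<^sup>+x. ?k x y t \<partial>lborel \<partial>lborel) \<le> indicator {0..1} t * ?S" if t0: "t \<noteq> 0" for t
  proof (cases "t \<in> {0..1}")
    case True
    then have t: "0 < t" "t \<le> 1" using t0 by auto
    have sp: "0 < \<sigma> * p" using sg p by (smt (verit) divide_pos_pos mult_pos_pos)
    have "(\<integral>\<^sup>+y. \<integral>\<^sup>+x. ?k x y t \<partial>lborel \<partial>lborel) \<le> (\<integral>\<^sup>+y. ennreal t * (\<integral>\<^sup>+x. ennreal (\<bar>t * y\<bar> powr (- \<sigma> * p - 1) * H x (t * y)) \<partial>lborel) \<partial>lborel)"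
    proof (rule nn_integral_mono)
      fix y :: real
      have "\<bar>y\<bar> powr (- \<sigma> * p - 1) = t powr (\<sigma> * p + 1) * \<bar>t * y\<bar> powr (- \<sigma> * p - 1)"
        using t by (simp add: abs_mult powr_mult mult.assoc[symmetric] powr_add[symmetric])
      also have "\<dots> \<le> t * \<bar>t * y\<bar> powr (- \<sigma> * p - 1)"
      proof (rule mult_right_mono)
        have "t powr (\<sigma> * p + 1) \<le> t powr 1" using t sp by (intro powr_mono') auto
        then show "t powr (\<sigma> * p + 1) \<le> t" using t by simp
      qed simp
      finally have b: "\<bar>y\<bar> powr (- \<sigma> * p - 1) \<le> t * \<bar>t * y\<bar> powr (- \<sigma> * p - 1)" .
      have "(\<integral>\<^sup>+x. ?k x y t \<partial>lborel) \<le> (\<integral>\<^sup>+x. ennreal t * ennreal (\<bar>t * y\<bar> powr (- \<sigma> * p - 1) * H x (t * y)) \<partial>lborel)"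
      proof (rule nn_integral_mono)
        fix x
        have "\<bar>y\<bar> powr (- \<sigma> * p - 1) * H x (t * y) \<le> (t * \<bar>t * y\<bar> powr (- \<sigma> * p - 1)) * H x (t * y)"
          using b by (intro mult_right_mono) (auto simp: H_def)
        then show "?k x y t \<le> ennreal t * ennreal (\<bar>t * y\<bar> powr (- \<sigma> * p - 1) * H x (t * y))"
          using True t by (simp add: ennreal_mult'[symmetric] H_def mult.assoc ennreal_leI)
      qed
      also have "\<dots> = ennreal t * (\<integral>\<^sup>+x. ennreal (\<bar>t * y\<bar> powr (- \<sigma> * p - 1) * H x (t * y)) \<partial>lborel)"
        by (rule nn_integral_cmult) measurable
      finally show "(\<integral>\<^sup>+x. ?k x y t \<partial>lborel) \<le> ennreal t * (\<integral>\<^sup>+x. ennreal (\<bar>t * y\<bar> powr (- \<sigma> * p - 1) * H x (t * y)) \<partial>lborel)" .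
    qed
    also have "\<dots> = ennreal t * (\<integral>\<^sup>+y. (\<integral>\<^sup>+x. ennreal (\<bar>t * y\<bar> powr (- \<sigma> * p - 1) * H x (t * y)) \<partial>lborel) \<partial>lborel)"
      by (rule nn_integral_cmult) measurable
    also have "\<dots> = ?S"
    proof -
      have m: "(\<lambda>v. \<integral>\<^sup>+x. ennreal (\<bar>v\<bar> powr (- \<sigma> * p - 1) * H x v) \<partial>lborel) \<in> borel_measurable borel" by measurable
      show ?thesis using nn_integral_real_affine[OF m, of t 0] t by simp
    qed
    finally show ?thesis using True by simp
  qed simp
  have "(\<integral>\<^sup>+x. \<integral>\<^sup>+y. \<integral>\<^sup>+t. ?k x y t \<partial>lborel \<partial>lborel \<partial>lborel) = (\<integral>\<^sup>+x. \<integral>\<^sup>+t. \<integral>\<^sup>+y. ?k x y t \<partial>lborel \<partial>lborel \<partial>lborel)"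
    by (intro nn_integral_cong lborel_pair.Fubini'[symmetric]) measurable
  also have "\<dots> = (\<integral>\<^sup>+t. \<integral>\<^sup>+x. \<integral>\<^sup>+y. ?k x y t \<partial>lborel \<partial>lborel \<partial>lborel)"
    by (intro lborel_pair.Fubini'[symmetric]) measurable
  also have "\<dots> = (\<integral>\<^sup>+t. \<integral>\<^sup>+y. \<integral>\<^sup>+x. ?k x y t \<partial>lborel \<partial>lborel \<partial>lborel)"
    by (intro nn_integral_cong lborel_pair.Fubini'[symmetric]) measurable
  also have "\<dots> \<le> (\<integral>\<^sup>+t. indicator {0..1::real} t * ?S \<partial>lborel)"
  proof (rule nn_integral_mono_AE)
    show "AE t in lborel. (\<integral>\<^sup>+y. \<integral>\<^sup>+x. ?k x y t \<partial>lborel \<partial>lborel) \<le> indicator {0..1} t * ?S"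
      using AE_lborel_singleton[of 0] by eventually_elim (rule le)
  qed
  also have "\<dots> = ?S" by (simp add: nn_integral_multc)
  also have "\<dots> < \<infinity>" by (rule gagliardo_finite)
  finally show ?thesis unfolding inner .
qed

lemma adl_kfin: "kfin adl"
proof -
  have m[measurable]: "(\<lambda>z. adl (fst z) (snd z)) \<in> borel_measurable (borel \<Otimes>\<^sub>M borel)" by measurable
  have dm: "dens adl \<in> borel_measurable (lborel \<Otimes>\<^sub>M lborel)" unfolding dens_def[abs_def] by measurable
  let ?l = "\<lambda>x y. \<bar>y\<bar> powr (- \<sigma> * p - 1) * (LINT t|lborel. indicator {0..1} t * H x (t * y))"
  let ?tp = "two_power 0 (-3/2)"
  have l0: "0 \<le> ?l x y" for x y by (intro mult_nonneg_nonneg Bochner_Integration.integral_nonneg) (auto simp: H_def)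
  have lm[measurable]: "(\<lambda>z. ?l (fst z) (fst z - snd z)) \<in> borel_measurable (lborel \<Otimes>\<^sub>M lborel)"
  proof -
    have "(\<lambda>z. LINT t|lborel. indicator {0..1} t * H (fst z) (t * (fst z - snd z))) \<in> borel_measurable (lborel \<Otimes>\<^sub>M lborel)"
      by (rule lborel.borel_measurable_lebesgue_integral) measurable
    then show ?thesis by measurable
  qed
  have li: "integrable (lborel \<Otimes>\<^sub>M lborel) (\<lambda>z. ?l (fst z) (fst z - snd z))"
  proof (rule integrableI_nonneg[OF lm])
    have sec: "(\<lambda>s. ennreal (?l x (x - s))) \<in> borel_measurable borel" "(\<lambda>y. ennreal (?l x y)) \<in> borel_measurable borel" for x
    proof -
      have "(\<lambda>y. LINT t|lborel. indicator {0..1} t * H x (t * y)) \<in> borel_measurable borel"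
        by (rule lborel.borel_measurable_lebesgue_integral) measurable
      then show "(\<lambda>y. ennreal (?l x y)) \<in> borel_measurable borel" by measurable
      then show "(\<lambda>s. ennreal (?l x (x - s))) \<in> borel_measurable borel" by measurable
    qed
    have "(\<integral>\<^sup>+z. ennreal (?l (fst z) (fst z - snd z)) \<partial>(lborel \<Otimes>\<^sub>M lborel)) = (\<integral>\<^sup>+x. \<integral>\<^sup>+s. ennreal (?l x (x - s)) \<partial>lborel \<partial>lborel)"
      by (subst lborel.nn_integral_fst[symmetric]) (use lm in auto)
    also have "\<dots> = (\<integral>\<^sup>+x. \<integral>\<^sup>+y. ennreal (?l x y) \<partial>lborel \<partial>lborel)"
    proof (rule nn_integral_cong)
      fix x :: real
      show "(\<integral>\<^sup>+s. ennreal (?l x (x - s)) \<partial>lborel) = (\<integral>\<^sup>+y. ennreal (?l x y) \<partial>lborel)"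
        by (subst nn_translate_reflect[where x = x, OF sec(1)[of x]]) simp
    qed
    also have "\<dots> < \<infinity>" by (rule local_part_finite)
    finally show "(\<integral>\<^sup>+z. ennreal (?l (fst z) (fst z - snd z)) \<partial>(lborel \<Otimes>\<^sub>M lborel)) < \<infinity>" .
  qed (use l0 in auto)
  have ti: "integrable lborel ?tp" by (rule two_power_integrable) auto
  have snd_i: "integrable (lborel \<Otimes>\<^sub>M lborel) (\<lambda>z. h (snd z) * ?tp (fst z - snd z))" if "integrable lborel h" for h
    by (rule integrable_conv[OF that ti])
  have fst_i: "integrable (lborel \<Otimes>\<^sub>M lborel) (\<lambda>z. h (fst z) * ?tp (fst z - snd z))" if "integrable lborel h" for h
  proof -
    \<comment> \<open>The power weight is even, so swapping the variables transfers the estimate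
      from \<open>snd\<close> to \<open>fst\<close>.\<close>
    have "integrable (lborel \<Otimes>\<^sub>M lborel) (\<lambda>(x, y). (\<lambda>z. h (snd z) * ?tp (fst z - snd z)) (y, x))"
      by (rule lborel_pair.integrable_product_swap[OF snd_i[OF that]])
    moreover have "(\<lambda>(x, y). (\<lambda>z. h (snd z) * ?tp (fst z - snd z)) (y, x)) = (\<lambda>z. h (fst z) * ?tp (fst z - snd z))"
      by (auto simp: fun_eq_iff two_power_def abs_minus_commute)
    ultimately show ?thesis by (simp only:)
  qed
  let ?f = "\<lambda>z. 2 powr p * (2 powr p) * (\<bar>G (fst z)\<bar> powr p + \<bar>F (fst z)\<bar> powr p + \<bar>F (snd z)\<bar> powr p) * ?tp (fst z - snd z)"
  have fi: "integrable (lborel \<Otimes>\<^sub>M lborel) ?f"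
  proof -
    have "integrable (lborel \<Otimes>\<^sub>M lborel) (\<lambda>z. 2 powr p * (2 powr p) * (\<bar>G (fst z)\<bar> powr p * ?tp (fst z - snd z) + \<bar>F (fst z)\<bar> powr p * ?tp (fst z - snd z) + \<bar>F (snd z)\<bar> powr p * ?tp (fst z - snd z)))"
      by (intro integrable_mult_right Bochner_Integration.integrable_add fst_i snd_i LpD(2)[OF GLp] LpD(2)[OF FLp]) 
    then show ?thesis by (simp only: distrib_right mult.assoc)
  qed
  have f0: "0 \<le> ?f z" for z using two_power_nonneg by simp
  have "integrable (lborel \<Otimes>\<^sub>M lborel) (dens adl)"
  proof (rule Bochner_Integration.integrable_bound[OF Bochner_Integration.integrable_add[OF li fi] dm])
    show "AE z in lborel \<Otimes>\<^sub>M lborel. norm (dens adl z) \<le> norm (?l (fst z) (fst z - snd z) + ?f z)"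
      using AE_off_diagonal
    proof eventually_elim
      case (elim z)
      obtain x s where z: "z = (x, s)" by fastforce
      have "dens adl (x, s) \<le> ?l x (x - s) + ?f (x, s)"
      proof (cases "\<bar>x - s\<bar> < 1")
        case True
        then show ?thesis using adl_local[of x s] elim f0[of "(x, s)"] z by simp
      next
        case False
        then show ?thesis using adl_far[of x s] l0[where x = x and y = "x - s"] by simp
      qed
      then show ?case using dens_nonneg[of adl z] unfolding z by simp
    qed
  qed
  then show ?thesis using m by (simp add: kfin_def)
qed

lemma adl_isCont: "x \<noteq> s \<Longrightarrow> isCont (\<lambda>z. adl (fst z) (snd z)) (x, s)"
proof -
  assume ne: "x \<noteq> s"
  have c: "isCont (\<lambda>z. F (fst z)) (x, s)" "isCont (\<lambda>z. F (snd z)) (x, s)" "isCont (\<lambda>z. G (fst z)) (x, s)"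
    by (auto intro!: isCont_o2[OF _ F_cont] isCont_o2[OF _ G_cont] continuous_intros)
  show ?thesis unfolding adl_def using ne
    by (intro continuous_intros c) (auto simp: add_nonneg_eq_0_iff)
qed

end

subsection \<open>Main result\<close>

lemma test_fun_bounded_support: assumes "test_fun w" shows "bounded_support w"
proof -
  obtain M where M: "0 < M" "\<And>x. M < \<bar>x\<bar> \<Longrightarrow> w x = 0" using test_fun_support[OF assms] by metis
  have "bounded (w ` {-M..M})"
    by (intro compact_imp_bounded compact_continuous_image test_fun_continuous assms) auto
  then obtain B where B: "\<forall>x\<in>{-M..M}. \<bar>w x\<bar> \<le> B" unfolding bounded_iff by auto
  have 1: "\<bar>w x\<bar> \<le> max B M" for x
  proof (cases "\<bar>x\<bar> \<le> M")
    case True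
    then have "x \<in> {-M..M}" by auto
    with B have "\<bar>w x\<bar> \<le> B" by blast
    then show ?thesis by simp
  next
    case False
    then have "w x = 0" by (intro M(2)) simp
    then show ?thesis using M(1) by simp
  qed
  have 2: "w x = 0" if "max B M < \<bar>x\<bar>" for x by (rule M(2)) (use that in simp)
  have "w \<in> borel_measurable borel"
    by (intro borel_measurable_continuous_onI test_fun_continuous assms)
  then show ?thesis unfolding bounded_support_def using 1 2 by blast
qed

lemma AE_reflect: assumes "AE x in lborel. P (x::real)" shows "AE y in lborel. P (x - y)"
proof -
  obtain N where N: "\<And>z. z \<in> space lborel - N \<Longrightarrow> P z" "N \<in> null_sets lborel"
    using AE_E3[OF assms] by blast
  have Ns: "N \<in> sets borel" using null_setsD2[OF N(2)] by simp
  have "{z \<in> space borel. z \<notin> N} = space borel - N" by blast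
  then have m: "Measurable.pred borel (\<lambda>z. z \<notin> N)"
    unfolding pred_def using sets.compl_sets[OF Ns] by (simp only:)
  have "AE y in lborel. x + (-1) * y \<notin> N"
    by (rule AE_borel_affine[OF _ m AE_not_in[OF N(2)]]) simp
  then show ?thesis
  proof eventually_elim
    case (elim y)
    show ?case by (rule N(1)) (use elim in simp)
  qed
qed

section \<open>Identification of the operator, injectivity on L_2 and the resolvent on L_p\<close>

context sobolev_graph
begin

abbreviation T where "T \<equiv> kop adl"

text \<open>The integrand is absolutely integrable, so the principal value is an ordinary limit by
  dominated convergence. Inverting the parameter turns the one-sided limit at 0 into a limit at
  infinity.\<close>

lemma T_trunc_tendsto:
  assumes w: "integrable lborel (\<lambda>s. adl x s * w s)" and wm[measurable]: "w \<in> borel_measurable borel"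
  shows "((\<lambda>\<epsilon>. LINT y|lborel. indicator {y. \<epsilon> < \<bar>y\<bar>} y * (adl x (x - y) * w (x - y))) \<longlongrightarrow> T w x) (at_right 0)"
  unfolding filterlim_at_right_to_top
proof -
  have i: "integrable lborel (\<lambda>y. adl x (x - y) * w (x - y))"
    using integrable_reflect[OF w, of x] by simp
  have "((\<lambda>t. LINT y|lborel. indicator {y. inverse t < \<bar>y\<bar>} y * (adl x (x - y) * w (x - y))) \<longlongrightarrow> (LINT y|lborel. adl x (x - y) * w (x - y))) at_top"
  proof (rule integral_dominated_convergence_at_top[where w = "\<lambda>y. \<bar>adl x (x - y) * w (x - y)\<bar>"])
    show "AE y in lborel. ((\<lambda>t. indicator {y. inverse t < \<bar>y\<bar>} y * (adl x (x - y) * w (x - y))) \<longlongrightarrow> adl x (x - y) * w (x - y)) at_top"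
      using AE_lborel_singleton[of 0]
    proof eventually_elim
      case (elim y)
      have "((\<lambda>t::real. inverse t) \<longlongrightarrow> 0) at_top" by (rule tendsto_inverse_0_at_top[OF filterlim_ident])
      from order_tendstoD(2)[OF this, of "\<bar>y\<bar>"] elim
      have "\<forall>\<^sub>F t in at_top. inverse t < \<bar>y\<bar>" by simp
      then have "\<forall>\<^sub>F t in at_top. indicator {y. inverse t < \<bar>y\<bar>} y * (adl x (x - y) * w (x - y)) = adl x (x - y) * w (x - y)"
        by eventually_elim simp
      then show ?case by (rule tendsto_eventually)
    qed
    show "\<forall>\<^sub>F t in at_top. AE y in lborel. norm (indicator {y. inverse t < \<bar>y\<bar>} y * (adl x (x - y) * w (x - y))) \<le> \<bar>adl x (x - y) * w (x - y)\<bar>"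
      by (intro always_eventually allI AE_I2) (auto simp: indicator_def)
  qed (use i in auto)
  moreover have "(LINT y|lborel. adl x (x - y) * w (x - y)) = T w x"
    unfolding kop_def by (rule integral_reflect[of "\<lambda>s. adl x s * w s" x])
  ultimately show "((\<lambda>t. LINT y|lborel. indicator {y. inverse t < \<bar>y\<bar>} y * (adl x (x - y) * w (x - y))) \<longlongrightarrow> T w x) at_top" by simp
qed

text \<open>f and \<open>f'\<close> equal F and G only almost everywhere. The point x is taken
  outside the exceptional sets, while under the integral f(x - y) is replaced by F(x - y) for almost
  every y, so the truncated integrals agree for almost every x.\<close>

lemma T_is_A_op:
  assumes fm [measurable]: "f \<in> borel_measurable borel" and f: "AE x in lborel. f x = F x" and f': "AE x in lborel. f' x = G x"
  shows "is_A_op p f f' T"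
  unfolding is_A_op_def
proof (intro conjI allI impI)
  show "bounded_op_Lp p T" using kop_bounded_op[OF adl_kfin] by blast
  fix w assume t: "test_fun w"
  have wL: "w \<in> Lp p" using bounded_support_Lp[OF test_fun_bounded_support[OF t]] p by simp
  have wm[measurable]: "w \<in> borel_measurable borel" using LpD[OF wL] by simp
  have "AE x in lborel. integrable lborel (\<lambda>s. adl x s * w s)" by (rule AE_kop_integrable[OF adl_kfin _ wL]) simp
  then show "AE x in lborel. ((\<lambda>\<epsilon>. A_trunc f f' w x \<epsilon>) \<longlongrightarrow> T w x) (at_right 0)"
    using f f'
  proof eventually_elim
    case (elim x)
    have "A_trunc f f' w x \<epsilon> = (LINT y|lborel. indicator {y. \<epsilon> < \<bar>y\<bar>} y * (adl x (x - y) * w (x - y)))" for \<epsilon>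
    proof -
      \<comment> \<open>The value at x - y is kept as a parameter c, so that the almost everywhere
        replacement acts on it alone.\<close>
      let ?k = "\<lambda>c y. indicator {y. \<epsilon> < \<bar>y\<bar>} y *\<^sub>R ((y * G x - (F x - c)) / (y\<^sup>2 + (F x - c)\<^sup>2) * w (x - y))"
      have set_eq: "(LINT y:{y. \<epsilon> < \<bar>y\<bar>}|lborel. (y * f' x - (f x - f (x - y))) / (y\<^sup>2 + (f x - f (x - y))\<^sup>2) * w (x - y))
          = (LINT y|lborel. ?k (f (x - y)) y)"
        unfolding set_lebesgue_integral_def elim ..
      have ae: "AE y in lborel. ?k (f (x - y)) y = ?k (F (x - y)) y"
        using AE_reflect[OF f, of x] by eventually_elim simp
      have "(LINT y|lborel. ?k (f (x - y)) y) = (LINT y|lborel. ?k (F (x - y)) y)"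
        by (rule integral_cong_AE[OF _ _ ae]) measurable
      also have "\<dots> = (LINT y|lborel. pi * (indicator {y. \<epsilon> < \<bar>y\<bar>} y * (adl x (x - y) * w (x - y))))"
        by (rule Bochner_Integration.integral_cong) (auto simp: adl_def)
      finally show ?thesis unfolding A_trunc_def set_eq by simp
    qed
    then show ?case using T_trunc_tendsto[OF elim(1) wm] by simp
  qed
qed

lemma kop_diff_le:
  assumes w: "w \<in> Lp 2" and v: "v \<in> Lp 2"
  shows "Lp_norm 2 (\<lambda>x. (T v x - lam * v x) - (T w x - lam * w x)) \<le> (knorm adl + \<bar>lam\<bar>) * Lp_norm 2 (\<lambda>x. w x - v x)"
proof -
  note op = kop_bounded_op[OF adl_kfin, of 2, simplified]
  let ?d = "\<lambda>x. w x - v x"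
  have d: "?d \<in> Lp 2" using w v by (intro Lp_diff) auto
  note L = bounded_op_Lp_D(1)[OF op w] bounded_op_Lp_D(1)[OF op v] bounded_op_Lp_D(1)[OF op d]
  have "AE x in lborel. T (\<lambda>x. 1 * w x + (-1) * v x) x = 1 * T w x + (-1) * T v x"
    by (rule bounded_op_Lp_D(3)[OF op w v])
  then have ae: "AE x in lborel. (T v x - lam * v x) - (T w x - lam * w x) = lam * ?d x - T ?d x"
    by eventually_elim (simp add: algebra_simps)
  note [measurable] = LpD(1)[OF w] LpD(1)[OF v] LpD(1)[OF L(1)] LpD(1)[OF L(2)] LpD(1)[OF L(3)]
  have "Lp_norm 2 (\<lambda>x. (T v x - lam * v x) - (T w x - lam * w x)) = Lp_norm 2 (\<lambda>x. lam * ?d x - T ?d x)"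
    by (rule Lp_norm_cong_AE[OF _ _ ae]) measurable
  also have "\<dots> \<le> Lp_norm 2 (\<lambda>x. lam * ?d x) + Lp_norm 2 (T ?d)"
    by (rule Lp_norm_diff_le[OF _ Lp_scale[OF d] L(3)]) simp
  also have "\<dots> \<le> \<bar>lam\<bar> * Lp_norm 2 ?d + knorm adl * Lp_norm 2 ?d"
    using kop_Lp(2)[OF adl_kfin, of 2 ?d] d Lp_norm_scale[of 2 lam ?d] by simp
  finally show ?thesis by (simp add: algebra_simps)
qed

lemma L2_coercivity:
  assumes lam: "1 \<le> \<bar>lam\<bar>"
  obtains C where "0 \<le> C" "\<And>\<phi>. bounded_support \<phi> \<Longrightarrow> lipschitz_support \<phi> \<Longrightarrow> Lp_norm 2 \<phi> \<le> C * Lp_norm 2 (\<lambda>x. T \<phi> x - lam * \<phi> x)"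
proof -
  \<comment> \<open>This repeats the constant \<alpha> outside the locale of a fixed density: the
    coercivity constant depends on L alone and is the same for all densities.\<close>
  define a where "a = 8 * L\<^sup>2 + 1"
  let ?C = "(1 + L\<^sup>2) * (4 + a + 2 * a * L\<^sup>2)"
  have C0: "0 \<le> ?C" by (simp add: a_def)
  have main: "Lp_norm 2 \<phi> \<le> sqrt ?C * Lp_norm 2 (\<lambda>x. T \<phi> x - lam * \<phi> x)" if b: "bounded_support \<phi>" and l: "lipschitz_support \<phi>" for \<phi>
  proof -
    obtain K R where KR: "\<And>x y. \<bar>\<phi> x - \<phi> y\<bar> \<le> K * \<bar>x - y\<bar>" "\<And>x. R < \<bar>x\<bar> \<Longrightarrow> \<phi> x = 0"
      using l unfolding lipschitz_support_def by blast
    obtain M where M: "\<And>x. \<bar>\<phi> x\<bar> \<le> M" using b unfolding bounded_support_def by blast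
    interpret D: graph_density F G \<gamma> L \<phi> "max 0 K" "max 0 R" M
    proof
      show "\<bar>\<phi> x - \<phi> y\<bar> \<le> max 0 K * \<bar>x - y\<bar>" for x y
        using KR(1)[of x y] mult_right_mono[of K "max 0 K" "\<bar>x - y\<bar>"] by simp
    qed (use KR(2) M in auto)
    have e: "Lp_norm 2 h powr 2 = (LINT x|lborel. (h x)\<^sup>2)" for h by (subst Lp_norm_powr) auto
    have "Lp_norm 2 \<phi> powr 2 \<le> ?C * Lp_norm 2 (\<lambda>x. T \<phi> x - lam * \<phi> x) powr 2"
      unfolding e using D.coercivity[OF lam] by (simp add: D.N_def D.\<alpha>_def D.A_def a_def)
    then have "(Lp_norm 2 \<phi>)\<^sup>2 \<le> (sqrt ?C * Lp_norm 2 (\<lambda>x. T \<phi> x - lam * \<phi> x))\<^sup>2"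
      using C0 by (simp add: power_mult_distrib)
    then show ?thesis by (rule power2_le_imp_le) (simp add: C0)
  qed
  show ?thesis by (rule that[of "sqrt ?C"]) (use main C0 in auto)
qed

text \<open>Approximate w in L_2 by Lipschitz densities. T is bounded on L_2, so their residuals
  tend to the residual of w, which is zero; coercivity then forces the densities, and hence w, to be
  arbitrarily small in norm.\<close>

lemma T_injective_L2:
  assumes lam: "1 \<le> \<bar>lam\<bar>" and w: "w \<in> Lp 2" and e: "AE x in lborel. lam * w x = T w x"
  shows "AE x in lborel. w x = 0"
proof -
  obtain C where C: "0 \<le> C" "\<And>\<phi>. bounded_support \<phi> \<Longrightarrow> lipschitz_support \<phi> \<Longrightarrow> Lp_norm 2 \<phi> \<le> C * Lp_norm 2 (\<lambda>x. T \<phi> x - lam * \<phi> x)"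
    using L2_coercivity[OF lam] by blast
  note op = kop_bounded_op[OF adl_kfin, of 2, simplified]
  let ?D = "1 + C * (knorm adl + \<bar>lam\<bar>)"
  have D: "0 < ?D" using C(1) knorm_nonneg[of adl] by (simp add: add_pos_nonneg)
  have le: "Lp_norm 2 w \<le> ?D * \<epsilon>" if \<epsilon>: "0 < \<epsilon>" for \<epsilon>
  proof -
    obtain \<phi> where \<phi>: "bounded_support \<phi>" "lipschitz_support \<phi>" "Lp_norm 2 (\<lambda>x. w x - \<phi> x) < \<epsilon>"
      by (rule lipschitz_support_dense[OF _ w \<epsilon>]) simp
    have \<phi>L: "\<phi> \<in> Lp 2" by (rule bounded_support_Lp[OF \<phi>(1)]) simp
    note L = bounded_op_Lp_D(1)[OF op w] bounded_op_Lp_D(1)[OF op \<phi>L]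
    note [measurable] = LpD(1)[OF w] LpD(1)[OF \<phi>L] LpD(1)[OF L(1)] LpD(1)[OF L(2)]
    have "Lp_norm 2 (\<lambda>x. T \<phi> x - lam * \<phi> x) = Lp_norm 2 (\<lambda>x. (T \<phi> x - lam * \<phi> x) - (T w x - lam * w x))"
      by (rule Lp_norm_cong_AE) (use e in \<open>auto\<close>)
    also have "\<dots> \<le> (knorm adl + \<bar>lam\<bar>) * Lp_norm 2 (\<lambda>x. w x - \<phi> x)" by (rule kop_diff_le[OF w \<phi>L])
    also have "\<dots> \<le> (knorm adl + \<bar>lam\<bar>) * \<epsilon>" using \<phi>(3) knorm_nonneg[of adl] by (intro mult_left_mono) auto
    finally have "C * Lp_norm 2 (\<lambda>x. T \<phi> x - lam * \<phi> x) \<le> C * ((knorm adl + \<bar>lam\<bar>) * \<epsilon>)" using C(1) by (rule mult_left_mono)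
    then have 1: "Lp_norm 2 \<phi> \<le> C * ((knorm adl + \<bar>lam\<bar>) * \<epsilon>)" using C(2)[OF \<phi>(1,2)] by linarith
    have "Lp_norm 2 (\<lambda>x. (w x - \<phi> x) + \<phi> x) \<le> Lp_norm 2 (\<lambda>x. w x - \<phi> x) + Lp_norm 2 \<phi>"
      by (rule Minkowski[OF _ Lp_diff \<phi>L]) (use w \<phi>L in auto)
    then have "Lp_norm 2 w \<le> \<epsilon> + C * ((knorm adl + \<bar>lam\<bar>) * \<epsilon>)" using \<phi>(3) 1 by simp
    then show ?thesis by (simp add: distrib_right mult.assoc)
  qed
  have "Lp_norm 2 w \<le> 0"
  proof (rule ccontr)
    assume "\<not> Lp_norm 2 w \<le> 0"
    then have "0 < Lp_norm 2 w / (2 * ?D)" using D by simp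
    have half: "d * (n / (2 * d)) = n / 2" if "0 < d" for d n :: real using that by simp
    from le[OF \<open>0 < Lp_norm 2 w / (2 * ?D)\<close>] have "Lp_norm 2 w \<le> Lp_norm 2 w / 2" unfolding half[OF D] .
    then show False using \<open>\<not> Lp_norm 2 w \<le> 0\<close> by simp
  qed
  then have "Lp_norm 2 w = 0" using Lp_norm_nonneg[of 2 w] by linarith
  then show ?thesis using Lp_norm_eq_0_iff[OF w] by simp
qed

text \<open>The remainder left by the finite rank approximation has norm at most 1/2 < |lam| on L_p
  and on L_2 alike, so the perturbation result reduces everything to the injectivity known on
  L_2.\<close>

lemma resolvent_isom:
  assumes lam: "1 \<le> \<bar>lam\<bar>"
  shows "isom_Lp p (\<lambda>w x. lam * w x - T w x)"
proof -
  \<comment> \<open>Chosen to make \<open>knorm\<close> of the remainder at most 1/2; the added 1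
    keeps the denominator positive without appeal to positivity of \<open>c0\<close>.\<close>
  let ?e = "(1/2) powr p / (c0 powr (p - 2) + 1)"
  have e: "0 < ?e" by (simp add: add_nonneg_pos)
  obtain I :: "(int \<times> int) set" and a b where I: "finite I" and a: "\<And>i. i \<in> I \<Longrightarrow> bounded_support (a i)"
    and b: "\<And>i. i \<in> I \<Longrightarrow> bounded_support (b i)"
    and fin: "kfin (\<lambda>x s. adl x s - (\<Sum>i\<in>I. a i x * b i s))" and small: "kmass (\<lambda>x s. adl x s - (\<Sum>i\<in>I. a i x * b i s)) < ?e"
    by (rule finite_rank_approx[OF adl_kfin adl_isCont e]) (assumption, rule that)
  let ?k = "\<lambda>x s. adl x s - (\<Sum>i\<in>I. a i x * b i s)"
  have kn: "knorm ?k \<le> 1/2"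
  proof -
    have "kmass ?k * c0 powr (p - 2) \<le> ?e * (c0 powr (p - 2) + 1)"
      using small kmass_nonneg[of ?k] by (intro mult_mono) auto
    also have "\<dots> = (1/2) powr p" by (simp add: add_nonneg_pos less_imp_neq[symmetric])
    finally have "(kmass ?k * c0 powr (p - 2)) powr (1/p) \<le> ((1/2) powr p) powr (1/p)"
      using p kmass_nonneg[of ?k] by (intro powr_mono2) auto
    then show ?thesis using p by (simp add: knorm_def powr_mult powr_powr kmass_nonneg)
  qed
  have ctr: "contraction q lam (1/2) (kop ?k)" if q: "q = p \<or> q = 2" for q
  proof
    show "1 \<le> q" using q p by auto
    show "bounded_op_Lp q (kop ?k)" by (rule kop_bounded_op[OF fin q])
    show "1/2 < \<bar>lam\<bar>" using lam by simp
    show "Lp_norm q (kop ?k g) \<le> 1/2 * Lp_norm q g" if "g \<in> Lp q" for g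
      using kop_Lp(2)[OF fin q that] mult_right_mono[OF kn Lp_norm_nonneg[of q g]] by linarith
  qed simp
  interpret P: contraction p lam "1/2" "kop ?k" by (rule ctr) simp
  interpret Q: contraction 2 lam "1/2" "kop ?k" by (rule ctr) simp
  interpret finite_rank_perturbation p lam "1/2" "kop ?k" T I a b
  proof
    show "1 < p" using p by simp
    show "bounded_op_Lp p T" using kop_bounded_op[OF adl_kfin] by blast
    show "finite I" by (rule I)
    show "bounded_support (a i)" "bounded_support (b i)" if "i \<in> I" for i using a b that by auto
    show "AE x in lborel. T w x = kop ?k w x + (\<Sum>i\<in>I. (LINT y|lborel. b i y * w y) * a i x)" if w: "w \<in> Lp p" for w
    proof -
      have "AE x in lborel. integrable lborel (\<lambda>s. adl x s * w s)" by (rule AE_kop_integrable[OF adl_kfin _ w]) simp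
      then show ?thesis
      proof eventually_elim
        case (elim x)
        have bi: "integrable lborel (\<lambda>s. a i x * (b i s * w s))" if "i \<in> I" for i
        proof -
          have p1: "1 < p" using p by simp
          show ?thesis by (rule bounded_support_pairing[OF b[OF that] p1]) (use w in auto)
        qed
        have "kop ?k w x = (LINT s|lborel. adl x s * w s - (\<Sum>i\<in>I. a i x * (b i s * w s)))"
          by (simp add: kop_def left_diff_distrib sum_distrib_right mult.assoc)
        also have "\<dots> = T w x - (LINT s|lborel. (\<Sum>i\<in>I. a i x * (b i s * w s)))"
          unfolding kop_def by (rule Bochner_Integration.integral_diff[OF elim]) (intro Bochner_Integration.integrable_sum bi)
        also have "(LINT s|lborel. (\<Sum>i\<in>I. a i x * (b i s * w s))) = (\<Sum>i\<in>I. (LINT y|lborel. b i y * w y) * a i x)"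
          using bi by (subst Bochner_Integration.integral_sum) (auto simp: mult.commute)
        finally show ?case by simp
      qed
    qed
    show "AE x in lborel. w x = 0" if "w \<in> Lp p" "w \<in> Lp 2" "AE x in lborel. lam * w x = T w x" for w
      by (rule T_injective_L2[OF lam that(2,3)])
  qed
  show ?thesis by (rule isomorphism)
qed

end

theorem theorem3p5:
  fixes p s lam :: real and f f' :: "real \<Rightarrow> real"
  assumes "2 < p"
    and "1 + 1 / p < s" and "s < 2"
    and "sobolev_slobodeckij s p f"
    and "weak_deriv f f'"
    and "1 \<le> \<bar>lam\<bar>"
  shows "\<exists>T. is_A_op p f f' T \<and> isom_Lp p (\<lambda>w x. lam * w x - T w x)"
proof -
  have p1: "1 < p" using assms(1) by simp
  obtain F G \<gamma> L where FG: "0 < \<gamma>" "0 < L" "\<And>x. (F has_real_derivative G x) (at x)"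
    "\<And>x y. \<bar>G x - G y\<bar> \<le> L * \<bar>x - y\<bar> powr \<gamma>" "\<And>x. \<bar>G x\<bar> \<le> L"
    "AE x in lborel. f x = F x" "AE x in lborel. f' x = G x" "F \<in> Lp p" "G \<in> Lp p"
    "integrable (lborel \<Otimes>\<^sub>M lborel) (\<lambda>(x, y). \<bar>G x - G y\<bar> powr p / \<bar>x - y\<bar> powr (1 + (s - 1) * p))"
    by (rule sobolev_slobodeckij_C1[OF p1 assms(2,4,5)]) (rule that)
  interpret sobolev_graph F G \<gamma> L p "s - 1"
    by unfold_locales (use FG assms in auto)
  have "f \<in> Lp p" using assms(4) by (simp add: sobolev_slobodeckij_def)
  then have "f \<in> borel_measurable borel" by (rule LpD(1))
  then show ?thesis using T_is_A_op[OF _ FG(6,7)] resolvent_isom[OF assms(6)] by blast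
qed

end
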